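(* Let $\mathcal{P}$ be a mobile poset with $n$ elements, built from an underlying ribbon $\mathcal{Z}=\mathcal{Z}^{(\ell)}_S$, let $F$ be the set of path folds for $\mathcal{P}$ (with respect to $\mathcal{Z}$), let $k=\#F$, and let $\sigma_0,\dots,\sigma_k$ be the induced path order on the connected components of $\mathcal{P}\ominus F$. Then for every $0\le i\le j\le k$ the poset $\mathcal{P}_{i,j}$ is a connected $d$-complete poset, and \[ e(\mathcal{P}) \,=\, n!\cdot\det(M_{i,j})_{0 \leq i,j\leq k}, \qquad M_{i,j} := \begin{cases}0 & \text{if } j<i-1,\\ 1 & \text{if } j = i-1,\\ 1/\prod_{x \in \mathcal{P}_{i,j}} h_{\mathcal{P}_{i,j}}(x) & \text{if } j\ge i, \end{cases} \] where $h_{\mathcal{P}_{i,j}}$ denotes the $d$-complete hook length in $\mathcal{P}_{i,j}$.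
   Context: All posets are finite. We write $x\lessdot y$ if $y$ covers $x$, and record a cover relation as the ordered pair $(x,y)$. $\mathcal{P}+\mathcal{Q}$ denotes the disjoint union of posets. $e(\mathcal{P})$ is the number of linear extensions of $\mathcal{P}$, i.e. order-preserving bijections $\mathcal{P}\to[\#\mathcal{P}]$. Ribbons: for $\ell\ge1$ and $S\subset[\ell-1]$, the ribbon $\mathcal{Z}^{(\ell)}_S$ is the poset on $\{z_1,\dots,z_\ell\}$ whose only cover relations are $z_{i+1}\lessdot z_i$ for $i\in S$ and $z_i\lessdot z_{i+1}$ for $i\in[\ell-1]\setminus S$. $d$-complete posets: for $k\ge3$, $d_k(1)$ is the poset consisting of a chain $c_1<\dots<c_{k-2}$, two incomparable elements $x,y$ both covering $c_{k-2}$, and a chain $n_1<\dots<n_{k-2}$ with $n_1$ covering both $x$ and $y$; $n_1,\dots,n_{k-2}$ form its neck. A $d_k$-interval of $\mathcal{P}$ is an interval $[w,z]$ isomorphic to $d_k(1)$ (its neck being the image of the neck). A $d_k^-$-convex set is a convex subset of $\mathcal{P}$ isomorphic to $d_k(1)$ with its maximum removed. $\mathcal{P}$ is $d$-complete if for every $k\ge3$: (1) for every $d_k^-$-convex set $I$ there is $p\in\mathcal{P}$ covering the maximal elements of $I$ with $I\cup\{p\}$ a $d_k$-interval; (2) if $[w,z]$ is a $d_k$-interval then $z$ covers no element outside $[w,z]$; (3) no two $d_k^-$-convex sets differ only in their minimal elements. A connected $d$-complete poset has a unique maximal element. Hook length in a $d$-complete $\mathcal{P}$: if $z$ is in the neck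 of no $d_k$-interval, $h_\mathcal{P}(z)=\#\{y\in\mathcal{P}: y\le z\}$; otherwise pick $w$ with $[w,z]$ a $d_m$-interval for some $m$, with incomparable elements $x,y$, and set $h_\mathcal{P}(z)=h_\mathcal{P}(x)+h_\mathcal{P}(y)-h_\mathcal{P}(w)$. The top tree of a connected $d$-complete $\mathcal{P}$ is the set of $x$ such that every $y\ge x$ is covered by at most one element; an element is acyclic if it lies in the top tree and in the neck of no $d_k$-interval. Mobile posets: starting from a ribbon $\mathcal{Z}=\mathcal{Z}^{(\ell)}_S$: (i) for each $z\in\mathcal{Z}$ choose $m_z\ge0$ connected $d$-complete posets (all pairwise disjoint and disjoint from $\mathcal{Z}$), take the disjoint union and make $z$ cover the maximal element of each of them (taking transitive closure); call the result $\mathcal{P}'$; (ii) for at most one element $z'=z_j\in\mathcal{Z}$ (the anchor), take a further disjoint connected $d$-complete poset $\mathcal{Q}$ with an acyclic element $q$, form $\mathcal{P}'+\mathcal{Q}$ and add the relation $z'\lessdot q$ (transitive closure). The result $\mathcal{P}$ is a mobile poset with underlying ribbon $\mathcal{Z}$; it is free-standing with respect to $\mathcal{Z}$ if step (ii) is not performed. Folds: for a set $F$ of cover relations of $\mathcal{P}$, $\mathcal{P}\ominus F$ is the poset on the same set whose order is the transitive closure of the cover relations of $\mathcal{P}$ not in $F$; the fold $\mathcal{P}_F$ is obtained from $\mathcal{P}\ominus F$ by adding $y<x$ for each $(x,y)\in F$ and taking the transitive closure. Path folds: $F=\{(z_{i+1},z_i): i\in S\}$ if $\mathcal{P}$ is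 free-standing with respect to $\mathcal{Z}$, and otherwise $F=\{(z_{i+1},z_i): i\in S, i<j\}\cup\{(z_i,z_{i+1}): i\notin S, j\le i\le \ell-1\}$, where $z_j$ is the anchor. Each connected component (of the Hasse diagram) of $\mathcal{P}\ominus F$ contains a nonempty block of consecutive ribbon elements; listing the $k+1$ components in increasing order of the indices of the ribbon elements they contain gives the induced path order $\sigma_0,\dots,\sigma_k$. For $0\le i\le j\le k$, $\mathcal{P}_{i,j}$ is the induced subposet of $\mathcal{P}_F$ on the union of the components $\sigma_i,\dots,\sigma_j$. *)

theory Defs
  imports "HOL-Library.FuncSet" "Jordan_Normal_Form.Determinant"
begin

text \<open>A poset is represented by its reflexive order relation \<^term>\<open>r\<close>; its underlying set is
  \<^term>\<open>Field r\<close>, and \<^term>\<open>(x, y) \<in> r\<close> means \<open>x \<le> y\<close>.\<close>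

definition finite_poset :: "'a rel \<Rightarrow> bool" where
  "finite_poset r \<longleftrightarrow> Partial_order r \<and> finite (Field r)"

definition generated_order :: "'a set \<Rightarrow> 'a rel \<Rightarrow> 'a rel" where
  "generated_order V E = Id_on V \<union> E\<^sup>+"

definition cover_relations :: "'a rel \<Rightarrow> 'a rel" where
  "cover_relations r = {(x, y). (x, y) \<in> r \<and> x \<noteq> y \<and>
     (\<forall>t. (x, t) \<in> r \<and> (t, y) \<in> r \<longrightarrow> t = x \<or> t = y)}"

definition maximal_elements :: "'a rel \<Rightarrow> 'a set \<Rightarrow> 'a set" where
  "maximal_elements r A = {x \<in> A. \<forall>y \<in> A. (x, y) \<in> r \<longrightarrow> y = x}"

definition minimal_elements :: "'a rel \<Rightarrow> 'a set \<Rightarrow> 'a set" where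
  "minimal_elements r A = {x \<in> A. \<forall>y \<in> A. (y, x) \<in> r \<longrightarrow> y = x}"

definition poset_interval :: "'a rel \<Rightarrow> 'a \<Rightarrow> 'a \<Rightarrow> 'a set" where
  "poset_interval r w z = {x. (w, x) \<in> r \<and> (x, z) \<in> r}"

definition poset_convex :: "'a rel \<Rightarrow> 'a set \<Rightarrow> bool" where
  "poset_convex r A \<longleftrightarrow> A \<subseteq> Field r \<and>
     (\<forall>x \<in> A. \<forall>z \<in> A. \<forall>y. (x, y) \<in> r \<and> (y, z) \<in> r \<longrightarrow> y \<in> A)"

definition hasse_connection :: "'a rel \<Rightarrow> 'a rel" where
  "hasse_connection r = (cover_relations r \<union> (cover_relations r)\<inverse>)\<^sup>*"

definition hasse_components :: "'a rel \<Rightarrow> 'a set set" where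
  "hasse_components r = Field r // hasse_connection r"

definition connected_poset :: "'a rel \<Rightarrow> bool" where
  "connected_poset r \<longleftrightarrow> Field r \<noteq> {} \<and>
     (\<forall>x \<in> Field r. \<forall>y \<in> Field r. (x, y) \<in> hasse_connection r)"

text \<open>Linear extensions are taken to be undefined outside the poset, so that each is counted once.\<close>

definition linear_extensions :: "'a rel \<Rightarrow> ('a \<Rightarrow> nat) set" where
  "linear_extensions r = {f \<in> Field r \<rightarrow>\<^sub>E {1..card (Field r)}.
     bij_betw f (Field r) {1..card (Field r)} \<and> (\<forall>(x, y) \<in> r. f x \<le> f y)}"

text \<open>Order isomorphism; by \<open>iso_iff2\<close> the library notion is meaningful for arbitrary relations.
  The qualified name avoids group isomorphisms.\<close>

abbreviation poset_iso :: "'a rel \<Rightarrow> 'b rel \<Rightarrow> ('a \<Rightarrow> 'b) \<Rightarrow> bool" where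
  "poset_iso \<equiv> BNF_Wellorder_Embedding.iso"


section \<open>d-complete posets\<close>

text \<open>The elements of $d_k(1)$: \<open>Tail i\<close> is $c_i$, \<open>Neck i\<close> is $n_i$, and \<open>SideX\<close>, \<open>SideY\<close>
  are the two incomparable elements $x$, $y$.\<close>

datatype dk_elt = Tail nat | SideX | SideY | Neck nat

definition dk_carrier :: "nat \<Rightarrow> dk_elt set" where
  "dk_carrier k = Tail ` {1..k-2} \<union> {SideX, SideY} \<union> Neck ` {1..k-2}"

definition dk_covers :: "nat \<Rightarrow> dk_elt rel" where
  "dk_covers k =
     {(Tail i, Tail (Suc i)) | i. 1 \<le> i \<and> Suc i \<le> k - 2} \<union>
     {(Tail (k-2), SideX), (Tail (k-2), SideY), (SideX, Neck 1), (SideY, Neck 1)} \<union>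
     {(Neck i, Neck (Suc i)) | i. 1 \<le> i \<and> Suc i \<le> k - 2}"

definition dk_poset :: "nat \<Rightarrow> dk_elt rel" where
  "dk_poset k = generated_order (dk_carrier k) (dk_covers k)"

definition dk_minus_poset :: "nat \<Rightarrow> dk_elt rel" where
  "dk_minus_poset k = Restr (dk_poset k) (dk_carrier k - {Neck (k-2)})"

definition dk_interval :: "'a rel \<Rightarrow> nat \<Rightarrow> 'a set \<Rightarrow> bool" where
  "dk_interval r k I \<longleftrightarrow>
     (\<exists>w z. I = poset_interval r w z) \<and> (\<exists>f. poset_iso (dk_poset k) (Restr r I) f)"

definition dk_minus_convex :: "'a rel \<Rightarrow> nat \<Rightarrow> 'a set \<Rightarrow> bool" where
  "dk_minus_convex r k I \<longleftrightarrow>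
     poset_convex r I \<and> (\<exists>f. poset_iso (dk_minus_poset k) (Restr r I) f)"

definition d_complete :: "'a rel \<Rightarrow> bool" where
  "d_complete r \<longleftrightarrow> finite_poset r \<and> (\<forall>k \<ge> 3.
     (\<forall>I. dk_minus_convex r k I \<longrightarrow>
        (\<exists>p \<in> Field r. (\<forall>x \<in> maximal_elements r I. (x, p) \<in> cover_relations r) \<and>
           dk_interval r k (I \<union> {p}))) \<and>
     (\<forall>w z. dk_interval r k (poset_interval r w z) \<longrightarrow>
        (\<forall>x. (x, z) \<in> cover_relations r \<longrightarrow> x \<in> poset_interval r w z)) \<and>
     (\<forall>I J. dk_minus_convex r k I \<and> dk_minus_convex r k J \<and>
        I - minimal_elements r I = J - minimal_elements r J \<longrightarrow> I = J))"

definition in_neck :: "'a rel \<Rightarrow> 'a \<Rightarrow> bool" where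
  "in_neck r z \<longleftrightarrow> (\<exists>k \<ge> 3. \<exists>u v f. poset_iso (dk_poset k) (Restr r (poset_interval r u v)) f \<and>
     z \<in> f ` Neck ` {1..k-2})"

text \<open>The interval from \<open>w\<close> to \<open>z\<close> is a $d_m$-interval for some $m$, with incomparable
  elements \<open>x\<close> and \<open>y\<close>.\<close>

definition dk_interval_sides :: "'a rel \<Rightarrow> 'a \<Rightarrow> 'a \<times> 'a \<times> 'a \<Rightarrow> bool" where
  "dk_interval_sides r z = (\<lambda>(w, x, y). \<exists>m \<ge> 3. \<exists>f.
     poset_iso (dk_poset m) (Restr r (poset_interval r w z)) f \<and> x = f SideX \<and> y = f SideY)"

fun dk_rank :: "nat \<Rightarrow> dk_elt \<Rightarrow> nat" where
  "dk_rank k (Tail i) = i"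
| "dk_rank k SideX = k - 1"
| "dk_rank k SideY = k - 1"
| "dk_rank k (Neck i) = k - 1 + i"

lemma dk_carrier_iff:
  "Tail i \<in> dk_carrier k \<longleftrightarrow> 1 \<le> i \<and> i \<le> k - 2"
  "Neck i \<in> dk_carrier k \<longleftrightarrow> 1 \<le> i \<and> i \<le> k - 2"
  "SideX \<in> dk_carrier k" "SideY \<in> dk_carrier k"
  by (auto simp: dk_carrier_def)

lemma dk_covers_rank:
  assumes "k \<ge> 3" "(a, b) \<in> dk_covers k"
  shows "a \<in> dk_carrier k \<and> b \<in> dk_carrier k \<and> dk_rank k a < dk_rank k b"
  using assms by (auto simp: dk_covers_def dk_carrier_def)

lemma dk_trancl_rank:
  assumes "k \<ge> 3" "(a, b) \<in> (dk_covers k)\<^sup>+"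
  shows "a \<in> dk_carrier k \<and> b \<in> dk_carrier k \<and> dk_rank k a < dk_rank k b"
  using assms(2)
proof induction
  case (base b)
  then show ?case using dk_covers_rank[OF assms(1)] by blast
next
  case (step b c)
  then show ?case using dk_covers_rank[OF assms(1) step.hyps(2)] by auto
qed

lemma dk_covers_step:
  assumes "k \<ge> 3" "a \<in> dk_carrier k" "b \<in> dk_carrier k" "dk_rank k a < dk_rank k b"
  shows "(a, b) \<in> dk_covers k \<or> (\<exists>c \<in> dk_carrier k. (c, b) \<in> dk_covers k \<and> dk_rank k a < dk_rank k c)"
proof -
  consider "\<exists>c \<in> dk_carrier k. (c, b) \<in> dk_covers k \<and> dk_rank k c + 1 = dk_rank k b \<and>
      (\<forall>a \<in> dk_carrier k. dk_rank k a = dk_rank k c \<longrightarrow> a = c)"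
    | "b = Neck 1" | "b = Tail 1"
  proof (cases b)
    case (Tail i)
    have "Tail (i-1) \<in> dk_carrier k \<and> (Tail (i-1), b) \<in> dk_covers k \<and>
      dk_rank k (Tail (i-1)) + 1 = dk_rank k b \<and>
      (\<forall>a \<in> dk_carrier k. dk_rank k a = dk_rank k (Tail (i-1)) \<longrightarrow> a = Tail (i-1))" if "i \<noteq> 1"
      using that assms(1,3) Tail by (auto simp: dk_covers_def dk_carrier_iff) (auto simp: dk_carrier_def)
    then show ?thesis using that(1,3) Tail by blast
  next
    case SideX
    have "Tail (k-2) \<in> dk_carrier k \<and> (Tail (k-2), b) \<in> dk_covers k \<and>
      dk_rank k (Tail (k-2)) + 1 = dk_rank k b \<and>
      (\<forall>a \<in> dk_carrier k. dk_rank k a = dk_rank k (Tail (k-2)) \<longrightarrow> a = Tail (k-2))"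
      using assms(1) SideX by (auto simp: dk_covers_def dk_carrier_iff) (auto simp: dk_carrier_def)
    then show ?thesis using that(1) by blast
  next
    case SideY
    have "Tail (k-2) \<in> dk_carrier k \<and> (Tail (k-2), b) \<in> dk_covers k \<and>
      dk_rank k (Tail (k-2)) + 1 = dk_rank k b \<and>
      (\<forall>a \<in> dk_carrier k. dk_rank k a = dk_rank k (Tail (k-2)) \<longrightarrow> a = Tail (k-2))"
      using assms(1) SideY by (auto simp: dk_covers_def dk_carrier_iff) (auto simp: dk_carrier_def)
    then show ?thesis using that(1) by blast
  next
    case (Neck i)
    have "Neck (i-1) \<in> dk_carrier k \<and> (Neck (i-1), b) \<in> dk_covers k \<and>
      dk_rank k (Neck (i-1)) + 1 = dk_rank k b \<and>
      (\<forall>a \<in> dk_carrier k. dk_rank k a = dk_rank k (Neck (i-1)) \<longrightarrow> a = Neck (i-1))" if "i \<noteq> 1"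
      using that assms(1,3) Neck by (auto simp: dk_covers_def dk_carrier_iff) (auto simp: dk_carrier_def)
    then show ?thesis using that(1,2) Neck by blast
  qed
  then show ?thesis
  proof cases
    case 1
    then obtain c where c: "c \<in> dk_carrier k" "(c, b) \<in> dk_covers k" "dk_rank k c + 1 = dk_rank k b"
      "a = c \<or> dk_rank k a \<noteq> dk_rank k c" using assms(2) by blast
    then have "a = c \<or> dk_rank k a < dk_rank k c" using assms(4) by linarith
    then show ?thesis using c by blast
  next
    case 2
    have "a = SideX \<or> a = SideY \<or> dk_rank k a < dk_rank k SideX"
      using assms 2 by (cases a) (auto simp: dk_carrier_iff)
    moreover have "(SideX, b) \<in> dk_covers k" "(SideY, b) \<in> dk_covers k"
      using 2 by (auto simp: dk_covers_def)
    ultimately show ?thesis using dk_carrier_iff(3) by blast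
  next
    case 3
    then show ?thesis using assms by (cases a) (auto simp: dk_carrier_iff)
  qed
qed

lemma dk_rank_trancl:
  assumes "k \<ge> 3" "a \<in> dk_carrier k" "b \<in> dk_carrier k" "dk_rank k a < dk_rank k b"
  shows "(a, b) \<in> (dk_covers k)\<^sup>+"
  using assms(3,4)
proof (induction "dk_rank k b" arbitrary: b rule: less_induct)
  case less
  from dk_covers_step[OF assms(1,2) less.prems] show ?case
  proof
    assume "\<exists>c \<in> dk_carrier k. (c, b) \<in> dk_covers k \<and> dk_rank k a < dk_rank k c"
    then obtain c where "c \<in> dk_carrier k" "(c, b) \<in> dk_covers k" "dk_rank k a < dk_rank k c"
      by blast
    then show ?case
      using less.hyps[of c] dk_covers_rank[OF assms(1)] by (meson trancl.trancl_into_trancl)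
  qed auto
qed

lemma dk_poset_iff:
  assumes "k \<ge> 3"
  shows "(a, b) \<in> dk_poset k \<longleftrightarrow>
    a \<in> dk_carrier k \<and> b \<in> dk_carrier k \<and> (a = b \<or> dk_rank k a < dk_rank k b)"
proof -
  have "(a, b) \<in> dk_poset k \<longleftrightarrow> a \<in> dk_carrier k \<and> a = b \<or> (a, b) \<in> (dk_covers k)\<^sup>+"
    by (auto simp: dk_poset_def generated_order_def)
  also have "\<dots> \<longleftrightarrow> a \<in> dk_carrier k \<and> b \<in> dk_carrier k \<and> (a = b \<or> dk_rank k a < dk_rank k b)"
    using dk_trancl_rank[OF assms, of a b] dk_rank_trancl[OF assms, of a b] by blast
  finally show ?thesis .
qed

lemma Field_dk_poset: "k \<ge> 3 \<Longrightarrow> Field (dk_poset k) = dk_carrier k"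
  by (auto simp: Field_def dk_poset_iff)

lemma Field_Restr_interval:
  assumes "Partial_order r"
  shows "Field (Restr r (poset_interval r u v)) = poset_interval r u v"
  using assms
  by (auto simp: Field_def poset_interval_def partial_order_on_def preorder_on_def refl_on_def)

lemma dk_iso_D:
  assumes "Partial_order r" "k \<ge> 3" "poset_iso (dk_poset k) (Restr r (poset_interval r u v)) f"
  shows "bij_betw f (dk_carrier k) (poset_interval r u v)"
    and "\<And>a b. a \<in> dk_carrier k \<Longrightarrow> b \<in> dk_carrier k \<Longrightarrow>
           (f a, f b) \<in> r \<longleftrightarrow> a = b \<or> dk_rank k a < dk_rank k b"
proof -
  show 1: "bij_betw f (dk_carrier k) (poset_interval r u v)"
    using assms by (simp add: iso_iff2 Field_dk_poset Field_Restr_interval)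
  fix a b assume ab: "a \<in> dk_carrier k" "b \<in> dk_carrier k"
  then have "f a \<in> poset_interval r u v" "f b \<in> poset_interval r u v"
    using 1 bij_betwE by blast+
  then show "(f a, f b) \<in> r \<longleftrightarrow> a = b \<or> dk_rank k a < dk_rank k b"
    using assms ab by (auto simp: iso_iff2 Field_dk_poset dk_poset_iff)
qed

lemma dk_shift:
  assumes "k \<ge> 3" "1 \<le> i" "i \<le> k - 2"
  defines "g \<equiv> \<lambda>a. case a of Tail j \<Rightarrow> Tail (j + (k - 2 - i)) | _ \<Rightarrow> a"
  shows "bij_betw g (dk_carrier (i + 2)) {a \<in> dk_carrier k.
           dk_rank k (Tail (k - 1 - i)) \<le> dk_rank k a \<and> dk_rank k a \<le> dk_rank k (Neck i)}"
    and "\<And>a. a \<in> dk_carrier (i + 2) \<Longrightarrow> dk_rank k (g a) = dk_rank (i + 2) a + (k - 2 - i)"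
proof -
  show "bij_betw g (dk_carrier (i + 2)) {a \<in> dk_carrier k.
           dk_rank k (Tail (k - 1 - i)) \<le> dk_rank k a \<and> dk_rank k a \<le> dk_rank k (Neck i)}"
    (is "bij_betw g ?A ?B")
  proof (rule bij_betwI[where g = "\<lambda>a. case a of Tail j \<Rightarrow> Tail (j - (k - 2 - i)) | _ \<Rightarrow> a"])
    show "g \<in> ?A \<rightarrow> ?B"
    proof
      fix a assume "a \<in> ?A"
      then show "g a \<in> ?B" using assms by (cases a) (simp_all add: dk_carrier_iff, arith+)
    qed
    show "(\<lambda>a. case a of Tail j \<Rightarrow> Tail (j - (k - 2 - i)) | _ \<Rightarrow> a) \<in> ?B \<rightarrow> ?A"
    proof
      fix a assume "a \<in> ?B"
      then show "(case a of Tail j \<Rightarrow> Tail (j - (k - 2 - i)) | _ \<Rightarrow> a) \<in> ?A"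
        using assms(1-3) by (cases a) (simp_all add: dk_carrier_iff, arith+)
    qed
  next
    fix a assume "a \<in> ?A"
    then show "(case g a of Tail j \<Rightarrow> Tail (j - (k - 2 - i)) | _ \<Rightarrow> g a) = a"
      by (cases a) (simp_all add: g_def)
  next
    fix a assume "a \<in> ?B"
    then show "g (case a of Tail j \<Rightarrow> Tail (j - (k - 2 - i)) | _ \<Rightarrow> a) = a"
      using assms(1-3) by (cases a) (simp_all add: g_def, arith)
  qed
  show "\<And>a. a \<in> dk_carrier (i + 2) \<Longrightarrow> dk_rank k (g a) = dk_rank (i + 2) a + (k - 2 - i)"
  proof -
    fix a assume "a \<in> dk_carrier (i + 2)"
    then show "dk_rank k (g a) = dk_rank (i + 2) a + (k - 2 - i)"
      using assms(1-3) by (cases a) (simp_all add: g_def)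
  qed
qed

lemma in_neck_dk_interval_sides:
  assumes "finite_poset r" "in_neck r z"
  shows "\<exists>t. dk_interval_sides r z t"
proof -
  have po: "Partial_order r" using assms(1) by (simp add: finite_poset_def)
  obtain k u v f i where k: "k \<ge> 3" and f: "poset_iso (dk_poset k) (Restr r (poset_interval r u v)) f"
    and i: "1 \<le> i" "i \<le> k - 2" and z: "z = f (Neck i)"
    using assms(2) unfolding in_neck_def by auto
  note F = dk_iso_D[OF po k f]
  define g where "g = (\<lambda>a. case a of Tail j \<Rightarrow> Tail (j + (k - 2 - i)) | _ \<Rightarrow> a)"
  note G = dk_shift[OF k i, folded g_def]
  have G2: "dk_rank k (g a) = dk_rank (i + 2) a + (k - 2 - i)" if "a \<in> dk_carrier (i + 2)" for a
    using dk_shift(2)[OF k i that] by (simp only: g_def)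
  define t where "t = Tail (k - 1 - i)"
  define w where "w = f t"
  have tN: "t \<in> dk_carrier k" "Neck i \<in> dk_carrier k"
    using i k by (auto simp: t_def dk_carrier_iff)
  define B where "B = {a \<in> dk_carrier k. dk_rank k t \<le> dk_rank k a \<and> dk_rank k a \<le> dk_rank k (Neck i)}"
  have eqr: "a = t" if "a \<in> dk_carrier k" "dk_rank k a = dk_rank k t" for a
    using that i k by (auto simp: t_def dk_carrier_def)
  have eqN: "a = Neck i" if "a \<in> dk_carrier k" "dk_rank k a = dk_rank k (Neck i)" for a
    using that i k by (auto simp: dk_carrier_def)
  have mem: "f a \<in> poset_interval r w z \<longleftrightarrow> a \<in> B" if "a \<in> dk_carrier k" for a
    using F(2)[OF tN(1) that] F(2)[OF that tN(2)] eqr[OF that] eqN[OF that] that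
    by (auto simp: poset_interval_def w_def z B_def order_le_less)
  have "poset_interval r w z \<subseteq> poset_interval r u v"
  proof -
    have "w \<in> poset_interval r u v" "z \<in> poset_interval r u v"
      using F(1) tN bij_betwE unfolding w_def z by blast+
    moreover have "trans r" using po by (simp add: order_on_defs)
    ultimately show ?thesis unfolding poset_interval_def by (auto dest: transD)
  qed
  then have sub: "\<exists>a \<in> dk_carrier k. x = f a" if "x \<in> poset_interval r w z" for x
    using F(1) that unfolding bij_betw_def by blast
  have im: "f ` B = poset_interval r w z"
  proof
    show "f ` B \<subseteq> poset_interval r w z"
      using mem unfolding B_def by blast
    show "poset_interval r w z \<subseteq> f ` B"
      using mem sub by blast
  qed
  have fB: "bij_betw f B (poset_interval r w z)"
    using F(1) im by (auto simp: bij_betw_def B_def intro: inj_on_subset)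
  have bij: "bij_betw (f \<circ> g) (dk_carrier (i + 2)) (poset_interval r w z)"
    using bij_betw_trans[OF G(1)[folded t_def, folded B_def] fB] .
  have gB: "g a \<in> B" if "a \<in> dk_carrier (i + 2)" for a
    using G(1)[folded t_def, folded B_def] that bij_betwE by blast
  have inj: "g a = g b \<longleftrightarrow> a = b" if "a \<in> dk_carrier (i + 2)" "b \<in> dk_carrier (i + 2)" for a b
    using G(1) that unfolding bij_betw_def inj_on_def by blast
  have "poset_iso (dk_poset (i + 2)) (Restr r (poset_interval r w z)) (f \<circ> g)"
    unfolding iso_iff2
  proof (intro conjI ballI)
    show "bij_betw (f \<circ> g) (Field (dk_poset (i + 2))) (Field (Restr r (poset_interval r w z)))"
      using bij i by (simp add: Field_dk_poset Field_Restr_interval[OF po])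
    fix a b assume "a \<in> Field (dk_poset (i + 2))" "b \<in> Field (dk_poset (i + 2))"
    then have ab: "a \<in> dk_carrier (i + 2)" "b \<in> dk_carrier (i + 2)"
      using i by (simp_all add: Field_dk_poset)
    have fab: "f (g a) \<in> poset_interval r w z" "f (g b) \<in> poset_interval r w z"
      using bij ab bij_betwE by fastforce+
    have "(f (g a), f (g b)) \<in> r \<longleftrightarrow> g a = g b \<or> dk_rank k (g a) < dk_rank k (g b)"
      using F(2) gB[OF ab(1)] gB[OF ab(2)] by (auto simp: B_def)
    also have "\<dots> \<longleftrightarrow> (a, b) \<in> dk_poset (i + 2)"
      unfolding inj[OF ab] G2[OF ab(1)] G2[OF ab(2)] add_less_cancel_right
      using ab i by (simp add: dk_poset_iff)
    finally show "((a, b) \<in> dk_poset (i + 2)) =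
        (((f \<circ> g) a, (f \<circ> g) b) \<in> Restr r (poset_interval r w z))"
      using fab by auto
  qed
  then have "dk_interval_sides r z (w, (f \<circ> g) SideX, (f \<circ> g) SideY)"
    using i unfolding dk_interval_sides_def by (auto intro!: exI[of _ "i + 2"])
  then show ?thesis ..
qed

lemma dk_interval_sides_less:
  assumes "finite_poset r" "dk_interval_sides r z (w, x, y)" "a \<in> {w, x, y}"
  shows "(a, z) \<in> r \<and> a \<noteq> z"
proof -
  have po: "Partial_order r" using assms(1) by (simp add: finite_poset_def)
  obtain m f where m: "m \<ge> 3" and f: "poset_iso (dk_poset m) (Restr r (poset_interval r w z)) f"
    and xy: "x = f SideX" "y = f SideY"
    using assms(2) unfolding dk_interval_sides_def by auto
  note F = dk_iso_D[OF po m f]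
  have c: "SideX \<in> dk_carrier m" "SideY \<in> dk_carrier m" by (auto simp: dk_carrier_def)
  have xyI: "x \<in> poset_interval r w z" "y \<in> poset_interval r w z"
    using F(1) c bij_betwE unfolding xy by blast+
  have nxy: "(x, y) \<notin> r" "(y, x) \<notin> r" using F(2)[OF c] F(2)[OF c(2,1)] xy by auto
  have "(w, z) \<in> r" using xyI po by (auto simp: poset_interval_def order_on_defs dest: transD)
  moreover have "w \<noteq> z"
    using xyI nxy po by (auto simp: poset_interval_def order_on_defs dest: antisymD)
  ultimately show ?thesis using xyI nxy assms(3) by (auto simp: poset_interval_def)
qed

lemma hook_length_termination:
  fixes r :: "'a rel"
  assumes "finite_poset r \<and> in_neck r z" "(SOME t. dk_interval_sides r z t) = (w, x, y)"
    "a \<in> {w, x, y}"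
  shows "card {y. (y, a) \<in> r} < card {y. (y, z) \<in> r}"
proof -
  have "dk_interval_sides r z (w, x, y)"
    using assms(1,2) in_neck_dk_interval_sides someI_ex by metis
  then have az: "(a, z) \<in> r" "a \<noteq> z" using dk_interval_sides_less assms by metis+
  have po: "refl_on (Field r) r" "trans r" "antisym r" "finite (Field r)"
    using assms(1) by (auto simp: finite_poset_def order_on_defs)
  have "finite {y. (y, z) \<in> r}"
    by (rule finite_subset[OF _ po(4)]) (auto simp: Field_def)
  moreover have "{y. (y, a) \<in> r} \<subset> {y. (y, z) \<in> r}"
  proof
    show "{y. (y, a) \<in> r} \<subseteq> {y. (y, z) \<in> r}" using az po(2) by (auto dest: transD)
    have "(z, z) \<in> r" using az po(1) by (auto simp: Field_def refl_on_def)
    moreover have "(z, a) \<notin> r" using az po(3) by (auto dest: antisymD)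
    ultimately show "{y. (y, a) \<in> r} \<noteq> {y. (y, z) \<in> r}" by blast
  qed
  ultimately show ?thesis by (rule psubset_card_mono)
qed

text \<open>The guard \<^term>\<open>finite_poset r\<close> only serves to make the recursion well-founded.\<close>

function hook_length :: "'a rel \<Rightarrow> 'a \<Rightarrow> int" where
  "hook_length r z =
     (if finite_poset r \<and> in_neck r z
      then (case (SOME t. dk_interval_sides r z t) of (w, x, y) \<Rightarrow>
              hook_length r x + hook_length r y - hook_length r w)
      else int (card {y. (y, z) \<in> r}))"
  by auto

termination
  by (relation "Wellfounded.measure (\<lambda>(r, z). card {y. (y, z) \<in> r})")
     (auto intro!: hook_length_termination[OF _ sym])

declare hook_length.simps [simp del]

definition top_tree :: "'a rel \<Rightarrow> 'a set" where
  "top_tree r = {x \<in> Field r. \<forall>y. (x, y) \<in> r \<longrightarrow> card {t. (y, t) \<in> cover_relations r} \<le> 1}"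

definition acyclic_element :: "'a rel \<Rightarrow> 'a \<Rightarrow> bool" where
  "acyclic_element r q \<longleftrightarrow> q \<in> top_tree r \<and> \<not> in_neck r q"


section \<open>Mobile posets\<close>

text \<open>The ribbon elements are \<open>z 1, \<dots>, z l\<close>, and \<open>H i\<close> is the set of connected d-complete posets
  hung below \<open>z i\<close> (a set suffices because they are nonempty and pairwise disjoint).
  The anchor datum is \<^term>\<open>None\<close> for a free-standing mobile, and \<^term>\<open>Some (j, Q, q)\<close> if
  \<open>z j\<close> is the anchor, covered by the acyclic element \<open>q\<close> of \<open>Q\<close>.\<close>

definition ribbon_covers :: "nat \<Rightarrow> nat set \<Rightarrow> (nat \<Rightarrow> 'a) \<Rightarrow> 'a rel" where
  "ribbon_covers l S z = {(z (i + 1), z i) | i. i \<in> S} \<union> {(z i, z (i + 1)) | i. i \<in> {1..l-1} - S}"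

definition ribbon :: "nat \<Rightarrow> nat set \<Rightarrow> (nat \<Rightarrow> 'a) \<Rightarrow> 'a rel" where
  "ribbon l S z = generated_order (z ` {1..l}) (ribbon_covers l S z)"

definition hanging_mobile :: "nat \<Rightarrow> nat set \<Rightarrow> (nat \<Rightarrow> 'a) \<Rightarrow> (nat \<Rightarrow> 'a rel set) \<Rightarrow> 'a rel" where
  "hanging_mobile l S z H =
     generated_order (z ` {1..l} \<union> (\<Union>i \<in> {1..l}. \<Union>D \<in> H i. Field D))
       (ribbon l S z \<union> (\<Union>i \<in> {1..l}. \<Union>D \<in> H i. D \<union> maximal_elements D (Field D) \<times> {z i}))"

definition mobile_poset :: "nat \<Rightarrow> nat set \<Rightarrow> (nat \<Rightarrow> 'a) \<Rightarrow> (nat \<Rightarrow> 'a rel set) \<Rightarrow>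
    (nat \<times> 'a rel \<times> 'a) option \<Rightarrow> 'a rel" where
  "mobile_poset l S z H anchor = (case anchor of
     None \<Rightarrow> hanging_mobile l S z H
   | Some (j, Q, q) \<Rightarrow>
       generated_order (Field (hanging_mobile l S z H) \<union> Field Q)
         (hanging_mobile l S z H \<union> Q \<union> {(z j, q)}))"

definition mobile_data :: "nat \<Rightarrow> nat set \<Rightarrow> (nat \<Rightarrow> 'a) \<Rightarrow> (nat \<Rightarrow> 'a rel set) \<Rightarrow>
    (nat \<times> 'a rel \<times> 'a) option \<Rightarrow> bool" where
  "mobile_data l S z H anchor \<longleftrightarrow>
     l \<ge> 1 \<and> S \<subseteq> {1..l-1} \<and> inj_on z {1..l} \<and>
     (\<forall>i \<in> {1..l}. finite (H i) \<and>
        (\<forall>D \<in> H i. d_complete D \<and> connected_poset D \<and> Field D \<inter> z ` {1..l} = {})) \<and>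
     (\<forall>i \<in> {1..l}. \<forall>i' \<in> {1..l}. \<forall>D \<in> H i. \<forall>D' \<in> H i'.
        (i, D) \<noteq> (i', D') \<longrightarrow> Field D \<inter> Field D' = {}) \<and>
     (case anchor of None \<Rightarrow> True
      | Some (j, Q, q) \<Rightarrow>
          j \<in> {1..l} \<and> d_complete Q \<and> connected_poset Q \<and> acyclic_element Q q \<and>
          Field Q \<inter> Field (hanging_mobile l S z H) = {})"


section \<open>Folds\<close>

definition remove_covers :: "'a rel \<Rightarrow> 'a rel \<Rightarrow> 'a rel"  (infixl \<open>\<ominus>\<close> 65) where
  "P \<ominus> F = generated_order (Field P) (cover_relations P - F)"

definition fold_poset :: "'a rel \<Rightarrow> 'a rel \<Rightarrow> 'a rel" where
  "fold_poset P F = generated_order (Field P) ((P \<ominus> F) \<union> F\<inverse>)"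

definition path_folds :: "nat \<Rightarrow> nat set \<Rightarrow> (nat \<Rightarrow> 'a) \<Rightarrow> (nat \<times> 'a rel \<times> 'a) option \<Rightarrow> 'a rel" where
  "path_folds l S z anchor = (case anchor of
     None \<Rightarrow> {(z (i + 1), z i) | i. i \<in> S}
   | Some (j, Q, q) \<Rightarrow>
       {(z (i + 1), z i) | i. i \<in> S \<and> i < j} \<union>
       {(z i, z (i + 1)) | i. i \<notin> S \<and> j \<le> i \<and> i \<le> l - 1})"

text \<open>The components partition the ribbon into blocks of consecutive elements, so sorting by the
  least ribbon index lists the components in increasing order of the ribbon indices.\<close>

definition path_order :: "nat \<Rightarrow> (nat \<Rightarrow> 'a) \<Rightarrow> 'a rel \<Rightarrow> 'a set list" where
  "path_order l z r =
     sorted_key_list_of_set (\<lambda>C. Min {i \<in> {1..l}. z i \<in> C}) (hasse_components r)"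

definition path_subposet :: "'a rel \<Rightarrow> 'a rel \<Rightarrow> 'a set list \<Rightarrow> nat \<Rightarrow> nat \<Rightarrow> 'a rel" where
  "path_subposet P F \<sigma> i j = Restr (fold_poset P F) (\<Union>t \<in> {i..j}. \<sigma> ! t)"

definition hook_matrix :: "'a rel \<Rightarrow> 'a rel \<Rightarrow> 'a set list \<Rightarrow> nat \<Rightarrow> real mat" where
  "hook_matrix P F \<sigma> k = mat (k + 1) (k + 1) (\<lambda>(i, j).
     if j + 1 < i then 0
     else if j + 1 = i then 1
     else 1 / of_int (\<Prod>x \<in> Field (path_subposet P F \<sigma> i j). hook_length (path_subposet P F \<sigma> i j) x))"

end

theory Submission
  imports Defs
begin

text \<open>
  Inclusion-exclusion over the orientation of the fold edges writes the proportion of labelings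
  respecting \<open>P\<close> as an alternating sum of products over blocks of consecutive components; expanding
  the Hessenberg determinant along its last row produces the same recursion. Each block poset is an
  iterated slant sum of d-complete posets and hence d-complete, so everything reduces to the hook
  formula of Peterson and Proctor.

  For the hook formula, color a d-complete poset so that the bottom and the top of every
  $d_k$-interval get the same color. Consecutive elements of one color then have exactly two elements
  of adjacent color between them, so every filter \<open>U\<close> carries an integral weight. Let \<open>b p\<close> be the
  height of the root attached to \<open>p\<close>. Applying the operators \<open>exp (b p f)\<close> in the order of a linear
  extension to the empty filter gives a vector \<open>\<xi>\<close> with \<open>\<xi> {} = 1\<close>, \<open>\<xi> P = (\<Prod>p. b p)\<close> and
  \<open>card (P - U) * \<xi> U = (\<Sum>p. \<xi> (U \<union> {p}))\<close>, the sum running over the filters covering \<open>U\<close>: conjugating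
  \<open>h - \<Sum>e\<^sub>i\<close> by such an exponential merely reflects \<open>h\<close>. Counting chains of filters yields the
  hook formula with heights, and a null root argument identifies heights with hook lengths.
\<close>

section \<open>Finite posets\<close>

text \<open>Hook lengths satisfy \<open>h(z) + h(w) = h(x) + h(y)\<close> along an interval. Heights
  satisfy the matching identity for two consecutive elements of one color, because the difference of
  their defining sums involves only what lies between. The obstacle is the base case: an element in
  no neck must have height equal to the size of its order ideal. For this, the weight of the filter
  of all elements not below it must vanish on the other colors of the ideal. The value 1 would make
  an element addable too early; the value -1 is the hard one, and it is what the null root excludes.
  On the side of the ribbon, folding turns all ribbon edges towards the anchor, or towards the last
  ribbon element if there is no anchor. So each stretch of the folded ribbon arises by hanging a
  part with a top below an acyclic element of another part. Acyclicity, that is being neither bottom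
  nor top of an interval, is what prevents intervals from growing across the new cover.\<close>

locale fin_poset =
  fixes r :: "'a rel"
  assumes finite_poset: "finite_poset r"
begin

abbreviation le (infix \<open>\<preceq>\<close> 50) where "x \<preceq> y \<equiv> (x, y) \<in> r"
abbreviation lt (infix \<open>\<prec>\<close> 50) where "x \<prec> y \<equiv> (x, y) \<in> r \<and> x \<noteq> y"
abbreviation cv (infix \<open>\<prec>\<cdot>\<close> 50) where "x \<prec>\<cdot> y \<equiv> (x, y) \<in> cover_relations r"

lemma partial_order: "Partial_order r"
  and finite_Field: "finite (Field r)"
  using finite_poset by (auto simp: finite_poset_def)

lemma le_refl: "x \<in> Field r \<Longrightarrow> x \<preceq> x"
  using partial_order by (auto simp: order_on_defs refl_on_def)

lemma le_trans: "x \<preceq> y \<Longrightarrow> y \<preceq> z \<Longrightarrow> x \<preceq> z"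
  using partial_order by (auto simp: order_on_defs dest: transD)

lemma le_antisym: "x \<preceq> y \<Longrightarrow> y \<preceq> x \<Longrightarrow> x = y"
  using partial_order by (auto simp: order_on_defs dest: antisymD)

lemma lt_le_trans: "x \<prec> y \<Longrightarrow> y \<preceq> z \<Longrightarrow> x \<prec> z"
  and le_lt_trans: "x \<preceq> y \<Longrightarrow> y \<prec> z \<Longrightarrow> x \<prec> z"
  using le_trans[of x y z] le_antisym[of x y] le_antisym[of y z] by auto

lemma le_Field: "x \<preceq> y \<Longrightarrow> x \<in> Field r" "x \<preceq> y \<Longrightarrow> y \<in> Field r"
  by (auto simp: Field_def)

lemma finite_down: "finite {y. y \<preceq> x}" and finite_up: "finite {y. x \<preceq> y}"
  by (rule finite_subset[OF _ finite_Field]; auto simp: Field_def)+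

lemma card_down_less: "x \<prec> y \<Longrightarrow> card {t. t \<preceq> x} < card {t. t \<preceq> y}"
proof (rule psubset_card_mono[OF finite_down])
  assume "x \<prec> y"
  then have "{t. t \<preceq> x} \<subseteq> {t. t \<preceq> y}" "y \<preceq> y" "\<not> y \<preceq> x"
    using le_trans[of _ x y] le_antisym[of x y] le_refl[of y] le_Field(2)[of x y] by auto
  then show "{t. t \<preceq> x} \<subset> {t. t \<preceq> y}" by blast
qed

lemma card_up_less: "x \<prec> y \<Longrightarrow> card {t. y \<preceq> t} < card {t. x \<preceq> t}"
proof (rule psubset_card_mono[OF finite_up])
  assume "x \<prec> y"
  then have "{t. y \<preceq> t} \<subseteq> {t. x \<preceq> t}" "x \<preceq> x" "\<not> y \<preceq> x"
    using le_trans[of x y] le_antisym[of x y] le_refl[of x] le_Field(1)[of x y] by auto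
  then show "{t. y \<preceq> t} \<subset> {t. x \<preceq> t}" by blast
qed

lemma down_induct [case_names less]:
  assumes "\<And>x. (\<And>y. y \<prec> x \<Longrightarrow> Q y) \<Longrightarrow> Q x"
  shows "Q x"
proof (induction "card {t. t \<preceq> x}" arbitrary: x rule: less_induct)
  case less
  show ?case by (rule assms) (use less card_down_less in blast)
qed

lemma up_induct [case_names greater]:
  assumes "\<And>x. (\<And>y. x \<prec> y \<Longrightarrow> Q y) \<Longrightarrow> Q x"
  shows "Q x"
proof (induction "card {t. x \<preceq> t}" arbitrary: x rule: less_induct)
  case less
  show ?case by (rule assms) (use less card_up_less in blast)
qed

lemma cv_lt: "x \<prec>\<cdot> y \<Longrightarrow> x \<prec> y"
  by (auto simp: cover_relations_def)

lemma cv_between: "x \<prec>\<cdot> y \<Longrightarrow> x \<preceq> t \<Longrightarrow> t \<preceq> y \<Longrightarrow> t = x \<or> t = y"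
  by (auto simp: cover_relations_def)

lemma cvI: "x \<prec> y \<Longrightarrow> (\<And>t. x \<preceq> t \<Longrightarrow> t \<preceq> y \<Longrightarrow> t = x \<or> t = y) \<Longrightarrow> x \<prec>\<cdot> y"
  by (auto simp: cover_relations_def)

lemma ex_cover_below: "x \<prec> y \<Longrightarrow> \<exists>v. x \<preceq> v \<and> v \<prec>\<cdot> y"
proof (induction x rule: up_induct)
  case (greater x)
  show ?case
  proof (cases "\<exists>t. x \<prec> t \<and> t \<prec> y")
    case True
    then obtain t where t: "x \<prec> t" "t \<prec> y" by blast
    then obtain v where "t \<preceq> v" "v \<prec>\<cdot> y" using greater.IH by blast
    then show ?thesis using t le_trans by blast
  next
    case False
    then have "x \<prec>\<cdot> y" using greater.prems by (intro cvI) auto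
    then show ?thesis using greater.prems le_refl le_Field by blast
  qed
qed

lemma ex_cover_above: "x \<prec> y \<Longrightarrow> \<exists>v. x \<prec>\<cdot> v \<and> v \<preceq> y"
proof (induction y rule: down_induct)
  case (less y)
  show ?case
  proof (cases "\<exists>t. x \<prec> t \<and> t \<prec> y")
    case True
    then obtain t where t: "x \<prec> t" "t \<prec> y" by blast
    then obtain v where "x \<prec>\<cdot> v" "v \<preceq> t" using less.IH by blast
    then show ?thesis using t le_trans by blast
  next
    case False
    then have "x \<prec>\<cdot> y" using less.prems by (intro cvI) auto
    then show ?thesis using less.prems le_refl le_Field by blast
  qed
qed

lemma le_cover_rtrancl: "x \<preceq> y \<Longrightarrow> (x, y) \<in> (cover_relations r)\<^sup>*"
proof (induction y rule: down_induct)
  case (less y)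
  show ?case
  proof (cases "x = y")
    case False
    then obtain v where v: "x \<preceq> v" "v \<prec>\<cdot> y" using less.prems ex_cover_below by blast
    then show ?thesis using less.IH cv_lt by (meson rtrancl.simps)
  qed simp
qed

lemma cv_same_lower: "w \<prec>\<cdot> x \<Longrightarrow> w \<prec>\<cdot> y \<Longrightarrow> x \<preceq> y \<Longrightarrow> x = y"
  using cv_between cv_lt by blast

lemma cv_same_upper: "x \<prec>\<cdot> z \<Longrightarrow> y \<prec>\<cdot> z \<Longrightarrow> x \<preceq> y \<Longrightarrow> x = y"
  using cv_between cv_lt by blast

lemma mem_interval: "t \<in> poset_interval r w z \<longleftrightarrow> w \<preceq> t \<and> t \<preceq> z"
  by (simp add: poset_interval_def)

lemma interval_convex: "poset_convex r (poset_interval r w z)"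
  unfolding poset_convex_def mem_interval by (meson le_Field le_trans mem_interval subsetI)

end


section \<open>The intervals of a d-complete poset\<close>

text \<open>Intervals isomorphic to \<open>d_k(1)\<close>, built from the inside out: a diamond,
  then one new bottom and one new top at a time. This replaces isomorphisms by covers and allows
  induction along neck and tail; \<open>dk_interval_iff\<close> proves the agreement.\<close>

inductive dk_int :: "'a rel \<Rightarrow> nat \<Rightarrow> 'a \<Rightarrow> 'a \<Rightarrow> 'a \<Rightarrow> 'a \<Rightarrow> bool" for r where
  diamond: "\<lbrakk>x \<noteq> y; (w, x) \<in> cover_relations r; (w, y) \<in> cover_relations r;
     (x, z) \<in> cover_relations r; (y, z) \<in> cover_relations r;
     poset_interval r w z = {w, x, y, z}\<rbrakk> \<Longrightarrow> dk_int r 3 w x y z"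
| extend: "\<lbrakk>dk_int r k w' x y z'; (w, w') \<in> cover_relations r; (z', z) \<in> cover_relations r;
     poset_interval r w z = insert w (insert z (poset_interval r w' z'))\<rbrakk>
     \<Longrightarrow> dk_int r (Suc k) w x y z"

lemma dk_int_ge_3: "dk_int r k w x y z \<Longrightarrow> k \<ge> 3"
  by (induction rule: dk_int.induct) auto

text \<open>Position of \<open>d_k(1)\<close> inside \<open>d_(k+1)(1)\<close>: the tail is numbered
  from the bottom, so a new bottom shifts its indices, while the neck is numbered from the sides
  upwards and keeps them.\<close>

definition dk_shift1 :: "dk_elt \<Rightarrow> dk_elt" where
  "dk_shift1 a = (case a of Tail j \<Rightarrow> Tail (Suc j) | _ \<Rightarrow> a)"

lemma dk_shift1_simps [simp]:
  "dk_shift1 (Tail j) = Tail (Suc j)" "dk_shift1 SideX = SideX" "dk_shift1 SideY = SideY"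
  "dk_shift1 (Neck j) = Neck j"
  by (auto simp: dk_shift1_def)

lemma inj_dk_shift1: "inj_on dk_shift1 A"
  by (auto simp: inj_on_def dk_shift1_def split: dk_elt.splits)

lemma dk_carrier_3: "dk_carrier 3 = {Tail 1, SideX, SideY, Neck 1}"
  by (auto simp: dk_carrier_def)

lemma dk_carrier_Suc:
  assumes "k \<ge> 3"
  shows "dk_carrier (Suc k) = insert (Tail 1) (insert (Neck (k - 1)) (dk_shift1 ` dk_carrier k))"
proof -
  have *: "{1..Suc k - 2} = insert 1 (Suc ` {1..k - 2})"
  proof -
    have "Suc ` {1..k - 2} = {2..Suc (k - 2)}"
      by (simp only: image_Suc_atLeastAtMost numeral_2_eq_2 One_nat_def)
    then show ?thesis using assms by auto
  qed
  have **: "{1..Suc k - 2} = insert (k - 1) {1..k - 2}"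
    using assms by auto
  have "Tail ` {1..Suc k - 2} = insert (Tail 1) (dk_shift1 ` Tail ` {1..k - 2})"
    unfolding * by (simp only: image_insert image_image dk_shift1_simps)
  moreover have "Neck ` {1..Suc k - 2} = insert (Neck (k - 1)) (dk_shift1 ` Neck ` {1..k - 2})"
    unfolding ** by (simp add: image_image)
  ultimately show ?thesis
    unfolding dk_carrier_def image_Un by auto
qed

lemma dk_shift1_notin: "Tail 1 \<notin> dk_shift1 ` dk_carrier k" "k \<ge> 3 \<Longrightarrow> Neck (k - 1) \<notin> dk_shift1 ` dk_carrier k"
  by (auto simp: dk_carrier_def)

lemma dk_rank_shift1: "k \<ge> 3 \<Longrightarrow> a \<in> dk_carrier k \<Longrightarrow> dk_rank (Suc k) (dk_shift1 a) = Suc (dk_rank k a)"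
  by (auto simp: dk_carrier_def)

text \<open>Comparability in \<open>d_k(1)\<close> is determined by rank
  (\<open>dk_poset_iff\<close>). Allowing any part \<open>A\<close> of the carrier treats
  \<open>d_k(1)\<close> and its version without maximum alike.\<close>

definition dk_embedding :: "'a rel \<Rightarrow> nat \<Rightarrow> dk_elt set \<Rightarrow> 'a set \<Rightarrow> (dk_elt \<Rightarrow> 'a) \<Rightarrow> bool" where
  "dk_embedding r k A I f \<longleftrightarrow> bij_betw f A I \<and>
     (\<forall>a \<in> A. \<forall>b \<in> A. (f a, f b) \<in> r \<longleftrightarrow> a = b \<or> dk_rank k a < dk_rank k b)"

context fin_poset
begin

lemma Field_Restr: "I \<subseteq> Field r \<Longrightarrow> Field (Restr r I) = I"
proof
  assume I: "I \<subseteq> Field r"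
  show "I \<subseteq> Field (Restr r I)"
  proof
    fix a assume "a \<in> I"
    then have "(a, a) \<in> Restr r I" using I le_refl by auto
    then show "a \<in> Field (Restr r I)" unfolding Field_def by blast
  qed
qed (auto simp: Field_def)

lemma iso_Restr_dk_iff:
  assumes "k \<ge> 3" "A \<subseteq> dk_carrier k" "I \<subseteq> Field r"
  shows "poset_iso (Restr (dk_poset k) A) (Restr r I) f \<longleftrightarrow> dk_embedding r k A I f"
proof -
  have FA: "Field (Restr (dk_poset k) A) = A"
  proof
    show "A \<subseteq> Field (Restr (dk_poset k) A)"
    proof
      fix a assume "a \<in> A"
      then have "(a, a) \<in> Restr (dk_poset k) A" using assms(1,2) by (auto simp: dk_poset_iff)
      then show "a \<in> Field (Restr (dk_poset k) A)" unfolding Field_def by blast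
    qed
  qed (auto simp: Field_def)
  have "(a, b) \<in> Restr (dk_poset k) A \<longleftrightarrow> a = b \<or> dk_rank k a < dk_rank k b" if "a \<in> A" "b \<in> A" for a b
    using that assms(1,2) by (auto simp: dk_poset_iff)
  moreover have "(f a, f b) \<in> Restr r I \<longleftrightarrow> (f a, f b) \<in> r" if "a \<in> A" "b \<in> A" "bij_betw f A I" for a b
    using that by (auto simp: bij_betw_def)
  ultimately show ?thesis
    unfolding iso_iff2 FA Field_Restr[OF assms(3)] dk_embedding_def by blast
qed

lemma iso_dk_iff:
  assumes "k \<ge> 3" "I \<subseteq> Field r"
  shows "poset_iso (dk_poset k) (Restr r I) f \<longleftrightarrow> dk_embedding r k (dk_carrier k) I f"
proof -
  have "Restr (dk_poset k) (dk_carrier k) = dk_poset k"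
    using assms(1) by (auto simp: dk_poset_iff)
  then show ?thesis using iso_Restr_dk_iff[OF assms(1) order_refl assms(2)] by simp
qed

lemma interval_subset_Field: "poset_interval r w z \<subseteq> Field r"
  using le_Field mem_interval by blast

lemma dk_int_D:
  assumes "dk_int r k w x y z"
  shows "w \<prec> x \<and> w \<prec> y \<and> x \<prec> z \<and> y \<prec> z \<and> x \<noteq> y \<and> \<not> x \<preceq> y \<and> \<not> y \<preceq> x"
  using assms
proof induction
  case (diamond x y w z)
  then show ?case using cv_lt cv_same_upper by metis
next
  case (extend k w' x y z' w z)
  then show ?case using cv_lt lt_le_trans le_lt_trans by metis
qed

lemma dk_int_lt: "dk_int r k w x y z \<Longrightarrow> w \<prec> z"
  using dk_int_D le_trans le_antisym by metis

lemma embedding_insert_top: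
  assumes f: "dk_embedding r k A I f" and c: "c \<notin> A" "\<And>a. a \<in> A \<Longrightarrow> dk_rank k a < dk_rank k c"
    and z: "z \<in> Field r" "\<And>t. t \<in> I \<Longrightarrow> t \<prec> z"
  shows "dk_embedding r k (insert c A) (insert z I) (f(c := z))"
proof -
  have fI: "f a \<in> I" if "a \<in> A" for a
    using f that by (auto simp: dk_embedding_def bij_betw_def)
  have ne: "a \<noteq> c" if "a \<in> A" for a using c(1) that by blast
  have lt: "f a \<preceq> z" "\<not> z \<preceq> f a" "dk_rank k a < dk_rank k c" "\<not> dk_rank k c < dk_rank k a" if "a \<in> A" for a
    using z(2)[OF fI[OF that]] le_antisym[of z "f a"] c(2)[OF that] by auto
  have "bij_betw (f(c := z)) A I"
    using f ne by (subst bij_betw_cong[of A _ f]) (auto simp: dk_embedding_def)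
  then have "bij_betw (f(c := z)) (insert c A) (insert z I)"
    using c(1) z(2) by (auto simp: bij_betw_def)
  moreover have "(f(c := z)) a \<preceq> (f(c := z)) b \<longleftrightarrow> a = b \<or> dk_rank k a < dk_rank k b"
    if "a \<in> insert c A" "b \<in> insert c A" for a b
    using that f lt ne le_refl[OF z(1)] by (auto simp: dk_embedding_def)
  ultimately show ?thesis unfolding dk_embedding_def by blast
qed

text \<open>The new bottom takes the position \<open>Tail 1\<close> and everything else moves by
  \<open>dk_shift1\<close>. The last neck position of \<open>d_(k+1)(1)\<close> stays empty, which
  is the shape in axioms (1) and (3).\<close>

lemma embedding_insert_bottom:
  assumes k: "k \<ge> 3" and f: "dk_embedding r k (dk_carrier k) I f"
    and w: "w \<in> Field r" "\<And>t. t \<in> I \<Longrightarrow> w \<prec> t"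
  shows "\<exists>g. dk_embedding r (Suc k) (dk_carrier (Suc k) - {Neck (k - 1)}) (insert w I) g \<and>
    g SideX = f SideX \<and> g SideY = f SideY"
proof -
  define g where "g = (\<lambda>a. case a of Tail i \<Rightarrow> if i = 1 then w else f (Tail (i - 1)) | _ \<Rightarrow> f a)"
  let ?C = "dk_carrier k" and ?D = "dk_shift1 ` dk_carrier k"
  have g1: "g (Tail 1) = w" by (auto simp: g_def)
  have g3: "g (dk_shift1 a) = f a" if "a \<in> ?C" for a
    using that k by (auto simp: g_def dk_carrier_def)
  have fI: "f a \<in> I" if "a \<in> ?C" for a
    using f that by (auto simp: dk_embedding_def bij_betw_def)
  have "inj_on g ?D"
    using f g3 by (auto simp: dk_embedding_def bij_betw_def inj_on_def)
  moreover have gD: "g ` ?D = I"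
    using f g3 by (auto simp: dk_embedding_def bij_betw_def image_image)
  ultimately have bijD: "bij_betw g ?D I" by (simp add: bij_betw_def)
  have bij1: "bij_betw g (insert (Tail 1) ?D) (insert w I)"
    using bijD w(2) g1 dk_shift1_notin(1)[of k] by (auto simp: bij_betw_def)
  have ord: "(g a, g b) \<in> r \<longleftrightarrow> a = b \<or> dk_rank (Suc k) a < dk_rank (Suc k) b"
    if "a \<in> insert (Tail 1) ?D" "b \<in> insert (Tail 1) ?D" for a b
  proof -
    have rw: "dk_rank (Suc k) (Tail 1) = 1" by auto
    have rC: "1 < dk_rank (Suc k) (dk_shift1 a)" "\<not> dk_rank (Suc k) (dk_shift1 a) < 1"
      if "a \<in> ?C" for a
      using that k by (auto simp: dk_carrier_def)
    have fw: "w \<preceq> f a" "\<not> f a \<preceq> w" if "a \<in> ?C" for a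
      using w(2)[OF fI[OF that]] le_antisym[of w "f a"] by auto
    have refl: "w \<preceq> w" using w le_refl by auto
    have sh: "dk_shift1 a = dk_shift1 b \<longleftrightarrow> a = b" for a b
      using inj_dk_shift1[of UNIV] by (auto simp: inj_on_def)
    have ff: "f a \<preceq> f b \<longleftrightarrow> dk_shift1 a = dk_shift1 b \<or> dk_rank (Suc k) (dk_shift1 a) < dk_rank (Suc k) (dk_shift1 b)"
      if "a \<in> ?C" "b \<in> ?C" for a b
      using that f k by (simp add: dk_embedding_def dk_rank_shift1 sh)
    have ne: "dk_shift1 c \<noteq> Tail 1" "Tail 1 \<noteq> dk_shift1 c" if "c \<in> ?C" for c
      using that dk_shift1_notin[of k] k by (metis imageI)+
    have "a = Tail 1 \<or> (\<exists>a' \<in> ?C. a = dk_shift1 a')" "b = Tail 1 \<or> (\<exists>b' \<in> ?C. b = dk_shift1 b')"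
      using that by blast+
    then show ?thesis
      by (elim disjE bexE; hypsubst; simp only: g1 g3 rw rC ff fw refl ne less_irrefl simp_thms)
  qed
  have "dk_carrier (Suc k) - {Neck (k - 1)} = insert (Tail 1) ?D"
    unfolding dk_carrier_Suc[OF k] using dk_shift1_notin(2)[OF k]
    by (metis Diff_insert_absorb dk_elt.distinct(5) insertE insert_commute)
  moreover have "g SideX = f SideX" "g SideY = f SideY" by (auto simp: g_def)
  ultimately show ?thesis
    using bij1 ord unfolding dk_embedding_def by (intro exI[of _ g]) simp
qed

lemma dk_int_embedding:
  assumes "dk_int r k w x y z"
  shows "\<exists>f. dk_embedding r k (dk_carrier k) (poset_interval r w z) f \<and> f SideX = x \<and> f SideY = y"
  using assms
proof induction
  case (diamond x y w z)
  have lt: "w \<prec> x" "w \<prec> y" "x \<prec> z" "y \<prec> z" "w \<prec> z" "\<not> x \<preceq> y" "\<not> y \<preceq> x"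
    using dk_int_D[OF dk_int.diamond[OF diamond]] dk_int_lt[OF dk_int.diamond[OF diamond]] by auto
  have refl: "t \<preceq> t" if "t \<in> {w, x, y, z}" for t using that lt le_refl le_Field by blast
  have n: "\<not> x \<preceq> w" "\<not> y \<preceq> w" "\<not> z \<preceq> x" "\<not> z \<preceq> y" "\<not> z \<preceq> w"
    using lt le_antisym by blast+
  define f where "f = (\<lambda>a. case a of Tail _ \<Rightarrow> w | SideX \<Rightarrow> x | SideY \<Rightarrow> y | Neck _ \<Rightarrow> z)"
  have "bij_betw f (dk_carrier 3) {w, x, y, z}"
    unfolding dk_carrier_3 using lt diamond(1) by (auto simp: bij_betw_def f_def)
  then have "dk_embedding r 3 (dk_carrier 3) {w, x, y, z} f"
    unfolding dk_embedding_def dk_carrier_3 using lt n refl by (auto simp: f_def)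
  then show ?case unfolding diamond by (intro exI[of _ f]) (auto simp: f_def)
next
  case (extend k w' x y z' w z)
  then obtain f where f: "dk_embedding r k (dk_carrier k) (poset_interval r w' z') f"
    "f SideX = x" "f SideY = y" by blast
  have k: "k \<ge> 3" using dk_int_ge_3[OF extend.hyps(1)] .
  have wt: "w \<prec> t" if "t \<in> poset_interval r w' z'" for t
    using that cv_lt extend.hyps(2) lt_le_trans unfolding mem_interval by metis
  have tz: "t \<prec> z" if "t \<in> insert w (poset_interval r w' z')" for t
    using that cv_lt extend.hyps(3) le_lt_trans dk_int_lt[OF dk_int.extend[OF extend.hyps(1-4)]]
    unfolding mem_interval by (metis insertE mem_interval)
  have F: "w \<in> Field r" "z \<in> Field r"
    using cv_lt extend.hyps(2,3) le_Field by blast+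
  obtain g where g: "dk_embedding r (Suc k) (dk_carrier (Suc k) - {Neck (k - 1)}) (insert w (poset_interval r w' z')) g"
    "g SideX = x" "g SideY = y"
    using embedding_insert_bottom[OF k f(1) F(1) wt] f(2,3) by auto
  have lt: "dk_rank (Suc k) a < dk_rank (Suc k) (Neck (k - 1))" if "a \<in> dk_carrier (Suc k) - {Neck (k - 1)}" for a
    using that k by (auto simp: dk_carrier_def)
  have "insert (Neck (k - 1)) (dk_carrier (Suc k) - {Neck (k - 1)}) = dk_carrier (Suc k)"
    unfolding dk_carrier_Suc[OF k] by blast
  then have "dk_embedding r (Suc k) (dk_carrier (Suc k)) (poset_interval r w z) (g(Neck (k - 1) := z))"
    using embedding_insert_top[OF g(1) _ lt F(2) tz] by (simp add: extend(4) insert_commute)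
  moreover have "(g(Neck (k - 1) := z)) SideX = x" "(g(Neck (k - 1) := z)) SideY = y" using g by auto
  ultimately show ?case by blast
qed

lemma embedding_shift:
  assumes k: "k \<ge> 3" and f: "dk_embedding r (Suc k) A I f" and A: "dk_shift1 ` dk_carrier k \<subseteq> A"
  shows "dk_embedding r k (dk_carrier k) (f ` dk_shift1 ` dk_carrier k) (f \<circ> dk_shift1)"
proof -
  have "inj_on f (dk_shift1 ` dk_carrier k)"
    using f A by (auto simp: dk_embedding_def bij_betw_def intro: inj_on_subset)
  then have "bij_betw (f \<circ> dk_shift1) (dk_carrier k) (f ` dk_shift1 ` dk_carrier k)"
    using inj_dk_shift1 by (auto simp: bij_betw_def comp_inj_on image_comp)
  moreover have "dk_shift1 a = dk_shift1 b \<longleftrightarrow> a = b" for a b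
    using inj_dk_shift1[of UNIV] by (auto simp: inj_on_def)
  ultimately show ?thesis
    using f A unfolding dk_embedding_def by (auto simp: dk_rank_shift1[OF k] subset_iff)
qed

text \<open>Converse of \<open>dk_int_embedding\<close>. Convexity turns comparabilities into
  covers, since whatever lies between two images is itself an image and the ranks leave no room. The
  induction strips bottom and top; the rest stays convex because these two lie strictly below and
  above all of it.\<close>

lemma embedding_convex:
  assumes "k \<ge> 3" "dk_embedding r k (dk_carrier k) I f" "poset_convex r I"
  shows "dk_int r k (f (Tail 1)) (f SideX) (f SideY) (f (Neck (k - 2))) \<and>
    I = poset_interval r (f (Tail 1)) (f (Neck (k - 2)))"
  using assms
proof (induction k arbitrary: I f rule: nat_induct_at_least)
  case base
  let ?w = "f (Tail 1)" and ?x = "f SideX" and ?y = "f SideY" and ?z = "f (Neck 1)"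
  have I: "I = {?w, ?x, ?y, ?z}" and ne: "distinct [?w, ?x, ?y, ?z]"
    using base(1) unfolding dk_embedding_def dk_carrier_3 by (auto simp: bij_betw_def)
  have le: "?w \<preceq> ?x" "?w \<preceq> ?y" "?x \<preceq> ?z" "?y \<preceq> ?z" "?w \<preceq> ?z"
    and n: "\<not> ?x \<preceq> ?y" "\<not> ?y \<preceq> ?x"
    using base(1) unfolding dk_embedding_def dk_carrier_3 by auto
  have conv: "t \<in> I" if "u \<in> I" "v \<in> I" "u \<preceq> t" "t \<preceq> v" for u v t
    using base(2) that unfolding poset_convex_def by blast
  have int: "I = poset_interval r ?w ?z"
  proof
    show "I \<subseteq> poset_interval r ?w ?z"
      using le le_refl le_Field unfolding I by (auto simp: mem_interval)
    show "poset_interval r ?w ?z \<subseteq> I"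
      using conv[of ?w ?z] I unfolding mem_interval subset_iff by blast
  qed
  have "?w \<prec>\<cdot> ?x" "?w \<prec>\<cdot> ?y" "?x \<prec>\<cdot> ?z" "?y \<prec>\<cdot> ?z"
  proof -
    show "?w \<prec>\<cdot> ?x" by (rule cvI) (use conv[of ?w ?x] le ne n le_antisym[of ?x ?z] I in auto)
    show "?w \<prec>\<cdot> ?y" by (rule cvI) (use conv[of ?w ?y] le ne n le_antisym[of ?y ?z] I in auto)
    show "?x \<prec>\<cdot> ?z" by (rule cvI) (use conv[of ?x ?z] le ne n le_antisym[of ?w ?x] I in auto)
    show "?y \<prec>\<cdot> ?z" by (rule cvI) (use conv[of ?y ?z] le ne n le_antisym[of ?w ?y] I in auto)
  qed
  then have "dk_int r 3 ?w ?x ?y ?z"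
    using I int ne by (intro diamond) auto
  then show ?case using int by auto
next
  case (Suc k)
  let ?w = "f (Tail 1)" and ?z = "f (Neck (k - 1))"
  let ?w' = "f (Tail 2)" and ?z' = "f (Neck (k - 2))"
  define J where "J = f ` dk_shift1 ` dk_carrier k"
  have I: "I = insert ?w (insert ?z J)"
    using Suc.prems(1) unfolding dk_embedding_def dk_carrier_Suc[OF Suc.hyps] J_def bij_betw_def by auto
  have f'': "dk_embedding r k (dk_carrier k) J (f \<circ> dk_shift1)"
    by (rule embedding_shift[OF Suc.hyps Suc.prems(1), folded J_def])
      (auto simp: dk_carrier_Suc[OF Suc.hyps])
  have ord: "f a \<preceq> f b \<longleftrightarrow> a = b \<or> dk_rank (Suc k) a < dk_rank (Suc k) b"
    if "a \<in> dk_carrier (Suc k)" "b \<in> dk_carrier (Suc k)" for a b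
    using Suc.prems(1) that by (simp add: dk_embedding_def)
  have inC: "Tail 1 \<in> dk_carrier (Suc k)" "Neck (k - 1) \<in> dk_carrier (Suc k)"
    "\<And>a. a \<in> dk_carrier k \<Longrightarrow> dk_shift1 a \<in> dk_carrier (Suc k)"
    by (auto simp: dk_carrier_Suc[OF Suc.hyps])
  have wJ: "?w \<preceq> t \<and> \<not> t \<preceq> ?w \<and> t \<preceq> ?z \<and> \<not> ?z \<preceq> t" if tJ: "t \<in> J" for t
  proof -
    obtain a where a: "a \<in> dk_carrier k" "t = f (dk_shift1 a)" using tJ unfolding J_def by blast
    have "1 < dk_rank (Suc k) (dk_shift1 a) \<and> dk_rank (Suc k) (dk_shift1 a) < k + (k - 1)"
      using a(1) Suc.hyps by (auto simp: dk_carrier_def)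
    moreover have "dk_shift1 a \<noteq> Tail 1" "dk_shift1 a \<noteq> Neck (k - 1)"
      using a dk_shift1_notin[of k] Suc.hyps by (metis imageI)+
    ultimately show ?thesis
      using ord inC a by simp
  qed
  have conv: "t \<in> I" if "u \<in> I" "v \<in> I" "u \<preceq> t" "t \<preceq> v" for u v t
    using Suc.prems(2) that unfolding poset_convex_def by blast
  have "poset_convex r J"
    unfolding poset_convex_def
  proof (intro conjI ballI allI impI)
    show "J \<subseteq> Field r" using Suc.prems(2) unfolding poset_convex_def I by blast
    fix u v t assume *: "u \<in> J" "v \<in> J" "u \<preceq> t \<and> t \<preceq> v"
    then have "t \<in> I" using conv I by blast
    moreover have "t \<noteq> ?w" "t \<noteq> ?z" using * wJ by blast+
    ultimately show "t \<in> J" using I by blast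
  qed
  from Suc.IH[OF f'' this]
  have IH: "dk_int r k ?w' (f SideX) (f SideY) ?z'" "J = poset_interval r ?w' ?z'"
    by (auto simp: numeral_2_eq_2)
  have wz: "?w \<preceq> ?z" using ord inC Suc.hyps by simp
  have mJ: "?w' \<in> J" "?z' \<in> J"
    using IH(2) dk_int_lt[OF IH(1)] le_refl le_Field by (auto simp: mem_interval)
  have IF: "I \<subseteq> Field r" using Suc.prems(2) by (simp add: poset_convex_def)
  have int: "I = poset_interval r ?w ?z"
  proof
    show "I \<subseteq> poset_interval r ?w ?z"
      using wJ wz IF le_refl unfolding I by (auto simp: mem_interval)
    show "poset_interval r ?w ?z \<subseteq> I"
      using conv[of ?w ?z] I unfolding mem_interval subset_iff by blast
  qed
  have "?w \<prec>\<cdot> ?w'"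
  proof (rule cvI)
    show "?w \<prec> ?w'" using wJ[OF mJ(1)] by auto
    fix t assume t: "?w \<preceq> t" "t \<preceq> ?w'"
    then have "t \<in> I" using conv[of ?w ?w'] I mJ by blast
    then show "t = ?w \<or> t = ?w'"
      using t wJ[OF mJ(1)] IH(2) le_antisym unfolding I by (auto simp: mem_interval)
  qed
  moreover have "?z' \<prec>\<cdot> ?z"
  proof (rule cvI)
    show "?z' \<prec> ?z" using wJ[OF mJ(2)] by auto
    fix t assume t: "?z' \<preceq> t" "t \<preceq> ?z"
    then have "t \<in> I" using conv[of ?z' ?z] I mJ by blast
    then show "t = ?z' \<or> t = ?z"
      using t wJ[OF mJ(2)] IH(2) le_antisym unfolding I by (auto simp: mem_interval)
  qed
  ultimately have "dk_int r (Suc k) ?w (f SideX) (f SideY) ?z"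
    using IH int I by (intro extend[OF IH(1)]) auto
  then show ?case using int by simp
qed

text \<open>An isomorphism yields an interval between the images of \<open>Tail 1\<close> and of the
  last neck element. That these are the given ends \<open>w\<close> and \<open>z\<close> follows
  because two equal nonempty intervals have the same ends.\<close>

lemma dk_interval_iff:
  assumes "k \<ge> 3"
  shows "poset_iso (dk_poset k) (Restr r (poset_interval r w z)) f \<Longrightarrow>
      dk_int r k w (f SideX) (f SideY) z \<and> z = f (Neck (k - 2))"
    and "dk_interval r k (poset_interval r w z) \<longleftrightarrow> (\<exists>x y. dk_int r k w x y z)"
proof -
  note iff = iso_dk_iff[OF assms interval_subset_Field]
  show 1: "dk_int r k w (f SideX) (f SideY) z \<and> z = f (Neck (k - 2))"
    if "poset_iso (dk_poset k) (Restr r (poset_interval r w z)) f" for f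
  proof -
    let ?w = "f (Tail 1)" and ?z = "f (Neck (k - 2))"
    from that have *: "dk_int r k ?w (f SideX) (f SideY) ?z" "poset_interval r w z = poset_interval r ?w ?z"
      using embedding_convex[OF assms _ interval_convex] iff by blast+
    have "?w \<preceq> ?z" using dk_int_lt[OF *(1)] by blast
    then have "?w \<in> poset_interval r w z" "?z \<in> poset_interval r w z"
      unfolding *(2) mem_interval using le_refl le_Field by blast+
    then have a: "w \<preceq> ?w" "?z \<preceq> z" "w \<preceq> z"
      unfolding mem_interval using le_trans[of w ?w z] by auto
    then have "w \<in> poset_interval r ?w ?z" "z \<in> poset_interval r ?w ?z"
      unfolding *(2)[symmetric] mem_interval using le_refl le_Field by blast+
    then have "w = ?w" "z = ?z" using a le_antisym unfolding mem_interval by blast+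
    then show ?thesis using *(1) by simp
  qed
  show "dk_interval r k (poset_interval r w z) \<longleftrightarrow> (\<exists>x y. dk_int r k w x y z)"
    using 1 dk_int_embedding iff unfolding dk_interval_def by metis
qed

lemma dk_interval_sides_iff: "dk_interval_sides r z (w, x, y) \<longleftrightarrow> (\<exists>k. dk_int r k w x y z)"
proof
  assume "dk_interval_sides r z (w, x, y)"
  then show "\<exists>k. dk_int r k w x y z"
    unfolding dk_interval_sides_def using dk_interval_iff(1) by blast
next
  assume "\<exists>k. dk_int r k w x y z"
  then obtain k where k: "dk_int r k w x y z" by blast
  then show "dk_interval_sides r z (w, x, y)"
    unfolding dk_interval_sides_def prod.case
    using dk_int_embedding[OF k] dk_int_ge_3[OF k] iso_dk_iff[OF dk_int_ge_3[OF k] interval_subset_Field] by blast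
qed

text \<open>The neck element \<open>Neck i\<close> of a \<open>d_k\<close>-interval is the top of
  the \<open>d_(i+2)\<close>-interval inside it, by \<open>in_neck_dk_interval_sides\<close>. So
  necks can be replaced by tops throughout.\<close>

lemma in_neck_iff: "in_neck r z \<longleftrightarrow> (\<exists>k w x y. dk_int r k w x y z)"
proof
  assume "in_neck r z"
  then obtain t where "dk_interval_sides r z t"
    using in_neck_dk_interval_sides[OF finite_poset] by blast
  then show "\<exists>k w x y. dk_int r k w x y z"
    using dk_interval_sides_iff by (cases t) blast
next
  assume "\<exists>k w x y. dk_int r k w x y z"
  then obtain k w x y where k: "dk_int r k w x y z" by blast
  obtain f where f: "poset_iso (dk_poset k) (Restr r (poset_interval r w z)) f"
    using dk_int_embedding[OF k] iso_dk_iff[OF dk_int_ge_3[OF k] interval_subset_Field] by blast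
  moreover have "z = f (Neck (k - 2))" "k \<ge> 3"
    using dk_interval_iff(1)[OF dk_int_ge_3[OF k] f] dk_int_ge_3[OF k] by auto
  ultimately show "in_neck r z"
    unfolding in_neck_def by (intro exI[of _ k] conjI exI[of _ w] exI[of _ z] exI[of _ f]) auto
qed

lemma dk_minus_convex_3_iff:
  "dk_minus_convex r 3 I \<longleftrightarrow> (\<exists>w x y. x \<noteq> y \<and> w \<prec>\<cdot> x \<and> w \<prec>\<cdot> y \<and> I = {w, x, y})"
proof -
  have C: "dk_carrier 3 - {Neck (3 - 2)} = {Tail 1, SideX, SideY}"
    unfolding dk_carrier_3 by auto
  have sub: "{Tail 1, SideX, SideY} \<subseteq> dk_carrier 3" unfolding dk_carrier_3 by auto
  have iff: "poset_iso (dk_minus_poset 3) (Restr r I) f \<longleftrightarrow> dk_embedding r 3 {Tail 1, SideX, SideY} I f"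
    if "I \<subseteq> Field r" for f
    unfolding dk_minus_poset_def C using iso_Restr_dk_iff[OF _ sub that] by simp
  show ?thesis
  proof
    assume "dk_minus_convex r 3 I"
    then obtain f where f: "dk_embedding r 3 {Tail 1, SideX, SideY} I f" and conv: "poset_convex r I"
      using iff unfolding dk_minus_convex_def poset_convex_def by blast
    let ?w = "f (Tail 1)" and ?x = "f SideX" and ?y = "f SideY"
    have I: "I = {?w, ?x, ?y}" and ne: "distinct [?w, ?x, ?y]"
      and le: "?w \<preceq> ?x" "?w \<preceq> ?y" and n: "\<not> ?x \<preceq> ?y" "\<not> ?y \<preceq> ?x"
      using f unfolding dk_embedding_def by (auto simp: bij_betw_def)
    have c: "t \<in> I" if "u \<in> I" "v \<in> I" "u \<preceq> t" "t \<preceq> v" for u v t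
      using conv that unfolding poset_convex_def by blast
    have "?w \<prec>\<cdot> ?x" by (rule cvI) (use c[of ?w ?x] le ne n I in auto)
    moreover have "?w \<prec>\<cdot> ?y" by (rule cvI) (use c[of ?w ?y] le ne n I in auto)
    ultimately show "\<exists>w x y. x \<noteq> y \<and> w \<prec>\<cdot> x \<and> w \<prec>\<cdot> y \<and> I = {w, x, y}"
      using I ne by (intro exI[of _ ?w] exI[of _ ?x] exI[of _ ?y]) auto
  next
    assume "\<exists>w x y. x \<noteq> y \<and> w \<prec>\<cdot> x \<and> w \<prec>\<cdot> y \<and> I = {w, x, y}"
    then obtain w x y where *: "x \<noteq> y" "w \<prec>\<cdot> x" "w \<prec>\<cdot> y" "I = {w, x, y}" by blast
    have lt: "w \<preceq> x" "w \<noteq> x" "w \<preceq> y" "w \<noteq> y" "\<not> x \<preceq> y" "\<not> y \<preceq> x" "\<not> x \<preceq> w" "\<not> y \<preceq> w"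
      using cv_lt[OF *(2)] cv_lt[OF *(3)] cv_same_lower * le_antisym by blast+
    have refl: "w \<preceq> w" "x \<preceq> x" "y \<preceq> y" using lt le_refl le_Field by blast+
    have F: "I \<subseteq> Field r" using refl le_Field unfolding *(4) by auto
    define f where "f = (\<lambda>a. case a of Tail _ \<Rightarrow> w | SideX \<Rightarrow> x | SideY \<Rightarrow> y | Neck _ \<Rightarrow> w)"
    have "dk_embedding r 3 {Tail 1, SideX, SideY} I f"
      unfolding dk_embedding_def using lt refl * by (auto simp: f_def bij_betw_def)
    moreover have "poset_convex r I"
      unfolding poset_convex_def
    proof (intro conjI ballI allI impI F)
      fix u v t assume a: "u \<in> I" "v \<in> I" "u \<preceq> t \<and> t \<preceq> v"
      then have "u \<preceq> v" using le_trans by blast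
      then have "u = v \<or> u = w" using a lt unfolding *(4) by blast
      then show "t \<in> I"
        using a cv_between[OF *(2), of t] cv_between[OF *(3), of t] le_antisym[of u t] unfolding *(4) by auto
    qed
    ultimately show "dk_minus_convex r 3 I"
      using iff[OF F] unfolding dk_minus_convex_def by blast
  qed
qed

text \<open>Removing the maximum of \<open>d_(k+1)(1)\<close> leaves a complete
  \<open>d_k(1)\<close> with one more element below it. The two descriptions of \<open>I\<close>
  together say that nothing else lies between the new bottom and \<open>z'\<close>.\<close>

lemma dk_minus_convex_Suc_iff:
  assumes k: "k \<ge> 3"
  shows "dk_minus_convex r (Suc k) I \<longleftrightarrow> (\<exists>w w' x y z'. dk_int r k w' x y z' \<and> w \<prec>\<cdot> w' \<and>
    I = poset_interval r w z' \<and> I = insert w (poset_interval r w' z'))"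
proof -
  let ?A = "dk_carrier (Suc k) - {Neck (k - 1)}"
  have C: "?A = insert (Tail 1) (dk_shift1 ` dk_carrier k)"
    unfolding dk_carrier_Suc[OF k] using dk_shift1_notin(2)[OF k]
    by (metis Diff_insert_absorb dk_elt.distinct(5) insertE insert_commute)
  have eq: "Suc k - 2 = k - 1" by simp
  have iff: "poset_iso (dk_minus_poset (Suc k)) (Restr r I) f \<longleftrightarrow> dk_embedding r (Suc k) ?A I f"
    if "I \<subseteq> Field r" for f
    unfolding dk_minus_poset_def eq using iso_Restr_dk_iff[OF _ Diff_subset that] k by simp
  show ?thesis
  proof
    assume "dk_minus_convex r (Suc k) I"
    then obtain f where f: "dk_embedding r (Suc k) ?A I f" and conv: "poset_convex r I"
      using iff unfolding dk_minus_convex_def poset_convex_def by blast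
    let ?w = "f (Tail 1)" and ?w' = "f (Tail 2)" and ?z' = "f (Neck (k - 2))"
    define J where "J = f ` dk_shift1 ` dk_carrier k"
    have I: "I = insert ?w J"
      using f unfolding dk_embedding_def C J_def bij_betw_def by auto
    have f': "dk_embedding r k (dk_carrier k) J (f \<circ> dk_shift1)"
      unfolding J_def by (rule embedding_shift[OF k f]) (use C in blast)
    have wJ: "?w \<preceq> t \<and> \<not> t \<preceq> ?w" if tJ: "t \<in> J" for t
    proof -
      obtain a where a: "a \<in> dk_carrier k" "t = f (dk_shift1 a)" using tJ unfolding J_def by blast
      have "1 < dk_rank (Suc k) (dk_shift1 a)"
        using a(1) k by (auto simp: dk_carrier_def)
      moreover have "dk_shift1 a \<noteq> Tail 1" using a dk_shift1_notin(1)[of k] by (metis imageI)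
      moreover have "dk_shift1 a \<in> ?A" "Tail 1 \<in> ?A" unfolding C using a by blast+
      ultimately show ?thesis using f a(2) unfolding dk_embedding_def by simp
    qed
    have c: "t \<in> I" if "u \<in> I" "v \<in> I" "u \<preceq> t" "t \<preceq> v" for u v t
      using conv that unfolding poset_convex_def by blast
    have IF: "I \<subseteq> Field r" using conv by (simp add: poset_convex_def)
    have "poset_convex r J"
      unfolding poset_convex_def
    proof (intro conjI ballI allI impI)
      show "J \<subseteq> Field r" using IF I by blast
      fix u v t assume *: "u \<in> J" "v \<in> J" "u \<preceq> t \<and> t \<preceq> v"
      then have "t \<in> I" using c I by blast
      moreover have "t \<noteq> ?w" using * wJ by blast
      ultimately show "t \<in> J" using I by blast
    qed
    from embedding_convex[OF k f' this]
    have d: "dk_int r k ?w' (f SideX) (f SideY) ?z'" "J = poset_interval r ?w' ?z'"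
      by (auto simp: numeral_2_eq_2)
    have mJ: "?w' \<in> J" "?z' \<in> J"
      using d(2) dk_int_lt[OF d(1)] le_refl le_Field by (auto simp: mem_interval)
    have "?w \<prec>\<cdot> ?w'"
    proof (rule cvI)
      show "?w \<prec> ?w'" using wJ[OF mJ(1)] by auto
      fix t assume t: "?w \<preceq> t" "t \<preceq> ?w'"
      then have "t \<in> I" using c[of ?w ?w'] I mJ by blast
      then show "t = ?w \<or> t = ?w'"
        using t d(2) le_antisym unfolding I by (auto simp: mem_interval)
    qed
    moreover have "I = poset_interval r ?w ?z'"
    proof
      show "I \<subseteq> poset_interval r ?w ?z'"
        using wJ d(2) mJ IF le_refl unfolding I by (auto simp: mem_interval)
      show "poset_interval r ?w ?z' \<subseteq> I"
        using c[of ?w ?z'] I mJ(2) unfolding mem_interval subset_iff by blast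
    qed
    ultimately show "\<exists>w w' x y z'. dk_int r k w' x y z' \<and> w \<prec>\<cdot> w' \<and>
        I = poset_interval r w z' \<and> I = insert w (poset_interval r w' z')"
      using d I by blast
  next
    assume "\<exists>w w' x y z'. dk_int r k w' x y z' \<and> w \<prec>\<cdot> w' \<and>
        I = poset_interval r w z' \<and> I = insert w (poset_interval r w' z')"
    then obtain w w' x y z' where *: "dk_int r k w' x y z'" "w \<prec>\<cdot> w'"
      "I = poset_interval r w z'" "I = insert w (poset_interval r w' z')" by blast
    obtain f where f: "dk_embedding r k (dk_carrier k) (poset_interval r w' z') f"
      using dk_int_embedding[OF *(1)] by blast
    have "w \<in> Field r" using *(2) cv_lt le_Field by blast
    moreover have "w \<prec> t" if "t \<in> poset_interval r w' z'" for t
      using that cv_lt[OF *(2)] lt_le_trans unfolding mem_interval by blast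
    ultimately obtain g where "dk_embedding r (Suc k) ?A I g"
      using embedding_insert_bottom[OF k f] unfolding *(4) by blast
    then show "dk_minus_convex r (Suc k) I"
      using iff[of g] interval_convex interval_subset_Field unfolding *(3) dk_minus_convex_def by blast
  qed
qed

end

text \<open>The axioms rewritten with covers and \<open>dk_int\<close>, where axioms (1) and (3) are
  split into the case \<open>k = 3\<close> and the case of a new bottom under a smaller interval.
  The clauses after finiteness are (1), (1), (2), (3), (3).\<close>

definition dcomp :: "'a rel \<Rightarrow> bool" where
  "dcomp r \<longleftrightarrow> finite_poset r \<and>
     (\<forall>w x y. x \<noteq> y \<and> (w, x) \<in> cover_relations r \<and> (w, y) \<in> cover_relations r \<longrightarrow>
        (\<exists>z. dk_int r 3 w x y z)) \<and>
     (\<forall>k w w' x y z'. dk_int r k w' x y z' \<and> (w, w') \<in> cover_relations r \<and>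
        poset_interval r w z' = insert w (poset_interval r w' z') \<longrightarrow>
        (\<exists>z. (z', z) \<in> cover_relations r \<and>
           poset_interval r w z = insert w (insert z (poset_interval r w' z')))) \<and>
     (\<forall>k w x y z v. dk_int r k w x y z \<and> (v, z) \<in> cover_relations r \<longrightarrow> (w, v) \<in> r) \<and>
     (\<forall>w w' x y. x \<noteq> y \<and> (w, x) \<in> cover_relations r \<and> (w, y) \<in> cover_relations r \<and>
        (w', x) \<in> cover_relations r \<and> (w', y) \<in> cover_relations r \<longrightarrow> w = w') \<and>
     (\<forall>k u w w' x y z'. dk_int r k w' x y z' \<and> (w, w') \<in> cover_relations r \<and>
        poset_interval r w z' = insert w (poset_interval r w' z') \<and> (u, w') \<in> cover_relations r \<and>
        poset_interval r u z' = insert u (poset_interval r w' z') \<longrightarrow> u = w)"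

lemma dcompD:
  assumes "dcomp r"
  shows "finite_poset r"
    and "x \<noteq> y \<Longrightarrow> (w, x) \<in> cover_relations r \<Longrightarrow> (w, y) \<in> cover_relations r \<Longrightarrow> \<exists>z. dk_int r 3 w x y z"
    and "dk_int r k w' x y z' \<Longrightarrow> (w, w') \<in> cover_relations r \<Longrightarrow>
      poset_interval r w z' = insert w (poset_interval r w' z') \<Longrightarrow>
      \<exists>z. (z', z) \<in> cover_relations r \<and> poset_interval r w z = insert w (insert z (poset_interval r w' z'))"
    and "dk_int r k w x y z \<Longrightarrow> (v, z) \<in> cover_relations r \<Longrightarrow> (w, v) \<in> r"
    and "x \<noteq> y \<Longrightarrow> (w, x) \<in> cover_relations r \<Longrightarrow> (w, y) \<in> cover_relations r \<Longrightarrow>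
      (u, x) \<in> cover_relations r \<Longrightarrow> (u, y) \<in> cover_relations r \<Longrightarrow> w = u"
    and "dk_int r k w' x y z' \<Longrightarrow> (w, w') \<in> cover_relations r \<Longrightarrow>
      poset_interval r w z' = insert w (poset_interval r w' z') \<Longrightarrow> (u, w') \<in> cover_relations r \<Longrightarrow>
      poset_interval r u z' = insert u (poset_interval r w' z') \<Longrightarrow> u = w"
proof -
  note d = assms[unfolded dcomp_def]
  note d1 = d[THEN conjunct2] and d2 = d[THEN conjunct2, THEN conjunct2]
  note d3 = d2[THEN conjunct2] and d4 = d2[THEN conjunct2, THEN conjunct2]
  show "finite_poset r" using d by (rule conjunct1)
  show "x \<noteq> y \<Longrightarrow> (w, x) \<in> cover_relations r \<Longrightarrow> (w, y) \<in> cover_relations r \<Longrightarrow> \<exists>z. dk_int r 3 w x y z"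
    using d1[THEN conjunct1] by blast
  show "dk_int r k w' x y z' \<Longrightarrow> (w, w') \<in> cover_relations r \<Longrightarrow>
      poset_interval r w z' = insert w (poset_interval r w' z') \<Longrightarrow>
      \<exists>z. (z', z) \<in> cover_relations r \<and> poset_interval r w z = insert w (insert z (poset_interval r w' z'))"
    using d2[THEN conjunct1] by blast
  show "dk_int r k w x y z \<Longrightarrow> (v, z) \<in> cover_relations r \<Longrightarrow> (w, v) \<in> r"
    using d3[THEN conjunct1] by blast
  show "x \<noteq> y \<Longrightarrow> (w, x) \<in> cover_relations r \<Longrightarrow> (w, y) \<in> cover_relations r \<Longrightarrow>
      (u, x) \<in> cover_relations r \<Longrightarrow> (u, y) \<in> cover_relations r \<Longrightarrow> w = u"
    using d4[THEN conjunct1] by blast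
  show "dk_int r k w' x y z' \<Longrightarrow> (w, w') \<in> cover_relations r \<Longrightarrow>
      poset_interval r w z' = insert w (poset_interval r w' z') \<Longrightarrow> (u, w') \<in> cover_relations r \<Longrightarrow>
      poset_interval r u z' = insert u (poset_interval r w' z') \<Longrightarrow> u = w"
    using d4[THEN conjunct2] by blast
qed

context fin_poset
begin

lemma interval_eqD:
  assumes "poset_interval r w z = poset_interval r w' z'" "w' \<preceq> z'"
  shows "w = w' \<and> z = z'"
proof -
  have "w' \<in> poset_interval r w z" "z' \<in> poset_interval r w z"
    unfolding assms(1) mem_interval using assms(2) le_refl le_Field by blast+
  then have a: "w \<preceq> w'" "z' \<preceq> z" "w \<preceq> z"
    unfolding mem_interval using le_trans[of w w' z] by auto
  then have "w \<in> poset_interval r w' z'" "z \<in> poset_interval r w' z'"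
    unfolding assms(1)[symmetric] mem_interval using le_refl le_Field by blast+
  then show ?thesis using a le_antisym unfolding mem_interval by blast
qed

lemma extremal_V:
  assumes "x \<noteq> y" "w \<prec>\<cdot> x" "w \<prec>\<cdot> y"
  shows "maximal_elements r {w, x, y} = {x, y}" "minimal_elements r {w, x, y} = {w}"
proof -
  have "w \<preceq> x" "w \<noteq> x" "w \<preceq> y" "w \<noteq> y" "\<not> x \<preceq> y" "\<not> y \<preceq> x" "\<not> x \<preceq> w" "\<not> y \<preceq> w"
    using cv_lt[OF assms(2)] cv_lt[OF assms(3)] cv_same_lower assms le_antisym by blast+
  then show "maximal_elements r {w, x, y} = {x, y}" "minimal_elements r {w, x, y} = {w}"
    using assms(1) by (auto simp: maximal_elements_def minimal_elements_def)
qed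

lemma extremal_interval:
  assumes "w \<preceq> z"
  shows "maximal_elements r (poset_interval r w z) = {z}" "minimal_elements r (poset_interval r w z) = {w}"
proof -
  have "w \<in> poset_interval r w z" "z \<in> poset_interval r w z"
    using assms le_refl le_Field unfolding mem_interval by blast+
  then show "maximal_elements r (poset_interval r w z) = {z}" "minimal_elements r (poset_interval r w z) = {w}"
    using le_antisym[of _ z] le_antisym[of _ w] unfolding maximal_elements_def minimal_elements_def
    by (auto simp: mem_interval)
qed

text \<open>Axiom (1) only says that \<open>I\<close> with \<open>p\<close> added is some interval.
  Its least and greatest elements have to be identified as \<open>w\<close> and
  \<open>p\<close>.\<close>

lemma interval_insert_top:
  assumes "insert p I = poset_interval r a b" "w \<in> I" "v \<in> I" "v \<prec> p" "\<And>t. t \<in> I \<Longrightarrow> w \<preceq> t \<and> \<not> p \<preceq> t"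
  shows "insert p I = poset_interval r w p"
proof -
  have "w \<preceq> p" using assms(3-5) le_trans by blast
  have "w \<in> poset_interval r a b" "p \<in> poset_interval r a b" using assms by blast+
  then have "a \<preceq> w" "p \<preceq> b" "a \<preceq> b" unfolding mem_interval using le_trans[of a w b] by auto
  then have "a \<in> insert p I" "b \<in> insert p I"
    unfolding assms(1) mem_interval using le_refl le_Field by blast+
  then have "w = a" "p = b"
    using \<open>a \<preceq> w\<close> \<open>p \<preceq> b\<close> \<open>w \<preceq> p\<close> assms(5) le_antisym by blast+
  then show ?thesis using assms(1) by simp
qed

lemma interval_shrink:
  assumes "w \<prec>\<cdot> w'" "z' \<prec>\<cdot> z" "w' \<preceq> z'" "poset_interval r w z = insert w (insert z (poset_interval r w' z'))"
  shows "poset_interval r w z' = insert w (poset_interval r w' z')"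
proof (rule Set.set_eqI)
  fix t
  have lt: "w \<preceq> w'" "z' \<preceq> z" "\<not> z \<preceq> z'" "w \<preceq> z'"
    using cv_lt[OF assms(1)] cv_lt[OF assms(2)] assms(3) le_antisym le_trans[of w w' z'] by blast+
  have "t \<in> poset_interval r w z \<longleftrightarrow> t = w \<or> t = z \<or> t \<in> poset_interval r w' z'"
    using assms(4) by blast
  then show "t \<in> poset_interval r w z' \<longleftrightarrow> t \<in> insert w (poset_interval r w' z')"
    using lt le_trans[of w w' t] le_trans[of t z' z] le_refl[OF le_Field(1)[OF lt(1)]]
    unfolding mem_interval insert_iff by blast
qed

text \<open>For \<open>k = 3\<close> the sets in axioms (1) and (3) consist of an element with two
  of its covers; for \<open>k = Suc m\<close> they are a new bottom under a
  \<open>d_m\<close>-interval.\<close>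

lemma d_complete_iff_dcomp: "d_complete r \<longleftrightarrow> dcomp r"
proof
  assume d: "d_complete r"
  have ax1: "\<exists>p \<in> Field r. (\<forall>x \<in> maximal_elements r I. x \<prec>\<cdot> p) \<and> dk_interval r k (insert p I)"
    if "dk_minus_convex r k I" "k \<ge> 3" for k I
    using d that unfolding d_complete_def by simp
  have ax2: "x \<in> poset_interval r w z" if "dk_interval r k (poset_interval r w z)" "x \<prec>\<cdot> z" "k \<ge> 3" for k w z x
    using d that unfolding d_complete_def by blast
  have ax3: "I = J" if "dk_minus_convex r k I" "dk_minus_convex r k J"
    "I - minimal_elements r I = J - minimal_elements r J" "k \<ge> 3" for k I J
    using d that unfolding d_complete_def by blast
  show "dcomp r"
    unfolding dcomp_def
  proof (intro conjI allI impI finite_poset; (elim conjE)?)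
    fix w x y assume V: "x \<noteq> y" "w \<prec>\<cdot> x" "w \<prec>\<cdot> y"
    then have "dk_minus_convex r 3 {w, x, y}" using dk_minus_convex_3_iff by blast
    then obtain p where p: "x \<prec>\<cdot> p" "y \<prec>\<cdot> p" "dk_interval r 3 (insert p {w, x, y})"
      using ax1[of 3 "{w, x, y}"] extremal_V(1)[OF V] by auto
    then obtain a b where ab: "insert p {w, x, y} = poset_interval r a b" unfolding dk_interval_def by blast
    have "insert p {w, x, y} = poset_interval r w p"
    proof (rule interval_insert_top[OF ab])
      have lts: "w \<preceq> x" "w \<preceq> y" "x \<prec> p" "y \<prec> p" using V p cv_lt by blast+
      show "x \<prec> p" by fact
      fix t assume "t \<in> {w, x, y}"
      then show "w \<preceq> t \<and> \<not> p \<preceq> t"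
        using lts le_antisym[of p x] le_antisym[of p y] le_trans[of p w x] le_refl[OF le_Field(1)[of w x]] by auto
    qed auto
    then have "poset_interval r w p = {w, x, y, p}" by auto
    then show "\<exists>z. dk_int r 3 w x y z" using V p by (intro exI[of _ p] diamond) auto
  next
    fix k w w' x y z'
    assume *: "dk_int r k w' x y z'" "w \<prec>\<cdot> w'" "poset_interval r w z' = insert w (poset_interval r w' z')"
    have k: "k \<ge> 3" using dk_int_ge_3[OF *(1)] .
    have le: "w \<preceq> w'" "w' \<preceq> z'" "w \<preceq> z'"
      using cv_lt[OF *(2)] dk_int_lt[OF *(1)] le_trans[of w w' z'] by auto
    have "dk_minus_convex r (Suc k) (poset_interval r w z')"
      by (rule dk_minus_convex_Suc_iff[OF k, THEN iffD2]) (use * in \<open>intro exI conjI; assumption?; simp\<close>)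
    then obtain p where p: "z' \<prec>\<cdot> p" "dk_interval r (Suc k) (insert p (poset_interval r w z'))"
      using ax1[of "Suc k" "poset_interval r w z'"] k unfolding extremal_interval(1)[OF le(3)] by auto
    then obtain a b where ab: "insert p (poset_interval r w z') = poset_interval r a b" unfolding dk_interval_def by blast
    have "insert p (poset_interval r w z') = poset_interval r w p"
    proof (rule interval_insert_top[OF ab])
      show "w \<in> poset_interval r w z'" "z' \<in> poset_interval r w z'" "z' \<prec> p"
        using le cv_lt[OF p(1)] le_refl le_Field unfolding mem_interval by blast+
      show "w \<preceq> t \<and> \<not> p \<preceq> t" if "t \<in> poset_interval r w z'" for t
        using that cv_lt[OF p(1)] le_trans[of p t z'] le_antisym[of p z'] unfolding mem_interval by blast
    qed
    then show "\<exists>z. z' \<prec>\<cdot> z \<and> poset_interval r w z = insert w (insert z (poset_interval r w' z'))"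
      using p(1) *(3) by (intro exI[of _ p]) auto
  next
    fix k w x y z v assume *: "dk_int r k w x y z" "v \<prec>\<cdot> z"
    have "dk_interval r k (poset_interval r w z)"
      using dk_interval_iff(2)[OF dk_int_ge_3[OF *(1)]] *(1) by blast
    then show "w \<preceq> v"
      using ax2[OF _ *(2) dk_int_ge_3[OF *(1)]] unfolding mem_interval by blast
  next
    fix w w' x y assume V: "x \<noteq> y" "w \<prec>\<cdot> x" "w \<prec>\<cdot> y" "w' \<prec>\<cdot> x" "w' \<prec>\<cdot> y"
    have "w \<notin> {x, y}" "w' \<notin> {x, y}" using V cv_lt by blast+
    then have "{w, x, y} - minimal_elements r {w, x, y} = {w', x, y} - minimal_elements r {w', x, y}"
      unfolding extremal_V(2)[OF V(1-3)] extremal_V(2)[OF V(1,4,5)] by auto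
    moreover have "dk_minus_convex r 3 {w, x, y}" "dk_minus_convex r 3 {w', x, y}"
      using V dk_minus_convex_3_iff by blast+
    ultimately have "{w, x, y} = {w', x, y}" using ax3[of 3] by simp
    then show "w = w'" using \<open>w \<notin> {x, y}\<close> by auto
  next
    fix k u w w' x y z'
    assume *: "dk_int r k w' x y z'" "w \<prec>\<cdot> w'" "poset_interval r w z' = insert w (poset_interval r w' z')"
      "u \<prec>\<cdot> w'" "poset_interval r u z' = insert u (poset_interval r w' z')"
    have k: "k \<ge> 3" using dk_int_ge_3[OF *(1)] .
    have le: "w' \<preceq> z'" "w \<preceq> z'" "u \<preceq> z'"
      using cv_lt[OF *(2)] cv_lt[OF *(4)] dk_int_lt[OF *(1)] le_trans[of w w' z'] le_trans[of u w' z'] by auto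
    have n: "w \<notin> poset_interval r w' z'" "u \<notin> poset_interval r w' z'"
      using cv_lt[OF *(2)] cv_lt[OF *(4)] le_antisym unfolding mem_interval by blast+
    have "dk_minus_convex r (Suc k) (poset_interval r w z')"
      by (rule dk_minus_convex_Suc_iff[OF k, THEN iffD2]) (use * in \<open>intro exI conjI; assumption?; simp\<close>)
    moreover have "dk_minus_convex r (Suc k) (poset_interval r u z')"
      by (rule dk_minus_convex_Suc_iff[OF k, THEN iffD2]) (use * in \<open>intro exI conjI; assumption?; simp\<close>)
    moreover have "poset_interval r w z' - minimal_elements r (poset_interval r w z') =
        poset_interval r u z' - minimal_elements r (poset_interval r u z')"
      unfolding extremal_interval(2)[OF le(2)] extremal_interval(2)[OF le(3)] unfolding *(3,5) using n by auto
    ultimately have "poset_interval r u z' = poset_interval r w z'" using ax3[of "Suc k"] k by simp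
    then show "u = w" using interval_eqD[OF _ le(2)] by blast
  qed
next
  assume d: "dcomp r"
  have kcase: "k = 3 \<or> (\<exists>m \<ge> 3. k = Suc m)" if "k \<ge> 3" for k :: nat
    using that by (cases k) (auto simp: le_Suc_eq)
  have *: "(\<exists>p \<in> Field r. (\<forall>x \<in> maximal_elements r I. x \<prec>\<cdot> p) \<and> dk_interval r k (I \<union> {p}))"
    if "k \<ge> 3" "dk_minus_convex r k I" for k I
    using kcase[OF that(1)]
  proof
    assume "k = 3"
    have "dk_minus_convex r 3 I" using that(2) \<open>k = 3\<close> by simp
    then obtain w x y where V: "x \<noteq> y" "w \<prec>\<cdot> x" "w \<prec>\<cdot> y" "I = {w, x, y}"
      unfolding dk_minus_convex_3_iff by blast
    then obtain z where z: "dk_int r 3 w x y z" using dcompD(2)[OF d] by blast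
    then have "poset_interval r w z = {w, x, y, z}" "x \<prec>\<cdot> z" "y \<prec>\<cdot> z"
      using dk_int_ge_3 by (cases; fastforce)+
    moreover have "dk_interval r 3 (poset_interval r w z)" using dk_interval_iff(2) z by blast
    moreover have "z \<in> Field r" using dk_int_lt[OF z] le_Field by blast
    ultimately show ?thesis
      using extremal_V(1)[OF V(1-3)] V(4) \<open>k = 3\<close> by (intro bexI[of _ z]) (auto simp: insert_commute)
  next
    assume "\<exists>m \<ge> 3. k = Suc m"
    then obtain m where m: "m \<ge> 3" "k = Suc m" by blast
    have "dk_minus_convex r (Suc m) I" using that(2) m by simp
    then obtain w w' x y z' where c: "dk_int r m w' x y z'" "w \<prec>\<cdot> w'"
      "I = poset_interval r w z'" "I = insert w (poset_interval r w' z')"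
      unfolding dk_minus_convex_Suc_iff[OF m(1)] by blast
    then obtain z where z: "z' \<prec>\<cdot> z" "poset_interval r w z = insert w (insert z (poset_interval r w' z'))"
      using dcompD(3)[OF d c(1,2)] by metis
    have wz: "w \<preceq> z'" using cv_lt[OF c(2)] dk_int_lt[OF c(1)] le_trans[of w w' z'] by auto
    have "dk_int r (Suc m) w x y z" by (rule dk_int.extend[OF c(1,2) z])
    then have "dk_interval r (Suc m) (poset_interval r w z)" using dk_interval_iff(2) m by auto
    moreover have "z \<in> Field r" using cv_lt[OF z(1)] le_Field by blast
    moreover have "poset_interval r w z = I \<union> {z}" unfolding z(2) c(4) by auto
    ultimately show ?thesis
      using extremal_interval(1)[OF wz, folded c(3)] z(1) m by (intro bexI[of _ z]) auto
  qed
  moreover have "v \<in> poset_interval r w z" if kv: "k \<ge> 3" "dk_interval r k (poset_interval r w z)" "v \<prec>\<cdot> z" for k w z v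
  proof -
    obtain x y where "dk_int r k w x y z" using dk_interval_iff(2)[OF kv(1)] kv(2) by blast
    then have "w \<preceq> v" using dcompD(4)[OF d _ kv(3)] by blast
    then show ?thesis using cv_lt[OF kv(3)] unfolding mem_interval by blast
  qed
  moreover have "I = J" if IJ: "k \<ge> 3" "dk_minus_convex r k I" "dk_minus_convex r k J"
    "I - minimal_elements r I = J - minimal_elements r J" for k I J
    using kcase[OF IJ(1)]
  proof
    assume "k = 3"
    then obtain w x y w' x' y' where V: "x \<noteq> y" "w \<prec>\<cdot> x" "w \<prec>\<cdot> y" "I = {w, x, y}"
      "x' \<noteq> y'" "w' \<prec>\<cdot> x'" "w' \<prec>\<cdot> y'" "J = {w', x', y'}"
      using IJ(2,3) unfolding \<open>k = 3\<close> dk_minus_convex_3_iff by metis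
    have "w \<notin> {x, y}" "w' \<notin> {x', y'}" using V cv_lt by blast+
    then have "{x, y} = {x', y'}"
      using IJ(4) unfolding V(4,8) extremal_V(2)[OF V(1-3)] extremal_V(2)[OF V(5-7)] by auto
    \<comment> \<open>The two sides are known only as a set, so they may come in the other
      order.\<close>
    then have e: "x' = x \<and> y' = y \<or> x' = y \<and> y' = x" by (auto simp: doubleton_eq_iff)
    then have "w' \<prec>\<cdot> x" "w' \<prec>\<cdot> y" using V by auto
    then have "w = w'" using dcompD(5)[OF d V(1-3)] by blast
    then show "I = J" using V(4,8) e by auto
  next
    assume "\<exists>m \<ge> 3. k = Suc m"
    then obtain m where m: "m \<ge> 3" "k = Suc m" by blast
    obtain w w' x y z' where c: "dk_int r m w' x y z'" "w \<prec>\<cdot> w'"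
      "I = poset_interval r w z'" "I = insert w (poset_interval r w' z')"
      using IJ(2) unfolding m(2) dk_minus_convex_Suc_iff[OF m(1)] by blast
    obtain u u' x' y' v' where e: "dk_int r m u' x' y' v'" "u \<prec>\<cdot> u'"
      "J = poset_interval r u v'" "J = insert u (poset_interval r u' v')"
      using IJ(3) unfolding m(2) dk_minus_convex_Suc_iff[OF m(1)] by blast
    have wz: "w \<preceq> z'" "u \<preceq> v'" "u' \<preceq> v'"
      using cv_lt[OF c(2)] dk_int_lt[OF c(1)] cv_lt[OF e(2)] dk_int_lt[OF e(1)]
        le_trans[of w w' z'] le_trans[of u u' v'] by auto
    have n: "w \<notin> poset_interval r w' z'" "u \<notin> poset_interval r u' v'"
      using cv_lt[OF c(2)] cv_lt[OF e(2)] le_antisym[of w w'] le_antisym[of u u'] unfolding mem_interval by auto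
    have "I - {w} = J - {u}"
      using IJ(4) extremal_interval(2)[OF wz(1), folded c(3)] extremal_interval(2)[OF wz(2), folded e(3)] by simp
    then have "poset_interval r w' z' = poset_interval r u' v'"
      unfolding c(4) e(4) using n by simp
    then have eq: "w' = u'" "z' = v'" using interval_eqD[OF _ wz(3)] by auto
    have "u = w"
      using dcompD(6)[OF d c(1,2) _ _] c(3,4) e(2-4) unfolding eq by metis
    then show "I = J" using c(3) e(3) eq by simp
  qed
  ultimately show "d_complete r"
    unfolding d_complete_def using finite_poset by blast
qed

end


section \<open>Uniqueness of the top and the bottom of an interval\<close>

locale dcomplete =
  fixes r :: "'a rel"
  assumes dcomp: "dcomp r"
begin

sublocale fin_poset r
  using dcompD(1)[OF dcomp] by unfold_locales

lemmas diamond_completion = dcompD(2)[OF dcomp]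
lemmas extend_completion = dcompD(3)[OF dcomp]
lemmas top_cover_ge = dcompD(4)[OF dcomp]
lemmas diamond_bottom_unique = dcompD(5)[OF dcomp]
lemmas extend_bottom_unique = dcompD(6)[OF dcomp]

lemma diamondD:
  assumes "dk_int r 3 w x y z"
  shows "x \<noteq> y" "w \<prec>\<cdot> x" "w \<prec>\<cdot> y" "x \<prec>\<cdot> z" "y \<prec>\<cdot> z" "poset_interval r w z = {w, x, y, z}"
proof -
  have "x \<noteq> y \<and> w \<prec>\<cdot> x \<and> w \<prec>\<cdot> y \<and> x \<prec>\<cdot> z \<and> y \<prec>\<cdot> z \<and> poset_interval r w z = {w, x, y, z}"
    using assms
  proof cases
    case (extend k w' z')
    then show ?thesis using dk_int_ge_3[of r k] by fastforce
  qed simp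
  then show "x \<noteq> y" "w \<prec>\<cdot> x" "w \<prec>\<cdot> y" "x \<prec>\<cdot> z" "y \<prec>\<cdot> z" "poset_interval r w z = {w, x, y, z}"
    by blast+
qed

lemma diamond_top_covers:
  assumes d: "dk_int r 3 w x y z" and v: "v \<prec>\<cdot> z"
  shows "v = x \<or> v = y"
proof -
  have "v \<in> {w, x, y, z}"
    using top_cover_ge[OF d v] cv_lt[OF v] unfolding diamondD(6)[OF d, symmetric] mem_interval by blast
  moreover have "v \<noteq> z" using cv_lt[OF v] by blast
  moreover have "v \<noteq> w"
    using cv_between[OF v, of x] dk_int_D[OF d] by blast
  ultimately show ?thesis by blast
qed

text \<open>Axiom (2) places every lower cover of \<open>z\<close> inside the interval, where only
  \<open>z'\<close> lies directly below \<open>z\<close>.\<close>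

lemma extend_top_covers:
  assumes d: "dk_int r k w' x y z'" "w \<prec>\<cdot> w'" "z' \<prec>\<cdot> z"
    "poset_interval r w z = insert w (insert z (poset_interval r w' z'))" and v: "v \<prec>\<cdot> z"
  shows "v = z'"
proof -
  have "w \<preceq> v" using top_cover_ge[OF dk_int.extend[OF d] v] .
  then have "v \<in> insert w (insert z (poset_interval r w' z'))"
    using cv_lt[OF v] unfolding d(4)[symmetric] mem_interval by blast
  moreover have "v \<noteq> z" using cv_lt[OF v] by blast
  moreover have "w \<prec> z'" using cv_lt[OF d(2)] dk_int_lt[OF d(1)] lt_le_trans by blast
  then have "v \<noteq> w" using cv_between[OF v, of z'] cv_lt[OF d(3)] by blast
  ultimately have "v \<preceq> z'" unfolding mem_interval[symmetric] by (auto simp: mem_interval)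
  then show ?thesis using cv_same_upper[OF v d(3)] by blast
qed

text \<open>The configuration would climb forever. The tops \<open>p\<close>, \<open>q\<close>,
  \<open>t\<close> of the three completed diamonds are distinct, since by axiom (2) each covers only
  its own two sides, and they again share lower covers in pairs, namely \<open>b\<close>,
  \<open>c\<close> and \<open>a\<close>.\<close>

lemma no_triangle:
  assumes "a \<noteq> b" "b \<noteq> c" "a \<noteq> c" "u \<prec>\<cdot> a" "u \<prec>\<cdot> b" "v \<prec>\<cdot> b" "v \<prec>\<cdot> c" "w \<prec>\<cdot> a" "w \<prec>\<cdot> c"
  shows False
  using assms
proof (induction a arbitrary: b c u v w rule: up_induct)
  case (greater a)
  obtain p where p: "dk_int r 3 u a b p" using diamond_completion greater.prems by blast
  obtain q where q: "dk_int r 3 v b c q" using diamond_completion greater.prems by blast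
  obtain t where t: "dk_int r 3 w a c t" using diamond_completion greater.prems by blast
  have "p \<noteq> q" using diamond_top_covers[OF p] diamondD(5)[OF q] greater.prems(1-3) by metis
  moreover have "q \<noteq> t" using diamond_top_covers[OF q] diamondD(4)[OF t] greater.prems(1-3) by metis
  moreover have "p \<noteq> t" using diamond_top_covers[OF p] diamondD(5)[OF t] greater.prems(1-3) by metis
  moreover have "a \<prec> p" using cv_lt[OF diamondD(4)[OF p]] .
  ultimately show False
    using greater.IH[of p q t b c a] diamondD[OF p] diamondD[OF q] diamondD[OF t] by blast
qed

lemma no_three_covers: "w \<prec>\<cdot> a \<Longrightarrow> w \<prec>\<cdot> b \<Longrightarrow> w \<prec>\<cdot> c \<Longrightarrow> a \<noteq> b \<Longrightarrow> b \<noteq> c \<Longrightarrow> a \<noteq> c \<Longrightarrow> False"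
  using no_triangle by blast

text \<open>The dual of axiom (2), which is not postulated. A second cover \<open>u\<close> of
  \<open>w\<close> forms a diamond with \<open>w'\<close>; its top covers \<open>w'\<close>, so by
  induction it lies below \<open>z'\<close>.\<close>

lemma bottom_cover_le:
  assumes "dk_int r k w x y z" "w \<prec>\<cdot> u"
  shows "u \<preceq> z"
  using assms
proof (induction arbitrary: u)
  case (diamond x y w z)
  then have "u = x \<or> u = y" using no_three_covers[of w x y u] by blast
  then show ?case using diamond cv_lt by blast
next
  case (extend k w' x y z' w z)
  have lt: "w' \<preceq> z'" "z' \<preceq> z" using dk_int_lt[OF extend.hyps(1)] cv_lt[OF extend.hyps(3)] by auto
  show ?case
  proof (cases "u = w'")
    case True
    then show ?thesis using lt le_trans by blast
  next
    case False
    then obtain t where t: "dk_int r 3 w w' u t"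
      using diamond_completion[of w' u w] extend.hyps(2) extend.prems by blast
    have "t \<preceq> z'" using extend.IH[OF diamondD(4)[OF t]] .
    moreover have "u \<preceq> t" using cv_lt[OF diamondD(5)[OF t]] by blast
    ultimately show ?thesis using lt le_trans by blast
  qed
qed

lemma diamond_bottom_covers: "dk_int r 3 w x y z \<Longrightarrow> w \<prec>\<cdot> u \<Longrightarrow> u = x \<or> u = y"
  using no_three_covers[of w x y u] diamondD[of w x y z] by blast

lemma extend_bottom_covers:
  assumes d: "dk_int r k w' x y z'" "w \<prec>\<cdot> w'" "z' \<prec>\<cdot> z"
    "poset_interval r w z = insert w (insert z (poset_interval r w' z'))" and u: "w \<prec>\<cdot> u"
  shows "u = w'"
proof -
  have "u \<preceq> z" using bottom_cover_le[OF dk_int.extend[OF d] u] .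
  then have "u \<in> insert w (insert z (poset_interval r w' z'))"
    using cv_lt[OF u] unfolding d(4)[symmetric] mem_interval by blast
  moreover have "u \<noteq> w" using cv_lt[OF u] by blast
  moreover have "w' \<prec> z" using cv_lt[OF d(3)] dk_int_lt[OF d(1)] lt_le_trans by blast
  then have "u \<noteq> z" using cv_between[OF u, of w'] cv_lt[OF d(2)] by blast
  ultimately have "w' \<preceq> u" by (auto simp: mem_interval)
  then show ?thesis using cv_same_lower[OF d(2) u] by blast
qed

text \<open>Axiom (2) determines the lower covers of \<open>z\<close>, so two intervals with top
  \<open>z\<close> have the same shape there and agree one level further in, by induction. Axiom (3)
  then fixes the bottom.\<close>

lemma bottom_unique:
  assumes "dk_int r k w x y z" "dk_int r k' u a b z"
  shows "k = k' \<and> w = u \<and> {x, y} = {a, b}"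
  using assms
proof (induction arbitrary: k' u a b)
  case (diamond x y w z)
  note d = dk_int.diamond[OF diamond.hyps]
  from diamond.prems show ?case
  proof cases
    case diamond2: diamond
    have "a = x \<or> a = y" "b = x \<or> b = y"
      using diamond_top_covers[OF d] diamond2 by blast+
    then have ab: "{x, y} = {a, b}" using diamond2 by auto
    moreover have "w = u"
      using diamond_bottom_unique[OF diamond.hyps(1-3), of u] diamond2 ab by (auto simp: doubleton_eq_iff)
    ultimately show ?thesis using diamond2 by simp
  next
    case (extend k1 w1 z1)
    then have "x = z1" "y = z1" using extend_top_covers[OF extend(2-5)] diamond.hyps by blast+
    then show ?thesis using diamond.hyps(1) by blast
  qed
next
  case (extend k w' x y z' w z)
  from extend.prems show ?case
  proof cases
    case diamond
    then have "a = z'" "b = z'" using extend_top_covers[OF extend.hyps(1-4)] by blast+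
    then show ?thesis using diamond by blast
  next
    case extend2: (extend k1 w1 z1)
    have z: "z1 = z'" using extend_top_covers[OF extend.hyps(1-4)] extend2 by blast
    have eq: "k = k1" "w' = w1" "{x, y} = {a, b}" using extend.IH[of k1 w1 a b] extend2(2) z by auto
    have "w1 \<preceq> z1" using dk_int_lt[OF extend2(2)] by blast
    then have "poset_interval r u z' = insert u (poset_interval r w' z')"
      using interval_shrink[OF extend2(3,4) _ extend2(5)] z eq by simp
    moreover have "w' \<preceq> z'" using dk_int_lt[OF extend.hyps(1)] by blast
    ultimately have "u = w"
      using extend_bottom_unique[OF extend.hyps(1,2) interval_shrink[OF extend.hyps(2,3) _ extend.hyps(4)]]
        extend2(3) eq by blast
    then show ?thesis using eq extend2(1) by simp
  qed
qed

lemma interval_only_cover: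
  assumes "p \<prec>\<cdot> q" "\<And>u. p \<prec>\<cdot> u \<Longrightarrow> u = q" "q \<preceq> t"
  shows "poset_interval r p t = insert p (poset_interval r q t)"
proof
  show "poset_interval r p t \<subseteq> insert p (poset_interval r q t)"
    using ex_cover_above[of p] assms(2) unfolding mem_interval subset_iff insert_iff by blast
  have "p \<preceq> q" using cv_lt[OF assms(1)] by blast
  then show "insert p (poset_interval r q t) \<subseteq> poset_interval r p t"
    using le_trans[of p q] assms(3) le_refl[OF le_Field(1)] unfolding mem_interval subset_iff insert_iff by blast
qed

text \<open>If \<open>q\<close> is the only cover of \<open>p\<close>, the interval from
  \<open>p\<close> to \<open>t\<close> has just the one extra element \<open>p\<close>. It is then a
  set as in axiom (1), which supplies the new top.\<close>

lemma extend_only_cover: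
  assumes "dk_int r k q x y t" "p \<prec>\<cdot> q" "\<And>u. p \<prec>\<cdot> u \<Longrightarrow> u = q"
  shows "\<exists>z. dk_int r (Suc k) p x y z \<and> t \<prec>\<cdot> z"
proof -
  have "q \<preceq> t" using dk_int_lt[OF assms(1)] by blast
  then obtain z where "t \<prec>\<cdot> z" "poset_interval r p z = insert p (insert z (poset_interval r q t))"
    using extend_completion[OF assms(1,2) interval_only_cover[OF assms(2,3)]] by blast
  then show ?thesis using dk_int.extend[OF assms(1,2)] by blast
qed

text \<open>The elements of the neck below \<open>z\<close> inherit the property of \<open>z\<close>, so the upper interval grows
  down the neck until both sides \<open>x\<close> and \<open>y\<close> extend it, which contradicts axiom (3).\<close>

lemma no_interval_on_top:
  assumes "dk_int r k w x y z" "dk_int r m z s e t" "\<And>g v. z \<prec>\<cdot> g \<Longrightarrow> v \<prec>\<cdot> g \<Longrightarrow> v = z"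
  shows False
  using assms
proof (induction arbitrary: m t)
  case (diamond x y w z)
  \<comment> \<open>A second cover of \<open>v\<close> would give a diamond whose top covers both
    \<open>z\<close> and \<open>u\<close>, against the assumption that covers of \<open>z\<close>
    have no other lower cover.\<close>
  have only: "u = z" if vu: "v \<prec>\<cdot> z" "v \<prec>\<cdot> u" for u v
  proof (rule ccontr)
    assume "u \<noteq> z"
    then obtain g where "dk_int r 3 v z u g" using diamond_completion vu by metis
    then show False using diamond.prems(2)[of g u] diamondD[of v z u g] by blast
  qed
  have zt: "z \<preceq> t" using dk_int_lt[OF diamond.prems(1)] by blast
  have "poset_interval r x t = insert x (poset_interval r z t)"
    "poset_interval r y t = insert y (poset_interval r z t)"
    using interval_only_cover only diamond.hyps zt by metis+
  then have "y = x"
    using extend_bottom_unique[OF diamond.prems(1) diamond.hyps(4) _ diamond.hyps(5)] by blast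
  then show False using diamond.hyps by blast
next
  case (extend k w' x y z' w z)
  have only: "u = z" if zu: "z' \<prec>\<cdot> u" for u
  proof (rule ccontr)
    assume "u \<noteq> z"
    then obtain g where "dk_int r 3 z' z u g" using diamond_completion zu extend.hyps(3) by metis
    then show False using extend.prems(2)[of g u] diamondD[of z' z u g] by blast
  qed
  obtain t' where "dk_int r (Suc m) z' s e t'"
    using extend_only_cover[OF extend.prems(1) extend.hyps(3) only] by blast
  moreover have "v = z'" if "z' \<prec>\<cdot> g" "v \<prec>\<cdot> g" for g v
    using only[OF that(1)] that(2) extend_top_covers[OF extend.hyps(1-4)] by blast
  ultimately show False using extend.IH by blast
qed

text \<open>Axiom (3) speaks only of bottoms. If \<open>z\<close> and \<open>t\<close> were
  different tops over the same \<open>z'\<close>, they would form a diamond standing on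
  \<open>z'\<close>. Every cover of \<open>z'\<close> is then one of the two and has
  \<open>z'\<close> as its only lower cover, which \<open>no_interval_on_top\<close>
  forbids.\<close>

lemma top_unique:
  assumes "dk_int r k w x y z" "dk_int r k' w a b t"
  shows "z = t"
  using assms
proof (induction arbitrary: k' t)
  case (diamond x y w z)
  note d = dk_int.diamond[OF diamond.hyps]
  from diamond.prems show ?case
  proof cases
    case diamond2: diamond
    have "a = x \<or> a = y" "b = x \<or> b = y"
      using diamond_bottom_covers[OF d] diamond2 by blast+
    then have "{x, y} = {a, b}" using diamond2 by auto
    then have "x \<prec>\<cdot> t" "y \<prec>\<cdot> t" using diamond2 by (auto simp: doubleton_eq_iff)
    then show ?thesis
      using diamond_bottom_unique[of z t x y] diamond.hyps by blast
  next
    case (extend k1 w1 z1)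
    then have "x = w1" "y = w1" using extend_bottom_covers[OF extend(2-5)] diamond.hyps by blast+
    then show ?thesis using diamond.hyps(1) by blast
  qed
next
  case (extend k w' x y z' w z)
  from extend.prems show ?case
  proof cases
    case diamond
    then have "a = w'" "b = w'" using extend_bottom_covers[OF extend.hyps(1-4)] by blast+
    then show ?thesis using diamond by blast
  next
    case extend2: (extend k1 w1 z1)
    have w: "w1 = w'" using extend_bottom_covers[OF extend.hyps(1-4)] extend2 by blast
    then have z: "z' = z1" using extend.IH extend2(2) by blast
    show ?thesis
    proof (rule ccontr)
      assume ne: "z \<noteq> t"
      have c: "z' \<prec>\<cdot> z" "z' \<prec>\<cdot> t" using extend.hyps(3) extend2(4) z by auto
      then obtain g where g: "dk_int r 3 z' z t g" using diamond_completion ne by blast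
      have "v = z'" if "z' \<prec>\<cdot> h" "v \<prec>\<cdot> h" for h v
      proof -
        have "h = z \<or> h = t" using no_three_covers[of z' z t h] c ne that by blast
        then show ?thesis
          using that extend_top_covers[OF extend.hyps(1-4)] extend_top_covers[OF extend2(2-5)] z by blast
      qed
      then show False using no_interval_on_top[OF extend.hyps(1) g] by blast
    qed
  qed
qed


subsection \<open>The coloring\<close>

text \<open>A partial injection, by \<open>top_unique\<close> and \<open>bottom_unique\<close>. Its
  orbits are chains, and they are going to be the color classes.\<close>

definition BT :: "'a rel" where
  "BT = {(w, z). \<exists>k x y. dk_int r k w x y z}"

lemma BT_lt: "(w, z) \<in> BT \<Longrightarrow> w \<prec> z"
  unfolding BT_def using dk_int_lt by blast

lemma single_valued_BT: "single_valued BT" and single_valued_BT_converse: "single_valued (BT\<inverse>)"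
  unfolding single_valued_def BT_def using top_unique bottom_unique by blast+

lemma BT_rtrancl_le: "(w, z) \<in> BT\<^sup>* \<Longrightarrow> w \<in> Field r \<or> z \<in> Field r \<Longrightarrow> w \<preceq> z"
proof (induction rule: rtrancl_induct)
  case base
  then show ?case using le_refl by blast
next
  case (step u v)
  have "u \<prec> v" using BT_lt[OF step.hyps(2)] .
  then show ?case using step.IH le_trans[of w u v] le_Field by blast
qed

lemma ex_color: "\<exists>t. (p, t) \<in> BT\<^sup>* \<and> t \<notin> Domain BT"
proof (induction p rule: up_induct)
  case (greater p)
  show ?case
  proof (cases "p \<in> Domain BT")
    case True
    then obtain z where z: "(p, z) \<in> BT" by blast
    then obtain t where "(z, t) \<in> BT\<^sup>*" "t \<notin> Domain BT" using greater.IH BT_lt by blast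
    then show ?thesis using z by (meson converse_rtrancl_into_rtrancl)
  qed blast
qed

lemma color_unique:
  assumes "(p, s) \<in> BT\<^sup>*" "s \<notin> Domain BT" "(p, t) \<in> BT\<^sup>*" "t \<notin> Domain BT"
  shows "s = t"
proof -
  have "(s, t) \<in> BT\<^sup>* \<or> (t, s) \<in> BT\<^sup>*"
    using single_valued_confluent[OF single_valued_BT assms(1,3)] .
  then show ?thesis using assms(2,4) by (metis Domain.DomainI converse_rtranclE)
qed

text \<open>The upper end of the orbit of \<open>p\<close>, unambiguous by
  \<open>color_unique\<close>. Colors are thus themselves elements, and those of poset elements form
  the top tree (see \<open>acyclic_element_iff\<close>).\<close>

definition color :: "'a \<Rightarrow> 'a" where
  "color p = (SOME t. (p, t) \<in> BT\<^sup>* \<and> t \<notin> Domain BT)"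

lemma color_props: "(p, color p) \<in> BT\<^sup>*" "color p \<notin> Domain BT"
  using someI_ex[OF ex_color[of p]] unfolding color_def by blast+

lemma color_BT: "(w, z) \<in> BT \<Longrightarrow> color w = color z"
  using color_unique[of w "color w" "color z"] color_props[of w] color_props[of z]
  by (meson converse_rtrancl_into_rtrancl)

lemma color_top: "t \<notin> Domain BT \<Longrightarrow> color t = t"
  using color_unique[of t "color t" t] color_props[of t] by blast

lemma le_color: "p \<in> Field r \<Longrightarrow> p \<preceq> color p"
  using BT_rtrancl_le color_props by blast

lemma color_Field: "p \<in> Field r \<Longrightarrow> color p \<in> Field r"
  using le_color le_Field by blast

lemma same_color:
  assumes "color p = color q"
  shows "(p, q) \<in> BT\<^sup>* \<or> (q, p) \<in> BT\<^sup>*"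
proof -
  have "(color p, p) \<in> (BT\<inverse>)\<^sup>*" "(color p, q) \<in> (BT\<inverse>)\<^sup>*"
    using color_props(1)[of p] color_props(1)[of q] assms by (auto simp: rtrancl_converse)
  from single_valued_confluent[OF single_valued_BT_converse this]
  show ?thesis by (auto simp: rtrancl_converse)
qed

lemma same_color_lt:
  assumes "color p = color q" "p \<prec> q"
  shows "\<exists>u. (p, u) \<in> BT\<^sup>* \<and> (u, q) \<in> BT"
proof -
  have "(p, q) \<in> BT\<^sup>*"
    using same_color[OF assms(1)] BT_rtrancl_le[of q p] le_Field assms(2) le_antisym[of p q] by blast
  then show ?thesis using assms(2) by (metis rtranclE)
qed

lemma same_color_lt_bottom:
  assumes "color p = color q" "p \<prec> q" "(w, q) \<in> BT"
  shows "(p, w) \<in> BT\<^sup>*" "p \<preceq> w"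
proof -
  obtain u where u: "(p, u) \<in> BT\<^sup>*" "(u, q) \<in> BT" using same_color_lt[OF assms(1,2)] by blast
  have "u = w" using single_valued_BT_converse u(2) assms(3) by (auto simp: single_valued_def)
  then show "(p, w) \<in> BT\<^sup>*" "p \<preceq> w"
    using u BT_rtrancl_le[of p w] BT_lt[OF assms(3)] le_Field by blast+
qed

text \<open>Two covers would complete to a diamond with bottom \<open>p\<close>, and an interval
  starting at the only cover \<open>q\<close> would extend down to \<open>p\<close>. So the elements
  that are no bottoms carry a forest in which a node has at most one parent.\<close>

lemma top_tree_cover:
  assumes "p \<notin> Domain BT" "p \<prec>\<cdot> q"
  shows "q \<notin> Domain BT" "p \<prec>\<cdot> u \<Longrightarrow> u = q"
proof -
  show u: "u = q" if "p \<prec>\<cdot> u" for u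
    using diamond_completion[of u q p] that assms unfolding BT_def by blast
  show "q \<notin> Domain BT"
  proof
    assume "q \<in> Domain BT"
    then obtain k x y z where "dk_int r k q x y z" unfolding BT_def by blast
    from extend_only_cover[OF this assms(2)] u show False using assms(1) unfolding BT_def by blast
  qed
qed

lemma top_tree_up: "p \<notin> Domain BT \<Longrightarrow> p \<preceq> q \<Longrightarrow> q \<notin> Domain BT"
proof (induction p rule: up_induct)
  case (greater p)
  show ?case
  proof (cases "p = q")
    case False
    then obtain v where "p \<prec>\<cdot> v" "v \<preceq> q" using ex_cover_above greater.prems by blast
    then show ?thesis using greater.IH[of v] cv_lt top_tree_cover(1) greater.prems by blast
  qed (use greater in simp)
qed

text \<open>Edges of the Dynkin diagram, which is the Hasse diagram of the top tree.\<close>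

definition cadj :: "'a \<Rightarrow> 'a \<Rightarrow> bool" where
  "cadj i j \<longleftrightarrow> i \<notin> Domain BT \<and> j \<notin> Domain BT \<and> (i \<prec>\<cdot> j \<or> j \<prec>\<cdot> i)"

lemma cadj_sym: "cadj i j \<Longrightarrow> cadj j i" and cadj_irrefl: "\<not> cadj i i"
  unfolding cadj_def using cv_lt by blast+

text \<open>Raising \<open>p\<close> to the top \<open>z\<close> of its interval keeps its color and
  produces a higher cover: \<open>q\<close> below \<open>z\<close> in a diamond, \<open>z'\<close>
  below \<open>z\<close> otherwise, where \<open>z'\<close> has the color of \<open>q\<close>. The
  roles of the two colors are exchanged, and adjacency is symmetric.\<close>

lemma cover_cadj: "p \<prec>\<cdot> q \<Longrightarrow> cadj (color p) (color q)"
proof (induction p arbitrary: q rule: up_induct)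
  case (greater p)
  show ?case
  proof (cases "p \<in> Domain BT")
    case False
    then show ?thesis using top_tree_cover(1)[OF False greater.prems] color_top greater.prems
      unfolding cadj_def by auto
  next
    case True
    then obtain k x y z where d: "dk_int r k p x y z" unfolding BT_def by blast
    then have c: "color p = color z" using color_BT unfolding BT_def by blast
    from d show ?thesis
    proof cases
      case diamond
      then have "q = x \<or> q = y" using diamond_bottom_covers[of p x y z q] d greater.prems by blast
      then have "q \<prec>\<cdot> z" using diamond by blast
      then show ?thesis using greater.IH[of q z] greater.prems cv_lt cadj_sym c by simp
    next
      case (extend k' w' z')
      then have q: "q = w'" using extend_bottom_covers greater.prems by blast
      have "color w' = color z'" using color_BT extend(2) unfolding BT_def by blast
      moreover have "p \<prec> z'"
        using cv_lt[OF greater.prems] dk_int_lt[OF extend(2)] lt_le_trans unfolding q by blast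
      ultimately show ?thesis using greater.IH[OF _ extend(4)] cadj_sym c q by simp
    qed
  qed
qed

subsection \<open>Separation in the tree of colors\<close>

text \<open>In the forest of colors the subtree under \<open>i\<close> is joined to the rest only
  through the parent \<open>j\<close>.\<close>

lemma cadj_below_child:
  assumes "i \<notin> Domain BT" "i \<prec>\<cdot> j" "cadj a b" "b \<noteq> j" "a \<preceq> i"
  shows "b \<preceq> i"
  using assms(3) unfolding cadj_def
proof (elim conjE disjE)
  assume a: "a \<notin> Domain BT" "a \<prec>\<cdot> b"
  show ?thesis
  proof (cases "a = i")
    case True
    then show ?thesis using top_tree_cover(2)[OF assms(1,2)] a assms(4) by blast
  next
    case False
    then obtain v where "a \<prec>\<cdot> v" "v \<preceq> i" using ex_cover_above assms(5) by blast
    then show ?thesis using top_tree_cover(2)[OF a] by blast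
  qed
next
  assume "b \<prec>\<cdot> a"
  then show ?thesis using cv_lt[of b a] le_trans[of b a i] assms(5) by blast
qed

lemma color_below_child:
  assumes "i \<notin> Domain BT" "i \<prec>\<cdot> j" "p \<preceq> q" "\<And>t. p \<preceq> t \<Longrightarrow> t \<preceq> q \<Longrightarrow> color t \<noteq> j"
  shows "color p \<preceq> i \<longleftrightarrow> color q \<preceq> i"
  using assms(3,4)
proof (induction p rule: up_induct)
  case (greater p)
  show ?case
  proof (cases "p = q")
    case False
    then obtain v where v: "p \<prec>\<cdot> v" "v \<preceq> q" using ex_cover_above greater.prems by blast
    have pv: "p \<prec> v" using cv_lt[OF v(1)] .
    have "color p \<noteq> j" "color v \<noteq> j"
      using greater.prems(2)[of p] greater.prems(2)[of v] greater.prems(1) pv v(2) le_refl le_Field by blast+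
    then have "color p \<preceq> i \<longleftrightarrow> color v \<preceq> i"
      using cadj_below_child[OF assms(1,2)] cover_cadj[OF v(1)] cadj_sym by blast
    moreover have "color v \<preceq> i \<longleftrightarrow> color q \<preceq> i"
      using greater.IH[OF pv v(2)] greater.prems(2) le_trans[of p v] pv by blast
    ultimately show ?thesis by blast
  qed simp
qed

text \<open>Two different neighbors of \<open>j\<close> lie in different parts of the forest once
  \<open>j\<close> is removed, so the walk of colors from \<open>p\<close> to \<open>q\<close> must
  visit \<open>j\<close>.\<close>

lemma color_separation:
  assumes "cadj (color p) j" "cadj (color q) j" "color p \<noteq> color q" "p \<preceq> q"
  shows "\<exists>t. p \<preceq> t \<and> t \<preceq> q \<and> color t = j"
proof (rule ccontr)
  assume n: "\<not> ?thesis"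
  have j: "j \<notin> Domain BT" using assms(1) unfolding cadj_def by blast
  have T: "color p \<notin> Domain BT" "color q \<notin> Domain BT" using color_props by blast+
  have F: "color p \<in> Field r" "color q \<in> Field r" using color_Field le_Field assms(4) by blast+
  \<comment> \<open>\<open>j\<close> has at most one parent, so one of its two different neighbors
    is a child.\<close>
  consider "color p \<prec>\<cdot> j" | "color q \<prec>\<cdot> j"
    using assms(1-3) top_tree_cover(2)[OF j] unfolding cadj_def by blast
  then show False
  proof cases
    case 1
    have "color q \<preceq> color p"
      using color_below_child[OF T(1) 1 assms(4)] n le_refl[OF F(1)] by blast
    then have "color q \<prec> color p" using assms(3) by auto
    then have "color q \<prec>\<cdot> j \<Longrightarrow> False" "j \<prec>\<cdot> color q \<Longrightarrow> False"
      using 1 cv_same_upper[of "color q" j "color p"] cv_lt[OF 1] cv_lt[of j "color q"]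
        le_antisym[of j "color q"] le_trans[of "color q" "color p" j] by blast+
    then show False using assms(2) unfolding cadj_def by blast
  next
    case 2
    have "color p \<preceq> color q"
      using color_below_child[OF T(2) 2 assms(4)] n le_refl[OF F(2)] by blast
    then have "color p \<prec> color q" using assms(3) by auto
    then have "color p \<prec>\<cdot> j \<Longrightarrow> False" "j \<prec>\<cdot> color p \<Longrightarrow> False"
      using 2 cv_same_upper[of "color p" j "color q"] cv_lt[OF 2] cv_lt[of j "color p"]
        le_antisym[of j "color p"] le_trans[of "color p" "color q" j] by blast+
    then show False using assms(1) unfolding cadj_def by blast
  qed
qed

text \<open>If \<open>q\<close> and \<open>v\<close> differ in color,
  \<open>color_separation\<close> gives an element of the color of \<open>z\<close> between them. It
  lies strictly below \<open>z\<close>, hence below or at \<open>w\<close>.\<close>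

lemma adjacent_below_top:
  assumes d: "dk_int r k w x y z" and q: "q \<prec> z" "cadj (color q) (color z)" and v: "q \<preceq> v" "v \<prec>\<cdot> z"
  shows "q \<prec> w \<or> q = v \<or> (color q = color v \<and> q \<prec> v)"
proof (cases "color q = color v")
  case True
  then show ?thesis using v by blast
next
  case False
  have wz: "(w, z) \<in> BT" using d unfolding BT_def by blast
  obtain t where t: "q \<preceq> t" "t \<preceq> v" "color t = color z"
    using color_separation[OF q(2) cover_cadj[OF v(2)] False v(1)] by blast
  have "t \<prec> z" using t(2) cv_lt[OF v(2)] le_lt_trans by blast
  then have "t \<preceq> w" using same_color_lt_bottom(2)[OF t(3) _ wz] by blast
  moreover have "q \<noteq> t" using q(2) t(3) cadj_irrefl by metis
  ultimately show ?thesis using t(1) lt_le_trans[of q t w] by blast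
qed

text \<open>The element \<open>v\<close> is the top of an interval whose bottom \<open>u\<close>
  still lies above or at \<open>q\<close>, and axiom (2) puts \<open>u\<close> below or at every
  element covered by \<open>v\<close>.\<close>

lemma lt_bottom_of_cover:
  assumes "color q = color v" "q \<prec> v" "w \<prec>\<cdot> v"
  shows "q \<prec> w"
proof -
  obtain u where u: "(q, u) \<in> BT\<^sup>*" "(u, v) \<in> BT" using same_color_lt[OF assms(1,2)] by blast
  then have "u \<preceq> w" using top_cover_ge assms(3) unfolding BT_def by blast
  moreover have "q \<preceq> u" using BT_rtrancl_le[OF u(1)] le_Field assms(2) by blast
  moreover have "color w \<noteq> color v" using cover_cadj[OF assms(3)] cadj_irrefl by metis
  ultimately show ?thesis using le_trans[of q u w] assms(1) by auto
qed

text \<open>Exactly two elements of an adjacent color lie between consecutive elements of one color: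
  the two sides of a diamond, or the ends of the next smaller interval.\<close>

lemma between:
  assumes "dk_int r k w x y z"
  shows "\<exists>a b. a \<noteq> b \<and> w \<prec> a \<and> a \<prec> z \<and> w \<prec> b \<and> b \<prec> z \<and>
    cadj (color a) (color z) \<and> cadj (color b) (color z) \<and>
    (a \<preceq> b \<or> b \<preceq> a \<longrightarrow> color a = color b) \<and>
    (\<forall>q. q \<prec> z \<and> cadj (color q) (color z) \<longrightarrow> q \<prec> w \<or> q = a \<or> q = b) \<and>
    (k = 3 \<longrightarrow> a = x \<and> b = y) \<and>
    (k \<noteq> 3 \<longrightarrow> dk_int r (k - 1) a x y b)"
  using assms
proof cases
  case diamond
  note d = assms[unfolded diamond(1)]
  have lt: "w \<prec> x" "w \<prec> y" "x \<prec> z" "y \<prec> z" "\<not> x \<preceq> y" "\<not> y \<preceq> x"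
    using dk_int_D[OF assms] by blast+
  have "q \<prec> w \<or> q = x \<or> q = y" if q: "q \<prec> z" "cadj (color q) (color z)" for q
  proof -
    obtain v where v: "q \<preceq> v" "v \<prec>\<cdot> z" using ex_cover_below q(1) by blast
    have vxy: "v = x \<or> v = y" using diamond_top_covers[OF d v(2)] .
    then have "w \<prec>\<cdot> v" using diamond by blast
    then show ?thesis
      using adjacent_below_top[OF assms q v] lt_bottom_of_cover[of q v w] vxy by blast
  qed
  moreover have "cadj (color x) (color z)" "cadj (color y) (color z)"
    using cover_cadj diamond by blast+
  ultimately show ?thesis
    using lt diamond(1,2) by (intro exI[of _ x] exI[of _ y]) simp
next
  case (extend k' w' z')
  have wz': "(w', z') \<in> BT" using extend(2) unfolding BT_def by blast
  have lt: "w' \<prec> z'" "w \<prec> w'" "z' \<prec> z" using dk_int_lt[OF extend(2)] cv_lt extend by blast+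
  then have lt2: "w \<prec> z'" "w' \<prec> z" using lt_le_trans le_lt_trans by blast+
  have c: "color w' = color z'" using color_BT wz' by blast
  have "q \<prec> w \<or> q = w' \<or> q = z'" if q: "q \<prec> z" "cadj (color q) (color z)" for q
  proof -
    obtain v where v: "q \<preceq> v" "v \<prec>\<cdot> z" using ex_cover_below q(1) by blast
    have v': "v = z'" using extend_top_covers[OF extend(2-5) v(2)] .
    consider "q \<prec> w" | "q = z'" | "color q = color z'" "q \<prec> z'"
      using adjacent_below_top[OF assms q v] v' by blast
    then show ?thesis
    proof cases
      case 3
      then have "q \<preceq> w'" using same_color_lt_bottom(2)[OF 3 wz'] by blast
      then show ?thesis
        using lt_bottom_of_cover[of q w' w] 3(1) c extend(3) by auto
    qed blast+
  qed
  moreover have "cadj (color z') (color z)" using cover_cadj extend by blast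
  moreover have "k \<noteq> 3" "k - 1 = k'" using extend(1) dk_int_ge_3[OF extend(2)] by auto
  ultimately show ?thesis
    using lt lt2 c extend(2) by (intro exI[of _ w'] exI[of _ z']) auto
qed

text \<open>Comparability is carried down the orbit of \<open>t\<close> one interval at a time: by
  \<open>between\<close>, an adjacent element below the top \<open>z\<close> is either below the
  bottom \<open>w\<close> or one of the two elements above \<open>w\<close>.\<close>

lemma adjacent_comparable_top:
  assumes "q \<prec> t" "cadj (color q) (color t)" "(z, t) \<in> BT\<^sup>*"
  shows "q \<prec> z \<or> z \<prec> q"
  using assms(3)
proof (induction rule: converse_rtrancl_induct)
  case base
  then show ?case using assms(1) by blast
next
  case (step w z)
  have c: "color z = color t"
    using step.hyps(2) by (induction rule: rtrancl_induct) (auto simp: color_BT)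
  obtain k x y where d: "dk_int r k w x y z" using step.hyps(1) unfolding BT_def by blast
  have wz: "w \<prec> z" using BT_lt[OF step.hyps(1)] .
  from step.IH show ?case
  proof
    assume "q \<prec> z"
    then show ?thesis using between[OF d] assms(2) c by metis
  next
    assume "z \<prec> q"
    then show ?thesis using wz lt_le_trans by blast
  qed
qed

lemma adjacent_comparable:
  assumes "p \<in> Field r" "q \<in> Field r" "cadj (color p) (color q)"
  shows "p \<prec> q \<or> q \<prec> p"
proof -
  have *: "p \<prec> q \<or> q \<prec> p" if "p \<in> Field r" "q \<in> Field r" "color p \<prec>\<cdot> color q" "cadj (color p) (color q)" for p q
  proof -
    \<comment> \<open>\<open>color q\<close> is the upper end of the orbit of \<open>q\<close>.
      Comparability with \<open>p\<close> is clear there and descends to \<open>q\<close>.\<close>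
    have "p \<prec> color q" using le_color[OF that(1)] cv_lt[OF that(3)] le_lt_trans by blast
    moreover have "color (color q) = color q" using color_top color_props by blast
    ultimately show ?thesis
      using adjacent_comparable_top[of p "color q" q] that(4) color_props(1)[of q] by simp
  qed
  show ?thesis
    using *[of p q] *[of q p] assms cadj_sym unfolding cadj_def by blast
qed

lemma same_color_comparable:
  assumes "p \<in> Field r" "q \<in> Field r" "color p = color q"
  shows "p \<preceq> q \<or> q \<preceq> p"
  using same_color[OF assms(3)] BT_rtrancl_le assms by blast

end


section \<open>Counting labelings\<close>

text \<open>\<open>R\<close> need not be an order. Only the constraints it imposes matter, so
  generating edges can be used as they are and single edges added, dropped or reversed.\<close>

definition labelings :: "'a rel \<Rightarrow> 'a set \<Rightarrow> ('a \<Rightarrow> nat) set" where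
  "labelings R V = {f \<in> V \<rightarrow>\<^sub>E {1..card V}. bij_betw f V {1..card V} \<and>
     (\<forall>x \<in> V. \<forall>y \<in> V. (x, y) \<in> R \<longrightarrow> f x \<le> f y)}"

lemma linear_extensions_eq_labelings: "linear_extensions r = labelings r (Field r)"
proof -
  have "(\<forall>(x, y) \<in> r. f x \<le> f y) \<longleftrightarrow> (\<forall>x \<in> Field r. \<forall>y \<in> Field r. (x, y) \<in> r \<longrightarrow> f x \<le> f y)"
    for f :: "'a \<Rightarrow> nat"
    using FieldI1[of _ _ r] FieldI2[of _ _ r] by blast
  then show ?thesis unfolding linear_extensions_def labelings_def by simp
qed

lemma labelings_cong:
  "(\<And>x y. x \<in> V \<Longrightarrow> y \<in> V \<Longrightarrow> (x, y) \<in> R \<longleftrightarrow> (x, y) \<in> R') \<Longrightarrow> labelings R V = labelings R' V"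
  unfolding labelings_def by (intro Collect_cong) blast

lemma finite_labelings: "finite V \<Longrightarrow> finite (labelings R V)"
  unfolding labelings_def by (rule finite_subset[OF _ finite_PiE[of V "\<lambda>_. {1..card V}"]]) auto

lemma labelings_generated_order:
  assumes "E \<subseteq> V \<times> V"
  shows "labelings (generated_order V E) V = labelings E V"
proof -
  have "(\<forall>x \<in> V. \<forall>y \<in> V. (x, y) \<in> generated_order V E \<longrightarrow> f x \<le> f y) \<longleftrightarrow>
    (\<forall>x \<in> V. \<forall>y \<in> V. (x, y) \<in> E \<longrightarrow> f x \<le> f y)" for f :: "'a \<Rightarrow> nat"
  proof
    assume E: "\<forall>x \<in> V. \<forall>y \<in> V. (x, y) \<in> E \<longrightarrow> f x \<le> f y"
    have "f x \<le> f y" if "(x, y) \<in> E\<^sup>+" for x y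
      using that
    proof induction
      case (base y)
      then show ?case using E assms by blast
    next
      case (step y z)
      have "f y \<le> f z" using step.hyps(2) E assms by blast
      then show ?case using step.IH by simp
    qed
    then show "\<forall>x \<in> V. \<forall>y \<in> V. (x, y) \<in> generated_order V E \<longrightarrow> f x \<le> f y"
      by (auto simp: generated_order_def)
  qed (auto simp: generated_order_def)
  then show ?thesis unfolding labelings_def by simp
qed

text \<open>The largest label sits at an element with no constraint to a different one, and deleting
  it leaves a labeling of the rest.\<close>

lemma labelings_remove_max:
  assumes "finite V" "V \<noteq> {}"
  shows "card (labelings R V) = (\<Sum>m \<in> maximal_elements R V. card (labelings R (V - {m})))"
proof -
  let ?n = "card V"
  let ?ext = "\<lambda>m g. g(m := ?n)"
  have n: "?n > 0" using assms by (simp add: card_gt_0_iff)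
  have cV: "card (V - {m}) = ?n - 1" if "m \<in> V" for m using that assms by simp
  have ins: "insert ?n {1..?n - 1} = {1..?n}" using n by auto
  have eq: "labelings R V = (\<Union>m \<in> maximal_elements R V. ?ext m ` labelings R (V - {m}))"
  proof (intro equalityI subsetI)
    fix f assume "f \<in> labelings R V"
    then have f: "f \<in> V \<rightarrow>\<^sub>E {1..?n}" "bij_betw f V {1..?n}" "\<And>x y. x \<in> V \<Longrightarrow> y \<in> V \<Longrightarrow> (x, y) \<in> R \<Longrightarrow> f x \<le> f y"
      unfolding labelings_def by auto
    obtain m where m: "m \<in> V" "f m = ?n"
      using f(2) n unfolding bij_betw_def by (metis atLeastAtMost_iff image_iff le_refl Suc_leI One_nat_def)
    have le: "f x \<le> ?n" if "x \<in> V" for x using f(1) that by auto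
    have inj: "x = y" if "x \<in> V" "y \<in> V" "f x = f y" for x y
      using f(2) that unfolding bij_betw_def inj_on_def by blast
    have "m \<in> maximal_elements R V"
    proof -
      have "y = m" if "y \<in> V" "(m, y) \<in> R" for y
        using inj[OF that(1) m(1)] f(3)[OF m(1) that] le[OF that(1)] m(2) by simp
      then show ?thesis using m(1) unfolding maximal_elements_def by blast
    qed
    moreover have "f(m := undefined) \<in> labelings R (V - {m})"
    proof -
      have b: "bij_betw f (V - {m}) {1..?n - 1}"
      proof -
        have "bij_betw f (V - {m}) ({1..?n} - {f m})"
          using f(2) m(1) by (auto simp: bij_betw_def inj_on_def)
        moreover have "{1..?n} - {f m} = {1..?n - 1}" using m(2) by auto
        ultimately show ?thesis by simp
      qed
      then have b': "bij_betw (f(m := undefined)) (V - {m}) {1..?n - 1}"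
        by (rule bij_betw_cong[THEN iffD1, rotated]) simp
      have "f(m := undefined) \<in> (V - {m}) \<rightarrow>\<^sub>E {1..?n - 1}"
      proof (rule PiE_I)
        fix x assume "x \<in> V - {m}"
        then show "(f(m := undefined)) x \<in> {1..?n - 1}" using b' by (auto simp: bij_betw_def)
      next
        fix x assume "x \<notin> V - {m}"
        then show "(f(m := undefined)) x = undefined" using f(1) by (cases "x = m") (auto simp: PiE_def extensional_def)
      qed
      then show ?thesis unfolding labelings_def cV[OF m(1)] using b' f(3) by auto
    qed
    moreover have "f = ?ext m (f(m := undefined))" using m by auto
    ultimately show "f \<in> (\<Union>m \<in> maximal_elements R V. ?ext m ` labelings R (V - {m}))" by blast
  next
    fix f assume "f \<in> (\<Union>m \<in> maximal_elements R V. ?ext m ` labelings R (V - {m}))"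
    then obtain m g where m: "m \<in> maximal_elements R V" and g: "g \<in> labelings R (V - {m})" and f: "f = ?ext m g"
      by blast
    have mV: "m \<in> V" and mx: "\<And>y. y \<in> V \<Longrightarrow> (m, y) \<in> R \<Longrightarrow> y = m"
      using m unfolding maximal_elements_def by auto
    have g': "g \<in> (V - {m}) \<rightarrow>\<^sub>E {1..?n - 1}" "bij_betw g (V - {m}) {1..?n - 1}"
      "\<And>x y. x \<in> V - {m} \<Longrightarrow> y \<in> V - {m} \<Longrightarrow> (x, y) \<in> R \<Longrightarrow> g x \<le> g y"
      using g unfolding labelings_def cV[OF mV] by auto
    have fb: "bij_betw f (V - {m}) {1..?n - 1}"
      unfolding f using g'(2) by (rule bij_betw_cong[THEN iffD1, rotated]) simp
    have "bij_betw f (insert m (V - {m})) (insert ?n {1..?n - 1})"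
    proof -
      have "f m = ?n" "?n \<notin> {1..?n - 1}" using n by (auto simp: f)
      then have "f m \<notin> f ` (V - {m})" using fb by (simp add: bij_betw_def)
      then show ?thesis
        using fb \<open>f m = ?n\<close> unfolding bij_betw_def inj_on_insert by auto
    qed
    then have b: "bij_betw f V {1..?n}" using mV unfolding ins by (simp add: insert_absorb)
    moreover have "f \<in> V \<rightarrow>\<^sub>E {1..?n}"
    proof (rule PiE_I)
      fix x assume "x \<in> V" then show "f x \<in> {1..?n}" using b by (auto simp: bij_betw_def)
    next
      fix x assume "x \<notin> V" then show "f x = undefined"
        using mV g'(1) by (cases "x = m") (auto simp: f PiE_def extensional_def)
    qed
    moreover have "f x \<le> f y" if "x \<in> V" "y \<in> V" "(x, y) \<in> R" for x y
    proof (cases "y = m")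
      case True
      then show ?thesis using PiE_mem[OF calculation(2) that(1)] by (simp add: f)
    next
      case False
      then have "x \<noteq> m" using mx that by blast
      then show ?thesis using g'(3)[of x y] that False by (simp add: f)
    qed
    ultimately show "f \<in> labelings R V" unfolding labelings_def by blast
  qed
  have gm: "g x \<noteq> ?n" if "m \<in> V" "g \<in> labelings R (V - {m})" "x \<in> V - {m}" for m g x
  proof -
    have "g \<in> (V - {m}) \<rightarrow>\<^sub>E {1..?n - 1}" using that(2) unfolding labelings_def cV[OF that(1)] by blast
    then have "g x \<in> {1..?n - 1}" using that(3) by (rule PiE_mem)
    then show ?thesis using n by auto
  qed
  have mV: "m \<in> V" if "m \<in> maximal_elements R V" for m using that unfolding maximal_elements_def by blast
  have "card (\<Union>m \<in> maximal_elements R V. ?ext m ` labelings R (V - {m})) =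
      (\<Sum>m \<in> maximal_elements R V. card (?ext m ` labelings R (V - {m})))"
  proof (rule card_UN_disjoint)
    show "finite (maximal_elements R V)" using assms(1) unfolding maximal_elements_def by simp
    show "\<forall>m \<in> maximal_elements R V. finite (?ext m ` labelings R (V - {m}))"
      using finite_labelings assms(1) by blast
    show "\<forall>m \<in> maximal_elements R V. \<forall>m' \<in> maximal_elements R V. m \<noteq> m' \<longrightarrow>
        ?ext m ` labelings R (V - {m}) \<inter> ?ext m' ` labelings R (V - {m'}) = {}"
    proof (intro ballI impI)
      fix m m' assume mm: "m \<in> maximal_elements R V" "m' \<in> maximal_elements R V" "m \<noteq> m'"
      have "?ext m g \<noteq> ?ext m' g'" if "g \<in> labelings R (V - {m})" "g' \<in> labelings R (V - {m'})" for g g'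
      proof
        assume "?ext m g = ?ext m' g'"
        then have "?ext m g m = ?ext m' g' m" by metis
        then have "g' m = ?n" using mm(3) by simp
        then show False using gm[OF mV[OF mm(2)] that(2), of m] mV[OF mm(1)] mm(3) by blast
      qed
      then show "?ext m ` labelings R (V - {m}) \<inter> ?ext m' ` labelings R (V - {m'}) = {}" by blast
    qed
  qed
  also have "\<dots> = (\<Sum>m \<in> maximal_elements R V. card (labelings R (V - {m})))"
  proof (rule sum.cong[OF refl], rule card_image, rule inj_onI)
    fix m g g' assume *: "m \<in> maximal_elements R V" "g \<in> labelings R (V - {m})" "g' \<in> labelings R (V - {m})"
      "?ext m g = ?ext m g'"
    have "g m = undefined" "g' m = undefined" using *(2,3) unfolding labelings_def by auto
    then show "g = g'" using *(4) by (metis fun_upd_triv fun_upd_upd)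
  qed
  finally show ?thesis unfolding eq .
qed

text \<open>The proportion of all bijections that respect \<open>R\<close>; unlike the count itself it is multiplicative
  over disjoint unions.\<close>

definition density :: "'a rel \<Rightarrow> 'a set \<Rightarrow> real" where
  "density R V = card (labelings R V) / fact (card V)"

lemma density_cong:
  "(\<And>x y. x \<in> V \<Longrightarrow> y \<in> V \<Longrightarrow> (x, y) \<in> R \<longleftrightarrow> (x, y) \<in> R') \<Longrightarrow> density R V = density R' V"
  unfolding density_def using labelings_cong[of V R R'] by simp

lemma density_empty [simp]: "density R {} = 1"
proof -
  have "labelings R {} = {\<lambda>_. undefined}" by (auto simp: labelings_def bij_betw_def)
  then show ?thesis by (simp add: density_def)
qed

lemma density_rec:
  assumes "finite V"
  shows "real (card V) * density R V = (\<Sum>m \<in> maximal_elements R V. density R (V - {m}))"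
proof (cases "V = {}")
  case True
  then show ?thesis by (simp add: maximal_elements_def)
next
  case False
  then obtain k where k: "card V = Suc k" using assms by (metis card_0_eq not0_implies_Suc)
  have "card (V - {m}) = k" if "m \<in> maximal_elements R V" for m
    using that assms k by (auto simp: maximal_elements_def)
  then have "(\<Sum>m \<in> maximal_elements R V. density R (V - {m})) =
      (\<Sum>m \<in> maximal_elements R V. card (labelings R (V - {m})) / fact k)"
    unfolding density_def by simp
  also have "\<dots> = card (labelings R V) / fact k"
    using labelings_remove_max[OF assms False, of R] by (simp add: sum_divide_distrib)
  also have "\<dots> = real (card V) * density R V"
    unfolding density_def k by (simp add: fact_Suc del: of_nat_Suc)
  finally show ?thesis by simp
qed

text \<open>No shuffles are counted: a maximal element of the union is maximal in one of the parts,
  so both sides satisfy the recursion \<open>density_rec\<close> with \<open>card V + card W\<close>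
  as factor.\<close>

lemma density_disjoint_union:
  assumes "finite V" "finite W" "V \<inter> W = {}" "\<And>x y. (x, y) \<in> R \<Longrightarrow> \<not> (x \<in> V \<and> y \<in> W) \<and> \<not> (x \<in> W \<and> y \<in> V)"
  shows "density R (V \<union> W) = density R V * density R W"
  using assms
proof (induction "card V + card W" arbitrary: V W rule: less_induct)
  case less
  show ?case
  proof (cases "V = {} \<or> W = {}")
    case True
    then show ?thesis by auto
  next
    case False
    have fin: "finite (maximal_elements R V)" "finite (maximal_elements R W)"
      using less.prems unfolding maximal_elements_def by auto
    have mx: "maximal_elements R (V \<union> W) = maximal_elements R V \<union> maximal_elements R W"
      using less.prems(3,4) unfolding maximal_elements_def by blast
    have disj: "maximal_elements R V \<inter> maximal_elements R W = {}"
      using less.prems(3) unfolding maximal_elements_def by blast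
    have V: "density R (V \<union> W - {m}) = density R (V - {m}) * density R W" if "m \<in> maximal_elements R V" for m
    proof -
      have m: "m \<in> V" using that unfolding maximal_elements_def by blast
      then have "V \<union> W - {m} = (V - {m}) \<union> W" using less.prems(3) by blast
      moreover have "card (V - {m}) < card V" using m less.prems(1) by (rule card_Diff1_less[rotated])
      moreover have "density R ((V - {m}) \<union> W) = density R (V - {m}) * density R W"
        by (rule less.hyps) (use less.prems calculation(2) in auto)
      ultimately show ?thesis by simp
    qed
    have W: "density R (V \<union> W - {m}) = density R V * density R (W - {m})" if "m \<in> maximal_elements R W" for m
    proof -
      have m: "m \<in> W" using that unfolding maximal_elements_def by blast
      then have "V \<union> W - {m} = V \<union> (W - {m})" using less.prems(3) by blast
      moreover have "card (W - {m}) < card W" using m less.prems(2) by (rule card_Diff1_less[rotated])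
      moreover have "density R (V \<union> (W - {m})) = density R V * density R (W - {m})"
        by (rule less.hyps) (use less.prems calculation(2) in auto)
      ultimately show ?thesis by simp
    qed
    have "real (card (V \<union> W)) * density R (V \<union> W) =
        (\<Sum>m \<in> maximal_elements R V. density R (V - {m})) * density R W +
        density R V * (\<Sum>m \<in> maximal_elements R W. density R (W - {m}))"
      using less.prems(1,2) V W
      by (simp add: density_rec mx sum.union_disjoint[OF fin disj] sum_distrib_left sum_distrib_right)
    also have "\<dots> = real (card (V \<union> W)) * (density R V * density R W)"
      using less.prems by (simp add: density_rec[symmetric] card_Un_disjoint algebra_simps)
    finally show ?thesis using False less.prems(1,2) by (simp add: card_eq_0_iff)
  qed
qed

lemma density_split:
  assumes "finite V" "x \<in> V" "y \<in> V" "x \<noteq> y"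
  shows "density R V = density (insert (x, y) R) V + density (insert (y, x) R) V"
proof -
  have "labelings R V = labelings (insert (x, y) R) V \<union> labelings (insert (y, x) R) V"
    using assms(2,3) unfolding labelings_def by auto
  moreover have "labelings (insert (x, y) R) V \<inter> labelings (insert (y, x) R) V = {}"
    using assms(2-4) unfolding labelings_def by (auto simp: bij_betw_def inj_on_def dest!: le_antisym)
  ultimately have "card (labelings R V) = card (labelings (insert (x, y) R) V) + card (labelings (insert (y, x) R) V)"
    using finite_labelings[OF assms(1)] by (metis card_Un_disjoint)
  then show ?thesis unfolding density_def by (simp add: add_divide_distrib)
qed


section \<open>The determinant\<close>

text \<open>The last column \<open>c\<close> is kept free so that expansion along the last row stays
  within the family: deleting the last column exposes a column of \<open>M\<close>, and deleting the
  one before it moves \<open>c\<close> into its place.\<close>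

definition hessenberg :: "(nat \<Rightarrow> nat \<Rightarrow> real) \<Rightarrow> (nat \<Rightarrow> real) \<Rightarrow> nat \<Rightarrow> real mat" where
  "hessenberg M c t = mat (t + 1) (t + 1) (\<lambda>(i, j). if j = t then c i
     else if j + 1 < i then 0 else if j + 1 = i then 1 else M i j)"

lemma det_hessenberg_0: "det (hessenberg M c 0) = c 0"
  by (simp add: hessenberg_def det_single)

lemma det_hessenberg_Suc:
  "det (hessenberg M c (Suc t)) =
     c (Suc t) * det (hessenberg M (\<lambda>i. M i t) t) - det (hessenberg M c t)"
proof -
  let ?A = "hessenberg M c (Suc t)"
  have A: "?A \<in> carrier_mat (Suc (Suc t)) (Suc (Suc t))" by (simp add: hessenberg_def)
  have "det ?A = (\<Sum>j<Suc (Suc t). ?A $$ (Suc t, j) * cofactor ?A (Suc t) j)"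
    by (rule laplace_expansion_row[OF A]) simp
  also have "\<dots> = ?A $$ (Suc t, t) * cofactor ?A (Suc t) t + ?A $$ (Suc t, Suc t) * cofactor ?A (Suc t) (Suc t)"
  proof -
    have "(\<Sum>j<t. ?A $$ (Suc t, j) * cofactor ?A (Suc t) j) = 0"
      by (rule sum.neutral) (simp add: hessenberg_def)
    then show ?thesis by (simp add: lessThan_Suc)
  qed
  also have "?A $$ (Suc t, t) = 1" by (simp add: hessenberg_def)
  also have "?A $$ (Suc t, Suc t) = c (Suc t)" by (simp add: hessenberg_def)
  also have "cofactor ?A (Suc t) t = - det (hessenberg M c t)"
  proof -
    have "mat_delete ?A (Suc t) t = hessenberg M c t"
      by (rule eq_matI) (auto simp: mat_delete_def hessenberg_def)
    then show ?thesis by (simp add: cofactor_def)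
  qed
  also have "cofactor ?A (Suc t) (Suc t) = det (hessenberg M (\<lambda>i. M i t) t)"
  proof -
    have "mat_delete ?A (Suc t) (Suc t) = hessenberg M (\<lambda>i. M i t) t"
      by (rule eq_matI) (auto simp: mat_delete_def hessenberg_def)
    then show ?thesis by (simp add: cofactor_def)
  qed
  finally show ?thesis by simp
qed

text \<open>\<open>f t\<close> and \<open>g t\<close> are the two orientations of the edge joining the blocks \<open>t - 1\<close> and \<open>t\<close>.
  Splitting by the orientation of one edge after the other mirrors the expansion of the Hessenberg
  determinant along its last row.\<close>

lemma density_path_det:
  fixes W :: "nat \<Rightarrow> 'a set" and a b :: "nat \<Rightarrow> 'a"
  assumes fin: "\<And>t. t \<le> k \<Longrightarrow> finite (W t)"
    and disj: "\<And>s t. s \<le> k \<Longrightarrow> t \<le> k \<Longrightarrow> s \<noteq> t \<Longrightarrow> W s \<inter> W t = {}"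
    and C: "\<And>x y. (x, y) \<in> C \<Longrightarrow> \<exists>t \<le> k. x \<in> W t \<and> y \<in> W t"
    and ab: "\<And>t. t \<in> {1..k} \<Longrightarrow> a t \<in> W (t - 1) \<and> b t \<in> W t"
    and fg: "\<And>t. t \<in> {1..k} \<Longrightarrow> f t = (a t, b t) \<and> g t = (b t, a t) \<or> f t = (b t, a t) \<and> g t = (a t, b t)"
  defines "WW i j \<equiv> \<Union>t \<in> {i..j}. W t"
  defines "M i j \<equiv> density (C \<union> g ` {i + 1..j}) (\<Union>t \<in> {i..j}. W t)"
  assumes "t \<le> T" "T \<le> k"
  shows "det (hessenberg M (\<lambda>i. M i T) t) = density (C \<union> f ` {1..t} \<union> g ` {t + 1..T}) (\<Union>t \<in> {0..T}. W t)"
  using assms(8,9)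
proof (induction t arbitrary: T)
  case 0
  then show ?case by (simp add: det_hessenberg_0 M_def)
next
  case (Suc t)
  have mem: "x \<in> WW i j \<longleftrightarrow> s \<in> {i..j}" if "x \<in> W s" "s \<le> k" "j \<le> k" for x s i j
  proof -
    have "s' = s" if "x \<in> W s'" "s' \<in> {i..j}" for s'
      using disj[of s s'] that \<open>x \<in> W s\<close> \<open>s \<le> k\<close> \<open>j \<le> k\<close> by fastforce
    then show ?thesis using that(1) unfolding WW_def by blast
  qed
  have edge: "\<exists>x y. h s = (x, y) \<and> (x \<in> W (s - 1) \<and> y \<in> W s \<or> x \<in> W s \<and> y \<in> W (s - 1))"
    if "s \<in> {1..k}" "h = f \<or> h = g" for s h
    using ab[OF that(1)] fg[OF that(1)] that(2) by auto
  have edge': "s \<in> {i + 1..j} \<and> s \<in> {1..k}" if "(x, y) = h s" "s \<in> {1..k}" "h = f \<or> h = g" "x \<in> WW i j" "y \<in> WW i j" "j \<le> k"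
    for x y s h i j
  proof -
    have "s - 1 \<le> k" "s \<le> k" using that(2) by auto
    then have "s - 1 \<in> {i..j} \<and> s \<in> {i..j}"
      using edge[OF that(2,3)] that mem[of _ "s - 1" j i] mem[of _ s j i] by auto
    then show ?thesis using that(2) by auto
  qed
  \<comment> \<open>Edge number \<open>Suc t\<close>, between the blocks \<open>t\<close> and
    \<open>Suc t\<close>, is left out here. Its two orientations add up to \<open>?R\<close>, for
    which the path falls apart into two independent pieces.\<close>
  let ?R = "C \<union> f ` {1..t} \<union> g ` {t + 2..T}"
  have T: "T \<le> k" "Suc t \<le> T" "t \<le> k" using Suc.prems by auto
  have finW: "finite (WW i j)" if "j \<le> k" for i j using fin that unfolding WW_def by auto
  have "density ?R (WW 0 T) = density (insert (f (Suc t)) ?R) (WW 0 T) + density (insert (g (Suc t)) ?R) (WW 0 T)"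
  proof -
    have St: "Suc t \<in> {1..k}" using T by auto
    have "a (Suc t) \<in> WW 0 T" "b (Suc t) \<in> WW 0 T"
      using ab[OF St] T by (auto simp: WW_def)
    moreover have "a (Suc t) \<noteq> b (Suc t)"
      using ab[OF St] disj[of t "Suc t"] T by auto
    ultimately show ?thesis
      using density_split[OF finW[OF T(1)], of "a (Suc t)" 0 "b (Suc t)" ?R] fg[OF St] by auto
  qed
  moreover have "insert (f (Suc t)) ?R = C \<union> f ` {1..Suc t} \<union> g ` {Suc t + 1..T}"
    by (auto simp: atLeastAtMostSuc_conv)
  moreover have "insert (g (Suc t)) ?R = C \<union> f ` {1..t} \<union> g ` {t + 1..T}"
  proof -
    have "{t + 1..T} = insert (Suc t) {t + 2..T}" using T by auto
    then show ?thesis by auto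
  qed
  moreover have "density ?R (WW 0 T) = M (Suc t) T * density (C \<union> f ` {1..t}) (WW 0 t)"
  proof -
    have un: "WW 0 T = WW 0 t \<union> WW (Suc t) T"
    proof -
      have "{0..T} = {0..t} \<union> {Suc t..T}" using T by auto
      then show ?thesis unfolding WW_def by (simp add: UN_Un)
    qed
    have R: "(x, y) \<in> C \<or> (\<exists>s \<in> {1..t}. (x, y) = f s) \<or> (\<exists>s \<in> {t + 2..T}. (x, y) = g s)"
      if "(x, y) \<in> ?R" for x y using that by auto
    have "density ?R (WW 0 T) = density ?R (WW 0 t) * density ?R (WW (Suc t) T)"
      unfolding un
    proof (rule density_disjoint_union)
      have "W s \<inter> W s' = {}" if "s \<in> {0..t}" "s' \<in> {Suc t..T}" for s s'
        using disj[of s s'] that T by auto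
      then show "WW 0 t \<inter> WW (Suc t) T = {}" unfolding WW_def by blast
      fix x y assume "(x, y) \<in> ?R"
      from R[OF this] show "\<not> (x \<in> WW 0 t \<and> y \<in> WW (Suc t) T) \<and> \<not> (x \<in> WW (Suc t) T \<and> y \<in> WW 0 t)"
      proof (elim disjE bexE)
        assume "(x, y) \<in> C"
        then obtain s where "s \<le> k" "x \<in> W s" "y \<in> W s" using C by blast
        then show ?thesis using mem[of x s t 0] mem[of y s t 0] mem[of x s T "Suc t"] mem[of y s T "Suc t"] T by auto
      next
        fix s assume s: "s \<in> {1..t}" "(x, y) = f s"
        then have "s \<in> {1..k}" "s \<le> k" "s - 1 \<le> k" using T by auto
        then show ?thesis using edge[of s f] s mem[of _ s T "Suc t"] mem[of _ "s - 1" T "Suc t"] T by auto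
      next
        fix s assume s: "s \<in> {t + 2..T}" "(x, y) = g s"
        then have "s \<in> {1..k}" "s \<le> k" "s - 1 \<le> k" using T by auto
        then show ?thesis using edge[of s g] s mem[of _ s t 0] mem[of _ "s - 1" t 0] T by auto
      qed
    qed (use finW T in auto)
    also have "density ?R (WW 0 t) = density (C \<union> f ` {1..t}) (WW 0 t)"
    proof (rule density_cong)
      fix x y assume xy: "x \<in> WW 0 t" "y \<in> WW 0 t"
      have False if "(x, y) = g s" "s \<in> {t + 2..T}" for s
        using edge'[of x y g s, OF that(1) _ _ xy T(3)] that(2) T by auto
      then show "(x, y) \<in> ?R \<longleftrightarrow> (x, y) \<in> C \<union> f ` {1..t}" by blast
    qed
    also have "density ?R (WW (Suc t) T) = density (C \<union> g ` {Suc t + 1..T}) (WW (Suc t) T)"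
    proof (rule density_cong)
      fix x y assume xy: "x \<in> WW (Suc t) T" "y \<in> WW (Suc t) T"
      have False if "(x, y) = f s" "s \<in> {1..t}" for s
        using edge'[of x y f s, OF that(1) _ _ xy T(1)] that(2) T by auto
      moreover have "Suc t + 1 = t + 2" by simp
      ultimately show "(x, y) \<in> ?R \<longleftrightarrow> (x, y) \<in> C \<union> g ` {Suc t + 1..T}" by (metis UnE UnI1 UnI2 imageE)
    qed
    finally show ?thesis by (simp add: M_def WW_def)
  qed
  moreover have "det (hessenberg M (\<lambda>i. M i t) t) = density (C \<union> f ` {1..t}) (WW 0 t)"
    using Suc.IH[of t] T by (simp add: WW_def)
  moreover have "det (hessenberg M (\<lambda>i. M i T) t) = density (C \<union> f ` {1..t} \<union> g ` {t + 1..T}) (WW 0 T)"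
    using Suc.IH[of T] T by (simp add: WW_def)
  ultimately show ?case
    unfolding det_hessenberg_Suc by (simp add: WW_def)
qed


section \<open>Minuscule heaps\<close>

text \<open>The heap of a dominant minuscule Weyl group element over the simply laced diagram
  \<open>adj\<close>. Minusculeness is \<open>consecutive_between\<close>, dominance is
  \<open>topmost_adj\<close>. The clause on comparable \<open>a\<close> and \<open>b\<close> enters
  in \<open>no_bad_interval\<close>.\<close>

locale heap = fin_poset r for r :: "'a rel" +
  fixes col :: "'a \<Rightarrow> 'c" and adj :: "'c \<Rightarrow> 'c \<Rightarrow> bool"
  assumes adj_sym: "adj i j \<Longrightarrow> adj j i"
    and adj_irrefl: "\<not> adj i i"
    and same_comparable: "p \<in> Field r \<Longrightarrow> q \<in> Field r \<Longrightarrow> col p = col q \<Longrightarrow> p \<preceq> q \<or> q \<preceq> p"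
    and adj_comparable: "p \<in> Field r \<Longrightarrow> q \<in> Field r \<Longrightarrow> adj (col p) (col q) \<Longrightarrow> p \<prec> q \<or> q \<prec> p"
    and cover_adj: "p \<prec>\<cdot> q \<Longrightarrow> adj (col p) (col q)"
    and consecutive_between: "w \<prec> z \<Longrightarrow> col w = col z \<Longrightarrow>
      (\<And>t. w \<prec> t \<Longrightarrow> t \<prec> z \<Longrightarrow> col t \<noteq> col w) \<Longrightarrow>
      \<exists>a b. a \<noteq> b \<and> {q. w \<prec> q \<and> q \<prec> z \<and> adj (col q) (col w)} = {a, b} \<and>
        (a \<preceq> b \<or> b \<preceq> a \<longrightarrow> col a = col b)"
    and topmost_adj: "t \<in> Field r \<Longrightarrow> (\<And>q. t \<prec> q \<Longrightarrow> col q \<noteq> col t) \<Longrightarrow>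
      card {q. t \<prec> q \<and> adj (col q) (col t)} \<le> 1"
begin

text \<open>The Cartan matrix of the simply laced diagram \<open>adj\<close>.\<close>

definition cart :: "'c \<Rightarrow> 'c \<Rightarrow> int" where
  "cart i j = (if i = j then 2 else if adj i j then -1 else 0)"

lemma cart_sym: "cart i j = cart j i"
  using adj_sym unfolding cart_def by auto

lemma cart_same [simp]: "cart i i = 2"
  by (simp add: cart_def)

lemma cart_nonzeroD:
  assumes "cart (col p) (col q) \<noteq> 0" "p \<in> Field r" "q \<in> Field r"
  shows "p \<preceq> q \<or> q \<preceq> p"
  using assms same_comparable adj_comparable unfolding cart_def by (auto split: if_splits)

lemma sum_cart:
  assumes "finite A"
  shows "(\<Sum>q \<in> A. cart (col q) i) = 2 * int (card {q \<in> A. col q = i}) - int (card {q \<in> A. adj (col q) i})"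
  using assms
proof induction
  case (insert x A)
  have "{q \<in> insert x A. col q = i} = (if col x = i then insert x {q \<in> A. col q = i} else {q \<in> A. col q = i})"
    "{q \<in> insert x A. adj (col q) i} =
      (if adj (col x) i then insert x {q \<in> A. adj (col q) i} else {q \<in> A. adj (col q) i})"
    by auto
  then show ?case using insert adj_irrefl by (auto simp: cart_def)
qed simp

lemma finite_above: "finite {q. p \<prec> q \<and> Q q}" and finite_below: "finite {q. q \<prec> p \<and> Q q}"
  by (rule finite_subset[OF _ finite_up[of p]], blast) (rule finite_subset[OF _ finite_down[of p]], blast)

definition consecutive :: "'a \<Rightarrow> 'a \<Rightarrow> bool" where
  "consecutive w z \<longleftrightarrow> w \<prec> z \<and> col w = col z \<and> (\<forall>t. w \<prec> t \<longrightarrow> t \<prec> z \<longrightarrow> col t \<noteq> col w)"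

definition mids :: "'a \<Rightarrow> 'a \<Rightarrow> 'a set" where
  "mids w z = {q. w \<prec> q \<and> q \<prec> z \<and> adj (col q) (col w)}"

lemma mids_pair:
  assumes "consecutive w z"
  obtains a b where "a \<noteq> b" "mids w z = {a, b}" "a \<preceq> b \<or> b \<preceq> a \<longrightarrow> col a = col b"
  using consecutive_between[of w z] assms unfolding consecutive_def mids_def by blast

lemma card_mids: "consecutive w z \<Longrightarrow> card (mids w z) = 2"
  using mids_pair by (metis card_2_iff)

lemma ex_consecutive_above: "p \<prec> q \<Longrightarrow> col p = col q \<Longrightarrow> \<exists>z. consecutive p z \<and> z \<preceq> q"
proof (induction q rule: down_induct)
  case (less q)
  show ?case
  proof (cases "\<exists>t. p \<prec> t \<and> t \<prec> q \<and> col t = col p")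
    case True
    then obtain t where t: "p \<prec> t" "t \<prec> q" "col t = col p" by blast
    then obtain z where "consecutive p z" "z \<preceq> t" using less.IH[of t] by auto
    then show ?thesis using t(2) le_trans[of z t q] by blast
  next
    case False
    then have "consecutive p q" using less.prems unfolding consecutive_def by blast
    then show ?thesis using less.prems le_refl le_Field by blast
  qed
qed

lemma ex_consecutive_below: "p \<prec> q \<Longrightarrow> col p = col q \<Longrightarrow> \<exists>w. consecutive w q \<and> p \<preceq> w"
proof (induction p rule: up_induct)
  case (greater p)
  show ?case
  proof (cases "\<exists>t. p \<prec> t \<and> t \<prec> q \<and> col t = col p")
    case True
    then obtain t where t: "p \<prec> t" "t \<prec> q" "col t = col p" by blast
    then obtain w where "consecutive w q" "t \<preceq> w" using greater.IH[of t] greater.prems by auto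
    then show ?thesis using t(1) le_trans[of p t w] by blast
  next
    case False
    then have "consecutive p q" using greater.prems unfolding consecutive_def by blast
    then show ?thesis using greater.prems le_refl le_Field by blast
  qed
qed

lemma consecutive_above_cases:
  assumes "consecutive w z" "w \<prec> q"
  shows "col q = col w \<Longrightarrow> z \<preceq> q" "adj (col q) (col w) \<Longrightarrow> z \<prec> q \<or> q \<in> mids w z"
proof -
  have F: "z \<in> Field r" "q \<in> Field r" and c: "col z = col w"
    using assms le_Field unfolding consecutive_def by auto
  have "\<not> (q \<prec> z \<and> col q = col w)" using assms unfolding consecutive_def by blast
  then show "z \<preceq> q" if "col q = col w"
    using same_comparable[OF F] that c by auto
  show "z \<prec> q \<or> q \<in> mids w z" if "adj (col q) (col w)"
    using adj_comparable[OF F(2,1)] that assms c unfolding mids_def by auto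
qed

lemma consecutive_below_cases:
  assumes "consecutive w z" "q \<prec> z"
  shows "col q = col w \<Longrightarrow> q \<preceq> w" "adj (col q) (col w) \<Longrightarrow> q \<prec> w \<or> q \<in> mids w z"
proof -
  have F: "w \<in> Field r" "q \<in> Field r" and c: "col z = col w"
    using assms le_Field unfolding consecutive_def by auto
  have "\<not> (w \<prec> q \<and> col q = col w)" using assms unfolding consecutive_def by blast
  then show "q \<preceq> w" if "col q = col w"
    using same_comparable[OF F] that by auto
  show "q \<prec> w \<or> q \<in> mids w z" if "adj (col q) (col w)"
    using adj_comparable[OF F(2,1)] that assms c unfolding mids_def by auto
qed

definition above_sum :: "'a \<Rightarrow> int" where
  "above_sum p = (\<Sum>q \<in> {q. p \<prec> q}. cart (col q) (col p))"

text \<open>Going down from \<open>z\<close> to \<open>w\<close> adds \<open>z\<close> itself,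
  contributing 2, and the two adjacent elements in between, contributing -1 each.\<close>

lemma above_sum_consecutive:
  assumes "consecutive w z"
  shows "above_sum w = above_sum z"
proof -
  have wz: "w \<prec> z" and c: "col z = col w" using assms unfolding consecutive_def by auto
  have up: "w \<prec> q" if "z \<prec> q" for q using wz that lt_le_trans[of w z q] by blast
  have 1: "{q \<in> {q. w \<prec> q}. col q = col w} = insert z {q \<in> {q. z \<prec> q}. col q = col w}"
  proof (rule Set.set_eqI)
    fix q
    show "q \<in> {q \<in> {q. w \<prec> q}. col q = col w} \<longleftrightarrow> q \<in> insert z {q \<in> {q. z \<prec> q}. col q = col w}"
    proof (cases "q = z")
      case True
      then show ?thesis using wz c by simp
    next
      case False
      then show ?thesis using consecutive_above_cases(1)[OF assms, of q] up[of q] by blast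
    qed
  qed
  have 2: "{q \<in> {q. w \<prec> q}. adj (col q) (col w)} = mids w z \<union> {q \<in> {q. z \<prec> q}. adj (col q) (col w)}"
    using consecutive_above_cases(2)[OF assms] up unfolding mids_def by blast
  have fin: "finite {q \<in> {q. z \<prec> q}. Q q}" for Q using finite_above[of z Q] by simp
  have fm: "finite (mids w z)" using card_mids[OF assms] by (metis card.infinite zero_neq_numeral)
  have disj: "mids w z \<inter> {q \<in> {q. z \<prec> q}. adj (col q) (col w)} = {}"
    using le_antisym unfolding mids_def by blast
  show ?thesis
    unfolding above_sum_def c using finite_above[of _ "\<lambda>_. True"]
    by (simp add: sum_cart 1[simplified] 2[simplified] card_insert_if fin[simplified]
        card_Un_disjoint[OF fm fin disj, simplified] card_mids[OF assms])
qed

lemma above_sum_same_color: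
  assumes "p \<in> Field r" "q \<in> Field r" "col p = col q"
  shows "above_sum p = above_sum q"
proof -
  have *: "p \<prec> q \<Longrightarrow> col p = col q \<Longrightarrow> above_sum p = above_sum q" for p q
  proof (induction p rule: up_induct)
    case (greater p)
    obtain z where z: "consecutive p z" "z \<preceq> q" using ex_consecutive_above greater.prems by blast
    then have "p \<prec> z" "col p = col z" unfolding consecutive_def by auto
    then show ?case
      using above_sum_consecutive[OF z(1)] greater.IH[of z] z(2) greater.prems by metis
  qed
  show ?thesis using same_comparable[OF assms] *[of p q] *[of q p] assms(3) by metis
qed

text \<open>The highest weight. It is normalized so that an element, once everything above it is in
  the filter, meets the weight 1 (\<open>wt_addable\<close>). The choice of \<open>p\<close> is
  irrelevant by \<open>above_sum_same_color\<close>; at colors that do not occur the value is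
  arbitrary.\<close>

definition lam :: "'c \<Rightarrow> int" where
  "lam j = 1 + above_sum (SOME p. p \<in> Field r \<and> col p = j)"

lemma lam_eq:
  assumes "p \<in> Field r"
  shows "lam (col p) = 1 + above_sum p"
proof -
  let ?q = "SOME q. q \<in> Field r \<and> col q = col p"
  have "?q \<in> Field r \<and> col ?q = col p" by (rule someI[of _ p]) (simp add: assms)
  then have "above_sum ?q = above_sum p" using above_sum_same_color assms by blast
  then show ?thesis unfolding lam_def by simp
qed

lemma ex_topmost:
  assumes "p \<in> Field r"
  shows "\<exists>t. p \<preceq> t \<and> col t = col p \<and> (\<forall>q. t \<prec> q \<longrightarrow> col q \<noteq> col p)"
  using assms
proof (induction p rule: up_induct)
  case (greater p)
  show ?case
  proof (cases "\<exists>q. p \<prec> q \<and> col q = col p")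
    case True
    then obtain q where q: "p \<prec> q" "col q = col p" by blast
    then obtain t where "q \<preceq> t" "col t = col q" "\<forall>u. t \<prec> u \<longrightarrow> col u \<noteq> col q"
      using greater.IH[of q] le_Field by blast
    then show ?thesis using q le_trans[of p q t] by (intro exI[of _ t]) auto
  next
    case False
    then show ?thesis using greater.prems le_refl by blast
  qed
qed

text \<open>Dominance of the highest weight: at the topmost element of a color, the only negative
  contribution comes from at most one adjacent element above.\<close>

lemma lam_nonneg:
  assumes "p \<in> Field r"
  shows "lam (col p) \<ge> 0"
proof -
  obtain t where t: "p \<preceq> t" "col t = col p" "\<And>q. t \<prec> q \<Longrightarrow> col q \<noteq> col p" using ex_topmost[OF assms] by blast
  have tF: "t \<in> Field r" using t(1) le_Field by blast
  have "{q \<in> {q. t \<prec> q}. col q = col t} = {}" using t by auto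
  moreover have "card {q. t \<prec> q \<and> adj (col q) (col t)} \<le> 1"
    using topmost_adj[OF tF] t by auto
  ultimately have "above_sum t \<ge> -1"
    unfolding above_sum_def using finite_above[of t "\<lambda>_. True"] by (simp add: sum_cart)
  then show ?thesis using lam_eq[OF tF] t(2) by simp
qed


subsection \<open>Filters and weights\<close>

definition filt :: "'a set \<Rightarrow> bool" where
  "filt U \<longleftrightarrow> U \<subseteq> Field r \<and> (\<forall>x \<in> U. \<forall>y. x \<preceq> y \<longrightarrow> y \<in> U)"

definition addable :: "'a set \<Rightarrow> 'a \<Rightarrow> bool" where
  "addable U p \<longleftrightarrow> p \<in> Field r \<and> p \<notin> U \<and> (\<forall>q. p \<prec> q \<longrightarrow> q \<in> U)"

definition removable :: "'a set \<Rightarrow> 'a \<Rightarrow> bool" where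
  "removable U p \<longleftrightarrow> p \<in> U \<and> (\<forall>q \<in> U. q \<preceq> p \<longrightarrow> q = p)"

text \<open>The topmost element of its color outside \<open>U\<close>, hence the only candidate of
  that color for extending \<open>U\<close>.\<close>

definition first_out :: "'a set \<Rightarrow> 'a \<Rightarrow> bool" where
  "first_out U w \<longleftrightarrow> w \<in> Field r \<and> w \<notin> U \<and> (\<forall>q. w \<prec> q \<longrightarrow> col q = col w \<longrightarrow> q \<in> U)"

text \<open>The pairing of the weight reached by the filter \<open>U\<close> with the simple coroot of color \<open>j\<close>.\<close>

definition wt :: "'c \<Rightarrow> 'a set \<Rightarrow> int" where
  "wt j U = lam j - (\<Sum>q \<in> U. cart (col q) j)"

lemma filtD: "filt U \<Longrightarrow> x \<in> U \<Longrightarrow> x \<preceq> y \<Longrightarrow> y \<in> U" "filt U \<Longrightarrow> U \<subseteq> Field r"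
  unfolding filt_def by blast+

lemma filt_finite: "filt U \<Longrightarrow> finite U"
  using finite_Field finite_subset filtD(2) by blast

lemma filt_insert: "filt U \<Longrightarrow> addable U p \<Longrightarrow> filt (insert p U)"
  unfolding filt_def addable_def by auto

lemma filt_remove: "filt U \<Longrightarrow> removable U p \<Longrightarrow> filt (U - {p})"
  unfolding filt_def removable_def by blast

lemma addable_remove: "filt U \<Longrightarrow> removable U p \<Longrightarrow> addable (U - {p}) p"
  unfolding filt_def removable_def addable_def by blast

lemma addable_first_out: "addable U p \<Longrightarrow> first_out U p"
  unfolding addable_def first_out_def by blast

lemma ex_removable:
  assumes "filt U" "U \<noteq> {}"
  shows "\<exists>p. removable U p"
proof -
  have "x \<in> U \<Longrightarrow> \<exists>p. removable U p" for x
  proof (induction x rule: down_induct)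
    case (less x)
    then show ?case unfolding removable_def by blast
  qed
  then show ?thesis using assms(2) by blast
qed

lemma ex_addable:
  assumes "filt U" "U \<noteq> Field r"
  shows "\<exists>p. addable U p"
proof -
  have "x \<in> Field r \<Longrightarrow> x \<notin> U \<Longrightarrow> \<exists>p. addable U p" for x
  proof (induction x rule: up_induct)
    case (greater x)
    then show ?case using le_Field unfolding addable_def by blast
  qed
  then show ?thesis using assms filtD(2) by blast
qed

lemma ex_first_out:
  assumes "p \<in> Field r" "p \<notin> U"
  shows "\<exists>w. p \<preceq> w \<and> col w = col p \<and> first_out U w"
  using assms
proof (induction p rule: up_induct)
  case (greater p)
  show ?case
  proof (cases "\<exists>q. p \<prec> q \<and> col q = col p \<and> q \<notin> U")
    case True
    then obtain q where q: "p \<prec> q" "col q = col p" "q \<notin> U" by blast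
    then obtain w where "q \<preceq> w" "col w = col q" "first_out U w"
      using greater.IH[of q] le_Field by blast
    then show ?thesis using q le_trans[of p q w] by (intro exI[of _ w]) auto
  next
    case False
    then have "first_out U p" using greater.prems unfolding first_out_def by blast
    then show ?thesis using greater.prems le_refl by blast
  qed
qed

lemma first_out_unique: "first_out U w \<Longrightarrow> first_out U w' \<Longrightarrow> col w = col w' \<Longrightarrow> w = w'"
  using same_comparable unfolding first_out_def by metis

lemma filt_above:
  assumes "filt U" "w \<in> Field r" "w \<notin> U" "q \<in> U" "col q = col w \<or> adj (col q) (col w)"
  shows "w \<prec> q"
proof -
  have "q \<in> Field r" using assms filtD by blast
  then have "q \<preceq> w \<or> w \<preceq> q" using assms(2,5) same_comparable adj_comparable by blast
  then show ?thesis using filtD(1)[OF assms(1,4)] assms(3,4) by blast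
qed

text \<open>\<open>lam\<close> may be evaluated at \<open>w\<close> itself. Of the elements above
  \<open>w\<close>, those of its color are all in \<open>U\<close>, so only the adjacent ones still
  missing from \<open>U\<close> distinguish the two sums.\<close>

lemma wt_first_out:
  assumes U: "filt U" and w: "first_out U w"
  shows "wt (col w) U = 1 - int (card {q. w \<prec> q \<and> q \<notin> U \<and> adj (col q) (col w)})"
proof -
  have wF: "w \<in> Field r" "w \<notin> U" and wq: "\<And>q. w \<prec> q \<Longrightarrow> col q = col w \<Longrightarrow> q \<in> U"
    using w unfolding first_out_def by blast+
  have 1: "{q. w \<prec> q \<and> col q = col w} = {q \<in> U. col q = col w}"
    using filt_above[OF U wF] wq by blast
  have 2: "{q. w \<prec> q \<and> adj (col q) (col w)} =
      {q \<in> U. adj (col q) (col w)} \<union> {q. w \<prec> q \<and> q \<notin> U \<and> adj (col q) (col w)}"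
    using filt_above[OF U wF] by blast
  have "card {q. w \<prec> q \<and> adj (col q) (col w)} =
      card {q \<in> U. adj (col q) (col w)} + card {q. w \<prec> q \<and> q \<notin> U \<and> adj (col q) (col w)}"
    unfolding 2 by (rule card_Un_disjoint) (use filt_finite[OF U] finite_above in auto)
  moreover have "card {q. w \<prec> q \<and> col q = col w} = card {q \<in> U. col q = col w}" using 1 by simp
  ultimately show ?thesis
    unfolding wt_def lam_eq[OF wF(1)] above_sum_def
    using finite_above[of w "\<lambda>_. True"] filt_finite[OF U] by (simp add: sum_cart)
qed

text \<open>By \<open>wt_first_out\<close> the weight counts the missing neighbors above
  \<open>w\<close>. There are at most two: at most one if \<open>w\<close> is topmost in its color,
  otherwise the missing part of \<open>mids w z\<close>. None missing means that \<open>w\<close>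
  can be added, both missing that \<open>z\<close> can be removed.\<close>

lemma wt_cases:
  assumes U: "filt U" and w: "first_out U w"
  shows "(wt (col w) U = 1 \<and> addable U w \<and> (\<forall>z. removable U z \<longrightarrow> col z \<noteq> col w)) \<or>
    (wt (col w) U = 0 \<and> \<not> addable U w \<and> (\<forall>z. removable U z \<longrightarrow> col z \<noteq> col w)) \<or>
    (wt (col w) U = -1 \<and> \<not> addable U w \<and> (\<exists>z. removable U z \<and> consecutive w z \<and> mids w z \<inter> U = {}))"
proof -
  define A where "A = {q. w \<prec> q \<and> q \<notin> U \<and> adj (col q) (col w)}"
  have finA: "finite A" unfolding A_def using finite_above by auto
  have wt: "wt (col w) U = 1 - int (card A)" using wt_first_out[OF U w] unfolding A_def .
  have wF: "w \<in> Field r" "w \<notin> U" and wq: "\<And>q. w \<prec> q \<Longrightarrow> col q = col w \<Longrightarrow> q \<in> U"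
    using w unfolding first_out_def by blast+
  have add: "addable U w \<longleftrightarrow> A = {}"
  proof
    show "addable U w \<Longrightarrow> A = {}" unfolding addable_def A_def by blast
    assume A: "A = {}"
    have "q \<in> U" if wq: "w \<prec> q" for q
    proof -
      obtain v where "w \<prec>\<cdot> v" "v \<preceq> q" using ex_cover_above wq by blast
      then show ?thesis using A cv_lt[of w v] cover_adj[of w v] adj_sym filtD(1)[OF U] unfolding A_def by blast
    qed
    then show "addable U w" unfolding addable_def using wF by blast
  qed
  show ?thesis
  proof (cases "\<exists>q. w \<prec> q \<and> col q = col w")
    case False
    then have top: "\<And>q. w \<prec> q \<Longrightarrow> col q \<noteq> col w" by blast
    have "A \<subseteq> {q. w \<prec> q \<and> adj (col q) (col w)}" unfolding A_def by blast
    then have "card A \<le> card {q. w \<prec> q \<and> adj (col q) (col w)}" by (rule card_mono[OF finite_above])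
    then have "card A \<le> 1" using topmost_adj[OF wF(1) top] by linarith
    moreover have "\<forall>z. removable U z \<longrightarrow> col z \<noteq> col w"
      using filt_above[OF U wF] top unfolding removable_def by blast
    moreover have "card A = 0 \<longleftrightarrow> A = {}" using finA by simp
    ultimately show ?thesis unfolding add wt by (cases "card A") auto
  next
    case True
    then obtain z where z: "consecutive w z" using ex_consecutive_above by metis
    then have wz: "w \<prec> z" "col z = col w" unfolding consecutive_def by auto
    have zU: "z \<in> U" using wq wz by blast
    have zr: "z' = z" if "removable U z'" "col z' = col w" for z'
    proof -
      have "w \<prec> z'" using filt_above[OF U wF] that unfolding removable_def by blast
      then have "z \<preceq> z'" using consecutive_above_cases(1)[OF z] that by blast
      then show ?thesis using that(1) zU unfolding removable_def by blast
    qed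
    have A: "A = mids w z - U"
    proof
      show "A \<subseteq> mids w z - U"
        using consecutive_above_cases(2)[OF z] filtD(1)[OF U zU] unfolding A_def by blast
      show "mids w z - U \<subseteq> A" unfolding A_def mids_def by blast
    qed
    have rem: "removable U z \<longleftrightarrow> mids w z \<inter> U = {}"
    proof
      show "removable U z \<Longrightarrow> mids w z \<inter> U = {}" unfolding removable_def mids_def by blast
      assume m: "mids w z \<inter> U = {}"
      have "q = z" if qz: "q \<in> U" "q \<preceq> z" for q
      proof (rule ccontr)
        assume "q \<noteq> z"
        then obtain v where v: "q \<preceq> v" "v \<prec>\<cdot> z" using ex_cover_below qz by blast
        then have "v \<in> U" "v \<prec> z" "adj (col v) (col w)"
          using filtD(1)[OF U qz(1)] cv_lt[OF v(2)] cover_adj[OF v(2)] wz(2) by auto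
        moreover have "w \<prec> v" using filt_above[OF U wF] calculation by blast
        ultimately show False using m unfolding mids_def by blast
      qed
      then show "removable U z" unfolding removable_def using zU by blast
    qed
    obtain a b where ab: "a \<noteq> b" "mids w z = {a, b}" using mids_pair[OF z] by metis
    consider "a \<in> U" "b \<in> U" | "a \<in> U" "b \<notin> U" | "a \<notin> U" "b \<in> U" | "a \<notin> U" "b \<notin> U" by blast
    then show ?thesis
    proof cases
      case 1
      then have "A = {}" "\<not> removable U z" using A rem ab by auto
      then show ?thesis using add zr wt by auto
    next
      case 2
      then have "A = {b}" "\<not> removable U z" using A rem ab by auto
      then show ?thesis using add zr wt by auto
    next
      case 3
      then have "A = {a}" "\<not> removable U z" using A rem ab by auto
      then show ?thesis using add zr wt by auto
    next
      case 4
      then have "A = {a, b}" "removable U z" "mids w z \<inter> U = {}" using A rem ab by auto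
      then show ?thesis using add z wt ab(1) by auto
    qed
  qed
qed

lemma wt_addable: "filt U \<Longrightarrow> addable U p \<Longrightarrow> wt (col p) U = 1"
  using wt_cases addable_first_out by blast

lemma wt_insert:
  assumes "filt U" "addable U p"
  shows "wt j (insert p U) = wt j U - cart (col p) j"
  using assms filt_finite unfolding wt_def addable_def by simp

lemma wt_diff:
  assumes "filt U" "filt W" "U \<subseteq> W"
  shows "(\<Sum>q \<in> W - U. cart (col q) j) = wt j U - wt j W"
  unfolding wt_def using sum_diff[OF filt_finite[OF assms(2)] assms(3), of "\<lambda>q. cart (col q) j"] by simp


subsection \<open>Heights of the roots\<close>

text \<open>Every element \<open>p\<close> corresponds to an inversion of the Weyl group element of the heap; \<open>height p\<close>
  is the height of the associated positive root.\<close>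

function height :: "'a \<Rightarrow> int" where
  "height p = 1 - (\<Sum>q \<in> {q. q \<prec> p}. cart (col q) (col p) * height q)"
  by auto
termination
  by (relation "Wellfounded.measure (\<lambda>p. card {t. t \<preceq> p})") (auto simp: card_down_less)

declare height.simps [simp del]

text \<open>The defining sums of the two heights differ by the term of \<open>w\<close>, with
  coefficient 2, and those of the two elements in between, with coefficient -1. This is the source
  of the hook length recursion.\<close>

lemma height_consecutive:
  assumes "consecutive w z"
  shows "height z + height w = (\<Sum>q \<in> mids w z. height q)"
proof -
  have wz: "w \<prec> z" and c: "col z = col w" using assms unfolding consecutive_def by auto
  define f where "f q = cart (col q) (col w) * height q" for q
  have fm: "finite (mids w z)" using card_mids[OF assms] by (metis card.infinite zero_neq_numeral)
  have sub: "insert w (mids w z \<union> {q. q \<prec> w}) \<subseteq> {q. q \<prec> z}"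
    using wz le_lt_trans unfolding mids_def by blast
  have "(\<Sum>q \<in> {q. q \<prec> z}. f q) = (\<Sum>q \<in> insert w (mids w z \<union> {q. q \<prec> w}). f q)"
  proof (rule sum.mono_neutral_right[OF _ sub])
    show "finite {q. q \<prec> z}" using finite_below[of z "\<lambda>_. True"] by simp
    show "\<forall>q \<in> {q. q \<prec> z} - insert w (mids w z \<union> {q. q \<prec> w}). f q = 0"
      using consecutive_below_cases[OF assms] unfolding f_def cart_def by auto
  qed
  also have "\<dots> = f w + ((\<Sum>q \<in> mids w z. f q) + (\<Sum>q \<in> {q. q \<prec> w}. f q))"
  proof -
    have "finite {q. q \<prec> w}" using finite_below[of w "\<lambda>_. True"] by simp
    moreover have "w \<notin> mids w z \<union> {q. q \<prec> w}" unfolding mids_def by blast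
    moreover have "mids w z \<inter> {q. q \<prec> w} = {}" using le_antisym unfolding mids_def by blast
    ultimately show ?thesis using fm by (simp add: sum.union_disjoint)
  qed
  also have "(\<Sum>q \<in> mids w z. f q) = - (\<Sum>q \<in> mids w z. height q)"
    unfolding f_def mids_def using adj_irrefl
    by (subst sum_negf[symmetric], intro sum.cong) (auto simp: cart_def)
  finally show ?thesis
    using height.simps[of z] height.simps[of w] unfolding c f_def by simp
qed

text \<open>Let \<open>mu\<close> be the weight of \<open>V\<close> and \<open>x\<close> the product
  of the reflections of the remaining elements. Then \<open>mu - x mu\<close> is the sum of their
  simple roots, whose height is their number. It also telescopes into the roots of these elements
  with the pairings of \<open>mu\<close> as coefficients.\<close>

lemma card_complement_eq_sum:
  assumes "filt V"
  shows "int (card (Field r - V)) = (\<Sum>q \<in> Field r - V. wt (col q) V * height q)"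
  using assms
proof (induction "card (Field r - V)" arbitrary: V)
  case 0
  then have "Field r - V = {}" using finite_Field by simp
  then show ?case by (simp only: card.empty sum.empty of_nat_0)
next
  case (Suc n)
  have "V \<noteq> Field r" using Suc.hyps(2) by auto
  then obtain p where p: "addable V p" using ex_addable Suc.prems by blast
  have pF: "p \<in> Field r" "p \<notin> V" and pq: "\<And>q. p \<prec> q \<Longrightarrow> q \<in> V" using p unfolding addable_def by blast+
  let ?I = "Field r - V" and ?J = "Field r - insert p V"
  have IJ: "?I = insert p ?J" "p \<notin> ?J" "finite ?J" using pF finite_Field by auto
  have cI: "card ?I = Suc (card ?J)" unfolding IJ(1) by (rule card_insert_disjoint[OF IJ(3,2)])
  then have cJ: "n = card ?J" using Suc.hyps(2) by linarith
  have IH: "int (card ?J) = (\<Sum>q \<in> ?J. wt (col q) (insert p V) * height q)"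
    using Suc.hyps(1)[OF cJ] filt_insert[OF Suc.prems p] by blast
  have "(\<Sum>q \<in> ?J. cart (col p) (col q) * height q) = (\<Sum>q \<in> {q. q \<prec> p}. cart (col q) (col p) * height q)"
  proof (rule sum.mono_neutral_cong_right)
    show "{q. q \<prec> p} \<subseteq> ?J" using filtD(1)[OF Suc.prems] pF le_Field by blast
    show "\<forall>q \<in> ?J - {q. q \<prec> p}. cart (col p) (col q) * height q = 0"
      using cart_nonzeroD[of p] pF pq by auto
  qed (use IJ(3) cart_sym[of "col p"] in simp_all)
  then have "height p + (\<Sum>q \<in> ?J. cart (col p) (col q) * height q) = 1"
    using height.simps[of p] by simp
  moreover have "(\<Sum>q \<in> ?J. wt (col q) V * height q) =
      (\<Sum>q \<in> ?J. wt (col q) (insert p V) * height q) + (\<Sum>q \<in> ?J. cart (col p) (col q) * height q)"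
    unfolding wt_insert[OF Suc.prems p] by (simp add: sum.distrib[symmetric] algebra_simps)
  moreover have "(\<Sum>q \<in> ?I. wt (col q) V * height q) = wt (col p) V * height p + (\<Sum>q \<in> ?J. wt (col q) V * height q)"
    unfolding IJ(1) by (rule sum.insert[OF IJ(3,2)])
  moreover have "wt (col p) V * height p = height p" using wt_addable[OF Suc.prems p] by simp
  ultimately show ?case using IH cI by linarith
qed

lemma ex_addable_in:
  assumes "filt U" "filt V" "U \<subseteq> V" "U \<noteq> V"
  shows "\<exists>p \<in> V. addable U p"
proof -
  have "x \<in> V \<Longrightarrow> x \<notin> U \<Longrightarrow> \<exists>p \<in> V. addable U p" for x
  proof (induction x rule: up_induct)
    case (greater x)
    then show ?case using filtD(1)[OF assms(2)] filtD(2)[OF assms(2)] unfolding addable_def by blast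
  qed
  then show ?thesis using assms(3,4) by blast
qed

section \<open>Elements that are lowest in their color\<close>

definition not_below :: "'a \<Rightarrow> 'a set" where
  "not_below p = {t \<in> Field r. \<not> t \<preceq> p}"

lemma filt_not_below: "filt (not_below p)"
  unfolding filt_def not_below_def using le_trans[of _ _ p] le_Field(2) by blast

lemma first_out_not_below:
  assumes "q \<preceq> p"
  obtains w where "q \<preceq> w" "col w = col q" "first_out (not_below p) w" "w \<preceq> p"
proof -
  have "q \<in> Field r" "q \<notin> not_below p" using assms le_Field unfolding not_below_def by blast+
  then obtain w where w: "q \<preceq> w" "col w = col q" "first_out (not_below p) w"
    using ex_first_out by blast
  then have "w \<preceq> p" unfolding first_out_def not_below_def by blast
  then show ?thesis using that w by blast
qed

lemma addable_not_below: "p \<in> Field r \<Longrightarrow> addable (not_below p) p"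
  unfolding addable_def not_below_def using le_refl[of p] le_antisym[of p] le_Field(2)[of p] by blast

lemma not_addable_not_below: "w \<prec> p \<Longrightarrow> \<not> addable (not_below p) w"
  unfolding addable_def not_below_def using le_refl[of p] le_Field(2)[of w p] by blast

text \<open>Between consecutive elements of the color of \<open>q\<close> there are two adjacent
  ones, and the lowest of them still has a lower cover at or above \<open>w\<close>, which accounts
  for one more.\<close>

lemma two_card_color_le:
  assumes "q \<preceq> p" "w \<prec> q" "col q \<noteq> col w"
  shows "2 * card {t. w \<preceq> t \<and> t \<preceq> q \<and> col t = col q} \<le> 1 + card {t. w \<preceq> t \<and> t \<prec> q \<and> adj (col t) (col q)}"
  using assms
proof (induction q rule: down_induct)
  case (less q)
  have fin: "finite {t. w \<preceq> t \<and> Q t}" for Q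
    by (rule finite_subset[OF _ finite_up[of w]]) blast
  show ?case
  proof (cases "\<exists>t. w \<preceq> t \<and> t \<prec> q \<and> col t = col q")
    case False
    then have "{t. w \<preceq> t \<and> t \<preceq> q \<and> col t = col q} = {q}"
      using less.prems le_refl[of q] le_Field(2)[of w q] by blast
    moreover obtain v where v: "w \<preceq> v" "v \<prec>\<cdot> q" using ex_cover_below less.prems by blast
    then have "v \<in> {t. w \<preceq> t \<and> t \<prec> q \<and> adj (col t) (col q)}"
      using cv_lt[OF v(2)] cover_adj[OF v(2)] by blast
    then have "0 < card {t. w \<preceq> t \<and> t \<prec> q \<and> adj (col t) (col q)}"
      using fin[of "\<lambda>t. t \<prec> q \<and> adj (col t) (col q)"] unfolding card_gt_0_iff by blast
    ultimately show ?thesis by simp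
  next
    case True
    then obtain t where t: "w \<preceq> t" "t \<prec> q" "col t = col q" by blast
    then obtain u where u: "consecutive u q" "t \<preceq> u" using ex_consecutive_below by blast
    have uq: "u \<prec> q" "col u = col q" using u(1) unfolding consecutive_def by auto
    have wu: "w \<preceq> u" using t(1) u(2) le_trans[of w t u] by blast
    have wu': "w \<prec> u" using wu uq less.prems(3) by auto
    have up: "u \<preceq> p" using uq less.prems(1) le_trans[of u q p] by blast
    have IH: "2 * card {t. w \<preceq> t \<and> t \<preceq> u \<and> col t = col q} \<le> 1 + card {t. w \<preceq> t \<and> t \<prec> u \<and> adj (col t) (col q)}"
      using less.IH[OF uq(1) up wu'] uq(2) less.prems(3) by simp
    have e1: "{t. w \<preceq> t \<and> t \<preceq> q \<and> col t = col q} = insert q {t. w \<preceq> t \<and> t \<preceq> u \<and> col t = col q}"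
    proof (rule Set.set_eqI)
      fix t
      show "t \<in> {t. w \<preceq> t \<and> t \<preceq> q \<and> col t = col q} \<longleftrightarrow> t \<in> insert q {t. w \<preceq> t \<and> t \<preceq> u \<and> col t = col q}"
      proof (cases "t = q")
        case True
        then show ?thesis using less.prems le_refl[of q] le_Field(2)[of w q] by blast
      next
        case False
        then show ?thesis
          using consecutive_below_cases(1)[OF u(1), of t, unfolded uq(2)] uq(1) le_trans[of t u q] by blast
      qed
    qed
    have qn: "q \<notin> {t. w \<preceq> t \<and> t \<preceq> u \<and> col t = col q}" using uq le_antisym by blast
    have sub: "mids u q \<union> {t. w \<preceq> t \<and> t \<prec> u \<and> adj (col t) (col q)} \<subseteq> {t. w \<preceq> t \<and> t \<prec> q \<and> adj (col t) (col q)}"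
    proof -
      have "w \<preceq> t" if "u \<prec> t" for t using wu that le_trans[of w u t] by blast
      moreover have "t \<prec> q" if "t \<prec> u" for t using uq that lt_le_trans[of t u q] by blast
      ultimately show ?thesis unfolding mids_def uq(2) by blast
    qed
    have disj: "mids u q \<inter> {t. w \<preceq> t \<and> t \<prec> u \<and> adj (col t) (col q)} = {}"
      unfolding mids_def using le_antisym[of u] by blast
    have fm: "finite (mids u q)" using card_mids[OF u(1)] by (metis card.infinite zero_neq_numeral)
    have "2 + card {t. w \<preceq> t \<and> t \<prec> u \<and> adj (col t) (col q)} =
        card (mids u q \<union> {t. w \<preceq> t \<and> t \<prec> u \<and> adj (col t) (col q)})"
      using card_Un_disjoint[OF fm fin disj] card_mids[OF u(1)] by simp
    also have "\<dots> \<le> card {t. w \<preceq> t \<and> t \<prec> q \<and> adj (col t) (col q)}"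
      by (rule card_mono[OF fin sub])
    finally show ?thesis
      using IH card_insert_disjoint[OF fin qn] unfolding e1 by simp
  qed
qed

text \<open>The sum of the simple roots along the interval from \<open>w\<close> to \<open>p\<close> would be a null root. Its pairing
  with the weights cannot decrease along filters, starts nonnegative and ends nonpositive, so all
  weights up to \<open>p\<close> vanish on its support, although \<open>p\<close> itself is addable.\<close>

lemma no_null_root:
  assumes wp: "w \<prec> p" and wz: "consecutive w z" "\<not> z \<preceq> p" and mids: "mids w z \<subseteq> {q. q \<preceq> p}"
    and p: "\<And>t. w \<preceq> t \<Longrightarrow> t \<prec> p \<Longrightarrow> col t \<noteq> col p"
    and B: "2 \<le> card {q. w \<preceq> q \<and> q \<preceq> p \<and> adj (col q) (col p)}"
  shows False
proof -
  define J where "J = {q. w \<preceq> q \<and> q \<preceq> p}"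
  define V where "V = not_below p"
  have V: "filt V" unfolding V_def by (rule filt_not_below)
  have F: "w \<in> Field r" "p \<in> Field r" using wp le_Field by blast+
  have wJ: "w \<in> J" and pJ: "p \<in> J" using wp le_refl F unfolding J_def by auto
  have finJ: "finite J" unfolding J_def by (rule finite_subset[OF _ finite_up[of w]]) blast
  have JF: "q \<in> Field r" if "q \<in> J" for q using that le_Field unfolding J_def by blast
  have mJ: "mids w z \<subseteq> J" using mids unfolding J_def mids_def by blast
  have Jp: "{q \<in> J. col q = col p} = {p}" using p pJ unfolding J_def by blast
  have Jw: "{q \<in> J. col q = col w} = {w}"
  proof -
    have "q = w" if q: "q \<in> J" "col q = col w" for q
    proof (rule ccontr)
      assume "q \<noteq> w"
      then have "z \<preceq> q" using consecutive_above_cases(1)[OF wz(1), of q] q unfolding J_def by blast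
      then show False using wz(2) q(1) le_trans[of z q p] unfolding J_def by blast
    qed
    then show ?thesis using wJ by blast
  qed
  \<comment> \<open>The sum of the simple roots along \<open>J\<close> pairs nonpositively with
    every simple coroot. The colors of \<open>p\<close> and \<open>w\<close> occur once and have two
    neighbors, by \<open>B\<close> and by \<open>mids\<close>. For any other color,
    \<open>two_card_color_le\<close> is one short, and a cover of its highest occurrence in
    \<open>J\<close> supplies the missing neighbor.\<close>
  have Delta: "(\<Sum>q \<in> J. cart (col q) k) \<le> 0" for k
  proof -
    consider "k \<notin> col ` J" | "k = col p" | "k = col w" | "k \<in> col ` J" "k \<noteq> col p" "k \<noteq> col w" by blast
    then have "2 * card {q \<in> J. col q = k} \<le> card {q \<in> J. adj (col q) k}"
    proof cases
      case 1
      then have "{q \<in> J. col q = k} = {}" by blast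
      then show ?thesis by (simp only: card.empty mult_0_right le0)
    next
      case 2
      then show ?thesis using Jp B by (simp add: J_def conj_assoc)
    next
      case 3
      have "card (mids w z) \<le> card {q \<in> J. adj (col q) k}"
        by (rule card_mono) (use finJ mJ 3 in \<open>auto simp: mids_def\<close>)
      then show ?thesis using 3 Jw card_mids[OF wz(1)] by simp
    next
      case 4
      then obtain q0 where q0: "q0 \<in> J" "col q0 = k" by blast
      then have "q0 \<preceq> p" unfolding J_def by blast
      then obtain q where q: "q0 \<preceq> q" "col q = col q0" "first_out V q" "q \<preceq> p"
        unfolding V_def by (rule first_out_not_below)
      have qk: "col q = k" using q q0 by simp
      have qJ: "q \<in> J" using q0(1) q(1,4) le_trans[of w q0 q] unfolding J_def by blast
      have qp: "q \<prec> p" "w \<prec> q" using qJ qk 4 unfolding J_def by auto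
      obtain v where v: "q \<prec>\<cdot> v" "v \<preceq> p" using ex_cover_above[OF qp(1)] by blast
      have qv: "q \<prec> v" using cv_lt[OF v(1)] .
      have vJ: "v \<in> J" using v(2) qv qp le_trans[of w q v] unfolding J_def by blast
      have sub: "insert v {t. w \<preceq> t \<and> t \<prec> q \<and> adj (col t) (col q)} \<subseteq> {t \<in> J. adj (col t) k}"
      proof -
        have "t \<in> J" if "w \<preceq> t" "t \<prec> q" for t using that q(4) le_trans[of t q p] unfolding J_def by blast
        then show ?thesis using vJ cover_adj[OF v(1)] adj_sym qk by blast
      qed
      have vn: "v \<notin> {t. w \<preceq> t \<and> t \<prec> q \<and> adj (col t) (col q)}" using qv le_antisym[of v q] by blast
      have fin: "finite {t. w \<preceq> t \<and> t \<prec> q \<and> adj (col t) (col q)}"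
        by (rule finite_subset[OF _ finite_up[of w]]) blast
      have "Suc (card {t. w \<preceq> t \<and> t \<prec> q \<and> adj (col t) (col q)}) \<le> card {t \<in> J. adj (col t) k}"
        using card_mono[OF _ sub] finJ card_insert_disjoint[OF fin vn] by simp
      moreover have "{t \<in> J. col t = k} = {t. w \<preceq> t \<and> t \<preceq> q \<and> col t = col q}"
      proof -
        have "t \<preceq> q" if t: "t \<in> J" "col t = k" for t
        proof (rule ccontr)
          assume "\<not> t \<preceq> q"
          then have "q \<preceq> t" "q \<noteq> t"
            using same_comparable[OF JF[OF t(1)] JF[OF qJ]] t(2) qk le_refl[OF JF[OF qJ]] by metis+
          then have "q \<prec> t" by blast
          moreover have "col t = col q" using t(2) qk by simp
          ultimately have "t \<in> V" using q(3) unfolding first_out_def by blast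
          then show False using t(1) unfolding V_def not_below_def J_def by blast
        qed
        moreover have "t \<in> J" if "w \<preceq> t" "t \<preceq> q" for t using that q(4) le_trans[of t q p] unfolding J_def by blast
        moreover have "w \<preceq> t" if "t \<in> J" for t using that unfolding J_def by blast
        ultimately show ?thesis unfolding qk by (intro Collect_cong) blast
      qed
      ultimately show ?thesis
        using two_card_color_le[OF q(4) qp(2)] qk 4(3) by simp
    qed
    then show ?thesis unfolding sum_cart[OF finJ] by linarith
  qed
  \<comment> \<open>Pairing of the weight of \<open>U\<close> with the sum of the coroots along
    \<open>J\<close>. As \<open>cart\<close> is symmetric, \<open>Delta\<close> controls its change
    when \<open>U\<close> grows.\<close>
  define N where "N U = (\<Sum>q \<in> J. wt (col q) U)" for U
  have N_insert: "N (insert q U) = N U - (\<Sum>t \<in> J. cart (col t) (col q))" if "filt U" "addable U q" for U q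
    unfolding N_def wt_insert[OF that] by (simp add: sum_subtractf cart_sym[of "col q"])
  have NV: "N V \<le> 0"
  proof -
    \<comment> \<open>The addable element \<open>p\<close> contributes 1. This is compensated by
      \<open>w\<close>, whose two neighbors in \<open>mids w z\<close> lie below or at
      \<open>p\<close> and hence outside \<open>V\<close>. The other elements of \<open>J\<close>
      contribute at most 0.\<close>
    have "wt (col q) V \<le> (if q = p then 1 else 0) + (if q = w then -1 else 0)" if qJ: "q \<in> J" for q
    proof (cases "q = p")
      case True
      moreover have "p \<noteq> w" using wp by blast
      ultimately show ?thesis using wt_addable[OF V, of p] addable_not_below F unfolding V_def by simp
    next
      case qp: False
      have "q \<preceq> p" using qJ unfolding J_def by blast
      then obtain u where u: "q \<preceq> u" "col u = col q" "first_out V u" "u \<preceq> p"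
        unfolding V_def by (rule first_out_not_below)
      have up: "u \<prec> p" using u p[of q] qJ qp unfolding J_def by auto
      have le0: "wt (col q) V \<le> 0"
        using wt_cases[OF V u(3)] not_addable_not_below[OF up] u(2) unfolding V_def by auto
      show ?thesis
      proof (cases "q = w")
        case True
        have "u \<in> J" using u qJ le_trans[of w q u] unfolding J_def by blast
        then have "u = w" using Jw u(2) True by blast
        have "mids w z \<subseteq> {q. w \<prec> q \<and> q \<notin> V \<and> adj (col q) (col w)}"
          using mids unfolding mids_def V_def not_below_def by blast
        then have "2 \<le> card {q. w \<prec> q \<and> q \<notin> V \<and> adj (col q) (col w)}"
          using card_mono[OF finite_above, of "mids w z"] card_mids[OF wz(1)] by simp
        then show ?thesis
          using wt_first_out[OF V u(3)] True qp \<open>u = w\<close> by simp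
      qed (use le0 qp in simp)
    qed
    then have "N V \<le> (\<Sum>q \<in> J. (if q = p then 1 else 0) + (if q = w then -1 else 0))"
      unfolding N_def by (rule sum_mono)
    also have "\<dots> = 0" using finJ wJ pJ by (simp add: sum.distrib)
    finally show ?thesis .
  qed
  have N_le: "N U \<le> 0" if "filt U" "U \<subseteq> V" for U
    using that
  proof (induction "card (V - U)" arbitrary: U rule: less_induct)
    case less
    show ?case
    proof (cases "U = V")
      case True
      then show ?thesis using NV by simp
    next
      case False
      then obtain q where q: "q \<in> V" "addable U q" using ex_addable_in[OF less.prems(1) V less.prems(2)] by blast
      have "q \<notin> U" using q(2) unfolding addable_def by blast
      then have "card (V - insert q U) < card (V - U)"
        using q(1) filt_finite[OF V] by (intro psubset_card_mono) auto
      then have "N (insert q U) \<le> 0"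
        using less.hyps[of "insert q U"] filt_insert[OF less.prems(1) q(2)] q(1) less.prems(2) by blast
      moreover have "N U \<le> N (insert q U)" unfolding N_insert[OF less.prems(1) q(2)] using Delta by simp
      ultimately show ?thesis by linarith
    qed
  qed
  have zero: "\<forall>q \<in> J. wt (col q) U = 0" if "filt U" "U \<subseteq> V" for U
    using that
  proof (induction "card U" arbitrary: U rule: less_induct)
    case less
    show ?case
    proof (cases "U = {}")
      case True
      have nn: "\<And>q. q \<in> J \<Longrightarrow> 0 \<le> wt (col q) U" using True lam_nonneg JF unfolding wt_def by simp
      have "N U = 0" using N_le[OF less.prems] sum_nonneg[of J "\<lambda>q. wt (col q) U"] nn unfolding N_def by fastforce
      then show ?thesis using sum_nonneg_eq_0_iff[OF finJ, of "\<lambda>q. wt (col q) U"] nn unfolding N_def by blast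
    next
      case False
      then obtain q where q: "removable U q" using ex_removable less.prems by blast
      let ?U = "U - {q}"
      have qU: "q \<in> U" using q unfolding removable_def by blast
      have U': "filt ?U" "addable ?U q" using filt_remove addable_remove less.prems q by blast+
      have ins: "insert q ?U = U" using qU by blast
      have "card ?U < card U" using qU filt_finite[OF less.prems(1)] by (rule card_Diff1_less[rotated])
      then have IH: "\<forall>t \<in> J. wt (col t) ?U = 0" using less.hyps[of ?U] U'(1) less.prems(2) by blast
      \<comment> \<open>An element is added at weight 1, whereas all weights along \<open>J\<close>
        are 0. So its color is foreign to \<open>J\<close>, and since \<open>N\<close> must not
        become positive, that color is not even adjacent to one of \<open>J\<close>. Adding
        \<open>q\<close> therefore leaves these weights at 0.\<close>
      have qn: "col q \<notin> col ` J" using IH wt_addable[OF U'] by fastforce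
      have "N ?U = 0" unfolding N_def using IH by simp
      then have "(\<Sum>t \<in> J. cart (col t) (col q)) \<ge> 0"
        using N_insert[OF U'] N_le[OF less.prems] unfolding ins by simp
      moreover have "col t \<noteq> col q" if "t \<in> J" for t using qn that by (metis imageI)
      then have "{t \<in> J. col t = col q} = {}" by blast
      ultimately have "card {t \<in> J. adj (col t) (col q)} = 0" unfolding sum_cart[OF finJ] by simp
      then have none: "{t \<in> J. adj (col t) (col q)} = {}" using finJ by simp
      have "cart (col q) (col t) = 0" if "t \<in> J" for t
        using none imageI[OF that, of col] qn that adj_sym unfolding cart_def by auto
      then show ?thesis using IH wt_insert[OF U'] unfolding ins by simp
    qed
  qed
  have "wt (col p) V = 0" using zero[OF V order_refl] pJ by blast
  then show False using wt_addable[OF V, of p] addable_not_below F unfolding V_def by simp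
qed

text \<open>If at least two elements of the interval are adjacent in color to \<open>p\<close>,
  there is a null root. Otherwise only one element \<open>q\<close> lies directly below
  \<open>p\<close> in the interval, and the whole configuration passes from \<open>p\<close> to
  \<open>q\<close>.\<close>

lemma no_bad_interval:
  assumes "w \<prec> p" "consecutive w z" "\<not> z \<preceq> p" "mids w z \<subseteq> {q. q \<preceq> p}"
    and "\<And>t. w \<preceq> t \<Longrightarrow> t \<prec> p \<Longrightarrow> col t \<noteq> col p"
  shows False
  using assms(1,3-5)
proof (induction p rule: down_induct)
  case (less p)
  define B where "B = {q. w \<preceq> q \<and> q \<preceq> p \<and> adj (col q) (col p)}"
  have finB: "finite B" unfolding B_def by (rule finite_subset[OF _ finite_up[of w]]) blast
  \<comment> \<open>Otherwise \<open>p\<close> is one of the two elements of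
    \<open>mids w z\<close>. The other one lies below it, so both have the same color, which is
    excluded for elements between \<open>w\<close> and \<open>p\<close>.\<close>
  have nadj: "\<not> adj (col p) (col w)"
  proof
    assume "adj (col p) (col w)"
    then have pm: "p \<in> mids w z"
      using consecutive_above_cases(2)[OF assms(2) less.prems(1)] less.prems(2) by blast
    obtain a b where ab: "a \<noteq> b" "mids w z = {a, b}" "a \<preceq> b \<or> b \<preceq> a \<longrightarrow> col a = col b"
      using mids_pair[OF assms(2)] by blast
    define c where "c = (if p = a then b else a)"
    have c: "c \<in> mids w z" "c \<noteq> p" using ab pm unfolding c_def by auto
    then have cp: "c \<prec> p" using less.prems(3) by blast
    then have "col c = col p" using ab pm c unfolding c_def by (auto split: if_splits)
    moreover have "w \<preceq> c" using c unfolding mids_def by blast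
    ultimately show False using less.prems(4) cp by blast
  qed
  obtain q where q: "w \<preceq> q" "q \<prec>\<cdot> p" using ex_cover_below[OF less.prems(1)] by blast
  have qp: "q \<prec> p" using cv_lt[OF q(2)] .
  have qB: "q \<in> B" using q qp cover_adj unfolding B_def by blast
  show False
  proof (cases "2 \<le> card B")
    case True
    then show False using no_null_root[OF less.prems(1) assms(2) less.prems(2-4)] unfolding B_def by blast
  next
    case False
    then have "card B \<le> Suc 0" by simp
    then have Bq: "t = q" if "t \<in> B" for t using that qB card_le_Suc0_iff_eq[OF finB] by blast
    have "w \<noteq> q" using nadj qB adj_sym unfolding B_def by blast
    then have wq: "w \<prec> q" using q by blast
    moreover have "\<not> z \<preceq> q" using less.prems(2) qp le_trans[of z q p] by blast
    moreover have "mids w z \<subseteq> {t. t \<preceq> q}"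
    proof
      fix m assume m: "m \<in> mids w z"
      then have "m \<noteq> p" using nadj unfolding mids_def by blast
      then have "m \<prec> p" using m less.prems(3) by blast
      then obtain v where v: "m \<preceq> v" "v \<prec>\<cdot> p" using ex_cover_below by blast
      have "w \<preceq> m" using m unfolding mids_def by blast
      then have "v \<in> B" using v cv_lt[OF v(2)] cover_adj[OF v(2)] le_trans[of w m v] unfolding B_def by blast
      then show "m \<in> {t. t \<preceq> q}" using Bq v by blast
    qed
    moreover have "col t \<noteq> col q" if "w \<preceq> t" "t \<prec> q" for t
    proof
      assume "col t = col q"
      then have "t \<in> B" using that qB qp le_trans[of t q p] unfolding B_def by auto
      then show False using Bq that by blast
    qed
    ultimately show False using less.IH[OF qp] by blast
  qed
qed

text \<open>In \<open>card_complement_eq_sum\<close> for the filter of elements not below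
  \<open>p\<close>, only the term of \<open>p\<close> survives. Weight 1 at another color would need
  an addable element strictly below \<open>p\<close>, and weight -1 would give the configuration of
  \<open>no_bad_interval\<close>.\<close>

lemma height_lowest:
  assumes p: "p \<in> Field r" and low: "\<And>q. q \<prec> p \<Longrightarrow> col q \<noteq> col p"
  shows "height p = int (card {q. q \<preceq> p})"
proof -
  let ?V = "not_below p"
  have I: "Field r - ?V = {q. q \<preceq> p}" unfolding not_below_def using le_Field by blast
  have zero: "wt (col q) ?V * height q = 0" if q: "q \<in> {q. q \<preceq> p} - {p}" for q
  proof -
    have "q \<preceq> p" "q \<prec> p" using q by blast+
    obtain w where w: "q \<preceq> w" "col w = col q" "first_out ?V w" "w \<preceq> p"
      using first_out_not_below[OF \<open>q \<preceq> p\<close>] .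
    have wp: "w \<prec> p" using w low[OF \<open>q \<prec> p\<close>] by auto
    have False if z: "removable ?V z" "consecutive w z" "mids w z \<inter> ?V = {}" for z
    proof (rule no_bad_interval[OF wp z(2)])
      show "\<not> z \<preceq> p" using z(1) unfolding removable_def not_below_def by blast
      show "mids w z \<subseteq> {q. q \<preceq> p}" using z(3) le_Field unfolding not_below_def mids_def by blast
    qed (use low in blast)
    then have "wt (col w) ?V = 0"
      using wt_cases[OF filt_not_below w(3)] not_addable_not_below[OF wp] by blast
    then show ?thesis using w(2) by simp
  qed
  have "int (card {q. q \<preceq> p}) = (\<Sum>q \<in> {q. q \<preceq> p}. wt (col q) ?V * height q)"
    using card_complement_eq_sum[OF filt_not_below, of p] unfolding I .
  also have "\<dots> = wt (col p) ?V * height p"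
  proof -
    have "(\<Sum>q \<in> {q. q \<preceq> p}. wt (col q) ?V * height q) =
        wt (col p) ?V * height p + (\<Sum>q \<in> {q. q \<preceq> p} - {p}. wt (col q) ?V * height q)"
      using finite_down[of p] le_refl[OF p] by (intro sum.remove) auto
    also have "(\<Sum>q \<in> {q. q \<preceq> p} - {p}. wt (col q) ?V * height q) = 0"
      by (rule sum.neutral) (use zero in blast)
    finally show ?thesis by simp
  qed
  also have "\<dots> = height p"
    using wt_addable[OF filt_not_below addable_not_below[OF p]] by simp
  finally show ?thesis by simp
qed


subsection \<open>The hook formula\<close>

text \<open>\<open>root_value W j\<close> is the height of the root obtained from the simple root \<open>j\<close> by applying the
  reflections of the elements outside the filter \<open>W\<close>.\<close>

definition root_value :: "'a set \<Rightarrow> 'c \<Rightarrow> int" where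
  "root_value W j = 1 - (\<Sum>q \<in> Field r - W. cart (col q) j * height q)"

text \<open>Coefficientwise form of an equation of a diagonal operator with the sum of the raising
  operators, which take an element out of a filter and so pair the coefficient at \<open>U\<close>
  with those at larger filters. For \<open>W = Field r\<close> all root values are 1 and the
  diagonal factor is the number of elements outside \<open>U\<close>.\<close>

definition eigenvector :: "'a set \<Rightarrow> ('a set \<Rightarrow> int) \<Rightarrow> bool" where
  "eigenvector W \<xi> \<longleftrightarrow> (\<forall>U. filt U \<and> U \<subseteq> W \<longrightarrow>
     (\<Sum>q \<in> W - U. root_value W (col q)) * \<xi> U = (\<Sum>p \<in> {p \<in> W. addable U p}. \<xi> (insert p U)))"

text \<open>As \<open>p\<close> is minimal in \<open>W\<close>, the elements outside
  \<open>W\<close> that have nonzero Cartan entry with it are exactly those below it. The second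
  claim is the simple reflection.\<close>

lemma root_value_removable:
  assumes W: "filt W" and p: "removable W p"
  shows "root_value W (col p) = height p"
    and "root_value (W - {p}) j = root_value W j - cart (col p) j * height p"
proof -
  have pW: "p \<in> W" "\<And>q. q \<in> W \<Longrightarrow> q \<preceq> p \<Longrightarrow> q = p" using p unfolding removable_def by blast+
  have pF: "p \<in> Field r" using pW W filtD(2) by blast
  have "(\<Sum>q \<in> Field r - W. cart (col q) (col p) * height q) = (\<Sum>q \<in> {q. q \<prec> p}. cart (col q) (col p) * height q)"
  proof (rule sum.mono_neutral_right)
    show "{q. q \<prec> p} \<subseteq> Field r - W" using pW(2) le_Field by blast
    show "\<forall>q \<in> Field r - W - {q. q \<prec> p}. cart (col q) (col p) * height q = 0"
    proof
      fix q assume q: "q \<in> Field r - W - {q. q \<prec> p}"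
      then have "q \<noteq> p" "\<not> p \<preceq> q" using pW filtD(1)[OF W pW(1)] by blast+
      then have "cart (col q) (col p) = 0" using cart_nonzeroD[of q p] q pF by blast
      then show "cart (col q) (col p) * height q = 0" by simp
    qed
  qed (use finite_Field in blast)
  then show "root_value W (col p) = height p"
    unfolding root_value_def using height.simps[of p] by simp
  have "Field r - (W - {p}) = insert p (Field r - W)" "p \<notin> Field r - W" using pF pW by blast+
  then show "root_value (W - {p}) j = root_value W j - cart (col p) j * height p"
    unfolding root_value_def using finite_Field by simp
qed

text \<open>Effect of the reflection on the diagonal factor. The sum of the Cartan entries is a
  difference of two weights, and that of \<open>W - {p}\<close> is 1 because \<open>p\<close> is
  addable there.\<close>

lemma sum_root_value:
  assumes W: "filt W" and p: "removable W p" and U: "filt U" "U \<subseteq> W - {p}"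
  shows "(\<Sum>q \<in> W - {p} - U. root_value W (col q)) =
    (\<Sum>q \<in> W - {p} - U. root_value (W - {p}) (col q)) + height p * (wt (col p) U - 1)"
proof -
  let ?W = "W - {p}"
  have "(\<Sum>q \<in> ?W - U. root_value W (col q)) =
      (\<Sum>q \<in> ?W - U. root_value ?W (col q) + height p * cart (col q) (col p))"
    unfolding root_value_removable(2)[OF W p] cart_sym[of "col p"] by simp
  also have "\<dots> = (\<Sum>q \<in> ?W - U. root_value ?W (col q)) + height p * (\<Sum>q \<in> ?W - U. cart (col q) (col p))"
    by (simp add: sum.distrib sum_distrib_left)
  also have "(\<Sum>q \<in> ?W - U. cart (col q) (col p)) = wt (col p) U - wt (col p) ?W"
    by (rule wt_diff[OF U(1) filt_remove[OF W p] U(2)])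
  also have "wt (col p) ?W = 1"
    by (rule wt_addable[OF filt_remove[OF W p] addable_remove[OF W p]])
  finally show ?thesis .
qed

text \<open>At most one element (\<open>rem_col_unique\<close>). Summing over this set gives the
  lowering operator of color \<open>i\<close> without a case distinction.\<close>

definition rem_col :: "'c \<Rightarrow> 'a set \<Rightarrow> 'a set" where
  "rem_col i U = {t. removable U t \<and> col t = i}"

lemma rem_col_unique:
  assumes "filt U" "t \<in> rem_col i U"
  shows "rem_col i U = {t}"
proof -
  have "t' = t" if t': "t' \<in> rem_col i U" for t'
  proof -
    have "t \<preceq> t' \<or> t' \<preceq> t" "t \<in> U" "t' \<in> U"
      using assms t' same_comparable[of t t'] filtD(2)[OF assms(1)] unfolding rem_col_def removable_def by auto
    then show ?thesis using assms t' unfolding rem_col_def removable_def by blast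
  qed
  then show ?thesis using assms(2) by blast
qed

lemma rem_col_insert_same:
  assumes "filt U" "addable U q" "col q = i"
  shows "rem_col i (insert q U) = {q}"
proof (rule rem_col_unique[OF filt_insert[OF assms(1,2)]])
  have "q \<notin> U" using assms(2) unfolding addable_def by blast
  then have "removable (insert q U) q" using filtD(1)[OF assms(1)] unfolding removable_def by blast
  then show "q \<in> rem_col i (insert q U)" using assms(3) unfolding rem_col_def by blast
qed

lemma rem_col_insert_other:
  assumes "filt U" "addable U q" "col q \<noteq> i"
  shows "rem_col i (insert q U) = {t \<in> rem_col i U. \<not> q \<prec> t}"
proof -
  have "q \<notin> U" using assms(2) unfolding addable_def by blast
  then show ?thesis using assms(3) unfolding rem_col_def removable_def by blast
qed

text \<open>The step multiplies by the exponential of the lowering operator of color \<open>col p\<close>; on the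
  vectors in question this is a computation in one copy of \<open>sl\<^sub>2\<close>.\<close>

lemma eigenvector_step:
  assumes W: "filt W" and p: "removable W p" and ev: "eigenvector (W - {p}) \<xi>"
  defines "\<zeta> \<equiv> \<lambda>U. (if p \<in> U then 0 else \<xi> U) + height p * (\<Sum>t \<in> rem_col (col p) U. \<xi> (U - {t}))"
  shows "eigenvector W \<zeta>"
  unfolding eigenvector_def
proof (intro allI impI, elim conjE)
  fix U assume U: "filt U" "U \<subseteq> W"
  define i where "i = col p"
  define b where "b = height p"
  define X where "X = W - {p}"
  define D where "D U = (\<Sum>q \<in> X - U. root_value X (col q))" for U
  have X: "filt X" "addable X p" unfolding X_def using filt_remove addable_remove W p by blast+
  have pW: "p \<in> W" and pmin: "\<And>q. q \<in> W \<Longrightarrow> q \<preceq> p \<Longrightarrow> q = p" using p unfolding removable_def by blast+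
  have pF: "p \<in> Field r" using pW filtD(2)[OF W] by blast
  have finW: "finite W" using filt_finite[OF W] .
  \<comment> \<open>The exponential has only a constant and a linear term, since in a minuscule
    setting the lowering operator squares to zero. The value 0 for \<open>p \<in> U\<close> confines
    \<open>\<xi>\<close> to the filters inside \<open>W - {p}\<close>, the only ones about which
    \<open>ev\<close> says anything.\<close>
  have \<zeta>: "\<zeta> U = (if p \<in> U then 0 else \<xi> U) + b * (\<Sum>t \<in> rem_col i U. \<xi> (U - {t}))" for U
    unfolding \<zeta>_def b_def i_def ..
  have evX: "D U * \<xi> U = (\<Sum>q \<in> {q \<in> X. addable U q}. \<xi> (insert q U))" if "filt U" "U \<subseteq> X" for U
    using ev that unfolding eigenvector_def D_def X_def by blast
  show "(\<Sum>q \<in> W - U. root_value W (col q)) * \<zeta> U = (\<Sum>p \<in> {p \<in> W. addable U p}. \<zeta> (insert p U))"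
  proof (cases "p \<in> U")
    case True
    define U' where "U' = U - {p}"
    have rp: "removable U p" using True pmin U(2) unfolding removable_def by blast
    have U': "filt U'" "U' \<subseteq> X" "addable U' p"
      unfolding U'_def X_def using filt_remove[OF U(1) rp] addable_remove[OF U(1) rp] U(2) by blast+
    \<comment> \<open>Only the linear term survives here, and the claim is \<open>b\<close> times
      the equation at \<open>U - {p}\<close>. There \<open>i\<close> has weight 1, so the correction
      in \<open>sum_root_value\<close> vanishes.\<close>
    have "rem_col i U = {p}" using rem_col_unique[OF U(1)] rp unfolding rem_col_def i_def by blast
    then have \<zeta>U: "\<zeta> U = b * \<xi> U'" unfolding \<zeta> U'_def using True by simp
    have Ad: "{q \<in> W. addable U q} = {q \<in> X. addable U' q}"
    proof -
      have "addable U q \<longleftrightarrow> addable U' q" if "q \<in> X" for q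
        using that True pmin[of q] unfolding addable_def U'_def X_def by blast
      moreover have "\<not> addable U p" using True unfolding addable_def by blast
      ultimately show ?thesis unfolding X_def by blast
    qed
    have "\<zeta> (insert q U) = b * \<xi> (insert q U')" if q: "q \<in> {q \<in> W. addable U q}" for q
    proof -
      have qa: "q \<in> W" "q \<notin> U" "addable U q" using q unfolding addable_def by blast+
      have qp: "q \<noteq> p" using qa True by blast
      have "col q \<noteq> i"
      proof
        assume "col q = i"
        then have "p \<preceq> q" using same_comparable[of p q] pF qa pmin[of q] filtD(2)[OF W] qp unfolding i_def by auto
        then show False using filtD(1)[OF U(1) True] qa by blast
      qed
      then have "rem_col i (insert q U) = {p}"
        using rem_col_insert_other[OF U(1) qa(3)] \<open>rem_col i U = {p}\<close> pmin[OF qa(1)] by auto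
      moreover have "insert q U - {p} = insert q U'" using qp unfolding U'_def by blast
      ultimately show ?thesis unfolding \<zeta> using True by simp
    qed
    then have "(\<Sum>q \<in> {q \<in> W. addable U q}. \<zeta> (insert q U)) = (\<Sum>q \<in> {q \<in> X. addable U' q}. b * \<xi> (insert q U'))"
      unfolding Ad by (intro sum.cong) auto
    also have "\<dots> = b * (D U' * \<xi> U')" unfolding evX[OF U'(1,2)] sum_distrib_left ..
    also have "D U' = (\<Sum>q \<in> W - U. root_value W (col q))"
    proof -
      have "W - U = W - {p} - U'" using True unfolding U'_def by blast
      then show ?thesis
        using sum_root_value[OF W p U'(1) U'(2)[unfolded X_def]] wt_addable[OF U'(1,3)]
        unfolding D_def X_def by simp
    qed
    finally show ?thesis unfolding \<zeta>U by simp
  next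
    case False
    have UX: "U \<subseteq> X" using U(2) False unfolding X_def by blast
    have pX: "p \<notin> X" "W = insert p X" using pW unfolding X_def by blast+
    have finX: "finite X" using finW unfolding X_def by simp
    have DW: "(\<Sum>q \<in> W - U. root_value W (col q)) = D U + b * wt i U"
    proof -
      have "W - U = insert p (W - {p} - U)" using pW False by blast
      then have "(\<Sum>q \<in> W - U. root_value W (col q)) = root_value W (col p) + (\<Sum>q \<in> W - {p} - U. root_value W (col q))"
        using finW by simp
      then show ?thesis
        using sum_root_value[OF W p U(1) UX[unfolded X_def]] root_value_removable(1)[OF W p]
        unfolding D_def X_def b_def i_def by (simp add: algebra_simps)
    qed
    obtain w where w: "p \<preceq> w" "col w = i" "first_out U w" using ex_first_out[OF pF False] unfolding i_def by blast
    have wW: "w \<in> W" using filtD(1)[OF W pW w(1)] .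
    have addi: "q = w" if "addable U q" "col q = i" for q
      using first_out_unique[OF addable_first_out[OF that(1)] w(3)] that(2) w(2) by simp
    define Ad where "Ad = {q \<in> W. addable U q}"
    have finAd: "finite Ad" unfolding Ad_def using finW by simp
    have first: "(\<Sum>q \<in> Ad. (if p \<in> insert q U then 0 else \<xi> (insert q U))) = D U * \<xi> U"
    proof -
      have "(\<Sum>q \<in> Ad. (if p \<in> insert q U then 0 else \<xi> (insert q U))) = (\<Sum>q \<in> {q \<in> X. addable U q}. \<xi> (insert q U))"
        by (rule sum.mono_neutral_cong_right) (use finAd False pX in \<open>auto simp: Ad_def\<close>)
      then show ?thesis using evX[OF U(1) UX] by simp
    qed
    define S where "S = (\<Sum>q \<in> Ad. \<Sum>t \<in> rem_col i (insert q U). \<xi> (insert q U - {t}))"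
    have RHS: "(\<Sum>q \<in> Ad. \<zeta> (insert q U)) = D U * \<xi> U + b * S"
      unfolding \<zeta> sum.distrib first S_def sum_distrib_left ..
    \<comment> \<open>The trichotomy of \<open>wt_cases\<close>, with the weights 1 and 0 merged.
      Only for weight -1 is there an element of color \<open>i\<close> to remove.\<close>
    consider (no) "rem_col i U = {}" "wt i U = (if addable U w then 1 else 0)"
      | (rem) t where "rem_col i U = {t}" "wt i U = -1" "\<not> addable U w"
      using wt_cases[OF U(1) w(3)] rem_col_unique[OF U(1)] w(2) unfolding rem_col_def consecutive_def by fastforce
    then show ?thesis
    proof cases
      case no
      have "(\<Sum>t \<in> rem_col i (insert q U). \<xi> (insert q U - {t})) = (if q = w then \<xi> U else 0)" if "q \<in> Ad" for q
      proof -
        have q: "addable U q" "q \<notin> U" using that unfolding Ad_def addable_def by blast+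
        show ?thesis
        proof (cases "col q = i")
          case True
          then show ?thesis using rem_col_insert_same[OF U(1) q(1) True] addi[OF q(1) True] q(2) by simp
        next
          case False
          then show ?thesis using rem_col_insert_other[OF U(1) q(1) False] no(1) w(2) by auto
        qed
      qed
      then have "S = (\<Sum>q \<in> Ad. if q = w then \<xi> U else 0)" unfolding S_def by simp
      also have "\<dots> = (if addable U w then \<xi> U else 0)" using finAd wW unfolding Ad_def by simp
      finally have S: "S = wt i U * \<xi> U" using no(2) by simp
      have "\<zeta> U = \<xi> U" unfolding \<zeta> using no(1) False by simp
      then show ?thesis using RHS unfolding DW S Ad_def by (simp add: algebra_simps)
    next
      case (rem t)
      let ?U = "U - {t}"
      have t: "removable U t" "col t = i" using rem(1) unfolding rem_col_def by blast+
      have tU: "t \<in> U" "t \<in> X" using t(1) UX unfolding removable_def by blast+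
      have U': "filt ?U" "?U \<subseteq> X" "addable ?U t" using filt_remove addable_remove U(1) t(1) UX by blast+
      have ni: "col q \<noteq> i" if "q \<in> Ad" for q using that addi rem(3) unfolding Ad_def by blast
      have AdX: "q \<in> X" if "q \<in> Ad" for q using that ni[OF that] pX(2) unfolding Ad_def i_def by blast
      have Ad': "{q \<in> X. addable ?U q} = insert t {q \<in> Ad. \<not> q \<prec> t}"
      proof (rule Set.set_eqI)
        fix q
        show "q \<in> {q \<in> X. addable ?U q} \<longleftrightarrow> q \<in> insert t {q \<in> Ad. \<not> q \<prec> t}"
        proof (cases "q = t")
          case True
          then show ?thesis using tU U'(3) by blast
        next
          case False
          then have "addable ?U q \<longleftrightarrow> addable U q \<and> \<not> q \<prec> t" unfolding addable_def by blast
          then show ?thesis using False AdX[of q] pX(2) unfolding Ad_def by blast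
        qed
      qed
      have tn: "t \<notin> {q \<in> Ad. \<not> q \<prec> t}" using tU unfolding Ad_def addable_def by blast
      have "(\<Sum>t' \<in> rem_col i (insert q U). \<xi> (insert q U - {t'})) = (if \<not> q \<prec> t then \<xi> (insert q ?U) else 0)"
        if "q \<in> Ad" for q
      proof -
        have q: "addable U q" "q \<notin> U" using that unfolding Ad_def addable_def by blast+
        have e: "insert q U - {t} = insert q ?U" using q(2) tU(1) by blast
        have "rem_col i (insert q U) = (if \<not> q \<prec> t then {t} else {})"
          using rem_col_insert_other[OF U(1) q(1) ni[OF that]] rem(1) by auto
        then show ?thesis using e by simp
      qed
      then have "S = (\<Sum>q \<in> Ad. if \<not> q \<prec> t then \<xi> (insert q ?U) else 0)" unfolding S_def by simp
      also have "\<dots> = (\<Sum>q \<in> {q \<in> Ad. \<not> q \<prec> t}. \<xi> (insert q ?U))"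
        using finAd by (rule sum.inter_filter[symmetric])
      also have "\<dots> = D ?U * \<xi> ?U - \<xi> U"
      proof -
        have "insert t ?U = U" using tU(1) by blast
        then show ?thesis
          using evX[OF U'(1,2)] finAd tn unfolding Ad' by simp
      qed
      also have "D ?U = D U - b"
      proof -
        have "X - ?U = insert t (X - U)" "t \<notin> X - U" using tU by blast+
        \<comment> \<open>The reflection negates its own root: \<open>b\<close> becomes
          \<open>b - 2 * b\<close>.\<close>
        moreover have "root_value X (col t) = - b"
          using root_value_removable(1)[OF W p] root_value_removable(2)[OF W p, of i] unfolding t(2) X_def i_def b_def by simp
        ultimately show ?thesis unfolding D_def using finX by simp
      qed
      finally have S: "S = (D U - b) * \<xi> ?U - \<xi> U" .
      have "\<zeta> U = \<xi> U + b * \<xi> ?U" unfolding \<zeta> using rem(1) False by simp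
      then show ?thesis using RHS rem(2) unfolding DW S Ad_def by (simp add: algebra_simps)
    qed
  qed
qed

text \<open>Take off a minimal element \<open>p\<close> and apply \<open>eigenvector_step\<close> to
  a solution for the rest. At \<open>{}\<close> nothing can be removed, so the value stays 1; at
  \<open>W\<close> only \<open>p\<close> can be removed in its color, so the value gains the factor
  \<open>height p\<close>.\<close>

lemma ex_eigenvector:
  assumes "filt W"
  shows "\<exists>\<xi>. \<xi> {} = 1 \<and> \<xi> W = (\<Prod>q \<in> W. height q) \<and> eigenvector W \<xi>"
  using assms
proof (induction "card W" arbitrary: W rule: less_induct)
  case less
  show ?case
  proof (cases "W = {}")
    case True
    then show ?thesis by (intro exI[of _ "\<lambda>_. 1"]) (auto simp: eigenvector_def)
  next
    case False
    then obtain p where p: "removable W p" using ex_removable less.prems by blast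
    then have pW: "p \<in> W" unfolding removable_def by blast
    have fin: "finite W" using filt_finite less.prems by blast
    have "card (W - {p}) < card W" using fin pW by (rule card_Diff1_less)
    then obtain \<xi> where \<xi>: "\<xi> {} = 1" "\<xi> (W - {p}) = (\<Prod>q \<in> W - {p}. height q)" "eigenvector (W - {p}) \<xi>"
      using less.hyps filt_remove[OF less.prems p] by blast
    let ?\<zeta> = "\<lambda>U. (if p \<in> U then 0 else \<xi> U) + height p * (\<Sum>t \<in> rem_col (col p) U. \<xi> (U - {t}))"
    have "rem_col (col p) {} = {}" unfolding rem_col_def removable_def by blast
    then have z0: "?\<zeta> {} = 1" using \<xi>(1) by simp
    have "rem_col (col p) W = {p}"
      using rem_col_unique[OF less.prems] p unfolding rem_col_def by blast
    then have zW: "?\<zeta> W = (\<Prod>q \<in> W. height q)"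
      using \<xi>(2) pW prod.remove[OF fin pW, of height] by simp
    show ?thesis
      using z0 zW eigenvector_step[OF less.prems p \<xi>(3)] by (intro exI[of _ ?\<zeta>] conjI)
  qed
qed

text \<open>For \<open>W = Field r\<close> the eigenvector equation is the recursion
  \<open>density_rec\<close> for the complements of filters. So \<open>\<xi> U\<close> is the
  density of the complement times \<open>\<xi> (Field r)\<close>, and the claim is the case
  \<open>U = {}\<close>.\<close>

lemma density_height: "density r (Field r) * real_of_int (\<Prod>q \<in> Field r. height q) = 1"
proof -
  have P: "filt (Field r)" unfolding filt_def using le_Field by blast
  obtain \<xi> where \<xi>: "\<xi> {} = 1" "\<xi> (Field r) = (\<Prod>q \<in> Field r. height q)" "eigenvector (Field r) \<xi>"
    using ex_eigenvector[OF P] by blast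
  have "real_of_int (\<xi> U) = density r (Field r - U) * real_of_int (\<xi> (Field r))" if "filt U" for U
    using that
  proof (induction "card (Field r - U)" arbitrary: U rule: less_induct)
    case less
    have UF: "U \<subseteq> Field r" using filtD(2) less.prems by blast
    show ?case
    proof (cases "U = Field r")
      case False
      let ?I = "Field r - U"
      have finI: "finite ?I" using finite_Field by blast
      have "?I \<noteq> {}" using False UF by blast
      then have c0: "card ?I \<noteq> 0" using finI by simp
      have Ad: "{p \<in> Field r. addable U p} = maximal_elements r ?I"
        unfolding addable_def maximal_elements_def using le_Field by blast
      have IH: "real_of_int (\<xi> (insert p U)) = density r (?I - {p}) * real_of_int (\<xi> (Field r))"
        if p: "p \<in> maximal_elements r ?I" for p
      proof -
        have a: "addable U p" using p Ad by blast
        then have "p \<in> ?I" unfolding addable_def by blast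
        then have "card (Field r - insert p U) < card ?I" using finI by (intro psubset_card_mono) auto
        moreover have "Field r - insert p U = ?I - {p}" by blast
        ultimately show ?thesis using less.hyps[of "insert p U"] filt_insert[OF less.prems a] by simp
      qed
      have "int (card ?I) * \<xi> U = (\<Sum>p \<in> maximal_elements r ?I. \<xi> (insert p U))"
        using \<xi>(3) less.prems UF unfolding eigenvector_def Ad[symmetric] root_value_def by simp
      then have "real (card ?I) * real_of_int (\<xi> U) = (\<Sum>p \<in> maximal_elements r ?I. real_of_int (\<xi> (insert p U)))"
        by (metis of_int_mult of_int_of_nat_eq of_int_sum)
      also have "\<dots> = (\<Sum>p \<in> maximal_elements r ?I. density r (?I - {p})) * real_of_int (\<xi> (Field r))"
        using IH by (simp add: sum_distrib_right)
      also have "\<dots> = real (card ?I) * density r ?I * real_of_int (\<xi> (Field r))"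
        using density_rec[OF finI, of r] by simp
      finally show ?thesis using c0 by simp
    qed simp
  qed
  from this[of "{}"] show ?thesis using \<xi>(1,2) by (simp add: filt_def)
qed

end


section \<open>The hook formula for d-complete posets\<close>

context dcomplete
begin

lemma BT_bottom_none_between:
  assumes "(w, z) \<in> BT" "w \<prec> t" "t \<prec> z"
  shows "color t \<noteq> color w"
proof
  assume "color t = color w"
  then have "color t = color z" using color_BT[OF assms(1)] by simp
  then have "t \<preceq> w" using same_color_lt_bottom(2)[OF _ assms(3,1)] by blast
  then show False using assms(2) le_antisym[of w t] by blast
qed

sublocale heap r color cadj
proof unfold_locales
  show "cadj i j \<Longrightarrow> cadj j i" for i j using cadj_sym .
  show "\<not> cadj i i" for i using cadj_irrefl .
  show "p \<preceq> q \<or> q \<preceq> p" if "p \<in> Field r" "q \<in> Field r" "color p = color q" for p q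
    using same_color_comparable[OF that] .
  show "p \<prec> q \<or> q \<prec> p" if "p \<in> Field r" "q \<in> Field r" "cadj (color p) (color q)" for p q
    using adjacent_comparable[OF that] .
  show "cadj (color p) (color q)" if "p \<prec>\<cdot> q" for p q using cover_cadj[OF that] .
next
  fix w z assume wz: "w \<prec> z" "color w = color z" and none: "\<And>t. w \<prec> t \<Longrightarrow> t \<prec> z \<Longrightarrow> color t \<noteq> color w"
  obtain u where u: "(w, u) \<in> BT\<^sup>*" "(u, z) \<in> BT" using same_color_lt[OF wz(2,1)] by blast
  have "w \<preceq> u" using BT_rtrancl_le[OF u(1)] le_Field wz by blast
  moreover have "u \<prec> z" "color u = color w" using BT_lt[OF u(2)] color_BT[OF u(2)] wz(2) by auto
  ultimately have "u = w" using none[of u] by auto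
  then obtain k x y where d: "dk_int r k w x y z" using u(2) unfolding BT_def by blast
  obtain a b where ab: "a \<noteq> b" "w \<prec> a" "a \<prec> z" "w \<prec> b" "b \<prec> z"
    "cadj (color a) (color z)" "cadj (color b) (color z)" "a \<preceq> b \<or> b \<preceq> a \<longrightarrow> color a = color b"
    "\<And>q. q \<prec> z \<Longrightarrow> cadj (color q) (color z) \<Longrightarrow> q \<prec> w \<or> q = a \<or> q = b"
    using between[OF d] by metis
  have "{q. w \<prec> q \<and> q \<prec> z \<and> cadj (color q) (color w)} = {a, b}"
    unfolding wz(2) using ab(2-7) ab(9) le_antisym[of w] by blast
  then show "\<exists>a b. a \<noteq> b \<and> {q. w \<prec> q \<and> q \<prec> z \<and> cadj (color q) (color w)} = {a, b} \<and>
      (a \<preceq> b \<or> b \<preceq> a \<longrightarrow> color a = color b)"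
    using ab(1,8) by blast
next
  fix t assume t: "t \<in> Field r" and none: "\<And>q. t \<prec> q \<Longrightarrow> color q \<noteq> color t"
  have T: "t \<notin> Domain BT"
  proof
    assume "t \<in> Domain BT"
    then obtain z where "(t, z) \<in> BT" by blast
    then show False using none[OF BT_lt] color_BT by metis
  qed
  have cov: "t \<prec>\<cdot> q" if q: "t \<prec> q" "cadj (color q) (color t)" for q
  proof -
    have "color t = t" by (rule color_top[OF T])
    moreover have "color q = q" by (rule color_top[OF top_tree_up[OF T q(1)[THEN conjunct1]]])
    ultimately have "cadj q t" using q(2) by simp
    moreover have "\<not> q \<prec>\<cdot> t"
    proof
      assume "q \<prec>\<cdot> t"
      then have "q \<preceq> t" using cv_lt by blast
      then show False using q(1) le_antisym[of t q] by simp
    qed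
    ultimately show ?thesis unfolding cadj_def by blast
  qed
  then have "{q. t \<prec> q \<and> cadj (color q) (color t)} \<subseteq> {q. t \<prec>\<cdot> q}" by blast
  also have "\<dots> \<subseteq> {SOME q. t \<prec>\<cdot> q}"
  proof
    fix q assume "q \<in> {q. t \<prec>\<cdot> q}"
    then have "t \<prec>\<cdot> q" "t \<prec>\<cdot> (SOME q. t \<prec>\<cdot> q)" by (simp, metis mem_Collect_eq someI_ex)
    then show "q \<in> {SOME q. t \<prec>\<cdot> q}" using top_tree_cover(2)[OF T] by blast
  qed
  finally show "card {q. t \<prec> q \<and> cadj (color q) (color t)} \<le> 1"
    using card_mono[of "{SOME q. t \<prec>\<cdot> q}"] by fastforce
qed

lemma BT_consecutive: "(w, z) \<in> BT \<Longrightarrow> consecutive w z"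
  unfolding consecutive_def using BT_lt color_BT BT_bottom_none_between by blast

text \<open>For \<open>k > 3\<close> the two elements between \<open>w\<close> and \<open>z\<close>
  are the ends of the next smaller interval. Adding its identity to
  \<open>height_consecutive\<close> cancels the height of that inner pair and leaves the
  sides.\<close>

lemma height_dk_int: "dk_int r k w x y z \<Longrightarrow> height z = height x + height y - height w"
proof (induction k arbitrary: w z rule: less_induct)
  case (less k)
  have BT: "(w, z) \<in> BT" using less.prems unfolding BT_def by blast
  obtain a b where ab: "a \<noteq> b" "w \<prec> a" "a \<prec> z" "w \<prec> b" "b \<prec> z"
    "cadj (color a) (color z)" "cadj (color b) (color z)"
    "\<And>q. q \<prec> z \<Longrightarrow> cadj (color q) (color z) \<Longrightarrow> q \<prec> w \<or> q = a \<or> q = b"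
    and k: "k = 3 \<Longrightarrow> a = x \<and> b = y" "k \<noteq> 3 \<Longrightarrow> dk_int r (k - 1) a x y b"
    using between[OF less.prems] by metis
  have "mids w z = {a, b}"
    unfolding mids_def color_BT[OF BT] using ab(2-8) le_antisym[of w] by blast
  then have h: "height z + height w = height a + height b"
    using height_consecutive[OF BT_consecutive[OF BT]] ab(1) by simp
  show ?case
  proof (cases "k = 3")
    case True
    then show ?thesis using h k(1) by simp
  next
    case False
    then have "k - 1 < k" using dk_int_ge_3[OF less.prems] by simp
    then have "height b = height x + height y - height a" using less.IH k(2)[OF False] by blast
    then show ?thesis using h by simp
  qed
qed

lemma hook_length_eq_height: "p \<in> Field r \<Longrightarrow> hook_length r p = height p"
proof (induction p rule: down_induct)
  case (less p)
  show ?case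
  proof (cases "in_neck r p")
    case True
    obtain w x y where t: "(SOME t. dk_interval_sides r p t) = (w, x, y)" by (cases "SOME t. dk_interval_sides r p t")
    have "dk_interval_sides r p (w, x, y)"
      using someI_ex[OF in_neck_dk_interval_sides[OF finite_poset True]] unfolding t .
    then obtain k where k: "dk_int r k w x y p" unfolding dk_interval_sides_iff by blast
    have lt: "x \<prec> p" "y \<prec> p" "w \<prec> p" using dk_int_D[OF k] dk_int_lt[OF k] by blast+
    then have "x \<in> Field r" "y \<in> Field r" "w \<in> Field r" using le_Field by blast+
    then have "hook_length r x = height x" "hook_length r y = height y" "hook_length r w = height w"
      using less.IH lt by blast+
    moreover have "hook_length r p = hook_length r x + hook_length r y - hook_length r w"
      using True finite_poset by (subst hook_length.simps) (simp add: t)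
    ultimately show ?thesis using height_dk_int[OF k] by simp
  next
    case False
    \<comment> \<open>An element of the same color below \<open>p\<close> would be linked to it by
      intervals, so \<open>p\<close> would be a top and thus in a neck.\<close>
    have "color q \<noteq> color p" if "q \<prec> p" for q
    proof
      assume "color q = color p"
      then show False using same_color_lt[OF _ that] False unfolding in_neck_iff BT_def by blast
    qed
    then have "height p = int (card {q. q \<preceq> p})" by (rule height_lowest[OF less.prems])
    then show ?thesis using False by (subst hook_length.simps) simp
  qed
qed

lemma density_hook: "density r (Field r) = 1 / of_int (\<Prod>p \<in> Field r. hook_length r p)"
proof -
  have "(\<Prod>p \<in> Field r. hook_length r p) = (\<Prod>p \<in> Field r. height p)"
    by (rule prod.cong) (auto simp: hook_length_eq_height)
  then show ?thesis
    using density_height by (metis mult_zero_right nonzero_eq_divide_eq zero_neq_one)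
qed

lemma ex_two_covers: "dk_int r k w x y z \<Longrightarrow> \<exists>u. w \<preceq> u \<and> u \<prec>\<cdot> x \<and> u \<prec>\<cdot> y"
proof (induction rule: dk_int.induct)
  case (diamond x y w z)
  then show ?case using cv_lt le_refl le_Field by blast
next
  case (extend k w' x y z' w z)
  then obtain u where u: "w' \<preceq> u" "u \<prec>\<cdot> x" "u \<prec>\<cdot> y" by blast
  then show ?case using cv_lt[OF extend.hyps(2)] le_trans[of w w' u] by blast
qed

text \<open>The top tree consists of the elements that are no bottoms: above a bottom some element
  has both sides as covers (\<open>ex_two_covers\<close>), while above any other element covers are
  unique.\<close>

lemma acyclic_element_iff: "acyclic_element r q \<longleftrightarrow>
  q \<in> Field r \<and> (\<forall>k x y z. \<not> dk_int r k q x y z) \<and> (\<forall>k w x y. \<not> dk_int r k w x y q)"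
proof -
  have fin: "finite {t. u \<prec>\<cdot> t}" for u
    by (rule finite_subset[OF _ finite_up[of u]]) (use cv_lt in blast)
  have "q \<in> top_tree r \<longleftrightarrow> q \<in> Field r \<and> q \<notin> Domain BT"
  proof (cases "q \<in> Domain BT")
    case True
    then obtain k x y z where d: "dk_int r k q x y z" unfolding BT_def by blast
    then obtain u where u: "q \<preceq> u" "u \<prec>\<cdot> x" "u \<prec>\<cdot> y" using ex_two_covers by blast
    have "card {x, y} \<le> card {t. u \<prec>\<cdot> t}" by (rule card_mono[OF fin]) (use u in blast)
    then have "\<not> card {t. u \<prec>\<cdot> t} \<le> 1" using dk_int_D[OF d] by simp
    then show ?thesis using u(1) True unfolding top_tree_def by blast
  next
    case False
    have "card {t. u \<prec>\<cdot> t} \<le> 1" if "q \<preceq> u" for u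
      using top_tree_cover(2)[OF top_tree_up[OF False that]] card_le_Suc0_iff_eq[OF fin] by simp
    then show ?thesis using False unfolding top_tree_def by blast
  qed
  then show ?thesis unfolding acyclic_element_def in_neck_iff BT_def by blast
qed

end

lemma d_complete_density_hook:
  assumes "dcomp r"
  shows "density r (Field r) = 1 / of_int (\<Prod>p \<in> Field r. hook_length r p)"
  using dcomplete.density_hook[of r] assms by (simp add: dcomplete_def)


section \<open>Slant sums\<close>

text \<open>\<open>R\<close> hung below \<open>Q\<close> by the single new cover from
  \<open>a\<close> to \<open>b\<close>. For disjoint orders this is already transitive.\<close>

definition slant :: "'a rel \<Rightarrow> 'a \<Rightarrow> 'a rel \<Rightarrow> 'a \<Rightarrow> 'a rel" where
  "slant R a Q b = R \<union> Q \<union> {(x, y). (x, a) \<in> R \<and> (b, y) \<in> Q}"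

locale slant_sum = R: fin_poset R + Q: fin_poset Q for R Q :: "'a rel" +
  fixes a b :: 'a
  assumes disjoint: "Field R \<inter> Field Q = {}" and a: "a \<in> Field R" and b: "b \<in> Field Q"
begin

abbreviation S :: "'a rel" where "S \<equiv> slant R a Q b"

lemma mem_S:
  "x \<in> Field R \<Longrightarrow> y \<in> Field R \<Longrightarrow> (x, y) \<in> S \<longleftrightarrow> (x, y) \<in> R"
  "x \<in> Field Q \<Longrightarrow> y \<in> Field Q \<Longrightarrow> (x, y) \<in> S \<longleftrightarrow> (x, y) \<in> Q"
  "x \<in> Field R \<Longrightarrow> y \<in> Field Q \<Longrightarrow> (x, y) \<in> S \<longleftrightarrow> (x, a) \<in> R \<and> (b, y) \<in> Q"
  "x \<in> Field Q \<Longrightarrow> y \<in> Field R \<Longrightarrow> (x, y) \<notin> S"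
proof -
  have 1: "x \<in> Field R" "y \<in> Field R" if "(x, y) \<in> R" for x y using that R.le_Field by blast+
  have 2: "x \<in> Field Q" "y \<in> Field Q" if "(x, y) \<in> Q" for x y using that Q.le_Field by blast+
  show "x \<in> Field R \<Longrightarrow> y \<in> Field R \<Longrightarrow> (x, y) \<in> S \<longleftrightarrow> (x, y) \<in> R"
    using 1[of x] 2[of x y] 2[of b y] disjoint unfolding slant_def by blast
  show "x \<in> Field Q \<Longrightarrow> y \<in> Field Q \<Longrightarrow> (x, y) \<in> S \<longleftrightarrow> (x, y) \<in> Q"
    using 1[of x] disjoint unfolding slant_def by blast
  show "x \<in> Field R \<Longrightarrow> y \<in> Field Q \<Longrightarrow> (x, y) \<in> S \<longleftrightarrow> (x, a) \<in> R \<and> (b, y) \<in> Q"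
    using 1[of x y] 2[of x y] disjoint unfolding slant_def by blast
  show "x \<in> Field Q \<Longrightarrow> y \<in> Field R \<Longrightarrow> (x, y) \<notin> S"
    using 1[of x] 2[of x y] 2[of b y] disjoint unfolding slant_def by blast
qed

lemma Field_S: "Field S = Field R \<union> Field Q"
proof
  show "Field S \<subseteq> Field R \<union> Field Q"
    unfolding slant_def Field_def by auto
  show "Field R \<union> Field Q \<subseteq> Field S"
    unfolding slant_def Field_def by auto
qed

lemma in_S_D: "(x, y) \<in> S \<Longrightarrow> x \<in> Field R \<and> y \<in> Field R \<or> x \<in> Field Q \<and> y \<in> Field Q \<or> x \<in> Field R \<and> y \<in> Field Q"
  using mem_S(4) Field_S FieldI1[of x y S] FieldI2[of x y S] by blast

lemma trans_S: "(x, y) \<in> S \<Longrightarrow> (y, z) \<in> S \<Longrightarrow> (x, z) \<in> S"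
proof -
  assume xy: "(x, y) \<in> S" and yz: "(y, z) \<in> S"
  have disj: "u \<in> Field R \<Longrightarrow> u \<in> Field Q \<Longrightarrow> False" for u using disjoint by blast
  consider "x \<in> Field R" "y \<in> Field R" "z \<in> Field R" | "x \<in> Field R" "y \<in> Field R" "z \<in> Field Q"
    | "x \<in> Field R" "y \<in> Field Q" "z \<in> Field Q" | "x \<in> Field Q" "y \<in> Field Q" "z \<in> Field Q"
    using in_S_D[OF xy] in_S_D[OF yz] disj[of y] by blast
  then show ?thesis
  proof cases
    case 1
    then show ?thesis using xy yz R.le_trans mem_S(1) by blast
  next
    case 2
    then show ?thesis using xy yz R.le_trans[of x y a] mem_S(1,3) by blast
  next
    case 3
    then show ?thesis using xy yz Q.le_trans[of b y z] mem_S(2,3) by blast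
  next
    case 4
    then show ?thesis using xy yz Q.le_trans mem_S(2) by blast
  qed
qed

lemma finite_poset_S: "finite_poset S"
  unfolding finite_poset_def order_on_defs
proof (intro conjI)
  show "refl_on (Field S) S"
    unfolding refl_on_def Field_S using R.le_refl Q.le_refl unfolding slant_def by blast
  show "trans S" using trans_S unfolding trans_def by blast
  show "antisym S"
  proof (rule antisymI)
    fix x y assume xy: "(x, y) \<in> S" "(y, x) \<in> S"
    then have "x \<in> Field R \<and> y \<in> Field R \<or> x \<in> Field Q \<and> y \<in> Field Q"
      using in_S_D mem_S(4) by blast
    then show "x = y"
      using xy mem_S(1)[of x y] mem_S(1)[of y x] mem_S(2)[of x y] mem_S(2)[of y x]
        R.le_antisym[of x y] Q.le_antisym[of x y] by blast
  qed
  show "S \<subseteq> Field S \<times> Field S" by (auto simp: Field_def)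
  show "finite (Field S)" using Field_S R.finite_Field Q.finite_Field by simp
qed

sublocale S: fin_poset S
  using finite_poset_S by unfold_locales

text \<open>Every relation from \<open>R\<close> to \<open>Q\<close> passes through \<open>a\<close>
  and \<open>b\<close>, so it is a cover only if these are its ends.\<close>

lemma covers_S: "(x, y) \<in> cover_relations S \<longleftrightarrow>
  (x, y) \<in> cover_relations R \<or> (x, y) \<in> cover_relations Q \<or> x = a \<and> y = b"
proof -
  have disj: "u \<in> Field R \<Longrightarrow> u \<in> Field Q \<Longrightarrow> False" for u using disjoint by blast
  have R: "(x, y) \<in> cover_relations S \<longleftrightarrow> (x, y) \<in> cover_relations R" if "x \<in> Field R" "y \<in> Field R"
  proof -
    have "(x, t) \<in> S \<and> (t, y) \<in> S \<longleftrightarrow> (x, t) \<in> R \<and> (t, y) \<in> R" for t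
      using that in_S_D[of t y] disj[of y] mem_S(1) R.le_Field by blast
    then show ?thesis unfolding cover_relations_def using mem_S(1)[OF that] by simp
  qed
  have Q: "(x, y) \<in> cover_relations S \<longleftrightarrow> (x, y) \<in> cover_relations Q" if "x \<in> Field Q" "y \<in> Field Q"
  proof -
    have "(x, t) \<in> S \<and> (t, y) \<in> S \<longleftrightarrow> (x, t) \<in> Q \<and> (t, y) \<in> Q" for t
      using that in_S_D[of x t] disj[of x] mem_S(2) Q.le_Field by blast
    then show ?thesis unfolding cover_relations_def using mem_S(2)[OF that] by simp
  qed
  have ab: "(a, b) \<in> cover_relations S"
  proof (rule S.cvI)
    show "(a, b) \<in> S \<and> a \<noteq> b" using a b mem_S(3)[OF a b] R.le_refl Q.le_refl disj by blast
    fix t assume "(a, t) \<in> S" "(t, b) \<in> S"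
    then show "t = a \<or> t = b"
      using in_S_D[of a t] disj[of a] a b mem_S(1)[of a t] mem_S(3)[of t b] mem_S(2)[of t b] mem_S(3)[of a t]
        R.le_antisym[of a t] Q.le_antisym[of b t] by blast
  qed
  have cross: "x = a \<and> y = b" if c: "(x, y) \<in> cover_relations S" "x \<in> Field R" "y \<in> Field Q"
  proof -
    have "(x, y) \<in> S" using S.cv_lt[OF c(1)] by blast
    then have xa: "(x, a) \<in> R" "(b, y) \<in> Q" using mem_S(3)[OF c(2,3)] by blast+
    have "(x, a) \<in> S" "(a, y) \<in> S" "(x, b) \<in> S" "(b, y) \<in> S"
      using xa mem_S(1)[OF c(2) a] mem_S(3)[OF a c(3)] mem_S(3)[OF c(2) b] mem_S(2)[OF b c(3)]
        R.le_refl[OF a] Q.le_refl[OF b] by blast+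
    then show ?thesis
      using S.cv_between[OF c(1), of a] S.cv_between[OF c(1), of b] a b c(2,3) disj by blast
  qed
  have RF: "x \<in> Field R \<and> y \<in> Field R" if "(x, y) \<in> cover_relations R"
    using R.cv_lt[OF that] R.le_Field by blast
  have QF: "x \<in> Field Q \<and> y \<in> Field Q" if "(x, y) \<in> cover_relations Q"
    using Q.cv_lt[OF that] Q.le_Field by blast
  show ?thesis
  proof
    assume c: "(x, y) \<in> cover_relations S"
    then show "(x, y) \<in> cover_relations R \<or> (x, y) \<in> cover_relations Q \<or> x = a \<and> y = b"
      using in_S_D[of x y] S.cv_lt[OF c] R Q cross by blast
  next
    assume "(x, y) \<in> cover_relations R \<or> (x, y) \<in> cover_relations Q \<or> x = a \<and> y = b"
    then show "(x, y) \<in> cover_relations S" using R Q ab RF QF by blast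
  qed
qed

lemma interval_S:
  "w \<in> Field R \<Longrightarrow> z \<in> Field R \<Longrightarrow> poset_interval S w z = poset_interval R w z"
  "w \<in> Field Q \<Longrightarrow> z \<in> Field Q \<Longrightarrow> poset_interval S w z = poset_interval Q w z"
proof -
  have disj: "u \<in> Field R \<Longrightarrow> u \<in> Field Q \<Longrightarrow> False" for u using disjoint by blast
  show "poset_interval S w z = poset_interval R w z" if "w \<in> Field R" "z \<in> Field R"
  proof -
    have "(w, t) \<in> S \<and> (t, z) \<in> S \<longleftrightarrow> (w, t) \<in> R \<and> (t, z) \<in> R" for t
      using that in_S_D[of t z] disj[of z] mem_S(1) R.le_Field by blast
    then show ?thesis unfolding poset_interval_def by simp
  qed
  show "poset_interval S w z = poset_interval Q w z" if "w \<in> Field Q" "z \<in> Field Q"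
  proof -
    have "(w, t) \<in> S \<and> (t, z) \<in> S \<longleftrightarrow> (w, t) \<in> Q \<and> (t, z) \<in> Q" for t
      using that in_S_D[of w t] disj[of w] mem_S(2) Q.le_Field by blast
    then show ?thesis unfolding poset_interval_def by simp
  qed
qed

lemma dk_int_S_if: "dk_int R k w x y z \<Longrightarrow> dk_int S k w x y z" "dk_int Q k w x y z \<Longrightarrow> dk_int S k w x y z"
proof -
  show "dk_int R k w x y z \<Longrightarrow> dk_int S k w x y z"
  proof (induction rule: dk_int.induct)
    case (diamond x y w z)
    have "w \<in> Field R" "z \<in> Field R" using R.cv_lt R.le_Field diamond by blast+
    then show ?case using diamond covers_S interval_S(1) by (intro dk_int.diamond) auto
  next
    case (extend k w' x y z' w z)
    have "w \<in> Field R" "z \<in> Field R" "w' \<in> Field R" "z' \<in> Field R"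
      using R.cv_lt[OF extend.hyps(2)] R.cv_lt[OF extend.hyps(3)] R.le_Field by blast+
    then show ?case using extend covers_S interval_S(1) by (intro dk_int.extend[OF extend.IH]) auto
  qed
  show "dk_int Q k w x y z \<Longrightarrow> dk_int S k w x y z"
  proof (induction rule: dk_int.induct)
    case (diamond x y w z)
    have "w \<in> Field Q" "z \<in> Field Q" using Q.cv_lt Q.le_Field diamond by blast+
    then show ?case using diamond covers_S interval_S(2) by (intro dk_int.diamond) auto
  next
    case (extend k w' x y z' w z)
    have "w \<in> Field Q" "z \<in> Field Q" "w' \<in> Field Q" "z' \<in> Field Q"
      using Q.cv_lt[OF extend.hyps(2)] Q.cv_lt[OF extend.hyps(3)] Q.le_Field by blast+
    then show ?case using extend covers_S interval_S(2) by (intro dk_int.extend[OF extend.IH]) auto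
  qed
qed

end

text \<open>\<open>a_max\<close> leaves \<open>a\<close> with \<open>b\<close> as its only cover. An
  interval with top \<open>b\<close> would violate axiom (2), because \<open>b\<close> now also
  covers \<open>a\<close>; an interval with bottom \<open>b\<close> would be extended downwards by
  \<open>a\<close> and call for a new top. Acyclicity of \<open>b\<close> excludes both.\<close>

locale dcomplete_slant = R: dcomplete R + Q: dcomplete Q for R Q :: "'a rel" +
  fixes a b :: 'a
  assumes disjoint: "Field R \<inter> Field Q = {}" and a: "a \<in> Field R"
    and a_max: "\<And>x. x \<in> Field R \<Longrightarrow> (x, a) \<in> R" and b: "acyclic_element Q b"
begin

lemma b_Field: "b \<in> Field Q" and b_bottom: "\<not> dk_int Q k b x y z" and b_top: "\<not> dk_int Q k w x y b"
  using b unfolding Q.acyclic_element_iff by blast+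

sublocale slant_sum R Q a b
  using disjoint a b_Field by unfold_locales

lemma cover_into_R: "(x, y) \<in> cover_relations S \<Longrightarrow> y \<in> Field R \<Longrightarrow> (x, y) \<in> cover_relations R"
  and cover_from_Q: "(x, y) \<in> cover_relations S \<Longrightarrow> x \<in> Field Q \<Longrightarrow> (x, y) \<in> cover_relations Q"
proof -
  have disj: "u \<in> Field R \<Longrightarrow> u \<in> Field Q \<Longrightarrow> False" for u using disjoint by blast
  show "(x, y) \<in> cover_relations S \<Longrightarrow> y \<in> Field R \<Longrightarrow> (x, y) \<in> cover_relations R"
    using covers_S[of x y] Q.cv_lt[of x y] Q.le_Field(2)[of x y] b_Field disj by blast
  show "(x, y) \<in> cover_relations S \<Longrightarrow> x \<in> Field Q \<Longrightarrow> (x, y) \<in> cover_relations Q"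
    using covers_S[of x y] R.cv_lt[of x y] R.le_Field(1)[of x y] a disj by blast
qed

lemma cover_from_R: "(x, y) \<in> cover_relations S \<Longrightarrow> x \<in> Field R \<Longrightarrow> (x, y) \<in> cover_relations R \<or> x = a \<and> y = b"
  and cover_into_Q: "(x, y) \<in> cover_relations S \<Longrightarrow> y \<in> Field Q \<Longrightarrow> (x, y) \<in> cover_relations Q \<or> x = a \<and> y = b"
proof -
  have disj: "u \<in> Field R \<Longrightarrow> u \<in> Field Q \<Longrightarrow> False" for u using disjoint by blast
  show "(x, y) \<in> cover_relations S \<Longrightarrow> x \<in> Field R \<Longrightarrow> (x, y) \<in> cover_relations R \<or> x = a \<and> y = b"
    using covers_S[of x y] Q.cv_lt[of x y] Q.le_Field(1)[of x y] disj by blast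
  show "(x, y) \<in> cover_relations S \<Longrightarrow> y \<in> Field Q \<Longrightarrow> (x, y) \<in> cover_relations Q \<or> x = a \<and> y = b"
    using covers_S[of x y] R.cv_lt[of x y] R.le_Field(2)[of x y] disj by blast
qed

lemma no_cover_of_a: "(a, x) \<notin> cover_relations R"
  using R.cv_lt[of a x] R.le_Field(2)[of a x] a_max[of x] R.le_antisym[of a x] by blast

text \<open>The new cover is the only one of \<open>a\<close>, so it never takes part in a
  diamond.\<close>

lemma two_covers_S:
  assumes "x \<noteq> y" "(w, x) \<in> cover_relations S" "(w, y) \<in> cover_relations S"
  shows "(w, x) \<in> cover_relations R \<and> (w, y) \<in> cover_relations R \<or>
    (w, x) \<in> cover_relations Q \<and> (w, y) \<in> cover_relations Q"
proof -
  have "w \<in> Field R \<or> w \<in> Field Q" using S.cv_lt[OF assms(2)] S.le_Field Field_S by blast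
  then show ?thesis
    using assms cover_from_R[of w x] cover_from_R[of w y] cover_from_Q[of w x] cover_from_Q[of w y]
      no_cover_of_a[of x] no_cover_of_a[of y] by blast
qed

lemma extend_S_R:
  assumes "dk_int R k w' x y z'" "(w, w') \<in> cover_relations S" "poset_interval S w z' = insert w (poset_interval S w' z')"
  shows "(w, w') \<in> cover_relations R" "poset_interval R w z' = insert w (poset_interval R w' z')"
proof -
  have F: "w' \<in> Field R" "z' \<in> Field R" using R.dk_int_lt[OF assms(1)] R.le_Field by blast+
  show c: "(w, w') \<in> cover_relations R" using cover_into_R[OF assms(2) F(1)] .
  then have "w \<in> Field R" using R.cv_lt[OF c] R.le_Field by blast
  then show "poset_interval R w z' = insert w (poset_interval R w' z')"
    using assms(3) interval_S(1) F by simp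
qed

lemma extend_S_Q:
  assumes "dk_int Q k w' x y z'" "(w, w') \<in> cover_relations S" "poset_interval S w z' = insert w (poset_interval S w' z')"
  shows "(w, w') \<in> cover_relations Q" "poset_interval Q w z' = insert w (poset_interval Q w' z')"
proof -
  have F: "w' \<in> Field Q" "z' \<in> Field Q" using Q.dk_int_lt[OF assms(1)] Q.le_Field by blast+
  have "w' \<noteq> b" using assms(1) b_bottom by blast
  then show c: "(w, w') \<in> cover_relations Q" using cover_into_Q[OF assms(2) F(1)] by blast
  then have "w \<in> Field Q" using Q.cv_lt[OF c] Q.le_Field by blast
  then show "poset_interval Q w z' = insert w (poset_interval Q w' z')"
    using assms(3) interval_S(2) F by simp
qed

text \<open>The slant sum creates no interval: a diamond cannot use the new cover, and an interval
  cannot be extended through it, neither upwards from the top \<open>a\<close> of \<open>R\<close>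
  nor downwards from \<open>b\<close>.\<close>

lemma dk_int_S_iff: "dk_int S k w x y z \<longleftrightarrow> dk_int R k w x y z \<or> dk_int Q k w x y z"
proof
  assume "dk_int S k w x y z"
  then show "dk_int R k w x y z \<or> dk_int Q k w x y z"
  proof (induction rule: dk_int.induct)
    case (diamond x y w z)
    from two_covers_S[OF diamond(1-3)] show ?case
    proof
      assume c: "(w, x) \<in> cover_relations R \<and> (w, y) \<in> cover_relations R"
      then have "x \<in> Field R" "y \<in> Field R" using R.cv_lt R.le_Field by blast+
      then have "(x, z) \<in> cover_relations R \<or> x = a \<and> z = b" "(y, z) \<in> cover_relations R \<or> y = a \<and> z = b"
        using cover_from_R[OF diamond(4)] cover_from_R[OF diamond(5)] by blast+
      then have c2: "(x, z) \<in> cover_relations R" "(y, z) \<in> cover_relations R"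
        using diamond(1) \<open>x \<in> Field R\<close> \<open>y \<in> Field R\<close> R.cv_lt[of _ z] R.le_Field(2)[of _ z] b_Field disjoint by blast+
      then have "w \<in> Field R" "z \<in> Field R" using c R.cv_lt R.le_Field by blast+
      then show ?case using c c2 diamond interval_S(1) dk_int.diamond[of x y w R z] by simp
    next
      assume c: "(w, x) \<in> cover_relations Q \<and> (w, y) \<in> cover_relations Q"
      then have "x \<in> Field Q" "y \<in> Field Q" using Q.cv_lt Q.le_Field by blast+
      then have c2: "(x, z) \<in> cover_relations Q" "(y, z) \<in> cover_relations Q"
        using cover_from_Q[OF diamond(4)] cover_from_Q[OF diamond(5)] by blast+
      then have "w \<in> Field Q" "z \<in> Field Q" using c Q.cv_lt Q.le_Field by blast+
      then show ?case using c c2 diamond interval_S(2) dk_int.diamond[of x y w Q z] by simp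
    qed
  next
    case (extend k w' x y z' w z)
    have wz: "(w', z') \<in> S" using extend.IH R.dk_int_lt Q.dk_int_lt unfolding slant_def by blast
    have int: "poset_interval S w z' = insert w (poset_interval S w' z')"
      using S.interval_shrink[OF extend.hyps(2,3) wz extend.hyps(4)] .
    from extend.IH show ?case
    proof
      assume d: "dk_int R k w' x y z'"
      note c = extend_S_R[OF d extend.hyps(2) int]
      \<comment> \<open>Completing inside \<open>R\<close> shows that \<open>z'\<close> has a cover
        there. So it is not the top \<open>a\<close>, and its cover \<open>z\<close> lies in
        \<open>R\<close> as well.\<close>
      obtain t where "(z', t) \<in> cover_relations R" using R.extend_completion[OF d c] by blast
      then have "z' \<noteq> a" using no_cover_of_a by blast
      moreover have F: "z' \<in> Field R" "w' \<in> Field R" using R.dk_int_lt[OF d] R.le_Field by blast+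
      ultimately have c2: "(z', z) \<in> cover_relations R" using cover_from_R[OF extend.hyps(3)] by blast
      have "w \<in> Field R" "z \<in> Field R" using R.cv_lt[OF c(1)] R.cv_lt[OF c2] R.le_Field by blast+
      then show ?case using dk_int.extend[OF d c(1) c2] extend.hyps(4) interval_S(1) F by simp
    next
      assume d: "dk_int Q k w' x y z'"
      note c = extend_S_Q[OF d extend.hyps(2) int]
      have F: "z' \<in> Field Q" "w' \<in> Field Q" using Q.dk_int_lt[OF d] Q.le_Field by blast+
      have c2: "(z', z) \<in> cover_relations Q" using cover_from_Q[OF extend.hyps(3) F(1)] .
      have "w \<in> Field Q" "z \<in> Field Q" using Q.cv_lt[OF c(1)] Q.cv_lt[OF c2] Q.le_Field by blast+
      then show ?case using dk_int.extend[OF d c(1) c2] extend.hyps(4) interval_S(2) F by simp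
    qed
  qed
next
  assume "dk_int R k w x y z \<or> dk_int Q k w x y z"
  then show "dk_int S k w x y z" using dk_int_S_if by blast
qed

lemma dcomp_S: "dcomp S"
  unfolding dcomp_def
proof (intro conjI allI impI finite_poset_S; (elim conjE)?)
  fix w x y assume V: "x \<noteq> y" "(w, x) \<in> cover_relations S" "(w, y) \<in> cover_relations S"
  from two_covers_S[OF V] show "\<exists>z. dk_int S 3 w x y z"
    using R.diamond_completion[OF V(1)] Q.diamond_completion[OF V(1)] dk_int_S_if by blast
next
  fix k w w' x y z'
  assume d: "dk_int S k w' x y z'" and c: "(w, w') \<in> cover_relations S"
    and int: "poset_interval S w z' = insert w (poset_interval S w' z')"
  from d[unfolded dk_int_S_iff]
  show "\<exists>z. (z', z) \<in> cover_relations S \<and> poset_interval S w z = insert w (insert z (poset_interval S w' z'))"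
  proof
    assume d: "dk_int R k w' x y z'"
    note e = extend_S_R[OF d c int]
    obtain z where z: "(z', z) \<in> cover_relations R" "poset_interval R w z = insert w (insert z (poset_interval R w' z'))"
      using R.extend_completion[OF d e] by blast
    have "w \<in> Field R" "z \<in> Field R" "w' \<in> Field R" "z' \<in> Field R"
      using R.cv_lt[OF e(1)] R.cv_lt[OF z(1)] R.le_Field by blast+
    then show ?thesis using z covers_S interval_S(1) by (intro exI[of _ z]) simp
  next
    assume d: "dk_int Q k w' x y z'"
    note e = extend_S_Q[OF d c int]
    obtain z where z: "(z', z) \<in> cover_relations Q" "poset_interval Q w z = insert w (insert z (poset_interval Q w' z'))"
      using Q.extend_completion[OF d e] by blast
    have "w \<in> Field Q" "z \<in> Field Q" "w' \<in> Field Q" "z' \<in> Field Q"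
      using Q.cv_lt[OF e(1)] Q.cv_lt[OF z(1)] Q.le_Field by blast+
    then show ?thesis using z covers_S interval_S(2) by (intro exI[of _ z]) simp
  qed
next
  fix k w x y z v assume d: "dk_int S k w x y z" and v: "(v, z) \<in> cover_relations S"
  from d[unfolded dk_int_S_iff] show "(w, v) \<in> S"
  proof
    assume d: "dk_int R k w x y z"
    then have "z \<in> Field R" using R.dk_int_lt R.le_Field by blast
    then show ?thesis using R.top_cover_ge[OF d cover_into_R[OF v]] unfolding slant_def by blast
  next
    assume d: "dk_int Q k w x y z"
    then have "z \<in> Field Q" "z \<noteq> b" using Q.dk_int_lt[OF d] Q.le_Field b_top by blast+
    then have "(v, z) \<in> cover_relations Q" using cover_into_Q[OF v] by blast
    then show ?thesis using Q.top_cover_ge[OF d] unfolding slant_def by blast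
  qed
next
  fix w u x y
  assume V: "x \<noteq> y" "(w, x) \<in> cover_relations S" "(w, y) \<in> cover_relations S"
    "(u, x) \<in> cover_relations S" "(u, y) \<in> cover_relations S"
  from two_covers_S[OF V(1-3)] show "w = u"
  proof
    assume c: "(w, x) \<in> cover_relations R \<and> (w, y) \<in> cover_relations R"
    then have "x \<in> Field R" "y \<in> Field R" using R.cv_lt R.le_Field by blast+
    then show ?thesis using R.diamond_bottom_unique[OF V(1)] c cover_into_R V(4,5) by blast
  next
    assume c: "(w, x) \<in> cover_relations Q \<and> (w, y) \<in> cover_relations Q"
    then have "x \<in> Field Q" "y \<in> Field Q" using Q.cv_lt Q.le_Field by blast+
    moreover have "(u, x) \<in> cover_relations R \<and> (u, y) \<in> cover_relations R \<or>
        (u, x) \<in> cover_relations Q \<and> (u, y) \<in> cover_relations Q" by (rule two_covers_S[OF V(1,4,5)])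
    moreover have "(u, x) \<notin> cover_relations R"
      using calculation(1) R.cv_lt[of u x] R.le_Field(2)[of u x] disjoint by blast
    ultimately show ?thesis using Q.diamond_bottom_unique[OF V(1)] c by blast
  qed
next
  fix k u w w' x y z'
  assume d: "dk_int S k w' x y z'" and c: "(w, w') \<in> cover_relations S" "poset_interval S w z' = insert w (poset_interval S w' z')"
    and c': "(u, w') \<in> cover_relations S" "poset_interval S u z' = insert u (poset_interval S w' z')"
  from d[unfolded dk_int_S_iff] show "u = w"
  proof
    assume d: "dk_int R k w' x y z'"
    show ?thesis using R.extend_bottom_unique[OF d extend_S_R[OF d c] extend_S_R[OF d c']] .
  next
    assume d: "dk_int Q k w' x y z'"
    show ?thesis using Q.extend_bottom_unique[OF d extend_S_Q[OF d c] extend_S_Q[OF d c']] .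
  qed
qed

lemma acyclic_element_S:
  assumes "acyclic_element R q \<or> acyclic_element Q q"
  shows "acyclic_element S q"
proof -
  interpret S: dcomplete S by unfold_locales (rule dcomp_S)
  have RF: "p \<in> Field R" "t \<in> Field R" if "dk_int R k p x y t" for k p x y t
    using R.dk_int_lt[OF that] R.le_Field by blast+
  have QF: "p \<in> Field Q" "t \<in> Field Q" if "dk_int Q k p x y t" for k p x y t
    using Q.dk_int_lt[OF that] Q.le_Field by blast+
  have "q \<in> Field R \<or> q \<in> Field Q"
    using assms unfolding R.acyclic_element_iff Q.acyclic_element_iff by blast
  then show ?thesis
  proof
    assume q: "q \<in> Field R"
    then have "q \<notin> Field Q" using disjoint by blast
    then have "\<not> dk_int Q k q x y z" "\<not> dk_int Q k w x y q" for k w x y z using QF by blast+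
    moreover have "acyclic_element R q" using assms \<open>q \<notin> Field Q\<close> Q.acyclic_element_iff by blast
    ultimately show ?thesis unfolding S.acyclic_element_iff R.acyclic_element_iff dk_int_S_iff Field_S by blast
  next
    assume q: "q \<in> Field Q"
    then have "q \<notin> Field R" using disjoint by blast
    then have "\<not> dk_int R k q x y z" "\<not> dk_int R k w x y q" for k w x y z using RF by blast+
    moreover have "acyclic_element Q q" using assms \<open>q \<notin> Field R\<close> R.acyclic_element_iff by blast
    ultimately show ?thesis unfolding S.acyclic_element_iff Q.acyclic_element_iff dk_int_S_iff Field_S by blast
  qed
qed

end


section \<open>Generated orders\<close>

lemma generated_order_iff:
  assumes "E \<subseteq> V \<times> V"
  shows "(x, y) \<in> generated_order V E \<longleftrightarrow> x \<in> V \<and> (x, y) \<in> E\<^sup>*"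
proof -
  have "E\<^sup>+ \<subseteq> V \<times> V" using assms by (rule trancl_subset_Sigma)
  then show ?thesis unfolding generated_order_def by (auto simp: rtrancl_eq_or_trancl)
qed

lemma Field_generated_order:
  assumes "E \<subseteq> V \<times> V"
  shows "Field (generated_order V E) = V"
proof -
  have "E\<^sup>+ \<subseteq> V \<times> V" using assms by (rule trancl_subset_Sigma)
  moreover have "(x, x) \<in> generated_order V E" if "x \<in> V" for x using that by (auto simp: generated_order_def)
  ultimately show ?thesis
    unfolding Field_def generated_order_def by auto
qed

lemma generated_order_least:
  assumes "\<And>x. x \<in> V \<Longrightarrow> (x, x) \<in> R" "trans R" "E \<subseteq> R"
  shows "generated_order V E \<subseteq> R"
proof -
  have "E\<^sup>+ \<subseteq> R" using trancl_mono_subset[OF assms(3)] trancl_id[OF assms(2)] by simp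
  then show ?thesis using assms(1) unfolding generated_order_def by auto
qed

lemma trans_generated_order: "trans (generated_order V E)"
  unfolding generated_order_def trans_def by (auto intro: trancl_trans)

lemma generated_order_refl: "x \<in> V \<Longrightarrow> (x, x) \<in> generated_order V E"
  and generated_order_base: "E \<subseteq> generated_order V E"
  unfolding generated_order_def by auto

lemma generated_order_mono:
  assumes "V \<subseteq> V'" "E \<subseteq> E'"
  shows "generated_order V E \<subseteq> generated_order V' E'"
proof (rule generated_order_least[OF _ trans_generated_order])
  show "E \<subseteq> generated_order V' E'" using assms(2) generated_order_base by blast
qed (rule generated_order_refl, use assms(1) in blast)

text \<open>Used to flatten the nested transitive closures in the definitions of mobile posets and
  folds into one set of generators.\<close>

lemma generated_order_absorb:
  assumes "V' \<subseteq> V"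
  shows "generated_order V (generated_order V' E \<union> E') = generated_order V (E \<union> E')"
proof
  show "generated_order V (generated_order V' E \<union> E') \<subseteq> generated_order V (E \<union> E')"
  proof (rule generated_order_least[OF _ trans_generated_order])
    have "generated_order V' E \<subseteq> generated_order V (E \<union> E')"
      by (rule generated_order_mono[OF assms]) blast
    then show "generated_order V' E \<union> E' \<subseteq> generated_order V (E \<union> E')"
      using generated_order_base[of "E \<union> E'" V] by blast
  qed (rule generated_order_refl)
  show "generated_order V (E \<union> E') \<subseteq> generated_order V (generated_order V' E \<union> E')"
    by (rule generated_order_mono) (use generated_order_base in blast)+
qed

lemma generated_order_id:
  assumes "Partial_order R"
  shows "generated_order (Field R) R = R"
proof
  show "generated_order (Field R) R \<subseteq> R"
    by (rule generated_order_least) (use assms in \<open>auto simp: order_on_defs refl_on_def\<close>)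
qed (rule generated_order_base)

text \<open>\<open>slant\<close> contains the generators and is transitive, which gives one
  inclusion; the other holds because its cross relations are compositions through the edge.\<close>

lemma generated_order_bridge:
  assumes E: "E \<subseteq> A \<times> A" "E' \<subseteq> B \<times> B" and AB: "A \<inter> B = {}" and a: "a \<in> A" and b: "b \<in> B"
  shows "generated_order (A \<union> B) (E \<union> E' \<union> {(a, b)}) = slant (generated_order A E) a (generated_order B E') b"
    (is "?G = ?S")
proof
  let ?R = "generated_order A E" and ?Q = "generated_order B E'"
  have RA: "?R \<subseteq> A \<times> A" and QB: "?Q \<subseteq> B \<times> B"
    using Field_generated_order[OF E(1)] Field_generated_order[OF E(2)] by (auto intro: FieldI1 FieldI2)
  have tR: "(x, u) \<in> ?R" if "(x, y) \<in> ?R" "(y, u) \<in> ?R" for x y u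
    using trans_generated_order that by (rule transD)
  have tQ: "(x, u) \<in> ?Q" if "(x, y) \<in> ?Q" "(y, u) \<in> ?Q" for x y u
    using trans_generated_order that by (rule transD)
  show "?G \<subseteq> ?S"
  proof (rule generated_order_least)
    show "(x, x) \<in> ?S" if "x \<in> A \<union> B" for x
      using that generated_order_refl[of x A E] generated_order_refl[of x B E'] unfolding slant_def by blast
    show "E \<union> E' \<union> {(a, b)} \<subseteq> ?S"
      using generated_order_base[of E A] generated_order_base[of E' B] generated_order_refl[OF a] generated_order_refl[OF b]
      unfolding slant_def by blast
    show "trans ?S"
    proof (rule transI)
      fix x y u assume xy: "(x, y) \<in> ?S" and yu: "(y, u) \<in> ?S"
      have n: "\<not> (v \<in> A \<and> v \<in> B)" for v using AB by blast
      from xy have "(x, y) \<in> ?R \<or> (x, y) \<in> ?Q \<or> (x, a) \<in> ?R \<and> (b, y) \<in> ?Q" unfolding slant_def by blast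
      moreover from yu have "(y, u) \<in> ?R \<or> (y, u) \<in> ?Q \<or> (y, a) \<in> ?R \<and> (b, u) \<in> ?Q" unfolding slant_def by blast
      ultimately have "(x, u) \<in> ?R \<or> (x, u) \<in> ?Q \<or> (x, a) \<in> ?R \<and> (b, u) \<in> ?Q"
        using RA QB n[of y] tR[of x y] tQ[of x y u] tQ[of b y u] by blast
      then show "(x, u) \<in> ?S" unfolding slant_def by blast
    qed
  qed
  have "?R \<subseteq> ?G" "?Q \<subseteq> ?G" by (rule generated_order_mono; blast)+
  moreover have "(a, b) \<in> ?G" using generated_order_base by blast
  moreover have "(x, y) \<in> ?G" if "(x, a) \<in> ?G" "(a, b) \<in> ?G" "(b, y) \<in> ?G" for x y
    using that trans_generated_order[of "A \<union> B" "E \<union> E' \<union> {(a, b)}"] by (meson transD)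
  ultimately show "?S \<subseteq> ?G" unfolding slant_def by blast
qed

lemma (in fin_poset) hasse_connection_eq: "hasse_connection r = (r \<union> r\<inverse>)\<^sup>*"
proof
  have "cover_relations r \<subseteq> r" by (auto simp: cover_relations_def)
  then show "hasse_connection r \<subseteq> (r \<union> r\<inverse>)\<^sup>*"
    unfolding hasse_connection_def by (intro rtrancl_mono) blast
  have "r \<subseteq> (cover_relations r)\<^sup>*" using le_cover_rtrancl by auto
  then have "r \<subseteq> hasse_connection r"
    unfolding hasse_connection_def using rtrancl_mono[of "cover_relations r" "cover_relations r \<union> (cover_relations r)\<inverse>"] by blast
  moreover have "sym (hasse_connection r)"
    unfolding hasse_connection_def by (intro sym_rtrancl) (auto simp: sym_def)
  ultimately have "r \<union> r\<inverse> \<subseteq> hasse_connection r" by (auto dest: symD)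
  then show "(r \<union> r\<inverse>)\<^sup>* \<subseteq> hasse_connection r"
    unfolding hasse_connection_def by (metis rtrancl_idemp rtrancl_mono)
qed

lemma sym_sym_rtrancl: "sym ((E \<union> E\<inverse>)\<^sup>*)"
  by (intro sym_rtrancl) (auto simp: sym_def)

text \<open>Covers and generators link the same elements when directions are ignored, so
  connectedness can be checked on the generators.\<close>

lemma hasse_connection_generated:
  assumes E: "E \<subseteq> V \<times> V" and "finite_poset (generated_order V E)"
  shows "hasse_connection (generated_order V E) = (E \<union> E\<inverse>)\<^sup>*"
proof -
  let ?G = "generated_order V E"
  interpret fin_poset ?G using assms(2) by unfold_locales
  have "?G \<subseteq> (E \<union> E\<inverse>)\<^sup>*"
    using generated_order_iff[OF E] rtrancl_mono[of E "E \<union> E\<inverse>"] by auto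
  then have "?G \<union> ?G\<inverse> \<subseteq> (E \<union> E\<inverse>)\<^sup>*" using sym_sym_rtrancl[of E] by (auto dest: symD)
  then have "(?G \<union> ?G\<inverse>)\<^sup>* \<subseteq> (E \<union> E\<inverse>)\<^sup>*" by (metis rtrancl_idemp rtrancl_mono)
  moreover have "(E \<union> E\<inverse>)\<^sup>* \<subseteq> (?G \<union> ?G\<inverse>)\<^sup>*"
    using generated_order_base[of E V] by (intro rtrancl_mono) blast
  ultimately show ?thesis using hasse_connection_eq by blast
qed

lemma connected_poset_generated:
  assumes "E \<subseteq> V \<times> V" "finite_poset (generated_order V E)"
  shows "connected_poset (generated_order V E) \<longleftrightarrow> V \<noteq> {} \<and> (\<forall>x \<in> V. \<forall>y \<in> V. (x, y) \<in> (E \<union> E\<inverse>)\<^sup>*)"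
  unfolding connected_poset_def Field_generated_order[OF assms(1)] hasse_connection_generated[OF assms] ..

section \<open>The unique maximal element of a connected d-complete poset\<close>

context dcomplete
begin

lemma ex_maximal_above: "x \<in> Field r \<Longrightarrow> \<exists>m. x \<preceq> m \<and> m \<in> maximal_elements r (Field r)"
proof (induction x rule: up_induct)
  case (greater x)
  show ?case
  proof (cases "x \<in> maximal_elements r (Field r)")
    case True
    then show ?thesis using le_refl greater.prems by blast
  next
    case False
    then obtain y where y: "x \<prec> y" "y \<in> Field r" using greater.prems unfolding maximal_elements_def by blast
    then obtain m where "y \<preceq> m" "m \<in> maximal_elements r (Field r)" using greater.IH by blast
    then show ?thesis using y le_trans[of x y m] by blast
  qed
qed

text \<open>A confluence argument: two different covers of \<open>x\<close> complete to a diamond,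
  hence have a maximal element above both, to which each branch is compared by induction.\<close>

lemma maximal_above_unique:
  assumes "x \<preceq> m" "x \<preceq> m'" "m \<in> maximal_elements r (Field r)" "m' \<in> maximal_elements r (Field r)"
  shows "m = m'"
  using assms
proof (induction x arbitrary: m m' rule: up_induct)
  case (greater x)
  have mx: "y = m" if "m \<preceq> y" for y using that greater.prems(3) le_Field(2)[OF that] unfolding maximal_elements_def by blast
  have mx': "y = m'" if "m' \<preceq> y" for y using that greater.prems(4) le_Field(2)[OF that] unfolding maximal_elements_def by blast
  show ?case
  proof (cases "x = m \<or> x = m'")
    case True
    then show ?thesis using mx[of m'] mx'[of m] greater.prems by blast
  next
    case False
    obtain y where y: "x \<prec>\<cdot> y" "y \<preceq> m" using ex_cover_above False greater.prems by blast
    obtain y' where y': "x \<prec>\<cdot> y'" "y' \<preceq> m'" using ex_cover_above False greater.prems by blast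
    note lt = cv_lt[OF y(1)] cv_lt[OF y'(1)]
    obtain u where u: "y \<preceq> u" "y' \<preceq> u" "u \<in> maximal_elements r (Field r)"
    proof (cases "y = y'")
      case True
      then show ?thesis using that y greater.prems(3) by blast
    next
      case False
      then obtain z where z: "dk_int r 3 x y y' z" using diamond_completion y y' by blast
      have yz: "y \<preceq> z" "y' \<preceq> z" using dk_int_D[OF z] by blast+
      obtain u where "z \<preceq> u" "u \<in> maximal_elements r (Field r)" using ex_maximal_above le_Field(2)[OF yz(1)] by blast
      then show ?thesis using that yz le_trans[of y z u] le_trans[of y' z u] by blast
    qed
    have "m = u" using greater.IH[OF lt(1) y(2) u(1) greater.prems(3) u(3)] .
    moreover have "m' = u" using greater.IH[OF lt(2) y'(2) u(2) greater.prems(4) u(3)] .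
    ultimately show ?thesis by simp
  qed
qed

text \<open>Lying below the maximal element \<open>t\<close> passes along covers in both directions,
  upwards by \<open>maximal_above_unique\<close>, and hence through the whole component.\<close>

lemma connected_max:
  assumes "connected_poset r"
  obtains t where "t \<in> Field r" "\<And>x. x \<in> Field r \<Longrightarrow> x \<preceq> t" "maximal_elements r (Field r) = {t}"
proof -
  obtain x0 where x0: "x0 \<in> Field r" using assms unfolding connected_poset_def by blast
  obtain t where t: "x0 \<preceq> t" "t \<in> maximal_elements r (Field r)" using ex_maximal_above[OF x0] by blast
  have cv: "x \<preceq> t \<longleftrightarrow> y \<preceq> t" if "x \<prec>\<cdot> y" for x y
  proof
    have xy: "x \<preceq> y" using cv_lt[OF that] by blast
    show "y \<preceq> t \<Longrightarrow> x \<preceq> t" using xy le_trans by blast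
    assume xt: "x \<preceq> t"
    obtain u where u: "y \<preceq> u" "u \<in> maximal_elements r (Field r)" using ex_maximal_above le_Field(2)[OF xy] by blast
    then have "u = t" using maximal_above_unique[of x u t] xt t(2) le_trans[OF xy u(1)] by blast
    then show "y \<preceq> t" using u by simp
  qed
  have all: "x \<preceq> t" if "x \<in> Field r" for x
  proof -
    have "(x0, x) \<in> (cover_relations r \<union> (cover_relations r)\<inverse>)\<^sup>*"
      using assms that x0 unfolding connected_poset_def hasse_connection_def by blast
    then show ?thesis
    proof induction
      case base
      then show ?case using t(1) .
    next
      case (step y z)
      then show ?case using cv by blast
    qed
  qed
  have tF: "t \<in> Field r" using le_Field(2)[OF t(1)] .
  have "maximal_elements r (Field r) = {t}"
  proof -
    have "u = t" if "u \<in> maximal_elements r (Field r)" for u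
      using that all[of u] tF unfolding maximal_elements_def by blast
    then show ?thesis using t(2) by blast
  qed
  then show ?thesis using that tF all by blast
qed

end

lemma dcomp_slant:
  assumes "dcomp R" "dcomp Q" "Field R \<inter> Field Q = {}" "a \<in> Field R" "\<And>x. x \<in> Field R \<Longrightarrow> (x, a) \<in> R"
    "acyclic_element Q b"
  shows "dcomp (slant R a Q b)"
    "acyclic_element R q \<or> acyclic_element Q q \<Longrightarrow> acyclic_element (slant R a Q b) q"
proof -
  interpret dcomplete_slant R Q a b
    using assms by unfold_locales
  show "dcomp (slant R a Q b)" by (rule dcomp_S)
  show "acyclic_element R q \<or> acyclic_element Q q \<Longrightarrow> acyclic_element (slant R a Q b) q"
    by (rule acyclic_element_S)
qed

lemma dcomp_singleton: "dcomp {(z, z)}" "acyclic_element {(z, z)} z"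
proof -
  have c: "cover_relations {(z, z)} = {}" by (auto simp: cover_relations_def)
  have n: "\<not> dk_int {(z, z)} k w x y t" for k w x y t
    by (rule notI, erule dk_int.cases) (auto simp: c)
  have "finite_poset {(z, z)}"
    by (auto simp: finite_poset_def order_on_defs refl_on_def trans_def antisym_def)
  then show d: "dcomp {(z, z)}" unfolding dcomp_def by (auto simp: c n)
  interpret dcomplete "{(z, z)}" by unfold_locales (rule d)
  show "acyclic_element {(z, z)} z" unfolding acyclic_element_iff using n by auto
qed

lemma generated_order_singleton: "generated_order {z} {} = {(z, z)}"
  by (auto simp: generated_order_def)

text \<open>The posets are hung at \<open>z\<close> one after the other as slant sums. Each step
  keeps \<open>z\<close> acyclic, so the next one can be attached at the same place.\<close>

lemma dcomp_hang:
  assumes fin: "finite \<D>" and E0: "E0 \<subseteq> V0 \<times> V0" and base: "dcomp (generated_order V0 E0)" "acyclic_element (generated_order V0 E0) z"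
    and z: "z \<in> V0"
    and D: "\<And>D. D \<in> \<D> \<Longrightarrow> dcomp D \<and> connected_poset D \<and> Field D \<inter> V0 = {}"
    and disj: "\<And>D D'. D \<in> \<D> \<Longrightarrow> D' \<in> \<D> \<Longrightarrow> D \<noteq> D' \<Longrightarrow> Field D \<inter> Field D' = {}"
  defines "V \<equiv> V0 \<union> (\<Union>D \<in> \<D>. Field D)"
    and "E \<equiv> E0 \<union> (\<Union>D \<in> \<D>. D \<union> maximal_elements D (Field D) \<times> {z})"
  shows "E \<subseteq> V \<times> V \<and> dcomp (generated_order V E) \<and> acyclic_element (generated_order V E) z \<and>
    ((\<forall>x \<in> V0. (x, z) \<in> generated_order V0 E0) \<longrightarrow> (\<forall>x \<in> V. (x, z) \<in> generated_order V E))"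
  using fin D disj unfolding V_def E_def
proof (induction \<D> rule: finite_induct)
  case empty
  then show ?case using E0 base by simp
next
  case (insert D \<D>)
  let ?V = "V0 \<union> (\<Union>D \<in> \<D>. Field D)" and ?E = "E0 \<union> (\<Union>D \<in> \<D>. D \<union> maximal_elements D (Field D) \<times> {z})"
  have IH: "?E \<subseteq> ?V \<times> ?V" "dcomp (generated_order ?V ?E)" "acyclic_element (generated_order ?V ?E) z"
    "(\<forall>x \<in> V0. (x, z) \<in> generated_order V0 E0) \<longrightarrow> (\<forall>x \<in> ?V. (x, z) \<in> generated_order ?V ?E)"
    using insert.IH insert.prems by simp_all
  have dD: "dcomp D" "connected_poset D" "Field D \<inter> V0 = {}" using insert.prems(1) by blast+
  interpret D: dcomplete D by unfold_locales (rule dD(1))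
  obtain t where t: "t \<in> Field D" "\<And>x. x \<in> Field D \<Longrightarrow> (x, t) \<in> D" "maximal_elements D (Field D) = {t}"
    using D.connected_max[OF dD(2)] by blast
  have "Field D \<inter> Field D' = {}" if "D' \<in> \<D>" for D'
    using insert.prems(2)[of D D'] that insert.hyps(2) by blast
  then have DV: "Field D \<inter> ?V = {}" using dD(3) by blast
  have DD: "D \<subseteq> Field D \<times> Field D" by (auto simp: Field_def)
  have eqV: "V0 \<union> (\<Union>D \<in> insert D \<D>. Field D) = Field D \<union> ?V" by blast
  have eqE: "E0 \<union> (\<Union>D \<in> insert D \<D>. D \<union> maximal_elements D (Field D) \<times> {z}) = D \<union> ?E \<union> {(t, z)}"
    using t(3) by auto
  have zV: "z \<in> ?V" using z by blast
  have eq: "generated_order (Field D \<union> ?V) (D \<union> ?E \<union> {(t, z)}) = slant D t (generated_order ?V ?E) z"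
    using generated_order_bridge[OF DD IH(1) DV t(1) zV] generated_order_id[OF D.partial_order] by simp
  have FQ: "Field (generated_order ?V ?E) = ?V" by (rule Field_generated_order[OF IH(1)])
  have disj: "Field D \<inter> Field (generated_order ?V ?E) = {}" using DV unfolding FQ .
  note sl = dcomp_slant[OF dD(1) IH(2) disj t(1,2) IH(3)]
  have "(x, z) \<in> slant D t (generated_order ?V ?E) z"
    if "\<forall>x \<in> V0. (x, z) \<in> generated_order V0 E0" "x \<in> Field D \<union> ?V" for x
    using that IH(4) t(2)[of x] generated_order_refl[OF zV, of ?E] unfolding slant_def by blast
  moreover have "D \<union> ?E \<union> {(t, z)} \<subseteq> (Field D \<union> ?V) \<times> (Field D \<union> ?V)"
    using DD IH(1) t(1) zV by blast
  ultimately show ?case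
    unfolding eqV eqE eq using sl(1) sl(2)[of z] IH(3) by blast
qed


section \<open>Ribbons of blocks\<close>

lemma (in linorder) sorted_key_list_of_set_eqI:
  assumes "sorted (map f xs)" "distinct (map f xs)"
  shows "sorted_key_list_of_set f (set xs) = xs"
proof -
  interpret key: folding_insort_key "(\<le>)" "(<)" "set xs" f
    using assms(2) by unfold_locales (simp add: distinct_map)
  show ?thesis using key.idem_if_sorted_distinct[of xs] assms by (simp add: distinct_map)
qed

text \<open>Block \<open>i\<close> stands for \<open>z i\<close> with everything attached to it. The
  orientations of the ribbon edges are not fixed here, so that the mobile poset, the poset with
  folds removed, the fold and their restrictions are all instances.\<close>

locale block_ribbon =
  fixes l :: nat and V :: "nat \<Rightarrow> 'a set" and E :: "nat \<Rightarrow> 'a rel" and z :: "nat \<Rightarrow> 'a"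
  assumes blocks_disjoint: "i \<in> {1..l} \<Longrightarrow> i' \<in> {1..l} \<Longrightarrow> i \<noteq> i' \<Longrightarrow> V i \<inter> V i' = {}"
    and E_sub: "i \<in> {1..l} \<Longrightarrow> E i \<subseteq> V i \<times> V i"
    and z_in: "i \<in> {1..l} \<Longrightarrow> z i \<in> V i"
    and block_poset: "i \<in> {1..l} \<Longrightarrow> finite_poset (generated_order (V i) (E i))"
    and block_connected: "i \<in> {1..l} \<Longrightarrow> x \<in> V i \<Longrightarrow> y \<in> V i \<Longrightarrow> (x, y) \<in> (E i \<union> (E i)\<inverse>)\<^sup>*"
begin

definition orientation :: "(nat \<Rightarrow> 'a \<times> 'a) \<Rightarrow> bool" where
  "orientation g \<longleftrightarrow> (\<forall>m. g m = (z m, z (Suc m)) \<or> g m = (z (Suc m), z m))"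

definition verts :: "nat \<Rightarrow> nat \<Rightarrow> 'a set" where
  "verts lo hi = (\<Union>i \<in> {lo..hi}. V i)"

text \<open>Edge \<open>m\<close> joins \<open>z m\<close> to \<open>z (Suc m)\<close>;
  \<open>M\<close> is the set of edges kept and \<open>g\<close> their orientation.\<close>

definition rel :: "(nat \<Rightarrow> 'a \<times> 'a) \<Rightarrow> nat set \<Rightarrow> nat \<Rightarrow> nat \<Rightarrow> 'a rel" where
  "rel g M lo hi = (\<Union>i \<in> {lo..hi}. E i) \<union> g ` M"

lemma finite_V: "i \<in> {1..l} \<Longrightarrow> finite (V i)"
  using block_poset[of i] Field_generated_order[OF E_sub, of i] by (simp add: finite_poset_def)

lemma index_unique: "x \<in> V i \<Longrightarrow> x \<in> V i' \<Longrightarrow> i \<in> {1..l} \<Longrightarrow> i' \<in> {1..l} \<Longrightarrow> i = i'"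
  using blocks_disjoint by blast

lemma z_inj: "i \<in> {1..l} \<Longrightarrow> i' \<in> {1..l} \<Longrightarrow> z i = z i' \<Longrightarrow> i = i'"
  using index_unique[of "z i" i i'] z_in by metis

lemma mem_verts:
  assumes "x \<in> V i" "i \<in> {1..l}" "1 \<le> lo" "hi \<le> l"
  shows "x \<in> verts lo hi \<longleftrightarrow> i \<in> {lo..hi}"
proof
  assume "x \<in> verts lo hi"
  then obtain i' where i': "i' \<in> {lo..hi}" "x \<in> V i'" unfolding verts_def by blast
  then have "i' \<in> {1..l}" using assms(3,4) by auto
  then show "i \<in> {lo..hi}" using index_unique[OF assms(1) i'(2) assms(2)] i'(1) by blast
qed (use assms(1) in \<open>auto simp: verts_def\<close>)

lemma rel_sub:
  assumes "orientation g" "1 \<le> lo" "hi \<le> l" "M \<subseteq> {lo..<hi}"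
  shows "rel g M lo hi \<subseteq> verts lo hi \<times> verts lo hi"
proof -
  have "E i \<subseteq> verts lo hi \<times> verts lo hi" if "i \<in> {lo..hi}" for i
    using E_sub[of i] that assms(2,3) unfolding verts_def by fastforce
  moreover have "g m \<in> verts lo hi \<times> verts lo hi" if "m \<in> M" for m
  proof -
    have m: "m \<in> {lo..hi}" "Suc m \<in> {lo..hi}" using that assms(4) by auto
    then have "z m \<in> verts lo hi" "z (Suc m) \<in> verts lo hi"
      using z_in[of m] z_in[of "Suc m"] assms(2,3) unfolding verts_def by auto
    then show ?thesis using assms(1) unfolding orientation_def by (metis SigmaI)
  qed
  ultimately show ?thesis unfolding rel_def by blast
qed

section \<open>Paths in an oriented ribbon\<close>

definition fwd :: "(nat \<Rightarrow> 'a \<times> 'a) \<Rightarrow> nat set \<Rightarrow> nat \<Rightarrow> nat \<Rightarrow> bool" where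
  "fwd g M i i' \<longleftrightarrow> (\<forall>m \<in> {i..<i'}. m \<in> M \<and> g m = (z m, z (Suc m)))"

definition bwd :: "(nat \<Rightarrow> 'a \<times> 'a) \<Rightarrow> nat set \<Rightarrow> nat \<Rightarrow> nat \<Rightarrow> bool" where
  "bwd g M i i' \<longleftrightarrow> (\<forall>m \<in> {i..<i'}. m \<in> M \<and> g m = (z (Suc m), z m))"

lemma not_fwd_bwd:
  assumes "m \<in> {1..<l}" "g m = (z m, z (Suc m))" "g m = (z (Suc m), z m)"
  shows False
proof -
  have "z m = z (Suc m)" using assms(2,3) by (metis prod.inject)
  then show False using z_inj[of m "Suc m"] assms(1) by simp
qed

text \<open>A closed description of reachability: stay in one block, or go to its ribbon element,
  follow ribbon edges in one direction, and then move inside the target block.\<close>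

definition path_ord :: "(nat \<Rightarrow> 'a \<times> 'a) \<Rightarrow> nat set \<Rightarrow> 'a \<Rightarrow> nat \<Rightarrow> 'a \<Rightarrow> nat \<Rightarrow> bool" where
  "path_ord g M x i y i' \<longleftrightarrow> (if i = i' then (x, y) \<in> (E i)\<^sup>*
     else (x, z i) \<in> (E i)\<^sup>* \<and> (z i', y) \<in> (E i')\<^sup>* \<and> (if i < i' then fwd g M i i' else bwd g M i' i))"

lemma path_ord_fwd: "path_ord g M x i y i' \<Longrightarrow> i \<le> m \<Longrightarrow> m < i' \<Longrightarrow> m \<in> M \<and> g m = (z m, z (Suc m))"
  and path_ord_bwd: "path_ord g M x i y i' \<Longrightarrow> i' \<le> m \<Longrightarrow> m < i \<Longrightarrow> m \<in> M \<and> g m = (z (Suc m), z m)"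
  unfolding path_ord_def fwd_def bwd_def by (auto split: if_splits)

text \<open>A path cannot turn around on the ribbon, because going back over an edge would need its
  opposite orientation as well.\<close>

lemma reach:
  assumes g: "orientation g" and M: "M \<subseteq> {1..<l}" and xy: "(x, y) \<in> (rel g M 1 l)\<^sup>*" and x: "x \<in> V i" "i \<in> {1..l}"
  shows "\<exists>i' \<in> {1..l}. y \<in> V i' \<and> path_ord g M x i y i'"
  using xy
proof (induction rule: rtrancl_induct)
  case base
  then show ?case using x unfolding path_ord_def by auto
next
  case (step y u)
  then obtain i' where i': "i' \<in> {1..l}" "y \<in> V i'" "path_ord g M x i y i'" by blast
  from step.hyps(2) consider k where "k \<in> {1..l}" "(y, u) \<in> E k" | m where "m \<in> M" "(y, u) = g m"
    unfolding rel_def by blast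
  then show ?case
  proof cases
    case 1
    have "y \<in> V k" "u \<in> V k" using E_sub[OF 1(1)] 1(2) by blast+
    then have k: "k = i'" using index_unique i' 1(1) by blast
    then have "path_ord g M x i u i'"
      using i'(3) 1(2) unfolding path_ord_def by (auto split: if_splits)
    then show ?thesis using \<open>u \<in> V k\<close> k i'(1) by blast
  next
    case 2
    have m: "m \<in> {1..<l}" "m \<in> {1..l}" "Suc m \<in> {1..l}" using 2(1) M by auto
    from g consider "g m = (z m, z (Suc m))" | "g m = (z (Suc m), z m)" unfolding orientation_def by blast
    then show ?thesis
    proof cases
      case f: 1
      then have yu: "y = z m" "u = z (Suc m)" using 2(2) by auto
      then have im: "i' = m" using index_unique[of y i' m] i' z_in m by blast
      have "i \<le> m"
      proof (rule ccontr)
        assume "\<not> i \<le> m"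
        then have "g m = (z (Suc m), z m)" using path_ord_bwd[OF i'(3), of m] im by simp
        then show False using not_fwd_bwd[OF m(1)] f by blast
      qed
      then have "(x, z i) \<in> (E i)\<^sup>*" "fwd g M i (Suc m)"
        using i'(3) im yu f 2(1) unfolding path_ord_def fwd_def by (auto simp: less_Suc_eq split: if_splits)
      then have "path_ord g M x i u (Suc m)" using \<open>i \<le> m\<close> yu unfolding path_ord_def by simp
      then show ?thesis using m(3) z_in yu by blast
    next
      case b: 2
      then have yu: "y = z (Suc m)" "u = z m" using 2(2) by auto
      then have im: "i' = Suc m" using index_unique[of y i' "Suc m"] i' z_in m by blast
      have "Suc m \<le> i"
      proof (rule ccontr)
        assume "\<not> Suc m \<le> i"
        then have "g m = (z m, z (Suc m))" using path_ord_fwd[OF i'(3), of m] im by simp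
        then show False using not_fwd_bwd[OF m(1)] b by blast
      qed
      have "m' \<in> M \<and> g m' = (z (Suc m'), z m')" if "m' \<in> {m..<i}" for m'
        using that b 2(1) path_ord_bwd[OF i'(3), of m'] im by (cases "m' = m") auto
      then have "bwd g M m i" unfolding bwd_def by blast
      moreover have "(x, z i) \<in> (E i)\<^sup>*"
        using i'(3) im yu unfolding path_ord_def by (auto split: if_splits)
      ultimately have "path_ord g M x i u m" using \<open>Suc m \<le> i\<close> yu unfolding path_ord_def by simp
      then show ?thesis using m(2) z_in yu by blast
    qed
  qed
qed

lemma fwd_path: "fwd g M i i' \<Longrightarrow> i \<le> i' \<Longrightarrow> (z i, z i') \<in> (g ` (M \<inter> {i..<i'}))\<^sup>*"
proof (induction "i' - i" arbitrary: i')
  case 0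
  then show ?case by simp
next
  case (Suc n)
  obtain k where k: "i' = Suc k" "i \<le> k"
  proof (cases i')
    case 0
    then show ?thesis using Suc.hyps(2) by simp
  next
    case (Suc k)
    moreover have "i \<le> k" using \<open>Suc n = i' - i\<close> Suc by arith
    ultimately show ?thesis using that by blast
  qed
  have "fwd g M i k" "k \<in> M" "g k = (z k, z (Suc k))" using Suc.prems k unfolding fwd_def by auto
  then have "(z i, z k) \<in> (g ` (M \<inter> {i..<k}))\<^sup>*" using Suc.hyps(1)[of k] Suc.hyps(2) k by simp
  then have "(z i, z k) \<in> (g ` (M \<inter> {i..<i'}))\<^sup>*"
    using rtrancl_mono[of "g ` (M \<inter> {i..<k})" "g ` (M \<inter> {i..<i'})"] k by force
  moreover have "(z k, z i') \<in> g ` (M \<inter> {i..<i'})"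
    using \<open>k \<in> M\<close> \<open>g k = _\<close> k by (intro image_eqI[of _ _ k]) auto
  ultimately show ?case by (rule rtrancl_into_rtrancl)
qed

lemma bwd_path: "bwd g M i i' \<Longrightarrow> i \<le> i' \<Longrightarrow> (z i', z i) \<in> (g ` (M \<inter> {i..<i'}))\<^sup>*"
proof (induction "i' - i" arbitrary: i')
  case 0
  then show ?case by simp
next
  case (Suc n)
  obtain k where k: "i' = Suc k" "i \<le> k"
  proof (cases i')
    case 0
    then show ?thesis using Suc.hyps(2) by simp
  next
    case (Suc k)
    moreover have "i \<le> k" using \<open>Suc n = i' - i\<close> Suc by arith
    ultimately show ?thesis using that by blast
  qed
  have "bwd g M i k" "k \<in> M" "g k = (z (Suc k), z k)" using Suc.prems k unfolding bwd_def by auto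
  then have "(z k, z i) \<in> (g ` (M \<inter> {i..<k}))\<^sup>*" using Suc.hyps(1)[of k] Suc.hyps(2) k by simp
  then have "(z k, z i) \<in> (g ` (M \<inter> {i..<i'}))\<^sup>*"
    using rtrancl_mono[of "g ` (M \<inter> {i..<k})" "g ` (M \<inter> {i..<i'})"] k by force
  moreover have "(z i', z k) \<in> g ` (M \<inter> {i..<i'})"
    using \<open>k \<in> M\<close> \<open>g k = _\<close> k by (intro image_eqI[of _ _ k]) auto
  ultimately show ?case by (rule converse_rtrancl_into_rtrancl[rotated])
qed

text \<open>The path read off from \<open>path_ord\<close> uses only the blocks and edges from
  \<open>i\<close> to \<open>i'\<close>, so it stays in any stretch that contains both.\<close>

lemma path_ord_reach:
  assumes "path_ord g M x i y i'" "i \<in> {lo..hi}" "i' \<in> {lo..hi}"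
  shows "(x, y) \<in> (rel g (M \<inter> {lo..<hi}) lo hi)\<^sup>*"
proof -
  let ?R = "rel g (M \<inter> {lo..<hi}) lo hi"
  have EE: "(E k)\<^sup>* \<subseteq> ?R\<^sup>*" if "k \<in> {lo..hi}" for k
    by (rule rtrancl_mono) (use that in \<open>auto simp: rel_def\<close>)
  have gg: "(g ` (M \<inter> {k..<k'}))\<^sup>* \<subseteq> ?R\<^sup>*" if "lo \<le> k" "k' \<le> hi" for k k'
    by (rule rtrancl_mono) (use that in \<open>auto simp: rel_def\<close>)
  consider "i = i'" | "i < i'" | "i' < i" by linarith
  then show ?thesis
  proof cases
    case 1
    then show ?thesis using assms EE unfolding path_ord_def by auto
  next
    case 2
    then have "(x, z i) \<in> ?R\<^sup>*" "(z i', y) \<in> ?R\<^sup>*" "fwd g M i i'"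
      using assms EE[of i] EE[of i'] unfolding path_ord_def by auto
    moreover have "(z i, z i') \<in> ?R\<^sup>*" using fwd_path[OF calculation(3)] gg[of i i'] 2 assms(2,3) by auto
    ultimately show ?thesis by (meson rtrancl_trans)
  next
    case 3
    then have "(x, z i) \<in> ?R\<^sup>*" "(z i', y) \<in> ?R\<^sup>*" "bwd g M i' i"
      using assms EE[of i] EE[of i'] unfolding path_ord_def by auto
    moreover have "(z i, z i') \<in> ?R\<^sup>*" using bwd_path[OF calculation(3)] gg[of i' i] 3 assms(2,3) by auto
    ultimately show ?thesis by (meson rtrancl_trans)
  qed
qed

lemma rel_finite_poset:
  assumes g: "orientation g" and M: "M \<subseteq> {1..<l}"
  shows "finite_poset (generated_order (verts 1 l) (rel g M 1 l))"
proof -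
  let ?R = "rel g M 1 l" and ?V = "verts 1 l"
  have sub: "?R \<subseteq> ?V \<times> ?V" using rel_sub[OF g] M by auto
  have "antisym (generated_order ?V ?R)"
  proof (rule antisymI)
    fix x y assume "(x, y) \<in> generated_order ?V ?R" "(y, x) \<in> generated_order ?V ?R"
    then have xy: "x \<in> ?V" "(x, y) \<in> ?R\<^sup>*" "(y, x) \<in> ?R\<^sup>*" using generated_order_iff[OF sub] by auto
    then obtain i where i: "i \<in> {1..l}" "x \<in> V i" unfolding verts_def by auto
    obtain i' where i': "i' \<in> {1..l}" "y \<in> V i'" "path_ord g M x i y i'" using reach[OF g M xy(2) i(2,1)] by blast
    have yx: "path_ord g M y i' x i" using reach[OF g M xy(3) i'(2,1)] index_unique i by metis
    have "i = i'"
    proof (rule ccontr)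
      assume "i \<noteq> i'"
      then consider "i < i'" | "i' < i" by linarith
      then show False
      proof cases
        case 1
        then have "g i = (z i, z (Suc i))" "g i = (z (Suc i), z i)"
          using path_ord_fwd[OF i'(3)] path_ord_bwd[OF yx] by blast+
        moreover have "i \<in> {1..<l}" using 1 i(1) i'(1) by auto
        ultimately show False using not_fwd_bwd by blast
      next
        case 2
        then have "g i' = (z i', z (Suc i'))" "g i' = (z (Suc i'), z i')"
          using path_ord_bwd[OF i'(3)] path_ord_fwd[OF yx] by blast+
        moreover have "i' \<in> {1..<l}" using 2 i(1) i'(1) by auto
        ultimately show False using not_fwd_bwd by blast
      qed
    qed
    then have "(x, y) \<in> (E i)\<^sup>*" "(y, x) \<in> (E i)\<^sup>*" using i'(3) yx unfolding path_ord_def by auto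
    then have "(x, y) \<in> generated_order (V i) (E i)" "(y, x) \<in> generated_order (V i) (E i)"
      using generated_order_iff[OF E_sub[OF i(1)]] i i' \<open>i = i'\<close> by auto
    then show "x = y" using block_poset[OF i(1)] unfolding finite_poset_def order_on_defs by (meson antisymD)
  qed
  moreover have F: "Field (generated_order ?V ?R) = ?V" by (rule Field_generated_order[OF sub])
  moreover have "finite ?V" unfolding verts_def using finite_V by auto
  moreover have "refl_on ?V (generated_order ?V ?R)"
    unfolding refl_on_def by (intro ballI generated_order_refl)
  moreover have "generated_order ?V ?R \<subseteq> ?V \<times> ?V"
    using FieldI1[of _ _ "generated_order ?V ?R"] FieldI2[of _ _ "generated_order ?V ?R"] unfolding F by auto
  ultimately show ?thesis
    unfolding finite_poset_def order_on_defs F using trans_generated_order by blast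
qed

lemma rel_mono: "1 \<le> lo \<Longrightarrow> hi \<le> l \<Longrightarrow> M' \<subseteq> M \<Longrightarrow> rel g M' lo hi \<subseteq> rel g M 1 l"
  unfolding rel_def by fastforce

text \<open>Restricting an order generated by edges may in general keep relations whose paths leave
  the subset. Here \<open>reach\<close> and \<open>path_ord_reach\<close> provide a path within the
  stretch.\<close>

lemma Restr_generated_order:
  assumes g: "orientation g" and M: "M \<subseteq> {1..<l}" and lh: "1 \<le> lo" "hi \<le> l"
  shows "Restr (generated_order (verts 1 l) (rel g M 1 l)) (verts lo hi) =
    generated_order (verts lo hi) (rel g (M \<inter> {lo..<hi}) lo hi)"
proof -
  have sub: "rel g M 1 l \<subseteq> verts 1 l \<times> verts 1 l" using rel_sub[OF g] M by auto
  have sub': "rel g (M \<inter> {lo..<hi}) lo hi \<subseteq> verts lo hi \<times> verts lo hi" using rel_sub[OF g lh] by auto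
  have vv: "verts lo hi \<subseteq> verts 1 l" unfolding verts_def by (rule UN_mono) (use lh in auto)
  show ?thesis
  proof (intro equalityI subrelI)
    fix x y assume xy: "(x, y) \<in> Restr (generated_order (verts 1 l) (rel g M 1 l)) (verts lo hi)"
    then have *: "(x, y) \<in> (rel g M 1 l)\<^sup>*" "x \<in> verts lo hi" "y \<in> verts lo hi" using generated_order_iff[OF sub] by auto
    then obtain i where i: "i \<in> {lo..hi}" "x \<in> V i" unfolding verts_def by blast
    then have i1: "i \<in> {1..l}" using lh by auto
    obtain i' where i': "i' \<in> {1..l}" "y \<in> V i'" "path_ord g M x i y i'" using reach[OF g M *(1) i(2) i1] by blast
    have "i' \<in> {lo..hi}" using mem_verts[OF i'(2,1) lh] *(3) by blast
    then show "(x, y) \<in> generated_order (verts lo hi) (rel g (M \<inter> {lo..<hi}) lo hi)"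
      using path_ord_reach[OF i'(3) i(1)] *(2) generated_order_iff[OF sub'] by blast
  next
    fix x y assume xy: "(x, y) \<in> generated_order (verts lo hi) (rel g (M \<inter> {lo..<hi}) lo hi)"
    then have "x \<in> verts lo hi" "y \<in> verts lo hi"
      using Field_generated_order[OF sub'] by (metis FieldI1, metis FieldI2)
    moreover have "generated_order (verts lo hi) (rel g (M \<inter> {lo..<hi}) lo hi) \<subseteq> generated_order (verts 1 l) (rel g M 1 l)"
      by (rule generated_order_mono[OF vv rel_mono[OF lh]]) blast
    ultimately show "(x, y) \<in> Restr (generated_order (verts 1 l) (rel g M 1 l)) (verts lo hi)" using xy by blast
  qed
qed

lemma block_path_connected:
  assumes g: "orientation g" and "1 \<le> lo" "hi \<le> l" "a \<le> b" "a \<in> {lo..hi}" "b \<in> {lo..hi}" "{a..<b} \<subseteq> M"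
    "x \<in> V a" "y \<in> V b"
  shows "(x, y) \<in> (rel g M lo hi \<union> (rel g M lo hi)\<inverse>)\<^sup>*"
proof -
  let ?S = "(rel g M lo hi \<union> (rel g M lo hi)\<inverse>)\<^sup>*"
  have E: "(u, v) \<in> ?S" if "i \<in> {lo..hi}" "u \<in> V i" "v \<in> V i" for u v i
  proof -
    have "(E i \<union> (E i)\<inverse>)\<^sup>* \<subseteq> ?S" by (rule rtrancl_mono) (use that(1) in \<open>auto simp: rel_def\<close>)
    then show ?thesis using block_connected[of i u v] that assms(2,3) by auto
  qed
  have zz: "(z m, z (Suc m)) \<in> ?S" if "m \<in> M" for m
  proof -
    have "g m \<in> rel g M lo hi" using that unfolding rel_def by blast
    then have "(z m, z (Suc m)) \<in> rel g M lo hi \<union> (rel g M lo hi)\<inverse>"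
      using g unfolding orientation_def by (metis UnI1 UnI2 converse_iff)
    then show ?thesis by blast
  qed
  have "(z a, z c) \<in> ?S" if "a \<le> c" "c \<le> b" for c
    using that
  proof (induction c rule: dec_induct)
    case (step n)
    then have "n \<in> M" using assms(7) by auto
    then show ?case using step zz[of n] by (meson Suc_leD rtrancl_trans)
  qed simp
  then have "(z a, z b) \<in> ?S" using assms(4) by blast
  moreover have "a \<in> {1..l}" "b \<in> {1..l}" using assms(2,3,5,6) by auto
  then have "(x, z a) \<in> ?S" "(z b, y) \<in> ?S" using E assms(5,6,8,9) z_in by blast+
  ultimately show ?thesis by (meson rtrancl_trans)
qed

end


section \<open>Folding a ribbon of blocks\<close>

text \<open>\<open>e\<close> is the orientation in the mobile poset, \<open>t\<close> the one after
  folding, and \<open>\<Phi>\<close> the set of edges on which they differ.\<close>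

locale folded_ribbon = block_ribbon +
  fixes e t :: "nat \<Rightarrow> 'a \<times> 'a" and \<Phi> :: "nat set"
  assumes e: "orientation e" and t: "orientation t" and \<Phi>: "\<Phi> \<subseteq> {1..<l}"
    and folded: "m \<in> \<Phi> \<Longrightarrow> e m = prod.swap (t m)"
    and unfolded: "m \<in> {1..<l} - \<Phi> \<Longrightarrow> e m = t m"
    and l_pos: "1 \<le> l"
begin

abbreviation "VV \<equiv> verts 1 l"
definition "P = generated_order VV (rel e {1..<l} 1 l)"
definition "F = e ` \<Phi>"

lemma rel_sub_e: "M \<subseteq> {1..<l} \<Longrightarrow> rel e M 1 l \<subseteq> VV \<times> VV"
  using rel_sub[OF e, of 1 l M] by simp

lemma Field_P: "Field P = VV"
  unfolding P_def by (rule Field_generated_order[OF rel_sub_e]) simp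

sublocale P: fin_poset P
  unfolding P_def by unfold_locales (rule rel_finite_poset[OF e], simp)

lemma P_iff: "(x, y) \<in> P \<longleftrightarrow> x \<in> VV \<and> (x, y) \<in> (rel e {1..<l} 1 l)\<^sup>*"
  unfolding P_def by (rule generated_order_iff[OF rel_sub_e]) simp

lemma cover_in_rel:
  assumes "(x, y) \<in> cover_relations P"
  shows "(x, y) \<in> rel e {1..<l} 1 l"
proof -
  let ?R = "rel e {1..<l} 1 l"
  have xy: "(x, y) \<in> P" "x \<noteq> y" using P.cv_lt[OF assms] by auto
  have "(x, y) \<in> ?R\<^sup>*" "x \<in> VV" using xy P_iff by blast+
  then have "x = y \<or> (\<exists>u. (x, u) \<in> ?R \<and> u \<noteq> x \<and> (u, y) \<in> ?R\<^sup>*)"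
  proof (induction rule: converse_rtrancl_induct)
    case (step v w)
    show ?case
    proof (cases "w = v")
      case True
      then show ?thesis using step by blast
    next
      case False
      then show ?thesis using step.hyps by blast
    qed
  qed simp
  then obtain u where u: "(x, u) \<in> ?R" "u \<noteq> x" "(u, y) \<in> ?R\<^sup>*" using xy(2) by blast
  have "x \<in> VV" "u \<in> VV" using u(1) rel_sub_e[of "{1..<l}"] by auto
  then have "(x, u) \<in> P" "(u, y) \<in> P" using u P_iff by blast+
  then have "u = y" using P.cv_between[OF assms] u(2) by blast
  then show ?thesis using u(1) by simp
qed

text \<open>The generators inside the blocks need not be covers, while \<open>P \<ominus> F\<close>
  is generated by covers. A relation is therefore refined to a chain of covers, none of which is a
  fold if no fold lies between its ends.\<close>

lemma avoid_folds:
  assumes "(x, y) \<in> P" "\<And>c d. (c, d) \<in> F \<Longrightarrow> (x, c) \<in> P \<Longrightarrow> (d, y) \<in> P \<Longrightarrow> False"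
  shows "(x, y) \<in> (cover_relations P - F)\<^sup>*"
  using assms
proof (induction y rule: P.down_induct)
  case (less y)
  show ?case
  proof (cases "x = y")
    case False
    then obtain v where v: "(x, v) \<in> P" "(v, y) \<in> cover_relations P" using P.ex_cover_below less.prems(1) by blast
    have vy: "(v, y) \<in> P \<and> v \<noteq> y" using P.cv_lt[OF v(2)] .
    have yy: "(y, y) \<in> P" using P.le_refl P.le_Field(2)[OF less.prems(1)] by blast
    then have nF: "(v, y) \<notin> F" using less.prems(2) v(1) by blast
    have "(x, v) \<in> (cover_relations P - F)\<^sup>*"
      using less.IH[OF vy v(1)] less.prems(2) P.le_trans[of _ v y] vy by blast
    then show ?thesis using v(2) nF by (meson DiffI rtrancl_into_rtrancl)
  qed simp
qed

text \<open>By \<open>reach\<close> a relation through the ribbon edge \<open>m\<close> runs along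
  the ribbon in the direction of that edge, so its ends lie on different sides of it.\<close>

lemma fold_edge_separates:
  assumes m: "m \<in> {1..<l}" and x: "x \<in> V i" "i \<in> {1..l}" and y: "y \<in> V i'" "i' \<in> {1..l}"
    and cd: "e m = (c, d)" "(x, c) \<in> P" "(d, y) \<in> P"
  shows "i \<le> m \<and> Suc m \<le> i' \<or> i' \<le> m \<and> Suc m \<le> i"
proof -
  let ?M = "{1..<l}"
  have mm: "m \<in> {1..l}" "Suc m \<in> {1..l}" using m by auto
  have R: "(x, c) \<in> (rel e ?M 1 l)\<^sup>*" "(d, y) \<in> (rel e ?M 1 l)\<^sup>*" using cd P_iff by blast+
  from e consider "e m = (z m, z (Suc m))" | "e m = (z (Suc m), z m)" unfolding orientation_def by blast
  then show ?thesis
  proof cases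
    case 1
    then have c: "c = z m" "d = z (Suc m)" using cd by auto
    have "path_ord e ?M x i c m"
      using reach[OF e order_refl R(1) x] index_unique[of c _ m] z_in[OF mm(1)] mm c by blast
    then have "i \<le> m" using not_fwd_bwd[of m e, OF m 1] path_ord_bwd[of e ?M x i c m m] by (meson not_le order_refl)
    moreover have "path_ord e ?M d (Suc m) y i'"
      using reach[OF e order_refl R(2) _ mm(2)] index_unique[of y _ i'] z_in[OF mm(2)] y c by blast
    then have "Suc m \<le> i'"
      using not_fwd_bwd[of m e, OF m 1] path_ord_bwd[of e ?M d "Suc m" y i' m] by (meson lessI not_less_eq_eq)
    ultimately show ?thesis by blast
  next
    case 2
    then have c: "c = z (Suc m)" "d = z m" using cd by auto
    have "path_ord e ?M x i c (Suc m)"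
      using reach[OF e order_refl R(1) x] index_unique[of c _ "Suc m"] z_in[OF mm(2)] mm c by blast
    then have "Suc m \<le> i"
      using not_fwd_bwd[of m e, OF m _ 2] path_ord_fwd[of e ?M x i c "Suc m" m] by (meson lessI not_less_eq_eq)
    moreover have "path_ord e ?M d m y i'"
      using reach[OF e order_refl R(2) _ mm(1)] index_unique[of y _ i'] z_in[OF mm(1)] y c by blast
    then have "i' \<le> m" using not_fwd_bwd[of m e, OF m _ 2] path_ord_fwd[of e ?M d m y i' m] by (meson not_le order_refl)
    ultimately show ?thesis by blast
  qed
qed

lemma remove_covers_eq: "P \<ominus> F = generated_order VV (rel e ({1..<l} - \<Phi>) 1 l)"
proof -
  let ?R0 = "rel e ({1..<l} - \<Phi>) 1 l"
  have sub0: "?R0 \<subseteq> VV \<times> VV" by (rule rel_sub_e) blast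
  have C: "cover_relations P - F \<subseteq> VV \<times> VV"
  proof (rule subrelI)
    fix x y assume "(x, y) \<in> cover_relations P - F"
    then have "(x, y) \<in> P" using P.cv_lt by blast
    then show "(x, y) \<in> VV \<times> VV" using P.le_Field unfolding Field_P by blast
  qed
  have "cover_relations P - F \<subseteq> ?R0"
    using cover_in_rel unfolding F_def rel_def by fastforce
  then have 1: "generated_order VV (cover_relations P - F) \<subseteq> generated_order VV ?R0"
    by (rule generated_order_mono[OF order_refl])
  have "?R0 \<subseteq> generated_order VV (cover_relations P - F)"
  proof (rule subrelI)
    fix x y assume xy: "(x, y) \<in> ?R0"
    then have "x \<in> VV" "y \<in> VV" using sub0 by blast+
    then obtain i i' where i: "x \<in> V i" "i \<in> {1..l}" "y \<in> V i'" "i' \<in> {1..l}" unfolding verts_def by blast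
    have "(x, y) \<in> rel e {1..<l} 1 l" using xy unfolding rel_def by blast
    then have P: "(x, y) \<in> P" using P_iff \<open>x \<in> VV\<close> by blast
    have ii: "i = i' \<or> (\<exists>m \<in> {1..<l} - \<Phi>. i = m \<and> i' = Suc m \<or> i = Suc m \<and> i' = m)"
    proof -
      from xy consider k where "k \<in> {1..l}" "(x, y) \<in> E k" | m where "m \<in> {1..<l} - \<Phi>" "(x, y) = e m"
        unfolding rel_def by blast
      then show ?thesis
      proof cases
        case 1
        then have "i = k" "i' = k" using E_sub[OF 1(1)] index_unique i by blast+
        then show ?thesis by simp
      next
        case 2
        have m: "m \<in> {1..l}" "Suc m \<in> {1..l}" using 2(1) by auto
        from e have "x = z m \<and> y = z (Suc m) \<or> x = z (Suc m) \<and> y = z m"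
          using 2(2) unfolding orientation_def by (metis prod.inject)
        then have "i = m \<and> i' = Suc m \<or> i = Suc m \<and> i' = m"
          using index_unique[of x i] index_unique[of y i'] i z_in[OF m(1)] z_in[OF m(2)] m by blast
        then show ?thesis using 2(1) by blast
      qed
    qed
    \<comment> \<open>A relation inside one block or over an edge that is not folded does not cross
      a folded edge.\<close>
    have "(x, y) \<in> (cover_relations P - F)\<^sup>*"
    proof (rule avoid_folds[OF P])
      fix c d assume cd: "(c, d) \<in> F" "(x, c) \<in> P" "(d, y) \<in> P"
      then obtain m where m: "m \<in> \<Phi>" "e m = (c, d)" unfolding F_def by auto
      then have "m \<in> {1..<l}" using \<Phi> by blast
      then have "i \<le> m \<and> Suc m \<le> i' \<or> i' \<le> m \<and> Suc m \<le> i"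
        using fold_edge_separates[OF _ i m(2) cd(2,3)] by blast
      then show False using ii m(1) by auto
    qed
    then show "(x, y) \<in> generated_order VV (cover_relations P - F)"
      using generated_order_iff[OF C] \<open>x \<in> VV\<close> by blast
  qed
  then have 2: "generated_order VV ?R0 \<subseteq> generated_order VV (cover_relations P - F)"
    by (intro generated_order_least generated_order_refl trans_generated_order)
  show ?thesis unfolding remove_covers_def Field_P using 1 2 by blast
qed

lemma converse_F: "F\<inverse> = t ` \<Phi>"
proof -
  have "F\<inverse> = prod.swap ` F" by (simp add: swap_product converse_unfold image_def) force
  also have "\<dots> = t ` \<Phi>" unfolding F_def image_image using folded by simp
  finally show ?thesis .
qed

lemma fold_poset_eq: "fold_poset P F = generated_order VV (rel t {1..<l} 1 l)"
proof -
  have "e ` ({1..<l} - \<Phi>) = t ` ({1..<l} - \<Phi>)" using unfolded by (intro image_cong) auto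
  moreover have "{1..<l} = ({1..<l} - \<Phi>) \<union> \<Phi>" using \<Phi> by blast
  ultimately have "rel e ({1..<l} - \<Phi>) 1 l \<union> t ` \<Phi> = rel t {1..<l} 1 l"
    unfolding rel_def by (metis Un_assoc image_Un)
  then show ?thesis
    unfolding fold_poset_def Field_P remove_covers_eq converse_F generated_order_absorb[OF order_refl]
    by (simp only:)
qed

subsection \<open>Components\<close>

text \<open>The number of the component that contains block \<open>i\<close>: each folded edge
  before \<open>i\<close> starts a new one.\<close>

definition bl :: "nat \<Rightarrow> nat" where
  "bl i = card {m \<in> \<Phi>. m < i}"

definition W :: "nat \<Rightarrow> 'a set" where
  "W s = (\<Union>i \<in> {i \<in> {1..l}. bl i = s}. V i)"

abbreviation "k \<equiv> card \<Phi>"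

lemma finite_\<Phi>: "finite \<Phi>"
  using \<Phi> finite_subset by blast

lemma bl_mono: "i \<le> j \<Longrightarrow> bl i \<le> bl j"
  unfolding bl_def by (rule card_mono) (use finite_\<Phi> in auto)

lemma bl_Suc: "bl (Suc i) = (if i \<in> \<Phi> then Suc (bl i) else bl i)"
proof -
  have "{m \<in> \<Phi>. m < Suc i} = (if i \<in> \<Phi> then insert i {m \<in> \<Phi>. m < i} else {m \<in> \<Phi>. m < i})"
    by (auto simp: less_Suc_eq)
  then show ?thesis unfolding bl_def using finite_\<Phi> by simp
qed

lemma bl_1: "bl 1 = 0" and bl_l: "bl l = k"
proof -
  have "{m \<in> \<Phi>. m < 1} = {}" using \<Phi> by auto
  then show "bl 1 = 0" unfolding bl_def by simp
  have "{m \<in> \<Phi>. m < l} = \<Phi>" using \<Phi> by auto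
  then show "bl l = k" unfolding bl_def by simp
qed

lemma bl_le: "i \<in> {1..l} \<Longrightarrow> bl i \<le> k"
  using bl_mono[of i l] bl_l by simp

lemma bl_surj: "s \<le> k \<Longrightarrow> \<exists>i \<in> {1..l}. bl i = s"
proof (induction s)
  case 0
  then show ?case using bl_1 l_pos by (intro bexI[of _ 1]) auto
next
  case (Suc s)
  have "\<exists>i \<in> {1..l}. bl i = Suc s"
  proof (rule ccontr)
    assume n: "\<not> ?thesis"
    have "bl i \<le> s" if "1 \<le> i" "i \<le> l" for i
      using that
    proof (induction i rule: dec_induct)
      case base
      then show ?case using bl_1 by simp
    next
      case (step j)
      then have "bl j \<le> s" by simp
      then have "bl (Suc j) \<le> Suc s" using bl_Suc[of j] by simp
      moreover have "bl (Suc j) \<noteq> Suc s" using n step by auto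
      ultimately show ?case by simp
    qed
    then show False using bl_l l_pos Suc.prems by fastforce
  qed
  then show ?case .
qed

lemma mem_W: "x \<in> V i \<Longrightarrow> i \<in> {1..l} \<Longrightarrow> x \<in> W s \<longleftrightarrow> bl i = s"
  using index_unique[of x i] unfolding W_def by blast

lemma finite_W: "finite (W s)"
  unfolding W_def using finite_V by auto

lemma W_disjoint: "s \<noteq> s' \<Longrightarrow> W s \<inter> W s' = {}"
  using index_unique unfolding W_def by blast

lemma z_in_W: "i \<in> {1..l} \<Longrightarrow> z i \<in> W s \<longleftrightarrow> bl i = s"
  using mem_W z_in by blast

text \<open>\<open>bl\<close> is monotone, so the blocks of consecutive components form a stretch of
  consecutive ribbon indices.\<close>

lemma union_W:
  assumes "i \<le> j" "j \<le> k"
  obtains lo hi where "1 \<le> lo" "lo \<le> hi" "hi \<le> l" "\<And>a. a \<in> {1..l} \<Longrightarrow> bl a \<in> {i..j} \<longleftrightarrow> a \<in> {lo..hi}"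
    "(\<Union>s \<in> {i..j}. W s) = verts lo hi"
proof -
  define A where "A = {a \<in> {1..l}. bl a \<in> {i..j}}"
  obtain a where "a \<in> {1..l}" "bl a = i" using bl_surj[of i] assms by auto
  then have A: "A \<noteq> {}" "finite A" using assms unfolding A_def by auto
  define lo hi where "lo = Min A" and "hi = Max A"
  have lh: "lo \<in> A" "hi \<in> A" "\<And>a. a \<in> A \<Longrightarrow> lo \<le> a \<and> a \<le> hi"
    using A unfolding lo_def hi_def by auto
  have iff: "bl a \<in> {i..j} \<longleftrightarrow> a \<in> {lo..hi}" if "a \<in> {1..l}" for a
  proof
    show "bl a \<in> {i..j} \<Longrightarrow> a \<in> {lo..hi}" using lh(3)[of a] that unfolding A_def by auto
    assume "a \<in> {lo..hi}"
    then show "bl a \<in> {i..j}" using bl_mono[of lo a] bl_mono[of a hi] lh(1,2) unfolding A_def by auto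
  qed
  have "(\<Union>s \<in> {i..j}. W s) = (\<Union>a \<in> {a \<in> {1..l}. bl a \<in> {i..j}}. V a)" unfolding W_def by blast
  also have "{a \<in> {1..l}. bl a \<in> {i..j}} = {lo..hi}"
  proof -
    have "{lo..hi} \<subseteq> {1..l}" using lh(1,2) unfolding A_def by auto
    then show ?thesis using iff by blast
  qed
  finally have "(\<Union>s \<in> {i..j}. W s) = verts lo hi" unfolding verts_def .
  moreover have "1 \<le> lo" "lo \<le> hi" "hi \<le> l" using lh unfolding A_def by auto
  ultimately show ?thesis using that iff by blast
qed

text \<open>\<open>bl\<close> is constant along every remaining edge. Conversely, no folded edge
  lies between two blocks with equal value, so the remaining edges connect them.\<close>

lemma hasse_components_eq: "hasse_components (P \<ominus> F) = W ` {0..k}"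
proof -
  let ?M = "{1..<l} - \<Phi>"
  let ?R = "rel e ?M 1 l"
  have sub: "?R \<subseteq> VV \<times> VV" by (rule rel_sub_e) blast
  have fp: "finite_poset (generated_order VV ?R)" by (rule rel_finite_poset[OF e]) blast
  have edge: "bl i = bl i'" if "(x, y) \<in> ?R" "x \<in> V i" "y \<in> V i'" "i \<in> {1..l}" "i' \<in> {1..l}" for x y i i'
  proof -
    from that(1) consider k where "k \<in> {1..l}" "(x, y) \<in> E k" | m where "m \<in> ?M" "(x, y) = e m"
      unfolding rel_def by blast
    then show ?thesis
    proof cases
      case 1
      then have "i = k" "i' = k" using E_sub[OF 1(1)] index_unique that by blast+
      then show ?thesis by simp
    next
      case 2
      have m: "m \<in> {1..l}" "Suc m \<in> {1..l}" using 2(1) by auto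
      from e have "x = z m \<and> y = z (Suc m) \<or> x = z (Suc m) \<and> y = z m"
        using 2(2) unfolding orientation_def by (metis prod.inject)
      then have "i = m \<and> i' = Suc m \<or> i = Suc m \<and> i' = m"
        using index_unique[of x i] index_unique[of y i'] that z_in[OF m(1)] z_in[OF m(2)] m by blast
      then show ?thesis using 2(1) bl_Suc[of m] by auto
    qed
  qed
  have cls: "(?R \<union> ?R\<inverse>)\<^sup>* `` {x} = W (bl i)" if x: "x \<in> V i" "i \<in> {1..l}" for x i
  proof (intro equalityI subsetI)
    fix y assume "y \<in> (?R \<union> ?R\<inverse>)\<^sup>* `` {x}"
    then have "(x, y) \<in> (?R \<union> ?R\<inverse>)\<^sup>*" by blast
    then show "y \<in> W (bl i)"
    proof (induction rule: rtrancl_induct)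
      case base
      then show ?case using mem_W x by blast
    next
      case (step y u)
      have "y \<in> VV" "u \<in> VV" using step.hyps(2) sub by blast+
      then obtain a b where ab: "y \<in> V a" "a \<in> {1..l}" "u \<in> V b" "b \<in> {1..l}" unfolding verts_def by blast
      have "bl a = bl b" using step.hyps(2) edge[OF _ ab(1,3,2,4)] edge[OF _ ab(3,1,4,2)] by fastforce
      then show ?case using step.IH mem_W ab by simp
    qed
  next
    fix y assume "y \<in> W (bl i)"
    then obtain b where b: "y \<in> V b" "b \<in> {1..l}" "bl b = bl i" unfolding W_def by auto
    have no: "{c..<d} \<subseteq> ?M" if "c \<le> d" "bl c = bl d" "c \<in> {1..l}" "d \<in> {1..l}" for c d
    proof
      fix m assume m: "m \<in> {c..<d}"
      have "m \<notin> \<Phi>"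
      proof
        assume "m \<in> \<Phi>"
        then have "bl (Suc m) = Suc (bl m)" using bl_Suc by simp
        moreover have "bl c \<le> bl m" "bl (Suc m) \<le> bl d" using m by (auto intro: bl_mono)
        ultimately show False using that(2) by simp
      qed
      then show "m \<in> ?M" using m that by auto
    qed
    have "(x, y) \<in> (?R \<union> ?R\<inverse>)\<^sup>*"
    proof (cases "i \<le> b")
      case True
      then show ?thesis
        using block_path_connected[OF e _ _ True _ _ no[OF True]] x b by auto
    next
      case False
      then have "(y, x) \<in> (?R \<union> ?R\<inverse>)\<^sup>*"
        using block_path_connected[OF e, of 1 l b i ?M y x] no[of b i] x b by auto
      then show ?thesis using sym_sym_rtrancl by (meson symD)
    qed
    then show "y \<in> (?R \<union> ?R\<inverse>)\<^sup>* `` {x}" by blast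
  qed
  have "hasse_components (P \<ominus> F) = VV // (?R \<union> ?R\<inverse>)\<^sup>*"
    unfolding hasse_components_def remove_covers_eq hasse_connection_generated[OF sub fp]
      Field_generated_order[OF sub] ..
  also have "\<dots> = W ` {0..k}"
  proof (intro equalityI subsetI)
    fix C assume "C \<in> VV // (?R \<union> ?R\<inverse>)\<^sup>*"
    then obtain x where x: "x \<in> VV" "C = (?R \<union> ?R\<inverse>)\<^sup>* `` {x}" by (rule quotientE)
    then obtain i where i: "x \<in> V i" "i \<in> {1..l}" unfolding verts_def by blast
    then show "C \<in> W ` {0..k}" using x(2) cls[OF i] bl_le[OF i(2)] by auto
  next
    fix C assume "C \<in> W ` {0..k}"
    then obtain s where s: "s \<le> k" "C = W s" by auto
    then obtain i where i: "i \<in> {1..l}" "bl i = s" using bl_surj by blast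
    have "z i \<in> VV" using z_in i(1) unfolding verts_def by blast
    then show "C \<in> VV // (?R \<union> ?R\<inverse>)\<^sup>*"
      using quotientI[of "z i" VV "(?R \<union> ?R\<inverse>)\<^sup>*"] cls[OF z_in i(1)] i s by simp
  qed
  finally show ?thesis .
qed

text \<open>By monotonicity of \<open>bl\<close> the least ribbon indices strictly increase with the
  component number, and a list sorted by distinct keys is unique.\<close>

lemma path_order_eq: "path_order l z (P \<ominus> F) = map W [0..<Suc k]"
proof -
  define key where "key C = Min {i \<in> {1..l}. z i \<in> C}" for C
  have key: "key (W s) \<in> {1..l} \<and> bl (key (W s)) = s" if "s \<le> k" for s
  proof -
    have eq: "{i \<in> {1..l}. z i \<in> W s} = {i \<in> {1..l}. bl i = s}" using z_in_W by blast
    have "Min {i \<in> {1..l}. bl i = s} \<in> {i \<in> {1..l}. bl i = s}"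
      by (rule Min_in) (use bl_surj[OF that] in auto)
    then show ?thesis unfolding key_def eq by blast
  qed
  have lt: "key (W s) < key (W s')" if "s < s'" "s' \<le> k" for s s'
  proof (rule ccontr)
    assume "\<not> key (W s) < key (W s')"
    then have "bl (key (W s')) \<le> bl (key (W s))" by (intro bl_mono) simp
    then show False using key[of s] key[of s'] that by simp
  qed
  have sorted: "sorted_wrt (<) (map key (map W [0..<Suc k]))"
    unfolding sorted_wrt_map sorted_wrt_upt
    by (rule sorted_wrt_mono_rel[OF _ sorted_wrt_upt]) (use lt in auto)
  then have sd: "sorted (map key (map W [0..<Suc k]))" "distinct (map key (map W [0..<Suc k]))"
    by (simp_all only: strict_sorted_iff)
  have set: "set (map W [0..<Suc k]) = W ` {0..k}"
    by (simp only: set_map set_upt atLeastLessThanSuc_atLeastAtMost)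
  have "sorted_key_list_of_set key (set (map W [0..<Suc k])) = map W [0..<Suc k]"
    by (rule sorted_key_list_of_set_eqI[OF sd])
  then show ?thesis
    unfolding path_order_def hasse_components_eq set key_def .
qed


subsection \<open>The determinant of a folded ribbon\<close>

lemma path_subposet_eq:
  assumes "i \<le> j" "j \<le> k" "1 \<le> lo" "hi \<le> l" "(\<Union>s \<in> {i..j}. W s) = verts lo hi"
  shows "path_subposet P F (path_order l z (P \<ominus> F)) i j = generated_order (verts lo hi) (rel t {lo..<hi} lo hi)"
proof -
  have "(\<Union>s \<in> {i..j}. map W [0..<Suc k] ! s) = (\<Union>s \<in> {i..j}. W s)"
    by (rule SUP_cong) (use assms(2) in \<open>auto simp del: upt_Suc\<close>)
  moreover have "{1..<l} \<inter> {lo..<hi} = {lo..<hi}" using assms(3,4) by auto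
  ultimately show ?thesis
    unfolding path_subposet_def path_order_eq fold_poset_eq
    using Restr_generated_order[OF t order_refl assms(3,4)] assms(5) by (simp del: upt_Suc)
qed

text \<open>\<open>\<phi> s\<close> is the folded edge between the components \<open>s - 1\<close>
  and \<open>s\<close>.\<close>

lemma fold_position:
  obtains \<phi> where "bij_betw \<phi> {1..k} \<Phi>" "\<And>s. s \<in> {1..k} \<Longrightarrow> Suc (bl (\<phi> s)) = s"
proof -
  let ?\<beta> = "\<lambda>m. Suc (bl m)"
  have lt: "bl m < bl m'" if "m \<in> \<Phi>" "m < m'" for m m'
    using bl_Suc[of m] bl_mono[of "Suc m" m'] that by simp
  have inj: "inj_on ?\<beta> \<Phi>"
  proof (rule inj_onI)
    fix m m' assume "m \<in> \<Phi>" "m' \<in> \<Phi>" "?\<beta> m = ?\<beta> m'"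
    then show "m = m'" using lt[of m m'] lt[of m' m] by (metis less_irrefl linorder_neqE_nat nat.inject)
  qed
  have "?\<beta> ` \<Phi> \<subseteq> {1..k}"
  proof
    fix s assume "s \<in> ?\<beta> ` \<Phi>"
    then obtain m where m: "m \<in> \<Phi>" "s = Suc (bl m)" by blast
    then have "bl (Suc m) = s" "Suc m \<in> {1..l}" using bl_Suc[of m] \<Phi> by auto
    then show "s \<in> {1..k}" using bl_le m(2) by fastforce
  qed
  then have "?\<beta> ` \<Phi> = {1..k}" using inj by (intro card_subset_eq) (auto simp: card_image)
  then have bij: "bij_betw ?\<beta> \<Phi> {1..k}" using inj by (simp add: bij_betw_def)
  show ?thesis
  proof (rule that)
    show "bij_betw (inv_into \<Phi> ?\<beta>) {1..k} \<Phi>" by (rule bij_betw_inv_into[OF bij])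
    show "Suc (bl (inv_into \<Phi> ?\<beta> s)) = s" if "s \<in> {1..k}" for s
      using bij_betw_inv_into_right[OF bij that] .
  qed
qed

text \<open>\<open>density_path_det\<close> is applied to the components, joined by the folded edges
  with \<open>f\<close> as original and \<open>g\<close> as folded orientation. The entries then use
  only folded orientations, so they are the densities of the block posets, where the hook formula
  applies.\<close>

lemma density_eq_det:
  assumes dc: "\<And>i j. i \<le> j \<Longrightarrow> j \<le> k \<Longrightarrow> dcomp (path_subposet P F (path_order l z (P \<ominus> F)) i j)"
  shows "density P (Field P) = det (hook_matrix P F (path_order l z (P \<ominus> F)) k)"
proof -
  let ?sub = "path_subposet P F (path_order l z (P \<ominus> F))"
  obtain \<phi> where \<phi>: "bij_betw \<phi> {1..k} \<Phi>" "\<And>s. s \<in> {1..k} \<Longrightarrow> Suc (bl (\<phi> s)) = s" using fold_position by blast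
  have \<phi>\<Phi>: "\<phi> s \<in> \<Phi>" "\<phi> s \<in> {1..l}" "Suc (\<phi> s) \<in> {1..l}" if "s \<in> {1..k}" for s
  proof -
    show "\<phi> s \<in> \<Phi>" using \<phi>(1) that bij_betwE by blast
    then have "\<phi> s \<in> {1..<l}" using \<Phi> by blast
    then show "\<phi> s \<in> {1..l}" "Suc (\<phi> s) \<in> {1..l}" by auto
  qed
  have bl\<phi>: "bl (\<phi> s) = s - 1" "bl (Suc (\<phi> s)) = s" if "s \<in> {1..k}" for s
    using \<phi>(2)[OF that] bl_Suc[of "\<phi> s"] \<phi>\<Phi>(1)[OF that] by auto
  define C where "C = rel e ({1..<l} - \<Phi>) 1 l"
  define f where "f s = e (\<phi> s)" for s
  define g where "g s = t (\<phi> s)" for s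
  define M where "M i j = density (C \<union> g ` {i + 1..j}) (\<Union>s \<in> {i..j}. W s)" for i j
  have Cblock: "\<exists>s \<le> k. x \<in> W s \<and> y \<in> W s" if "(x, y) \<in> C" for x y
  proof -
    from that consider c where "c \<in> {1..l}" "(x, y) \<in> E c" | m where "m \<in> {1..<l} - \<Phi>" "(x, y) = e m"
      unfolding C_def rel_def by blast
    then show ?thesis
    proof cases
      case 1
      then have "x \<in> V c" "y \<in> V c" using E_sub by blast+
      then show ?thesis using mem_W[OF _ 1(1)] bl_le[OF 1(1)] by blast
    next
      case 2
      have m: "m \<in> {1..l}" "Suc m \<in> {1..l}" using 2(1) by auto
      have "bl (Suc m) = bl m" using bl_Suc[of m] 2(1) by simp
      then have "z m \<in> W (bl m)" "z (Suc m) \<in> W (bl m)" using z_in_W m by simp_all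
      moreover from e have "x = z m \<and> y = z (Suc m) \<or> x = z (Suc m) \<and> y = z m"
        using 2(2) unfolding orientation_def by (metis prod.inject)
      ultimately show ?thesis using bl_le[OF m(1)] by blast
    qed
  qed
  have ab: "z (\<phi> s) \<in> W (s - 1) \<and> z (Suc (\<phi> s)) \<in> W s" if "s \<in> {1..k}" for s
    using z_in_W \<phi>\<Phi>[OF that] bl\<phi>[OF that] by simp
  have fg: "f s = (z (\<phi> s), z (Suc (\<phi> s))) \<and> g s = (z (Suc (\<phi> s)), z (\<phi> s)) \<or>
      f s = (z (Suc (\<phi> s)), z (\<phi> s)) \<and> g s = (z (\<phi> s), z (Suc (\<phi> s)))" if "s \<in> {1..k}" for s
  proof -
    have "e (\<phi> s) = prod.swap (t (\<phi> s))" using folded \<phi>\<Phi>(1)[OF that] by blast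
    moreover have "t (\<phi> s) = (z (\<phi> s), z (Suc (\<phi> s))) \<or> t (\<phi> s) = (z (Suc (\<phi> s)), z (\<phi> s))"
      using t unfolding orientation_def by blast
    ultimately show ?thesis unfolding f_def g_def by auto
  qed
  \<comment> \<open>With \<open>t = T = k\<close> every folded edge is in its original orientation,
    so the right side is the density of \<open>P\<close>. The free column is the last column of
    \<open>M\<close>.\<close>
  have det: "det (hessenberg M (\<lambda>i. M i k) k) = density (C \<union> f ` {1..k} \<union> g ` {k + 1..k}) (\<Union>s \<in> {0..k}. W s)"
    unfolding M_def
    by (rule density_path_det[of k W C "\<lambda>s. z (\<phi> s)" "\<lambda>s. z (Suc (\<phi> s))" f g k k])
      (use finite_W W_disjoint Cblock ab fg in auto)
  have "C \<union> f ` {1..k} \<union> g ` {k + 1..k} = rel e {1..<l} 1 l"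
  proof -
    have "f ` {1..k} = e ` \<Phi>" using \<phi>(1) unfolding f_def by (simp add: image_image[symmetric] bij_betw_def)
    moreover have "{1..<l} = ({1..<l} - \<Phi>) \<union> \<Phi>" using \<Phi> by blast
    ultimately show ?thesis unfolding C_def rel_def by (auto simp: image_Un)
  qed
  moreover have "(\<Union>s \<in> {0..k}. W s) = VV"
  proof
    show "(\<Union>s \<in> {0..k}. W s) \<subseteq> VV" unfolding W_def verts_def by blast
    show "VV \<subseteq> (\<Union>s \<in> {0..k}. W s)"
      using bl_le mem_W unfolding verts_def by fastforce
  qed
  moreover have "density P (Field P) = density (rel e {1..<l} 1 l) VV"
    unfolding density_def Field_P unfolding P_def labelings_generated_order[OF rel_sub_e[OF order_refl]] ..
  ultimately have 1: "density P (Field P) = det (hessenberg M (\<lambda>i. M i k) k)" using det by simp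
  have entry: "M i j = 1 / of_int (\<Prod>x \<in> Field (?sub i j). hook_length (?sub i j) x)" if ij: "i \<le> j" "j \<le> k" for i j
  proof -
    obtain lo hi where lh: "1 \<le> lo" "lo \<le> hi" "hi \<le> l"
      and iff: "\<And>a. a \<in> {1..l} \<Longrightarrow> bl a \<in> {i..j} \<longleftrightarrow> a \<in> {lo..hi}"
      and W: "(\<Union>s \<in> {i..j}. W s) = verts lo hi"
      using union_W[OF ij] by metis
    have sub: "?sub i j = generated_order (verts lo hi) (rel t {lo..<hi} lo hi)"
      by (rule path_subposet_eq[OF ij lh(1,3) W])
    have rs: "rel t {lo..<hi} lo hi \<subseteq> verts lo hi \<times> verts lo hi" by (rule rel_sub[OF t lh(1,3) order_refl])
    have F: "Field (?sub i j) = verts lo hi" unfolding sub by (rule Field_generated_order[OF rs])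
    have "M i j = density (rel t {lo..<hi} lo hi) (verts lo hi)"
      unfolding M_def W
    proof (rule density_cong)
      fix x y assume xy: "x \<in> verts lo hi" "y \<in> verts lo hi"
      have zm: "m \<in> {lo..<hi}" if "m \<in> {1..<l}" "h m = (x, y)" "h = e \<or> h = t" for m h
      proof -
        have m: "m \<in> {1..l}" "Suc m \<in> {1..l}" using that(1) by auto
        have "x = z m \<and> y = z (Suc m) \<or> x = z (Suc m) \<and> y = z m"
          using that(2,3) e t unfolding orientation_def by (metis prod.inject)
        then have "m \<in> {lo..hi}" "Suc m \<in> {lo..hi}"
          using xy mem_verts[OF z_in[OF m(1)] m(1) lh(1,3)] mem_verts[OF z_in[OF m(2)] m(2) lh(1,3)] by blast+
        then show ?thesis by simp
      qed
      show "(x, y) \<in> C \<union> g ` {i + 1..j} \<longleftrightarrow> (x, y) \<in> rel t {lo..<hi} lo hi"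
      proof
        assume "(x, y) \<in> C \<union> g ` {i + 1..j}"
        then consider c where "c \<in> {1..l}" "(x, y) \<in> E c" | m where "m \<in> {1..<l} - \<Phi>" "e m = (x, y)"
          | s where "s \<in> {i + 1..j}" "t (\<phi> s) = (x, y)"
          unfolding C_def rel_def g_def by fastforce
        then show "(x, y) \<in> rel t {lo..<hi} lo hi"
        proof cases
          case 1
          then have "x \<in> V c" using E_sub by blast
          then have "c \<in> {lo..hi}" using mem_verts[OF _ 1(1) lh(1,3)] xy(1) by blast
          then show ?thesis using 1(2) unfolding rel_def by blast
        next
          case 2
          then have "m \<in> {lo..<hi}" "t m = (x, y)" using zm[of m e] unfolded[of m] by auto
          then show ?thesis unfolding rel_def by (metis UnI2 imageI)
        next
          case 3
          then have "s \<in> {1..k}" using ij by auto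
          then have "\<phi> s \<in> {1..<l}" using \<phi>\<Phi>(1) \<Phi> by blast
          then have "\<phi> s \<in> {lo..<hi}" using zm 3(2) by blast
          then show ?thesis using 3(2) unfolding rel_def by (metis UnI2 imageI)
        qed
      next
        assume "(x, y) \<in> rel t {lo..<hi} lo hi"
        then consider c where "c \<in> {lo..hi}" "(x, y) \<in> E c" | m where "m \<in> {lo..<hi}" "t m = (x, y)"
          unfolding rel_def by fastforce
        then show "(x, y) \<in> C \<union> g ` {i + 1..j}"
        proof cases
          case 1
          then show ?thesis using lh unfolding C_def rel_def by auto
        next
          case 2
          have m: "m \<in> {1..<l}" "m \<in> {1..l}" "Suc m \<in> {1..l}" "m \<in> {lo..hi}" "Suc m \<in> {lo..hi}" using 2(1) lh by auto
          show ?thesis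
          proof (cases "m \<in> \<Phi>")
            case False
            then have "e m = (x, y)" using unfolded[of m] m(1) 2(2) by simp
            then show ?thesis using False m(1) unfolding C_def rel_def by (metis DiffI UnI1 UnI2 imageI)
          next
            case True
            then have "m \<in> \<phi> ` {1..k}" using bij_betw_imp_surj_on[OF \<phi>(1)] by simp
            then obtain s where s: "s \<in> {1..k}" "\<phi> s = m" by blast
            have "bl m \<in> {i..j}" "bl (Suc m) \<in> {i..j}" using iff m by blast+
            then have "s \<in> {i + 1..j}" using bl\<phi>[OF s(1)] s by auto
            then show ?thesis using 2(2) s(2) unfolding g_def by (metis UnI2 imageI)
          qed
        qed
      qed
    qed
    also have "\<dots> = density (?sub i j) (Field (?sub i j))"
      unfolding density_def F unfolding sub labelings_generated_order[OF rs] ..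
    also have "\<dots> = 1 / of_int (\<Prod>x \<in> Field (?sub i j). hook_length (?sub i j) x)"
      by (rule d_complete_density_hook[OF dc[OF ij]])
    finally show ?thesis .
  qed
  have "hessenberg M (\<lambda>i. M i k) k = hook_matrix P F (path_order l z (P \<ominus> F)) k"
  proof (rule eq_matI)
    fix i j
    assume "i < dim_row (hook_matrix P F (path_order l z (P \<ominus> F)) k)" "j < dim_col (hook_matrix P F (path_order l z (P \<ominus> F)) k)"
    then have ij: "i < k + 1" "j < k + 1" by (simp_all add: hook_matrix_def)
    show "hessenberg M (\<lambda>i. M i k) k $$ (i, j) = hook_matrix P F (path_order l z (P \<ominus> F)) k $$ (i, j)"
    proof (cases "i \<le> j")
      case True
      then show ?thesis using ij entry[OF True] unfolding hessenberg_def hook_matrix_def by (cases "j = k") auto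
    next
      case False
      then have "j \<noteq> k" using ij by simp
      then show ?thesis using ij False unfolding hessenberg_def hook_matrix_def by simp
    qed
  qed (simp_all add: hessenberg_def hook_matrix_def)
  then show ?thesis using 1 by simp
qed

end


section \<open>Mobile posets\<close>

locale dcomplete_ribbon = block_ribbon +
  fixes S :: "nat set" and J :: nat
  assumes l_pos: "1 \<le> l"
    and block_dcomp: "i \<in> {1..l} \<Longrightarrow> dcomp (generated_order (V i) (E i))"
    and block_acyclic: "i \<in> {1..l} \<Longrightarrow> acyclic_element (generated_order (V i) (E i)) (z i)"
    and block_max: "i \<in> {1..l} \<Longrightarrow> i \<noteq> J \<Longrightarrow> x \<in> V i \<Longrightarrow> (x, z i) \<in> generated_order (V i) (E i)"
begin

definition e :: "nat \<Rightarrow> 'a \<times> 'a" where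
  "e m = (if m \<in> S then (z (Suc m), z m) else (z m, z (Suc m)))"

text \<open>All ribbon edges point towards block \<open>J\<close>, the only one whose ribbon element
  may have elements of its own block above it.\<close>

definition t :: "nat \<Rightarrow> 'a \<times> 'a" where
  "t m = (if m < J then (z m, z (Suc m)) else (z (Suc m), z m))"

definition \<Phi> :: "nat set" where
  "\<Phi> = {m \<in> {1..<l}. m \<in> S \<longleftrightarrow> m < J}"

lemma t_orientation: "orientation t"
  unfolding orientation_def t_def by auto

sublocale folded_ribbon l V E z e t \<Phi>
proof unfold_locales
  show "orientation e" unfolding orientation_def e_def by auto
  show "orientation t" by (rule t_orientation)
  show "\<Phi> \<subseteq> {1..<l}" unfolding \<Phi>_def by blast
  show "e m = prod.swap (t m)" if "m \<in> \<Phi>" for m using that unfolding \<Phi>_def e_def t_def by auto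
  show "e m = t m" if "m \<in> {1..<l} - \<Phi>" for m using that unfolding \<Phi>_def e_def t_def by auto
  show "1 \<le> l" by (rule l_pos)
qed

section \<open>Stretches of the folded ribbon as iterated slant sums\<close>

definition G :: "nat \<Rightarrow> nat \<Rightarrow> 'a rel" where
  "G lo hi = generated_order (verts lo hi) (rel t {lo..<hi} lo hi)"

lemma Field_G: "1 \<le> lo \<Longrightarrow> hi \<le> l \<Longrightarrow> Field (G lo hi) = verts lo hi"
  unfolding G_def by (rule Field_generated_order[OF rel_sub[OF t_orientation]]) auto

lemma verts_split:
  assumes "lo \<le> m" "m < hi"
  shows "verts lo hi = verts lo m \<union> verts (Suc m) hi"
proof -
  have "{lo..hi} = {lo..m} \<union> {Suc m..hi}" using assms by auto
  then show ?thesis unfolding verts_def by (simp only: UN_Un)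
qed

lemma rel_split:
  assumes "lo \<le> m" "m < hi"
  shows "rel g {lo..<hi} lo hi = rel g {lo..<m} lo m \<union> rel g {Suc m..<hi} (Suc m) hi \<union> {g m}"
proof -
  have "{lo..hi} = {lo..m} \<union> {Suc m..hi}" "{lo..<hi} = {lo..<m} \<union> {Suc m..<hi} \<union> {m}" using assms by auto
  then show ?thesis unfolding rel_def by (simp only: UN_Un image_Un image_insert image_empty) blast
qed

lemma verts_disjoint:
  assumes "1 \<le> lo" "hi \<le> l"
  shows "verts lo m \<inter> verts (Suc m) hi = {}"
proof -
  have False if x: "x \<in> verts lo m" "x \<in> verts (Suc m) hi" for x
  proof -
    obtain i where i: "i \<in> {lo..m}" "x \<in> V i" using x(1) unfolding verts_def by blast
    obtain i' where i': "i' \<in> {Suc m..hi}" "x \<in> V i'" using x(2) unfolding verts_def by blast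
    have "i = i'" using index_unique[OF i(2) i'(2)] i(1) i'(1) assms by auto
    then show False using i(1) i'(1) by auto
  qed
  then show ?thesis by blast
qed

lemma G_single: "G i i = generated_order (V i) (E i)"
  unfolding G_def verts_def rel_def by simp

lemma G_bridge:
  assumes "1 \<le> lo" "lo \<le> m" "m < hi" "hi \<le> l"
  shows "m < J \<Longrightarrow> G lo hi = slant (G lo m) (z m) (G (Suc m) hi) (z (Suc m))"
    and "\<not> m < J \<Longrightarrow> G lo hi = slant (G (Suc m) hi) (z (Suc m)) (G lo m) (z m)"
proof -
  let ?E = "rel t {lo..<m} lo m" and ?E' = "rel t {Suc m..<hi} (Suc m) hi"
  have sub: "?E \<subseteq> verts lo m \<times> verts lo m" "?E' \<subseteq> verts (Suc m) hi \<times> verts (Suc m) hi"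
    using rel_sub[OF t_orientation] assms by auto
  have disj: "verts lo m \<inter> verts (Suc m) hi = {}" using verts_disjoint[OF assms(1,4)] .
  have zz: "z m \<in> verts lo m" "z (Suc m) \<in> verts (Suc m) hi"
    using z_in[of m] z_in[of "Suc m"] assms unfolding verts_def by auto
  show "G lo hi = slant (G lo m) (z m) (G (Suc m) hi) (z (Suc m))" if "m < J"
  proof -
    have "t m = (z m, z (Suc m))" using that unfolding t_def by simp
    then show ?thesis
      unfolding G_def verts_split[OF assms(2,3)] rel_split[OF assms(2,3)]
      using generated_order_bridge[OF sub disj zz] by simp
  qed
  show "G lo hi = slant (G (Suc m) hi) (z (Suc m)) (G lo m) (z m)" if "\<not> m < J"
  proof -
    have tm: "t m = (z (Suc m), z m)" using that unfolding t_def by simp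
    have disj': "verts (Suc m) hi \<inter> verts lo m = {}" using disj by blast
    have V: "verts lo hi = verts (Suc m) hi \<union> verts lo m" using verts_split[OF assms(2,3)] by blast
    have R: "rel t {lo..<hi} lo hi = ?E' \<union> ?E \<union> {(z (Suc m), z m)}" unfolding rel_split[OF assms(2,3)] tm by blast
    show ?thesis
      unfolding G_def V R by (rule generated_order_bridge[OF sub(2,1) disj' zz(2,1)])
  qed
qed

lemma max_in_slant:
  assumes "\<And>x. x \<in> Field R \<Longrightarrow> (x, a) \<in> R" "(b, b) \<in> Q" "\<And>x. x \<in> Field Q \<Longrightarrow> (x, b) \<in> Q"
    "x \<in> Field R \<union> Field Q"
  shows "(x, b) \<in> slant R a Q b"
  using assms unfolding slant_def by blast

text \<open>Left of \<open>J\<close> the part already built has the top \<open>z m\<close>, which is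
  hung below the acyclic \<open>z (Suc m)\<close> of the next block. The top is lost when block
  \<open>J\<close> is reached, where the process ends.\<close>

lemma G_left:
  assumes "1 \<le> lo" "lo \<le> hi" "hi \<le> l" "hi \<le> J"
  shows "dcomp (G lo hi) \<and> acyclic_element (G lo hi) (z hi) \<and>
    (hi < J \<longrightarrow> (\<forall>x \<in> verts lo hi. (x, z hi) \<in> G lo hi))"
  using assms(2-4)
proof (induction hi rule: dec_induct)
  case base
  then have "lo \<in> {1..l}" using assms(1) by auto
  then show ?case using block_dcomp block_acyclic block_max unfolding G_single verts_def by auto
next
  case (step m)
  have IH: "dcomp (G lo m)" "\<And>x. x \<in> verts lo m \<Longrightarrow> (x, z m) \<in> G lo m" using step by auto
  have m: "Suc m \<in> {1..l}" "m \<in> {1..l}" "m \<le> l" using step assms(1) by auto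
  have eq: "G lo (Suc m) = slant (G lo m) (z m) (G (Suc m) (Suc m)) (z (Suc m))"
    by (rule G_bridge(1)) (use assms(1) step in auto)
  have F: "Field (G lo m) = verts lo m" "Field (G (Suc m) (Suc m)) = verts (Suc m) (Suc m)"
    using Field_G assms(1) m by auto
  have disj: "Field (G lo m) \<inter> Field (G (Suc m) (Suc m)) = {}"
    unfolding F by (rule verts_disjoint) (use assms(1) m in auto)
  have zm: "z m \<in> Field (G lo m)" using z_in[OF m(2)] step.hyps unfolding F verts_def by auto
  have Q: "dcomp (G (Suc m) (Suc m))" "acyclic_element (G (Suc m) (Suc m)) (z (Suc m))"
    using block_dcomp block_acyclic m unfolding G_single by auto
  note sl = dcomp_slant[OF IH(1) Q(1) disj zm IH(2)[folded F(1)] Q(2)]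
  have "(x, z (Suc m)) \<in> G lo (Suc m)" if "Suc m < J" "x \<in> verts lo (Suc m)" for x
    unfolding eq
  proof (rule max_in_slant)
    show "(x, z m) \<in> G lo m" if "x \<in> Field (G lo m)" for x using IH(2) that unfolding F .
    show "(x, z (Suc m)) \<in> G (Suc m) (Suc m)" if "x \<in> Field (G (Suc m) (Suc m))" for x
    proof -
      have "x \<in> V (Suc m)" using that unfolding F verts_def by simp
      then show ?thesis using block_max[OF m(1)] \<open>Suc m < J\<close> unfolding G_single by simp
    qed
    then show "(z (Suc m), z (Suc m)) \<in> G (Suc m) (Suc m)" using z_in[OF m(1)] unfolding F verts_def by auto
    have "lo \<le> m" using step.hyps by simp
    then show "x \<in> Field (G lo m) \<union> Field (G (Suc m) (Suc m))"
      using that(2) verts_split[of lo m "Suc m"] unfolding F by blast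
  qed
  then show ?case using sl(1) sl(2)[of "z (Suc m)"] Q(2) unfolding eq by blast
qed

text \<open>Mirror image of \<open>G_left\<close>: from the right end towards \<open>J\<close> each
  part has the ribbon element of its leftmost block as top.\<close>

lemma G_right:
  assumes "J < lo" "lo \<le> hi" "hi \<le> l"
  shows "dcomp (G lo hi) \<and> acyclic_element (G lo hi) (z lo) \<and> (\<forall>x \<in> verts lo hi. (x, z lo) \<in> G lo hi)"
  using assms(2,1)
proof (induction lo rule: inc_induct)
  case base
  then have "hi \<in> {1..l}" using assms(3) by auto
  then show ?case using block_dcomp block_acyclic block_max base unfolding G_single verts_def by auto
next
  case (step m)
  have IH: "dcomp (G (Suc m) hi)" "\<And>x. x \<in> verts (Suc m) hi \<Longrightarrow> (x, z (Suc m)) \<in> G (Suc m) hi" using step by auto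
  have m: "Suc m \<in> {1..l}" "m \<in> {1..l}" using step assms(3) by auto
  have eq: "G m hi = slant (G (Suc m) hi) (z (Suc m)) (G m m) (z m)"
    by (rule G_bridge(2)) (use m step assms(3) in auto)
  have F: "Field (G m m) = verts m m" "Field (G (Suc m) hi) = verts (Suc m) hi"
    using Field_G assms(3) m by auto
  have disj: "Field (G (Suc m) hi) \<inter> Field (G m m) = {}"
    unfolding F using verts_disjoint[of m hi m] assms(3) m by auto
  have zm: "z (Suc m) \<in> Field (G (Suc m) hi)" using z_in[OF m(1)] step.hyps unfolding F verts_def by auto
  have Q: "dcomp (G m m)" "acyclic_element (G m m) (z m)"
    using block_dcomp block_acyclic m unfolding G_single by auto
  note sl = dcomp_slant[OF IH(1) Q(1) disj zm IH(2)[folded F(2)] Q(2)]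
  have "(x, z m) \<in> G m hi" if "x \<in> verts m hi" for x
    unfolding eq
  proof (rule max_in_slant)
    show "(x, z (Suc m)) \<in> G (Suc m) hi" if "x \<in> Field (G (Suc m) hi)" for x using IH(2) that unfolding F .
    show "(x, z m) \<in> G m m" if "x \<in> Field (G m m)" for x
    proof -
      have "x \<in> V m" using that unfolding F verts_def by simp
      then show ?thesis using block_max[OF m(2)] step.prems unfolding G_single by simp
    qed
    then show "(z m, z m) \<in> G m m" using z_in[OF m(2)] unfolding F verts_def by auto
    show "x \<in> Field (G (Suc m) hi) \<union> Field (G m m)"
      using that verts_split[of m m hi] step.hyps unfolding F by auto
  qed
  then show ?case using sl(1) sl(2)[of "z m"] Q(2) unfolding eq by blast
qed

lemma dcomp_G:
  assumes "1 \<le> lo" "lo \<le> hi" "hi \<le> l"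
  shows "dcomp (G lo hi)"
proof -
  consider "hi \<le> J" | "J < lo" | "lo \<le> J" "J < hi" by linarith
  then show ?thesis
  proof cases
    case 1
    then show ?thesis using G_left assms by blast
  next
    case 2
    then show ?thesis using G_right assms by blast
  next
    case 3
    \<comment> \<open>Both sides meet at \<open>z J\<close>. It is still acyclic after the left part
      has been attached, so the right part can be hung below it too.\<close>
    have L: "dcomp (G lo J)" "acyclic_element (G lo J) (z J)" using G_left[of lo J] assms 3 by auto
    have R: "dcomp (G (Suc J) hi)" "\<And>x. x \<in> verts (Suc J) hi \<Longrightarrow> (x, z (Suc J)) \<in> G (Suc J) hi"
      using G_right[of "Suc J" hi] assms 3 by auto
    have eq: "G lo hi = slant (G (Suc J) hi) (z (Suc J)) (G lo J) (z J)"
      by (rule G_bridge(2)) (use assms 3 in auto)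
    have F: "Field (G lo J) = verts lo J" "Field (G (Suc J) hi) = verts (Suc J) hi"
      using Field_G assms 3 by auto
    have disj: "Field (G (Suc J) hi) \<inter> Field (G lo J) = {}"
      unfolding F using verts_disjoint[OF assms(1,3), of J] by blast
    have "Suc J \<in> {1..l}" using assms 3 by auto
    then have zm: "z (Suc J) \<in> Field (G (Suc J) hi)"
      using z_in 3 unfolding F verts_def by (intro UN_I[of "Suc J"]) auto
    show ?thesis unfolding eq using dcomp_slant(1)[OF R(1) L(1) disj zm R(2)[folded F(2)] L(2)] .
  qed
qed

lemma connected_G:
  assumes "1 \<le> lo" "lo \<le> hi" "hi \<le> l"
  shows "connected_poset (G lo hi)"
proof -
  have rs: "rel t {lo..<hi} lo hi \<subseteq> verts lo hi \<times> verts lo hi" by (rule rel_sub[OF t_orientation assms(1,3) order_refl])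
  have fp: "finite_poset (generated_order (verts lo hi) (rel t {lo..<hi} lo hi))"
    using dcompD(1)[OF dcomp_G[OF assms]] unfolding G_def .
  have conn: "(x, y) \<in> (rel t {lo..<hi} lo hi \<union> (rel t {lo..<hi} lo hi)\<inverse>)\<^sup>*"
    if xy: "a \<le> b" "a \<in> {lo..hi}" "b \<in> {lo..hi}" "x \<in> V a" "y \<in> V b" for a b x y
    by (rule block_path_connected[OF t_orientation assms(1,3) xy(1-3) _ xy(4,5)]) (use xy in auto)
  have "(x, y) \<in> (rel t {lo..<hi} lo hi \<union> (rel t {lo..<hi} lo hi)\<inverse>)\<^sup>*" if xy: "x \<in> verts lo hi" "y \<in> verts lo hi" for x y
  proof -
    obtain a b where ab: "a \<in> {lo..hi}" "b \<in> {lo..hi}" "x \<in> V a" "y \<in> V b" using xy unfolding verts_def by blast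
    show ?thesis
    proof (cases "a \<le> b")
      case True
      then show ?thesis using conn ab by blast
    next
      case False
      then have "(y, x) \<in> (rel t {lo..<hi} lo hi \<union> (rel t {lo..<hi} lo hi)\<inverse>)\<^sup>*" using conn[of b a y x] ab by simp
      then show ?thesis using sym_sym_rtrancl by (meson symD)
    qed
  qed
  moreover have "z lo \<in> verts lo hi" using z_in[of lo] assms unfolding verts_def by auto
  ultimately show ?thesis unfolding G_def connected_poset_generated[OF rs fp] by blast
qed

lemma path_subposet_G:
  assumes "i \<le> j" "j \<le> k"
  obtains lo hi where "1 \<le> lo" "lo \<le> hi" "hi \<le> l" "path_subposet P F (path_order l z (P \<ominus> F)) i j = G lo hi"
  using union_W[OF assms] path_subposet_eq[OF assms] unfolding G_def by metis

lemma ribbon_determinant: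
  "(\<forall>i j. i \<le> j \<and> j \<le> k \<longrightarrow> connected_poset (path_subposet P F (path_order l z (P \<ominus> F)) i j) \<and>
      d_complete (path_subposet P F (path_order l z (P \<ominus> F)) i j)) \<and>
   real (card (linear_extensions P)) = fact (card (Field P)) * det (hook_matrix P F (path_order l z (P \<ominus> F)) k)"
proof
  have dc: "dcomp (path_subposet P F (path_order l z (P \<ominus> F)) i j)"
    "connected_poset (path_subposet P F (path_order l z (P \<ominus> F)) i j)" if ij: "i \<le> j" "j \<le> k" for i j
    using path_subposet_G[OF ij] dcomp_G connected_G by metis+
  have "d_complete (path_subposet P F (path_order l z (P \<ominus> F)) i j)" if "i \<le> j" "j \<le> k" for i j
  proof -
    interpret R: fin_poset "path_subposet P F (path_order l z (P \<ominus> F)) i j"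
      by unfold_locales (rule dcompD(1)[OF dc(1)[OF that]])
    show ?thesis using R.d_complete_iff_dcomp dc(1)[OF that] by blast
  qed
  then show "\<forall>i j. i \<le> j \<and> j \<le> k \<longrightarrow> connected_poset (path_subposet P F (path_order l z (P \<ominus> F)) i j) \<and>
      d_complete (path_subposet P F (path_order l z (P \<ominus> F)) i j)" using dc(2) by blast
  have "real (card (linear_extensions P)) = fact (card (Field P)) * density P (Field P)"
    unfolding density_def linear_extensions_eq_labelings by simp
  then show "real (card (linear_extensions P)) = fact (card (Field P)) * det (hook_matrix P F (path_order l z (P \<ominus> F)) k)"
    using density_eq_det[OF dc(1)] by simp
qed

end


lemma d_complete_dcomp: "d_complete r \<Longrightarrow> dcomp r"
proof -
  assume d: "d_complete r"
  then interpret fin_poset r by unfold_locales (simp add: d_complete_def)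
  show "dcomp r" using d d_complete_iff_dcomp by blast
qed

section \<open>From the data of a mobile poset to a ribbon of blocks\<close>

locale mobile =
  fixes l :: nat and S :: "nat set" and z :: "nat \<Rightarrow> 'a" and H :: "nat \<Rightarrow> 'a rel set"
    and anchor :: "(nat \<times> 'a rel \<times> 'a) option"
  assumes data: "mobile_data l S z H anchor"
begin

text \<open>Without anchor, \<open>Suc l\<close> lies beyond the ribbon. Then all edges point to
  \<open>z l\<close> and every block has its ribbon element as maximum.\<close>

definition J :: nat where
  "J = (case anchor of None \<Rightarrow> Suc l | Some (j, Q, q) \<Rightarrow> j)"

definition anchor_set :: "nat \<Rightarrow> 'a set" where
  "anchor_set i = (case anchor of None \<Rightarrow> {} | Some (j, Q, q) \<Rightarrow> if i = j then Field Q else {})"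

definition anchor_rel :: "nat \<Rightarrow> 'a rel" where
  "anchor_rel i = (case anchor of None \<Rightarrow> {} | Some (j, Q, q) \<Rightarrow> if i = j then Q \<union> {(z i, q)} else {})"

definition hung_set :: "nat \<Rightarrow> 'a set" where
  "hung_set i = insert (z i) (\<Union>D \<in> H i. Field D)"

definition hung_rel :: "nat \<Rightarrow> 'a rel" where
  "hung_rel i = (\<Union>D \<in> H i. D \<union> maximal_elements D (Field D) \<times> {z i})"

definition V :: "nat \<Rightarrow> 'a set" where "V i = insert (z i) (anchor_set i) \<union> (\<Union>D \<in> H i. Field D)"
definition E :: "nat \<Rightarrow> 'a rel" where "E i = anchor_rel i \<union> hung_rel i"

lemma anchor_None:
  assumes "anchor = None"
  shows "J = Suc l" "anchor_set i = {}" "anchor_rel i = {}"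
  unfolding J_def anchor_set_def anchor_rel_def using assms by simp_all

lemma anchor_Some:
  assumes "anchor = Some (j, Q, q)"
  shows "J = j" "anchor_set i = (if i = j then Field Q else {})"
    "anchor_rel i = (if i = j then Q \<union> {(z i, q)} else {})"
  unfolding J_def anchor_set_def anchor_rel_def using assms by simp_all

lemma l_pos: "1 \<le> l" and S_sub: "S \<subseteq> {1..<l}" and z_inj: "inj_on z {1..l}"
  and H: "i \<in> {1..l} \<Longrightarrow> finite (H i)"
  and D: "i \<in> {1..l} \<Longrightarrow> D \<in> H i \<Longrightarrow> dcomp D \<and> connected_poset D \<and> Field D \<inter> z ` {1..l} = {}"
  and D_disjoint: "i \<in> {1..l} \<Longrightarrow> i' \<in> {1..l} \<Longrightarrow> D \<in> H i \<Longrightarrow> D' \<in> H i' \<Longrightarrow> (i, D) \<noteq> (i', D') \<Longrightarrow>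
    Field D \<inter> Field D' = {}"
proof -
  note d1 = data[unfolded mobile_data_def]
  note d2 = d1[THEN conjunct2]
  note d3 = d2[THEN conjunct2]
  note d4 = d3[THEN conjunct2]
  note d5 = d4[THEN conjunct2]
  show l: "1 \<le> l" by (rule d1[THEN conjunct1])
  have "S \<subseteq> {1..l - 1}" by (rule d2[THEN conjunct1])
  then show "S \<subseteq> {1..<l}" using l by fastforce
  show "inj_on z {1..l}" by (rule d3[THEN conjunct1])
  have *: "\<forall>i \<in> {1..l}. finite (H i) \<and>
        (\<forall>D \<in> H i. d_complete D \<and> connected_poset D \<and> Field D \<inter> z ` {1..l} = {})"
    by (rule d4[THEN conjunct1])
  show "i \<in> {1..l} \<Longrightarrow> finite (H i)" using * by blast
  show "i \<in> {1..l} \<Longrightarrow> D \<in> H i \<Longrightarrow> dcomp D \<and> connected_poset D \<and> Field D \<inter> z ` {1..l} = {}"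
    using * d_complete_dcomp by blast
  have "\<forall>i \<in> {1..l}. \<forall>i' \<in> {1..l}. \<forall>D \<in> H i. \<forall>D' \<in> H i'.
        (i, D) \<noteq> (i', D') \<longrightarrow> Field D \<inter> Field D' = {}"
    by (rule d5[THEN conjunct1])
  then show "i \<in> {1..l} \<Longrightarrow> i' \<in> {1..l} \<Longrightarrow> D \<in> H i \<Longrightarrow> D' \<in> H i' \<Longrightarrow> (i, D) \<noteq> (i', D') \<Longrightarrow>
    Field D \<inter> Field D' = {}" by blast
qed

lemma hung_rel_sub: "hung_rel i \<subseteq> hung_set i \<times> hung_set i"
proof -
  have "D \<union> maximal_elements D (Field D) \<times> {z i} \<subseteq> hung_set i \<times> hung_set i" if "D \<in> H i" for D
  proof -
    have "D \<subseteq> Field D \<times> Field D" by (auto simp: Field_def)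
    moreover have "maximal_elements D (Field D) \<subseteq> Field D" unfolding maximal_elements_def by blast
    moreover have "Field D \<subseteq> hung_set i" "z i \<in> hung_set i" using that unfolding hung_set_def by blast+
    ultimately show ?thesis by blast
  qed
  then show ?thesis unfolding hung_rel_def by blast
qed

definition ribbon_edge :: "nat \<Rightarrow> 'a \<times> 'a" where
  "ribbon_edge m = (if m \<in> S then (z (Suc m), z m) else (z m, z (Suc m)))"

lemma ribbon_covers_eq: "ribbon_covers l S z = ribbon_edge ` {1..<l}"
proof -
  have "{1..l - 1} = {1..<l}" using l_pos by auto
  then have "ribbon_covers l S z = (\<lambda>i. (z (Suc i), z i)) ` S \<union> (\<lambda>i. (z i, z (Suc i))) ` ({1..<l} - S)"
    unfolding ribbon_covers_def by auto
  also have "\<dots> = ribbon_edge ` S \<union> ribbon_edge ` ({1..<l} - S)"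
    unfolding ribbon_edge_def by (intro arg_cong2[of _ _ _ _ "(\<union>)"] image_cong) auto
  also have "\<dots> = ribbon_edge ` {1..<l}" using S_sub by blast
  finally show ?thesis .
qed

text \<open>The ribbon is itself given as a transitive closure inside another one; flattening it
  regroups all generators by block.\<close>

lemma hanging_mobile_eq: "hanging_mobile l S z H =
  generated_order (\<Union>i \<in> {1..l}. hung_set i) ((\<Union>i \<in> {1..l}. hung_rel i) \<union> ribbon_edge ` {1..<l})"
proof -
  have V: "z ` {1..l} \<union> (\<Union>i \<in> {1..l}. \<Union>D \<in> H i. Field D) = (\<Union>i \<in> {1..l}. hung_set i)"
    unfolding hung_set_def by blast
  have "z ` {1..l} \<subseteq> (\<Union>i \<in> {1..l}. hung_set i)" unfolding hung_set_def by blast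
  then show ?thesis
    unfolding hanging_mobile_def ribbon_def V hung_rel_def[symmetric] ribbon_covers_eq
    using generated_order_absorb by (simp add: Un_commute)
qed

lemma hanging_sub: "(\<Union>i \<in> {1..l}. hung_rel i) \<union> ribbon_edge ` {1..<l} \<subseteq>
  (\<Union>i \<in> {1..l}. hung_set i) \<times> (\<Union>i \<in> {1..l}. hung_set i)"
proof -
  have "ribbon_edge m \<in> (\<Union>i \<in> {1..l}. hung_set i) \<times> (\<Union>i \<in> {1..l}. hung_set i)" if "m \<in> {1..<l}" for m
  proof -
    have "m \<in> {1..l}" "Suc m \<in> {1..l}" using that by auto
    then have "z m \<in> (\<Union>i \<in> {1..l}. hung_set i)" "z (Suc m) \<in> (\<Union>i \<in> {1..l}. hung_set i)"
      unfolding hung_set_def by blast+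
    then show ?thesis unfolding ribbon_edge_def by simp
  qed
  then show ?thesis using hung_rel_sub by blast
qed

lemma Field_hanging_mobile: "Field (hanging_mobile l S z H) = (\<Union>i \<in> {1..l}. hung_set i)"
  unfolding hanging_mobile_eq by (rule Field_generated_order[OF hanging_sub])

lemma V_eq: "V i = hung_set i \<union> anchor_set i"
  unfolding V_def hung_set_def by blast

lemma anchorD:
  assumes "anchor = Some (j, Q, q)"
  shows "j \<in> {1..l}" "dcomp Q" "connected_poset Q" "acyclic_element Q q" "q \<in> Field Q"
    "i \<in> {1..l} \<Longrightarrow> Field Q \<inter> hung_set i = {}"
proof -
  have *: "j \<in> {1..l} \<and> d_complete Q \<and> connected_poset Q \<and> acyclic_element Q q \<and>
      Field Q \<inter> Field (hanging_mobile l S z H) = {}"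
    using data unfolding mobile_data_def assms by simp
  then show "j \<in> {1..l}" "dcomp Q" "connected_poset Q" "acyclic_element Q q" using d_complete_dcomp by blast+
  show "q \<in> Field Q" using * unfolding acyclic_element_def top_tree_def by blast
  show "i \<in> {1..l} \<Longrightarrow> Field Q \<inter> hung_set i = {}" using * unfolding Field_hanging_mobile by blast
qed

lemma mobile_poset_eq: "mobile_poset l S z H anchor =
  generated_order (\<Union>i \<in> {1..l}. V i) ((\<Union>i \<in> {1..l}. E i) \<union> ribbon_edge ` {1..<l})"
proof (cases anchor)
  case None
  then have "V i = hung_set i" "E i = hung_rel i" for i
    unfolding V_eq E_def using anchor_None by auto
  then show ?thesis unfolding mobile_poset_def using hanging_mobile_eq None by simp
next
  case (Some a)
  then obtain j Q q where a: "anchor = Some (j, Q, q)" by (cases a) auto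
  have j: "j \<in> {1..l}" using anchorD[OF a] by blast
  have "(\<Union>i \<in> {1..l}. anchor_set i) = Field Q" "(\<Union>i \<in> {1..l}. anchor_rel i) = Q \<union> {(z j, q)}"
    using j unfolding anchor_Some(2,3)[OF a] by (auto split: if_splits)
  then have VV: "(\<Union>i \<in> {1..l}. V i) = (\<Union>i \<in> {1..l}. hung_set i) \<union> Field Q"
    and EE: "(\<Union>i \<in> {1..l}. E i) = (\<Union>i \<in> {1..l}. hung_rel i) \<union> (Q \<union> {(z j, q)})"
    unfolding V_eq E_def UN_Un_distrib by blast+
  have "mobile_poset l S z H anchor = generated_order (Field (hanging_mobile l S z H) \<union> Field Q)
      (hanging_mobile l S z H \<union> (Q \<union> {(z j, q)}))"
    unfolding mobile_poset_def using a by (simp add: Un_assoc)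
  also have "\<dots> = generated_order (\<Union>i \<in> {1..l}. V i)
      ((\<Union>i \<in> {1..l}. hung_rel i) \<union> ribbon_edge ` {1..<l} \<union> (Q \<union> {(z j, q)}))"
    unfolding Field_hanging_mobile VV unfolding hanging_mobile_eq
    by (rule generated_order_absorb[OF Un_upper1])
  also have "(\<Union>i \<in> {1..l}. hung_rel i) \<union> ribbon_edge ` {1..<l} \<union> (Q \<union> {(z j, q)}) =
      (\<Union>i \<in> {1..l}. E i) \<union> ribbon_edge ` {1..<l}"
    unfolding EE by blast
  finally show ?thesis .
qed

text \<open>Without anchor the block starts as a single point. At the anchor it starts as that point
  hung below \<open>q\<close>, where acyclicity of \<open>q\<close> makes the slant sum d-complete
  and the point remains acyclic.\<close>

lemma base_block:
  assumes i: "i \<in> {1..l}"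
  shows "anchor_rel i \<subseteq> insert (z i) (anchor_set i) \<times> insert (z i) (anchor_set i)"
    "dcomp (generated_order (insert (z i) (anchor_set i)) (anchor_rel i))"
    "acyclic_element (generated_order (insert (z i) (anchor_set i)) (anchor_rel i)) (z i)"
    "i \<noteq> J \<Longrightarrow> x \<in> insert (z i) (anchor_set i) \<Longrightarrow> (x, z i) \<in> generated_order (insert (z i) (anchor_set i)) (anchor_rel i)"
proof -
  let ?V = "insert (z i) (anchor_set i)"
  consider (none) "anchor_set i = {}" "anchor_rel i = {}"
    | (some) Q q where "anchor = Some (i, Q, q)" "anchor_set i = Field Q" "anchor_rel i = Q \<union> {(z i, q)}" "i = J"
  proof (cases anchor)
    case None
    then show ?thesis using that(1) anchor_None by blast
  next
    case (Some a)
    then obtain j Q q where a: "anchor = Some (j, Q, q)" by (cases a) auto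
    show ?thesis
    proof (cases "i = j")
      case True
      then show ?thesis using that(2) anchor_Some[OF a] a by simp
    next
      case False
      then show ?thesis using that(1) anchor_Some[OF a] by simp
    qed
  qed
  then have "anchor_rel i \<subseteq> ?V \<times> ?V \<and> dcomp (generated_order ?V (anchor_rel i)) \<and>
    acyclic_element (generated_order ?V (anchor_rel i)) (z i) \<and>
    (i \<noteq> J \<longrightarrow> (\<forall>x \<in> ?V. (x, z i) \<in> generated_order ?V (anchor_rel i)))"
  proof cases
    case none
    then show ?thesis using dcomp_singleton[of "z i"] by (simp add: generated_order_singleton)
  next
    case some
    note a = anchorD[OF some(1)]
    interpret Q: dcomplete Q by unfold_locales (rule a(2))
    have zQ: "z i \<notin> Field Q" using a(6)[OF i] unfolding hung_set_def by blast
    have QQ: "Q \<subseteq> Field Q \<times> Field Q" by (auto simp: Field_def)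
    have "generated_order ({z i} \<union> Field Q) ({} \<union> Q \<union> {(z i, q)}) =
        slant (generated_order {z i} {}) (z i) (generated_order (Field Q) Q) q"
      by (rule generated_order_bridge) (use QQ zQ a(5) in auto)
    then have eq: "generated_order ?V (anchor_rel i) = slant {(z i, z i)} (z i) Q q"
      unfolding some(2,3) generated_order_singleton generated_order_id[OF Q.partial_order] by simp
    have F: "Field {(z i, z i)} = {z i}" by (auto simp: Field_def)
    have disj: "Field {(z i, z i)} \<inter> Field Q = {}" using zQ unfolding F by blast
    note sl = dcomp_slant[OF dcomp_singleton(1) a(2) disj _ _ a(4)]
    have "dcomp (slant {(z i, z i)} (z i) Q q)" "acyclic_element (slant {(z i, z i)} (z i) Q q) (z i)"
      using sl[of "z i"] dcomp_singleton(2)[of "z i"] unfolding F by blast+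
    then show ?thesis using eq some(2-4) QQ a(5) by auto
  qed
  then show "anchor_rel i \<subseteq> ?V \<times> ?V" "dcomp (generated_order ?V (anchor_rel i))"
    "acyclic_element (generated_order ?V (anchor_rel i)) (z i)"
    "i \<noteq> J \<Longrightarrow> x \<in> ?V \<Longrightarrow> (x, z i) \<in> generated_order ?V (anchor_rel i)" by blast+
qed

lemma block:
  assumes i: "i \<in> {1..l}"
  shows "E i \<subseteq> V i \<times> V i" "dcomp (generated_order (V i) (E i))" "acyclic_element (generated_order (V i) (E i)) (z i)"
    "i \<noteq> J \<Longrightarrow> x \<in> V i \<Longrightarrow> (x, z i) \<in> generated_order (V i) (E i)"
proof -
  have "anchor_set i \<inter> Field D = {}" if "D \<in> H i" for D
    using anchorD(6) i that unfolding anchor_set_def hung_set_def by (fastforce split: option.splits if_splits)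
  then have D': "dcomp D \<and> connected_poset D \<and> Field D \<inter> insert (z i) (anchor_set i) = {}" if "D \<in> H i" for D
    using D[OF i that] i that by blast
  have disj: "Field D \<inter> Field D' = {}" if "D \<in> H i" "D' \<in> H i" "D \<noteq> D'" for D D'
    using D_disjoint[OF i i that(1,2)] that(3) by blast
  note h = dcomp_hang[OF H[OF i] base_block(1-3)[OF i] insertI1 D' disj, folded V_def hung_rel_def, folded E_def]
  show "E i \<subseteq> V i \<times> V i" "dcomp (generated_order (V i) (E i))" "acyclic_element (generated_order (V i) (E i)) (z i)"
    using h by blast+
  show "i \<noteq> J \<Longrightarrow> x \<in> V i \<Longrightarrow> (x, z i) \<in> generated_order (V i) (E i)"
    using h base_block(4)[OF i] by blast
qed

lemma block_connected_to_z:
  assumes i: "i \<in> {1..l}" and x: "x \<in> V i"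
  shows "(x, z i) \<in> (E i \<union> (E i)\<inverse>)\<^sup>*"
proof -
  consider "x = z i" | D where "D \<in> H i" "x \<in> Field D" | "x \<in> anchor_set i" using x unfolding V_def by blast
  then show ?thesis
  proof cases
    case 1
    then show ?thesis by simp
  next
    case (2 D)
    interpret D: dcomplete D using D[OF i 2(1)] by unfold_locales blast
    obtain t where t: "t \<in> Field D" "\<And>x. x \<in> Field D \<Longrightarrow> (x, t) \<in> D" "maximal_elements D (Field D) = {t}"
      using D.connected_max D[OF i 2(1)] by blast
    then have "(x, t) \<in> E i" "(t, z i) \<in> E i" using 2 unfolding E_def hung_rel_def by blast+
    then show ?thesis by (meson UnI1 r_into_rtrancl rtrancl_trans)
  next
    case 3
    then obtain Q q where a: "anchor = Some (i, Q, q)" "x \<in> Field Q"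
      unfolding anchor_set_def by (auto split: option.splits if_splits)
    note b = anchorD[OF a(1)]
    interpret Q: dcomplete Q by unfold_locales (rule b(2))
    have E: "Q \<union> {(z i, q)} \<subseteq> E i" unfolding E_def anchor_Some(3)[OF a(1)] by auto
    have "(x, q) \<in> (Q \<union> Q\<inverse>)\<^sup>*"
      using b(3,5) a(2) unfolding connected_poset_def Q.hasse_connection_eq by blast
    moreover have "(Q \<union> Q\<inverse>)\<^sup>* \<subseteq> (E i \<union> (E i)\<inverse>)\<^sup>*" by (rule rtrancl_mono) (use E in blast)
    moreover have "(q, z i) \<in> (E i \<union> (E i)\<inverse>)\<^sup>*" using E by blast
    ultimately show ?thesis by (meson rtrancl_trans subsetD)
  qed
qed

sublocale dcomplete_ribbon l V E z S J
proof unfold_locales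
  fix i i' assume i: "i \<in> {1..l}" "i' \<in> {1..l}" "i \<noteq> i'"
  have hh: "hung_set i \<inter> hung_set i' = {}"
  proof -
    have "z i \<noteq> z i'" using z_inj i unfolding inj_on_def by blast
    moreover have "z i \<notin> Field D" "z i' \<notin> Field D" if "D \<in> H i \<or> D \<in> H i'" for D
      using D[OF i(1), of D] D[OF i(2), of D] i(1,2) that by blast+
    moreover have "Field D \<inter> Field D' = {}" if "D \<in> H i" "D' \<in> H i'" for D D'
      using D_disjoint[OF i(1,2) that] i(3) by blast
    ultimately show ?thesis unfolding hung_set_def by blast
  qed
  have "hung_set i \<inter> anchor_set i' = {}" "anchor_set i \<inter> hung_set i' = {}" "anchor_set i \<inter> anchor_set i' = {}"
    using i anchorD(6) unfolding anchor_set_def by (fastforce split: option.splits if_splits)+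
  then show "V i \<inter> V i' = {}" using hh unfolding V_eq by blast
next
  fix i assume i: "i \<in> {1..l}"
  show "E i \<subseteq> V i \<times> V i" by (rule block(1)[OF i])
  show "z i \<in> V i" unfolding V_def by blast
  show "finite_poset (generated_order (V i) (E i))" by (rule dcompD(1)[OF block(2)[OF i]])
  show "dcomp (generated_order (V i) (E i))" by (rule block(2)[OF i])
  show "acyclic_element (generated_order (V i) (E i)) (z i)" by (rule block(3)[OF i])
  show "(x, z i) \<in> generated_order (V i) (E i)" if "i \<noteq> J" "x \<in> V i" for x by (rule block(4)[OF i that])
  show "(x, y) \<in> (E i \<union> (E i)\<inverse>)\<^sup>*" if "x \<in> V i" "y \<in> V i" for x y
    using block_connected_to_z[OF i that(1)] block_connected_to_z[OF i that(2)] sym_sym_rtrancl[of "E i"]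
    by (meson rtrancl_trans symD)
next
  show "1 \<le> l" by (rule l_pos)
qed

lemma P_eq: "mobile_poset l S z H anchor = P"
proof -
  have "ribbon_edge = e" unfolding ribbon_edge_def e_def ..
  then show ?thesis unfolding mobile_poset_eq P_def verts_def rel_def by simp
qed

text \<open>Both branches of \<open>path_folds\<close> list the ribbon edges that do not point
  towards \<open>J\<close> in the mobile poset: those in \<open>S\<close> to the left of
  \<open>J\<close>, and those outside \<open>S\<close> from \<open>J\<close> on.\<close>

lemma F_eq: "path_folds l S z anchor = F"
proof -
  have \<Phi>_iff: "m \<in> \<Phi> \<longleftrightarrow> m \<in> {1..<l} \<and> (m \<in> S \<longleftrightarrow> m < J)" for m unfolding \<Phi>_def by simp
  have "path_folds l S z anchor = (\<lambda>i. (z (Suc i), z i)) ` {i \<in> \<Phi>. i \<in> S} \<union> (\<lambda>i. (z i, z (Suc i))) ` {i \<in> \<Phi>. i \<notin> S}"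
  proof (cases anchor)
    case None
    then have J: "J = Suc l" by (rule anchor_None)
    have "{i \<in> \<Phi>. i \<in> S} = S" "{i \<in> \<Phi>. i \<notin> S} = {}" using S_sub unfolding \<Phi>_iff unfolding J by auto
    then show ?thesis unfolding path_folds_def using None by auto
  next
    case (Some a)
    then obtain j Q q where a: "anchor = Some (j, Q, q)" by (cases a) auto
    then have J: "J = j" by (rule anchor_Some)
    have j: "1 \<le> j" using anchorD(1)[OF a] by simp
    have "{i \<in> \<Phi>. i \<in> S} = {i. i \<in> S \<and> i < j}" using S_sub unfolding \<Phi>_iff unfolding J by auto
    moreover have "{i \<in> \<Phi>. i \<notin> S} = {i. i \<notin> S \<and> j \<le> i \<and> i \<le> l - 1}"
      using j l_pos unfolding \<Phi>_iff unfolding J by auto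
    ultimately show ?thesis unfolding path_folds_def using a by auto
  qed
  also have "\<dots> = e ` {i \<in> \<Phi>. i \<in> S} \<union> e ` {i \<in> \<Phi>. i \<notin> S}"
    unfolding e_def by (intro arg_cong2[of _ _ _ _ "(\<union>)"] image_cong) auto
  also have "\<dots> = F" unfolding F_def by blast
  finally show ?thesis .
qed

lemma card_F: "card F = card \<Phi>"
proof -
  have "inj_on e \<Phi>"
  proof (rule inj_onI)
    fix m m' assume m: "m \<in> \<Phi>" "m' \<in> \<Phi>" "e m = e m'"
    then have r: "m \<in> {1..l}" "Suc m \<in> {1..l}" "m' \<in> {1..l}" "Suc m' \<in> {1..l}" unfolding \<Phi>_def by auto
    have "z m = z m' \<or> z m = z (Suc m') \<and> z (Suc m) = z m'" using m(3) unfolding e_def by (auto split: if_splits)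
    then show "m = m'" using z_inj r unfolding inj_on_def by (metis Suc_n_not_le_n le_SucI nat_le_linear)
  qed
  then show ?thesis unfolding F_def by (rule card_image)
qed

end

theorem theorem4p9:
  fixes l :: nat and S :: "nat set" and z :: "nat \<Rightarrow> 'a" and H :: "nat \<Rightarrow> 'a rel set"
    and anchor :: "(nat \<times> 'a rel \<times> 'a) option"
    and P F :: "'a rel" and n k :: nat and \<sigma> :: "'a set list"
  assumes "mobile_data l S z H anchor"
    and "P = mobile_poset l S z H anchor"
    and "n = card (Field P)"
    and "F = path_folds l S z anchor"
    and "k = card F"
    and "\<sigma> = path_order l z (P \<ominus> F)"
  shows "(\<forall>i j. i \<le> j \<and> j \<le> k \<longrightarrow>
            connected_poset (path_subposet P F \<sigma> i j) \<and> d_complete (path_subposet P F \<sigma> i j)) \<and>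
         real (card (linear_extensions P)) = fact n * det (hook_matrix P F \<sigma> k)"
proof -
  interpret mobile l S z H anchor using assms(1) by unfold_locales
  show ?thesis
    using ribbon_determinant unfolding assms(2-6) P_eq F_eq card_F .
qed

end
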